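(* Let $\{A_\gamma\mid\gamma\in\omega\}$ be a family of non-trivial ordered abelian groups. Then there exists an ordered field $(K,<)$ such that: (1) for any $n\in\mathbb{N}$ there exists a convex $n_\leq$-henselian valuation $u_n$ on $K$ with value group $u_nK=\coprod_{\gamma>-\infty}^{-n}A_{-\gamma}$; and (2) $K$ does not admit a non-trivial henselian valuation. In particular, $K$ is $t$-henselian but not henselian.
   Context: $\mathbb{N}=\{1,2,\ldots\}$ and $\omega=\{0,1,2,\ldots\}$. For a valuation $v$ on a field $K$, $vK$ is its value group and $\mathcal{O}_v=\{a\in K\mid v(a)\ge 0\}$ its valuation ring. A valuation $v$ on an ordered field $(K,<)$ is convex if $\mathcal{O}_v$ is a convex subset of $(K,<)$. For $n\in\mathbb{N}$, a valued field $(K,v)$ (or the valuation $v$) is $n_\leq$-henselian if Hensel's Lemma holds in $(K,v)$ for all polynomials of degree at most $n$: for every $f\in\mathcal{O}_v[X]$ of degree at most $n$, every simple zero in the residue field of the reduction of $f$ lifts to a zero of $f$ in $\mathcal{O}_v$. A field is called henselian if it admits a non-trivial henselian valuation. A field $K$ is called $t$-henselian if there is a henselian field $L$ with $K\equiv L$ (elementary equivalence in the language of rings $\{+,-,\cdot,0,1\}$). The Hahn sum $\coprod_{\gamma>-\infty}^{-n}A_{-\gamma}$ is the group of all finitely supported functions $s$ on the set of integers $\{\gamma\in\mathbb{Z}\mid\gamma\leq-n\}$ (with its usual ordering) with $s(\gamma)\in A_{-\gamma}$ for each $\gamma$, under pointwise addition, ordered as follows: for $s\neq0$, $s>0$ if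 and only if $s(\gamma_0)>0$ in $A_{-\gamma_0}$, where $\gamma_0$ is the minimum of the support of $s$. Equality of value groups is understood up to isomorphism of ordered groups. *)

theory Defs
  imports
    Complex_Main
    "HOL-Algebra.Polynomial_Divisibility"
    "HOL-Algebra.Multiplicative_Group"
    "HOL-Algebra.Product_Groups"
    "HOL-Algebra.QuotRing"
begin

section \<open>Ordered abelian groups, Hahn sums, ordered fields\<close>

text \<open>Groups are written multiplicatively, as everywhere in HOL-Algebra: the neutral element of
  an ordered abelian group is \<open>\<one>\<close>, and \<open>\<one> \<le> g\<close> plays the role of \<open>g \<ge> 0\<close>.\<close>

record 'a ogroup = "'a monoid" +
  gle :: "'a \<Rightarrow> 'a \<Rightarrow> bool"

definition gless :: "('a, 'b) ogroup_scheme \<Rightarrow> 'a \<Rightarrow> 'a \<Rightarrow> bool" where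
  "gless G x y \<longleftrightarrow> gle G x y \<and> x \<noteq> y"

locale ordered_abelian_group = comm_group G
  for G :: "('a, 'b) ogroup_scheme" (structure) +
  assumes gle_refl: "x \<in> carrier G \<Longrightarrow> gle G x x"
    and gle_antisym: "\<lbrakk>x \<in> carrier G; y \<in> carrier G; gle G x y; gle G y x\<rbrakk> \<Longrightarrow> x = y"
    and gle_trans: "\<lbrakk>x \<in> carrier G; y \<in> carrier G; z \<in> carrier G; gle G x y; gle G y z\<rbrakk>
                    \<Longrightarrow> gle G x z"
    and gle_total: "\<lbrakk>x \<in> carrier G; y \<in> carrier G\<rbrakk> \<Longrightarrow> gle G x y \<or> gle G y x"
    and gle_mult: "\<lbrakk>x \<in> carrier G; y \<in> carrier G; z \<in> carrier G; gle G x y\<rbrakk>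
                    \<Longrightarrow> gle G (x \<otimes> z) (y \<otimes> z)"

definition ordered_group_iso ::
    "('a, 'c) ogroup_scheme \<Rightarrow> ('b, 'd) ogroup_scheme \<Rightarrow> bool" where
  "ordered_group_iso G H \<longleftrightarrow>
     (\<exists>h \<in> iso G H. \<forall>x \<in> carrier G. \<forall>y \<in> carrier G. gle G x y \<longleftrightarrow> gle H (h x) (h y))"

text \<open>The order compares \<open>s\<close> and \<open>t\<close> by the sign of the difference \<open>t - s\<close> at the minimum of its
  support.\<close>

definition hahn_pos :: "'i::linorder set \<Rightarrow> ('i \<Rightarrow> ('a, 'b) ogroup_scheme) \<Rightarrow> ('i \<Rightarrow> 'a) \<Rightarrow> bool" where
  "hahn_pos I A s \<longleftrightarrow>
     s \<noteq> \<one>\<^bsub>sum_group I A\<^esub> \<and>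
     (let i = Min {i \<in> I. s i \<noteq> \<one>\<^bsub>A i\<^esub>} in gless (A i) \<one>\<^bsub>A i\<^esub> (s i))"

definition hahn_sum :: "'i::linorder set \<Rightarrow> ('i \<Rightarrow> ('a, 'b) ogroup_scheme) \<Rightarrow> ('i \<Rightarrow> 'a) ogroup" where
  "hahn_sum I A =
     \<lparr>carrier = carrier (sum_group I A),
      monoid.mult = monoid.mult (sum_group I A),
      one = \<one>\<^bsub>sum_group I A\<^esub>,
      gle = (\<lambda>s t. s = t \<or> hahn_pos I A (t \<otimes>\<^bsub>sum_group I A\<^esub> inv\<^bsub>sum_group I A\<^esub> s))\<rparr>"

lemma ordered_abelian_group_hahn_sum:
  assumes A: "\<And>i. i \<in> I \<Longrightarrow> ordered_abelian_group (A i)"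
  shows "ordered_abelian_group (hahn_sum I A)"
proof -
  let ?S = "sum_group I A" and ?supp = "\<lambda>s. {i \<in> I. s i \<noteq> \<one>\<^bsub>A i\<^esub>}"
  have com: "comm_group (A i)" if "i \<in> I" for i
    using A[OF that] by (simp add: ordered_abelian_group_def)
  then have grp: "Group.group (A i)" if "i \<in> I" for i
    using that comm_group.axioms(2) by blast
  note car = carrier_sum_group[OF grp]
  have cS: "comm_group ?S"
    by (rule group.group_comm_groupI[OF sum_group[OF grp]])
      (auto simp: car PiE_iff intro!: restrict_ext
        comm_monoid.m_comm[OF comm_group.axioms(1)[OF com]])
  interpret S: comm_group ?S by (rule cS)
  have comp: "s i \<in> carrier (A i)" if "s \<in> carrier ?S" "i \<in> I" for s i
    using that by (auto simp: car)
  have fin: "finite (?supp s)" if "s \<in> carrier ?S" for s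
    using that by (simp add: car)
  have one: "s = \<one>\<^bsub>?S\<^esub> \<longleftrightarrow> ?supp s = {}" if "s \<in> carrier ?S" for s
    using that by (auto simp: car PiE_iff extensional_def fun_eq_iff)
  have pos_iff: "hahn_pos I A s \<longleftrightarrow>
      (\<exists>i \<in> I. gless (A i) \<one>\<^bsub>A i\<^esub> (s i) \<and> (\<forall>k \<in> I. k < i \<longrightarrow> s k = \<one>\<^bsub>A k\<^esub>))"
    if s: "s \<in> carrier ?S" for s
  proof
    assume *: "hahn_pos I A s"
    then have ne: "?supp s \<noteq> {}" using one[OF s] unfolding hahn_pos_def by blast
    have "Min (?supp s) \<in> ?supp s" by (rule Min_in[OF fin[OF s] ne])
    moreover have "s k = \<one>\<^bsub>A k\<^esub>" if "k \<in> I" "k < Min (?supp s)" for k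
      using Min_le[OF fin[OF s], of k] that by (metis (mono_tags, lifting) leD mem_Collect_eq)
    ultimately show "\<exists>i \<in> I. gless (A i) \<one>\<^bsub>A i\<^esub> (s i) \<and> (\<forall>k \<in> I. k < i \<longrightarrow> s k = \<one>\<^bsub>A k\<^esub>)"
      using * unfolding hahn_pos_def Let_def by blast
  next
    assume "\<exists>i \<in> I. gless (A i) \<one>\<^bsub>A i\<^esub> (s i) \<and> (\<forall>k \<in> I. k < i \<longrightarrow> s k = \<one>\<^bsub>A k\<^esub>)"
    then obtain i where i: "i \<in> I" "gless (A i) \<one>\<^bsub>A i\<^esub> (s i)"
      "\<forall>k \<in> I. k < i \<longrightarrow> s k = \<one>\<^bsub>A k\<^esub>" by blast
    then have mem: "i \<in> ?supp s" by (auto simp: gless_def)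
    then have "Min (?supp s) = i"
      using i(3) by (intro Min_eqI[OF fin[OF s]]) (force simp: not_less[symmetric])+
    then show "hahn_pos I A s"
      using mem i(2) one[OF s] unfolding hahn_pos_def Let_def by auto
  qed
  have pos_inv: "gless (A i) \<one>\<^bsub>A i\<^esub> (inv\<^bsub>A i\<^esub> g) \<longleftrightarrow> gless (A i) g \<one>\<^bsub>A i\<^esub>"
    if "i \<in> I" "g \<in> carrier (A i)" for i g
  proof -
    interpret ordered_abelian_group "A i" by (rule A[OF that(1)])
    have "\<one>\<^bsub>A i\<^esub> = inv\<^bsub>A i\<^esub> g \<longleftrightarrow> g = \<one>\<^bsub>A i\<^esub>"
      using inv_eq_1_iff[OF that(2)] by metis
    then show ?thesis
      using gle_mult[of "\<one>\<^bsub>A i\<^esub>" "inv\<^bsub>A i\<^esub> g" g] gle_mult[of g "\<one>\<^bsub>A i\<^esub>" "inv\<^bsub>A i\<^esub> g"] that(2)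
      by (auto simp: gless_def)
  qed
  have pos_mult: "gless (A i) \<one>\<^bsub>A i\<^esub> (g \<otimes>\<^bsub>A i\<^esub> g')"
    if "i \<in> I" "g \<in> carrier (A i)" "g' \<in> carrier (A i)"
      "gless (A i) \<one>\<^bsub>A i\<^esub> g" "gless (A i) \<one>\<^bsub>A i\<^esub> g'" for i g g'
  proof -
    interpret ordered_abelian_group "A i" by (rule A[OF that(1)])
    have le: "gle (A i) g' (g \<otimes>\<^bsub>A i\<^esub> g')"
      using gle_mult[of "\<one>\<^bsub>A i\<^esub>" g g'] that by (simp add: gless_def)
    have g': "gle (A i) \<one>\<^bsub>A i\<^esub> g'" "\<one>\<^bsub>A i\<^esub> \<noteq> g'" using that(5) by (simp_all add: gless_def)
    have "gle (A i) \<one>\<^bsub>A i\<^esub> (g \<otimes>\<^bsub>A i\<^esub> g')"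
      using gle_trans[OF one_closed that(3) m_closed[OF that(2,3)] g'(1) le] .
    moreover have "\<one>\<^bsub>A i\<^esub> \<noteq> g \<otimes>\<^bsub>A i\<^esub> g'"
      using gle_antisym[OF one_closed that(3) g'(1)] g'(2) le by metis
    ultimately show ?thesis by (simp add: gless_def)
  qed
  have invc: "(inv\<^bsub>?S\<^esub> s) i = inv\<^bsub>A i\<^esub> (s i)" if "s \<in> carrier ?S" "i \<in> I" for s i
  proof -
    have "(inv\<^bsub>?S\<^esub> s \<otimes>\<^bsub>?S\<^esub> s) i = \<one>\<^bsub>?S\<^esub> i"
      by (rule fun_cong[OF S.l_inv[OF that(1)]])
    then have "(inv\<^bsub>?S\<^esub> s) i \<otimes>\<^bsub>A i\<^esub> s i = \<one>\<^bsub>A i\<^esub>"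
      using that(2) by (simp only: mult_sum_group one_sum_group restrict_apply if_True)
    then show ?thesis
      using group.inv_equality[OF grp] that comp S.inv_closed by metis
  qed
  have trichotomy: "s = \<one>\<^bsub>?S\<^esub> \<or> hahn_pos I A s \<or> hahn_pos I A (inv\<^bsub>?S\<^esub> s)" if s: "s \<in> carrier ?S" for s
  proof (cases "?supp s = {}")
    case False
    define i where "i = Min (?supp s)"
    have i: "i \<in> I" "s i \<noteq> \<one>\<^bsub>A i\<^esub>"
      using Min_in[OF fin[OF s] False] unfolding i_def by auto
    have below: "\<forall>k \<in> I. k < i \<longrightarrow> s k = \<one>\<^bsub>A k\<^esub>"
      using Min_le[OF fin[OF s]] unfolding i_def
      by (metis (mono_tags, lifting) leD mem_Collect_eq)
    then have below': "\<forall>k \<in> I. k < i \<longrightarrow> (inv\<^bsub>?S\<^esub> s) k = \<one>\<^bsub>A k\<^esub>"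
      using invc[OF s] grp by (simp add: monoid.inv_one group.is_monoid)
    interpret ordered_abelian_group "A i" by (rule A[OF i(1)])
    have "gless (A i) \<one>\<^bsub>A i\<^esub> (s i) \<or> gless (A i) (s i) \<one>\<^bsub>A i\<^esub>"
      using gle_total[of "\<one>\<^bsub>A i\<^esub>" "s i"] comp[OF s i(1)] i(2) by (auto simp: gless_def)
    then show ?thesis
      using pos_iff[OF s] pos_iff[OF S.inv_closed[OF s]] below below' i(1)
        pos_inv[OF i(1) comp[OF s i(1)]] invc[OF s i(1)] by metis
  qed (use one[OF s] in blast)
  have add_pos: "hahn_pos I A (s \<otimes>\<^bsub>?S\<^esub> t)"
    if s: "s \<in> carrier ?S" "hahn_pos I A s" and t: "t \<in> carrier ?S" "hahn_pos I A t" for s t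
  proof -
    obtain i where i: "i \<in> I" "gless (A i) \<one>\<^bsub>A i\<^esub> (s i)" "\<forall>k \<in> I. k < i \<longrightarrow> s k = \<one>\<^bsub>A k\<^esub>"
      using s pos_iff by blast
    obtain j where j: "j \<in> I" "gless (A j) \<one>\<^bsub>A j\<^esub> (t j)" "\<forall>k \<in> I. k < j \<longrightarrow> t k = \<one>\<^bsub>A k\<^esub>"
      using t pos_iff by blast
    have l1: "\<one>\<^bsub>A k\<^esub> \<otimes>\<^bsub>A k\<^esub> g = g" and r1: "g \<otimes>\<^bsub>A k\<^esub> \<one>\<^bsub>A k\<^esub> = g"
      if "k \<in> I" "g \<in> carrier (A k)" for k g
      using that grp monoid.l_one monoid.r_one group.is_monoid by metis+
    have one_in: "\<one>\<^bsub>A k\<^esub> \<in> carrier (A k)" if "k \<in> I" for k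
      using that grp monoid.one_closed group.is_monoid by metis
    have "gless (A (min i j)) \<one>\<^bsub>A (min i j)\<^esub> ((s \<otimes>\<^bsub>?S\<^esub> t) (min i j))"
    proof (cases i j rule: linorder_cases)
      case less
      then show ?thesis using i j comp[OF s(1)] r1 by (simp add: min_absorb1)
    next
      case equal
      then show ?thesis using i j pos_mult comp[OF s(1)] comp[OF t(1)] by simp
    next
      case greater
      then show ?thesis using i j comp[OF t(1)] l1 by (simp add: min_absorb2)
    qed
    moreover have "(s \<otimes>\<^bsub>?S\<^esub> t) k = \<one>\<^bsub>A k\<^esub>" if "k \<in> I" "k < min i j" for k
      using that i(3) j(3) l1 one_in by simp
    moreover have "min i j \<in> I" using i(1) j(1) by (simp add: min_def)
    ultimately show ?thesis
      using pos_iff[OF S.m_closed[OF s(1) t(1)]] by blast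
  qed
  have not_pos_one: "\<not> hahn_pos I A \<one>\<^bsub>?S\<^esub>"
    by (simp add: hahn_pos_def del: one_sum_group)
  have simps: "carrier (hahn_sum I A) = carrier ?S" "monoid.mult (hahn_sum I A) = monoid.mult ?S"
    "\<one>\<^bsub>hahn_sum I A\<^esub> = \<one>\<^bsub>?S\<^esub>"
    by (simp_all add: hahn_sum_def)
  have le: "gle (hahn_sum I A) s t \<longleftrightarrow> s = t \<or> hahn_pos I A (t \<otimes>\<^bsub>?S\<^esub> inv\<^bsub>?S\<^esub> s)" for s t
    by (simp add: hahn_sum_def)
  note [simp del] = one_sum_group mult_sum_group
  have split: "u \<otimes>\<^bsub>?S\<^esub> inv\<^bsub>?S\<^esub> s = (u \<otimes>\<^bsub>?S\<^esub> inv\<^bsub>?S\<^esub> t) \<otimes>\<^bsub>?S\<^esub> (t \<otimes>\<^bsub>?S\<^esub> inv\<^bsub>?S\<^esub> s)"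
    if "s \<in> carrier ?S" "t \<in> carrier ?S" "u \<in> carrier ?S" for s t u
    using that by (metis S.inv_closed S.l_inv S.l_one S.m_assoc S.m_closed)
  have trans: "gle (hahn_sum I A) s u"
    if "s \<in> carrier ?S" "t \<in> carrier ?S" "u \<in> carrier ?S"
      "gle (hahn_sum I A) s t" "gle (hahn_sum I A) t u" for s t u
    using that add_pos[of "u \<otimes>\<^bsub>?S\<^esub> inv\<^bsub>?S\<^esub> t" "t \<otimes>\<^bsub>?S\<^esub> inv\<^bsub>?S\<^esub> s"] split[of s t u] le by auto
  have antisym: "s = t"
    if "s \<in> carrier ?S" "t \<in> carrier ?S"
      "gle (hahn_sum I A) s t" "gle (hahn_sum I A) t s" for s t
    using that add_pos[of "s \<otimes>\<^bsub>?S\<^esub> inv\<^bsub>?S\<^esub> t" "t \<otimes>\<^bsub>?S\<^esub> inv\<^bsub>?S\<^esub> s"] split[of s t s] le not_pos_one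
    by auto
  have total: "gle (hahn_sum I A) s t \<or> gle (hahn_sum I A) t s"
    if "s \<in> carrier ?S" "t \<in> carrier ?S" for s t
  proof -
    have "inv\<^bsub>?S\<^esub> (t \<otimes>\<^bsub>?S\<^esub> inv\<^bsub>?S\<^esub> s) = s \<otimes>\<^bsub>?S\<^esub> inv\<^bsub>?S\<^esub> t"
      using that by (simp add: S.inv_mult_group)
    moreover have "t \<otimes>\<^bsub>?S\<^esub> inv\<^bsub>?S\<^esub> s = \<one>\<^bsub>?S\<^esub> \<Longrightarrow> s = t"
      using that by (metis S.inv_closed S.inv_equality S.inv_inv)
    ultimately show ?thesis
      using trichotomy[of "t \<otimes>\<^bsub>?S\<^esub> inv\<^bsub>?S\<^esub> s"] that le by auto
  qed
  have mono: "gle (hahn_sum I A) (s \<otimes>\<^bsub>?S\<^esub> u) (t \<otimes>\<^bsub>?S\<^esub> u)"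
    if "s \<in> carrier ?S" "t \<in> carrier ?S" "u \<in> carrier ?S" "gle (hahn_sum I A) s t" for s t u
  proof -
    have "(t \<otimes>\<^bsub>?S\<^esub> u) \<otimes>\<^bsub>?S\<^esub> inv\<^bsub>?S\<^esub> (s \<otimes>\<^bsub>?S\<^esub> u) = t \<otimes>\<^bsub>?S\<^esub> inv\<^bsub>?S\<^esub> s"
      using that S.m_assoc[of u "inv\<^bsub>?S\<^esub> u" "inv\<^bsub>?S\<^esub> s"] by (simp add: S.inv_mult_group S.m_assoc)
    then show ?thesis using that le by auto
  qed
  have "comm_group (hahn_sum I A)"
    by (rule comm_groupI; unfold simps)
      (use S.l_inv_ex in \<open>auto simp: S.m_assoc S.m_lcomm S.m_comm\<close>)
  then show ?thesis
    unfolding ordered_abelian_group_def ordered_abelian_group_axioms_def simps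
    using trans antisym total mono le by blast
qed

text \<open>An existential statement about a field needs a type for its elements. Formal series with real
  coefficients and exponents in \<open>nat \<Rightarrow> 'a\<close> provide room for every real Hahn series over a Hahn sum of
  a sequence of groups on \<open>'a\<close>; the field itself is an arbitrary carrier set in this type, with
  arbitrary operations.\<close>

type_synonym 'a hahn_series = "(nat \<Rightarrow> 'a) \<Rightarrow> real"

locale ordered_field = field K
  for K :: "('k, 'b) ring_scheme" (structure) +
  fixes leK :: "'k \<Rightarrow> 'k \<Rightarrow> bool" (infix \<open>\<preceq>\<close> 50)
  assumes le_refl: "x \<in> carrier K \<Longrightarrow> x \<preceq> x"
    and le_antisym: "\<lbrakk>x \<in> carrier K; y \<in> carrier K; x \<preceq> y; y \<preceq> x\<rbrakk> \<Longrightarrow> x = y"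
    and le_trans: "\<lbrakk>x \<in> carrier K; y \<in> carrier K; z \<in> carrier K; x \<preceq> y; y \<preceq> z\<rbrakk> \<Longrightarrow> x \<preceq> z"
    and le_total: "\<lbrakk>x \<in> carrier K; y \<in> carrier K\<rbrakk> \<Longrightarrow> x \<preceq> y \<or> y \<preceq> x"
    and le_add: "\<lbrakk>x \<in> carrier K; y \<in> carrier K; z \<in> carrier K; x \<preceq> y\<rbrakk> \<Longrightarrow> x \<oplus> z \<preceq> y \<oplus> z"
    and le_mult: "\<lbrakk>x \<in> carrier K; y \<in> carrier K; \<zero> \<preceq> x; \<zero> \<preceq> y\<rbrakk> \<Longrightarrow> \<zero> \<preceq> x \<otimes> y"


section \<open>Valuations\<close>

text \<open>A valuation is given by its restriction to the nonzero elements; \<open>v \<zero> = \<infinity>\<close> is treated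
  separately. It need not be surjective onto the ordered group \<open>G\<close>.\<close>

locale valuation = field K + G: ordered_abelian_group G
  for K :: "('k, 'b) ring_scheme" (structure) and G :: "('g, 'c) ogroup_scheme"
    and v :: "'k \<Rightarrow> 'g" +
  assumes v_hom: "v \<in> hom (Multiplicative_Group.mult_of K) G"
    and v_add: "\<lbrakk>x \<in> carrier K; y \<in> carrier K; x \<noteq> \<zero>; y \<noteq> \<zero>; x \<oplus> y \<noteq> \<zero>\<rbrakk>
                \<Longrightarrow> gle G (v x) (v (x \<oplus> y)) \<or> gle G (v y) (v (x \<oplus> y))"

definition value_group ::
    "('k, 'b) ring_scheme \<Rightarrow> ('g, 'c) ogroup_scheme \<Rightarrow> ('k \<Rightarrow> 'g) \<Rightarrow> ('g, 'c) ogroup_scheme" where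
  "value_group K G v = G\<lparr>carrier := v ` carrier (Multiplicative_Group.mult_of K)\<rparr>"

definition val_ring_set ::
    "('k, 'b) ring_scheme \<Rightarrow> ('g, 'c) ogroup_scheme \<Rightarrow> ('k \<Rightarrow> 'g) \<Rightarrow> 'k set" where
  "val_ring_set K G v = {x \<in> carrier K. x = \<zero>\<^bsub>K\<^esub> \<or> gle G \<one>\<^bsub>G\<^esub> (v x)}"

definition val_ring ::
    "('k, 'b) ring_scheme \<Rightarrow> ('g, 'c) ogroup_scheme \<Rightarrow> ('k \<Rightarrow> 'g) \<Rightarrow> ('k, 'b) ring_scheme" where
  "val_ring K G v = K\<lparr>carrier := val_ring_set K G v\<rparr>"

definition val_ideal ::
    "('k, 'b) ring_scheme \<Rightarrow> ('g, 'c) ogroup_scheme \<Rightarrow> ('k \<Rightarrow> 'g) \<Rightarrow> 'k set" where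
  "val_ideal K G v = {x \<in> carrier K. x = \<zero>\<^bsub>K\<^esub> \<or> gless G \<one>\<^bsub>G\<^esub> (v x)}"

definition residue_field ::
    "('k, 'b) ring_scheme \<Rightarrow> ('g, 'c) ogroup_scheme \<Rightarrow> ('k \<Rightarrow> 'g) \<Rightarrow> 'k set ring" where
  "residue_field K G v = val_ring K G v Quot val_ideal K G v"

definition residue ::
    "('k, 'b) ring_scheme \<Rightarrow> ('g, 'c) ogroup_scheme \<Rightarrow> ('k \<Rightarrow> 'g) \<Rightarrow> 'k \<Rightarrow> 'k set" where
  "residue K G v x = val_ideal K G v +>\<^bsub>val_ring K G v\<^esub> x"

definition convex_valuation ::
    "('k, 'b) ring_scheme \<Rightarrow> ('k \<Rightarrow> 'k \<Rightarrow> bool) \<Rightarrow> ('g, 'c) ogroup_scheme \<Rightarrow> ('k \<Rightarrow> 'g) \<Rightarrow> bool" where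
  "convex_valuation K leK G v \<longleftrightarrow>
     (\<forall>a \<in> val_ring_set K G v. \<forall>b \<in> val_ring_set K G v. \<forall>x \<in> carrier K.
        leK a x \<and> leK x b \<longrightarrow> x \<in> val_ring_set K G v)"

definition nontrivial_valuation ::
    "('k, 'b) ring_scheme \<Rightarrow> ('g, 'c) ogroup_scheme \<Rightarrow> ('k \<Rightarrow> 'g) \<Rightarrow> bool" where
  "nontrivial_valuation K G v \<longleftrightarrow> (\<exists>x \<in> carrier (Multiplicative_Group.mult_of K). v x \<noteq> \<one>\<^bsub>G\<^esub>)"


section \<open>Henselianity\<close>

text \<open>Polynomials are the coefficient lists of \<^theory>\<open>HOL-Algebra.Polynomials\<close>, leading
  coefficient first and nonzero; \<open>normalize\<close> drops the leading coefficients that reduce to zero.\<close>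

definition reduction ::
    "('k, 'b) ring_scheme \<Rightarrow> ('g, 'c) ogroup_scheme \<Rightarrow> ('k \<Rightarrow> 'g) \<Rightarrow> 'k list \<Rightarrow> 'k set list" where
  "reduction K G v f = ring.normalize (residue_field K G v) (map (residue K G v) f)"

definition simple_zeros_lift ::
    "('k, 'b) ring_scheme \<Rightarrow> ('g, 'c) ogroup_scheme \<Rightarrow> ('k \<Rightarrow> 'g) \<Rightarrow> 'k list \<Rightarrow> bool" where
  "simple_zeros_lift K G v f \<longleftrightarrow>
     (\<forall>\<alpha> \<in> carrier (residue_field K G v).
        ring.alg_mult (residue_field K G v) (reduction K G v f) \<alpha> = 1 \<longrightarrow>
        (\<exists>a \<in> val_ring_set K G v.
           ring.eval (val_ring K G v) f a = \<zero>\<^bsub>val_ring K G v\<^esub> \<and> residue K G v a = \<alpha>))"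

definition n_henselian ::
    "nat \<Rightarrow> ('k, 'b) ring_scheme \<Rightarrow> ('g, 'c) ogroup_scheme \<Rightarrow> ('k \<Rightarrow> 'g) \<Rightarrow> bool" where
  "n_henselian n K G v \<longleftrightarrow>
     (\<forall>f \<in> carrier (poly_ring (val_ring K G v)). degree f \<le> n \<longrightarrow> simple_zeros_lift K G v f)"

definition henselian_valuation ::
    "('k, 'b) ring_scheme \<Rightarrow> ('g, 'c) ogroup_scheme \<Rightarrow> ('k \<Rightarrow> 'g) \<Rightarrow> bool" where
  "henselian_valuation K G v \<longleftrightarrow>
     (\<forall>f \<in> carrier (poly_ring (val_ring K G v)). simple_zeros_lift K G v f)"

text \<open>The definiens has to fix a type for the value groups. Every valuation is equivalent to one
  whose values are the cosets of the unit group, which are sets of field elements; that this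
  choice loses no generality is \<open>henselian_fieldI\<close> below.\<close>

definition henselian_field :: "('k, 'b) ring_scheme \<Rightarrow> bool" where
  "henselian_field K \<longleftrightarrow> field K \<and>
     (\<exists>(G :: 'k set ogroup) v.
        valuation K G v \<and> nontrivial_valuation K G v \<and> henselian_valuation K G v)"


section \<open>Elementary equivalence in the language of rings\<close>

datatype rterm =
    RVar nat | RZero | ROne
  | RAdd rterm rterm | RSub rterm rterm | RMul rterm rterm

datatype rformula =
    REq rterm rterm | RNot rformula | RAnd rformula rformula | REx nat rformula

primrec tvars :: "rterm \<Rightarrow> nat set" where
  "tvars (RVar x) = {x}"
| "tvars RZero = {}"
| "tvars ROne = {}"
| "tvars (RAdd s t) = tvars s \<union> tvars t"
| "tvars (RSub s t) = tvars s \<union> tvars t"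
| "tvars (RMul s t) = tvars s \<union> tvars t"

primrec fvars :: "rformula \<Rightarrow> nat set" where
  "fvars (REq s t) = tvars s \<union> tvars t"
| "fvars (RNot \<phi>) = fvars \<phi>"
| "fvars (RAnd \<phi> \<psi>) = fvars \<phi> \<union> fvars \<psi>"
| "fvars (REx x \<phi>) = fvars \<phi> - {x}"

primrec teval :: "('k, 'b) ring_scheme \<Rightarrow> (nat \<Rightarrow> 'k) \<Rightarrow> rterm \<Rightarrow> 'k" where
  "teval R e (RVar x) = e x"
| "teval R e RZero = \<zero>\<^bsub>R\<^esub>"
| "teval R e ROne = \<one>\<^bsub>R\<^esub>"
| "teval R e (RAdd s t) = teval R e s \<oplus>\<^bsub>R\<^esub> teval R e t"
| "teval R e (RSub s t) = teval R e s \<ominus>\<^bsub>R\<^esub> teval R e t"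
| "teval R e (RMul s t) = teval R e s \<otimes>\<^bsub>R\<^esub> teval R e t"

primrec rsat :: "('k, 'b) ring_scheme \<Rightarrow> (nat \<Rightarrow> 'k) \<Rightarrow> rformula \<Rightarrow> bool" where
  "rsat R e (REq s t) \<longleftrightarrow> teval R e s = teval R e t"
| "rsat R e (RNot \<phi>) \<longleftrightarrow> \<not> rsat R e \<phi>"
| "rsat R e (RAnd \<phi> \<psi>) \<longleftrightarrow> rsat R e \<phi> \<and> rsat R e \<psi>"
| "rsat R e (REx x \<phi>) \<longleftrightarrow> (\<exists>a \<in> carrier R. rsat R (e(x := a)) \<phi>)"

definition rmodels :: "('k, 'b) ring_scheme \<Rightarrow> rformula \<Rightarrow> bool" where
  "rmodels R \<phi> \<longleftrightarrow> (\<forall>e. range e \<subseteq> carrier R \<longrightarrow> rsat R e \<phi>)"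

definition elem_equiv :: "('k, 'b) ring_scheme \<Rightarrow> ('l, 'c) ring_scheme \<Rightarrow> bool" where
  "elem_equiv R S \<longleftrightarrow> (\<forall>\<phi>. fvars \<phi> = {} \<longrightarrow> (rmodels R \<phi> \<longleftrightarrow> rmodels S \<phi>))"

text \<open>Again a type for \<open>L\<close> has to be fixed. The type chosen contains every ultrapower of \<open>K\<close> over
  a countable index set. By the downward Loewenheim-Skolem theorem for the valued field \<open>L\<close>
  already countable \<open>L\<close> would suffice, so nothing is lost.\<close>

definition t_henselian :: "('k, 'b) ring_scheme \<Rightarrow> bool" where
  "t_henselian K \<longleftrightarrow> field K \<and>
     (\<exists>L :: (nat \<Rightarrow> 'k) set ring. henselian_field L \<and> elem_equiv K L)"


section \<open>Independence of the type of the value group\<close>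

lemma henselian_fieldI:
  fixes K :: "('k, 'b) ring_scheme" and G :: "('g, 'c) ogroup_scheme"
  assumes val: "valuation K G v" and nt: "nontrivial_valuation K G v"
    and hens: "henselian_valuation K G v"
  shows "henselian_field K"
proof -
  interpret valuation K G v by (rule val)
  define V where "V = v ` carrier (Multiplicative_Group.mult_of K)"
  define j where "j g = {x \<in> carrier (Multiplicative_Group.mult_of K). v x = g}" for g
  define i where "i = inv_into V j"
  define H :: "'k set ogroup" where
    "H = \<lparr>carrier = j ` V, monoid.mult = (\<lambda>C D. j (i C \<otimes>\<^bsub>G\<^esub> i D)), one = j \<one>\<^bsub>G\<^esub>,
          gle = (\<lambda>C D. gle G (i C) (i D))\<rparr>"
  define w where "w = j \<circ> v"
  have inj: "inj_on j V"
    unfolding inj_on_def V_def j_def by blast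
  have ij [simp]: "i (j g) = g" if "g \<in> V" for g
    unfolding i_def using inj that by simp
  have VG: "g \<in> carrier G" if "g \<in> V" for g
    using that v_hom unfolding V_def hom_def by auto
  have units: "Group.group (Multiplicative_Group.mult_of K)"
    by (rule field_mult_group)
  interpret h: group_hom "Multiplicative_Group.mult_of K" G v
    using units v_hom by (simp add: group_hom_def group_hom_axioms_def G.is_group)
  have oneV: "\<one>\<^bsub>G\<^esub> \<in> V"
    unfolding V_def using h.hom_one h.G.one_closed by (metis image_eqI)
  have multV: "g \<otimes>\<^bsub>G\<^esub> g' \<in> V" if "g \<in> V" "g' \<in> V" for g g'
  proof -
    from that obtain x y where "x \<in> carrier (Multiplicative_Group.mult_of K)" "g = v x"
      "y \<in> carrier (Multiplicative_Group.mult_of K)" "g' = v y"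
      unfolding V_def by blast
    then show ?thesis
      unfolding V_def using h.hom_mult[symmetric] h.G.m_closed by (metis image_eqI)
  qed
  have invV: "inv\<^bsub>G\<^esub> g \<in> V" if "g \<in> V" for g
    using that unfolding V_def
    by (metis (no_types, lifting) h.hom_inv h.G.inv_closed image_iff)
  have ordH: "ordered_abelian_group H"
  proof -
    have "comm_group H"
    proof (rule comm_groupI)
      fix C assume "C \<in> carrier H"
      then obtain g where g: "g \<in> V" "C = j g" by (auto simp: H_def)
      have "j (inv\<^bsub>G\<^esub> g) \<in> carrier H" "j (inv\<^bsub>G\<^esub> g) \<otimes>\<^bsub>H\<^esub> C = \<one>\<^bsub>H\<^esub>"
        using g invV VG by (auto simp: H_def)
      then show "\<exists>D \<in> carrier H. D \<otimes>\<^bsub>H\<^esub> C = \<one>\<^bsub>H\<^esub>" by blast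
    qed (auto simp: H_def oneV multV VG G.m_assoc G.m_lcomm G.m_comm)
    moreover have "ordered_abelian_group_axioms H"
    proof
      fix C D E assume "C \<in> carrier H" "D \<in> carrier H" "E \<in> carrier H" "gle H C D" "gle H D E"
      then show "gle H C E" by (auto simp: H_def intro: G.gle_trans[OF VG VG VG])
    next
      fix C D assume "C \<in> carrier H" "D \<in> carrier H"
      then obtain g g' where "g \<in> V" "C = j g" "g' \<in> V" "D = j g'" by (auto simp: H_def)
      then show "gle H C D \<or> gle H D C" using G.gle_total[OF VG VG, of g g'] by (simp add: H_def)
    next
      fix C D assume "C \<in> carrier H" "D \<in> carrier H" "gle H C D" "gle H D C"
      then show "C = D" by (auto simp: H_def dest: G.gle_antisym[OF VG VG])
    qed (auto simp: H_def multV VG G.gle_refl G.gle_mult)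
    ultimately show ?thesis by (simp add: ordered_abelian_group_def)
  qed
  have vV: "v x \<in> V" if "x \<in> carrier K" "x \<noteq> \<zero>\<^bsub>K\<^esub>" for x
    using that by (simp add: V_def)
  have valH: "valuation K H w"
  proof -
    have "w \<in> hom (Multiplicative_Group.mult_of K) H"
      using v_hom by (auto simp: hom_def w_def H_def vV)
    moreover have "gle H (w x) (w (x \<oplus>\<^bsub>K\<^esub> y)) \<or> gle H (w y) (w (x \<oplus>\<^bsub>K\<^esub> y))"
      if "x \<in> carrier K" "y \<in> carrier K" "x \<noteq> \<zero>\<^bsub>K\<^esub>" "y \<noteq> \<zero>\<^bsub>K\<^esub>" "x \<oplus>\<^bsub>K\<^esub> y \<noteq> \<zero>\<^bsub>K\<^esub>" for x y
      using v_add[OF that] that by (simp add: w_def H_def vV)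
    ultimately show ?thesis
      using ordH field_axioms by (simp add: valuation_def valuation_axioms_def)
  qed
  have le_w: "gle H \<one>\<^bsub>H\<^esub> (w x) \<longleftrightarrow> gle G \<one>\<^bsub>G\<^esub> (v x)"
    if "x \<in> carrier K" "x \<noteq> \<zero>\<^bsub>K\<^esub>" for x
    using vV[OF that] oneV by (simp add: w_def H_def)
  have wone: "w x = \<one>\<^bsub>H\<^esub> \<longleftrightarrow> v x = \<one>\<^bsub>G\<^esub>" if "x \<in> carrier K" "x \<noteq> \<zero>\<^bsub>K\<^esub>" for x
    using inj_on_eq_iff[OF inj vV[OF that] oneV] by (simp add: w_def H_def)
  have rng: "val_ring_set K H w = val_ring_set K G v"
    unfolding val_ring_set_def using le_w by blast
  have idl: "val_ideal K H w = val_ideal K G v"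
    unfolding val_ideal_def gless_def using le_w wone by metis
  have same: "val_ring K H w = val_ring K G v" "residue_field K H w = residue_field K G v"
    "residue K H w = residue K G v" "reduction K H w = reduction K G v"
    unfolding residue_field_def reduction_def[abs_def] residue_def[abs_def] val_ring_def rng idl
    by (rule refl)+
  have "nontrivial_valuation K H w"
    using nt wone by (auto simp: nontrivial_valuation_def)
  moreover have "henselian_valuation K H w"
    using hens by (simp add: henselian_valuation_def simple_zeros_lift_def same rng)
  ultimately show ?thesis
    using valH field_axioms unfolding henselian_field_def by blast
qed

end

(* K is the union of a chain of fields of real Hahn series with exponents in the Hahn sum of the A_i,
   taken in the order in which the largest index dominates. Let C_n be the convex subgroup of exponents
   supported below n. To pass from K_n, with exponents in C_n, to K_(n+1), take inside the Hahn series
   field over K_n with exponents in C_(n+1)/C_n a maximal subfield M over which some y with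
   y^p = 1 + t^a still has degree at least p, for a prime p > n and an exponent a > C_n. Then y is
   not in M, but every root of degree less than p that Hensel's lemma provides in the big field is
   already in M, since otherwise the degree of y over M would drop below p by the tower law.

   Reading off the coordinates of index at least n of the leading exponent gives the valuation u_n;
   it is henselian for degree at most n because all later primes exceed n. A henselian valuation v on K would be
   convex (discriminant of X^2 + X + c), hence some t^(a_n) would lie in its maximal ideal and 1 + t^(a_n)
   would have a p_n-th root in K, which the construction excluded.

   In an ultrapower of K the valuation rings of the u_n have an ultraproduct, in which
   Hensel's lemma holds in every degree; so K is elementarily equivalent to a henselian field. *)

theory Submission
  imports
    Defs
    "HOL-Algebra.Finite_Extensions"
    "HOL-Computational_Algebra.Primes"
begin

section \<open>Difference quotients and simple zeros of polynomials\<close>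

text \<open>Everything takes place inside one field of real Hahn series over the full exponent
  group. A Hahn series with exponents in C_(n+1)/C_n and coefficients in K_n is then a real series
  all of whose slices along cosets of C_n lie in K_n, and passing to residues is truncation, a map
  into K_n itself. Because truncation maps K_(m+1) into K_m for every m, no stage after K_(n+1) adds
  a series with exponents in C_(n+1), so a root kept out of K_(n+1) stays out for good. It is the
  only candidate: for odd p a positive element of an ordered field has at most one p-th root. The
  obstacle is to keep y out while admitting all Hensel roots of low degree. The starting field must
  contain K_n and all monomials, so that no value is lost, yet y, an infinite series in t, must keep
  degree p over it; fractions of series with finitely many nonzero slices achieve both. A fixed
  point theorem for contractions replaces transfinite iteration, and diagonals of difference
  quotients replace derivatives, since they pass directly to residues, subfields and
  ultrapowers.\<close>

fun (in ring) pow_diff :: "'a \<Rightarrow> 'a \<Rightarrow> nat \<Rightarrow> 'a" where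
  "pow_diff x y 0 = \<zero>"
| "pow_diff x y (Suc k) = x \<otimes> pow_diff x y k \<oplus> y [^] k"

text \<open>The polynomial function with \<open>f(x) - f(y) = (x - y) dq f x y\<close>; its diagonal \<open>dq f a a\<close> plays
  the role of the derivative \<open>f'(a)\<close>.\<close>

fun (in ring) dq :: "'a list \<Rightarrow> 'a \<Rightarrow> 'a \<Rightarrow> 'a" where
  "dq [] x y = \<zero>"
| "dq (c # cs) x y = c \<otimes> pow_diff x y (length cs) \<oplus> dq cs x y"

context ring
begin

lemma pow_diff_closed [simp, intro]:
  "\<lbrakk>x \<in> carrier R; y \<in> carrier R\<rbrakk> \<Longrightarrow> pow_diff x y k \<in> carrier R"
  by (induct k) auto

lemma dq_closed [intro]:
  "\<lbrakk>set f \<subseteq> carrier R; x \<in> carrier R; y \<in> carrier R\<rbrakk> \<Longrightarrow> dq f x y \<in> carrier R"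
  by (induct f) auto

lemma dq_normalize:
  "\<lbrakk>set f \<subseteq> carrier R; x \<in> carrier R; y \<in> carrier R\<rbrakk> \<Longrightarrow> dq (normalize f) x y = dq f x y"
  by (induct f) (auto simp: dq_closed)

text \<open>Restricting the carrier leaves the operations alone, so difference quotients over
  valuation rings and subfields may be computed in the ambient ring.\<close>

lemma pow_diff_consistent:
  assumes "subring K R" shows "ring.pow_diff (R\<lparr>carrier := K\<rparr>) = pow_diff"
proof (intro ext)
  fix x y k show "ring.pow_diff (R\<lparr>carrier := K\<rparr>) x y k = pow_diff x y k"
    by (induct k) (simp_all add: ring.pow_diff.simps[OF subring_is_ring[OF assms]] nat_pow_consistent[symmetric])
qed

lemma dq_consistent:
  assumes "subring K R" shows "ring.dq (R\<lparr>carrier := K\<rparr>) = dq"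
proof (intro ext)
  fix f x y show "ring.dq (R\<lparr>carrier := K\<rparr>) f x y = dq f x y"
    by (induct f) (simp_all add: ring.dq.simps[OF subring_is_ring[OF assms]] pow_diff_consistent[OF assms])
qed

end

text \<open>\<open>pow_diff x y k\<close> is the sum of the monomials x^i y^j with i + j = k - 1, so
  this is the classical factorisation of a difference of powers.\<close>

lemma (in cring) pow_diff_mult:
  assumes "x \<in> carrier R" "y \<in> carrier R"
  shows "x [^] k \<ominus> y [^] k = (x \<ominus> y) \<otimes> pow_diff x y k"
proof (induct k)
  case (Suc k)
  let ?p = "pow_diff x y k" and ?X = "x [^] k" and ?Y = "y [^] k"
  have c: "?p \<in> carrier R" "?X \<in> carrier R" "?Y \<in> carrier R" using assms by auto
  have "(x \<ominus> y) \<otimes> (x \<otimes> ?p \<oplus> ?Y) = x \<otimes> ((x \<ominus> y) \<otimes> ?p) \<oplus> (x \<ominus> y) \<otimes> ?Y"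
    using assms c by algebra
  also have "\<dots> = x \<otimes> (?X \<ominus> ?Y) \<oplus> (x \<ominus> y) \<otimes> ?Y" using Suc by simp
  also have "\<dots> = ?X \<otimes> x \<ominus> ?Y \<otimes> y" using assms c by algebra
  finally show ?case by simp
qed (simp add: assms a_minus_def r_neg)

lemma (in cring) eval_diff:
  assumes "set f \<subseteq> carrier R" "x \<in> carrier R" "y \<in> carrier R"
  shows "eval f x \<ominus> eval f y = (x \<ominus> y) \<otimes> dq f x y"
  using assms(1)
proof (induct f)
  case (Cons c f)
  let ?n = "length f"
  have c: "c \<in> carrier R" "eval f x \<in> carrier R" "eval f y \<in> carrier R" "dq f x y \<in> carrier R"
    "x [^] ?n \<in> carrier R" "y [^] ?n \<in> carrier R" "pow_diff x y ?n \<in> carrier R"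
    using Cons assms eval_in_carrier[of f] dq_closed[of f] by auto
  have "(c \<otimes> x [^] ?n \<oplus> eval f x) \<ominus> (c \<otimes> y [^] ?n \<oplus> eval f y) =
      c \<otimes> (x [^] ?n \<ominus> y [^] ?n) \<oplus> (eval f x \<ominus> eval f y)"
    using assms c by algebra
  also have "\<dots> = c \<otimes> ((x \<ominus> y) \<otimes> pow_diff x y ?n) \<oplus> (x \<ominus> y) \<otimes> dq f x y"
    using Cons pow_diff_mult assms by simp
  also have "\<dots> = (x \<ominus> y) \<otimes> (c \<otimes> pow_diff x y ?n \<oplus> dq f x y)"
    using assms c by algebra
  finally show ?case by simp
qed (use assms in \<open>auto simp: a_minus_def\<close>)

lemma (in ring_hom_ring) dq_hom:
  assumes "set f \<subseteq> carrier R" "x \<in> carrier R" "y \<in> carrier R"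
  shows "h (R.dq f x y) = S.dq (map h f) (h x) (h y)"
proof -
  have p: "h (R.pow_diff x y k) = S.pow_diff (h x) (h y) k" for k
    using assms by (induct k) (auto simp: hom_nat_pow)
  show ?thesis
    using assms(1) by (induct f) (auto simp: p assms R.dq_closed)
qed

text \<open>Applied to \<open>f\<close> as a polynomial over the polynomial ring, the identity for difference
  quotients splits off the linear factor.\<close>

lemma (in domain) split_linear_factor:
  assumes f: "f \<in> carrier (poly_ring R)" and a: "a \<in> carrier R" and root: "eval f a = \<zero>"
  obtains q where "q \<in> carrier (poly_ring R)" "f = [\<one>, \<ominus> a] \<otimes>\<^bsub>poly_ring R\<^esub> q" "eval q a = dq f a a"
proof -
  note sr = carrier_is_subring
  let ?c = "poly_of_const"
  interpret UP: domain "poly_ring R" by (rule univ_poly_is_domain[OF sr])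
  interpret C: ring_hom_ring R "poly_ring R" ?c
    using canonical_embedding_is_hom[OF sr] by (intro ring_hom_ringI2) (auto intro: ring_axioms UP.ring_axioms)
  interpret E: ring_hom_ring "poly_ring R" R "\<lambda>p. eval p a"
    by (rule eval_ring_hom[OF sr a])
  have fc: "set f \<subseteq> carrier R" using f by (simp add: univ_poly_carrier[symmetric] polynomial_in_carrier[OF sr])
  have cf: "set (map ?c f) \<subseteq> carrier (poly_ring R)" using fc C.hom_closed by auto
  have X: "X \<in> carrier (poly_ring R)" by (rule var_closed[OF sr])
  have ca: "?c a \<in> carrier (poly_ring R)" using a by simp
  have evc: "eval (?c b) a = b" if "b \<in> carrier R" for b
    using that a by (auto simp: poly_of_const_def)
  define q where "q = UP.dq (map ?c f) X (?c a)"
  have q: "q \<in> carrier (poly_ring R)" unfolding q_def using cf X ca by (rule UP.dq_closed)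
  have z: "UP.eval (map ?c f) (?c a) = \<zero>\<^bsub>poly_ring R\<^esub>"
    using C.eval_hom'[OF a fc] root by simp
  have lin: "X \<ominus>\<^bsub>poly_ring R\<^esub> ?c a = [\<one>, \<ominus> a]"
  proof -
    have "\<ominus>\<^bsub>poly_ring R\<^esub> ?c a = ?c (\<ominus> a)" using C.hom_a_inv[OF a] by (rule sym)
    then have "X \<ominus>\<^bsub>poly_ring R\<^esub> ?c a = poly_add X (normalize [\<ominus> a])"
      by (simp add: a_minus_def univ_poly_add poly_of_const_def del: poly_add.simps)
    also have "\<dots> = poly_add (monom \<one> (length [\<ominus> a])) [\<ominus> a]"
      using poly_add_normalize(2)[of "monom \<one> (length [\<ominus> a])" "[\<ominus> a]"] a by (simp add: var_def monom_def del: poly_add.simps)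
    also have "\<dots> = [\<one>, \<ominus> a]" using poly_add_monom[of "[\<ominus> a]" \<one>] a by (simp del: poly_add.simps)
    finally show ?thesis .
  qed
  \<comment> \<open>The lift of \<open>f\<close> takes the value \<open>f\<close> at
    \<open>X\<close> and the value zero at the constant \<open>a\<close>; the identity for
    difference quotients is applied at these two points of the polynomial ring.\<close>
  have "f = UP.eval (map ?c f) X \<ominus>\<^bsub>poly_ring R\<^esub> UP.eval (map ?c f) (?c a)"
    using eval_rewrite[OF sr f] z f by (simp add: a_minus_def)
  also have "\<dots> = (X \<ominus>\<^bsub>poly_ring R\<^esub> ?c a) \<otimes>\<^bsub>poly_ring R\<^esub> q"
    unfolding q_def by (rule UP.eval_diff[OF cf X ca])
  finally have "f = [\<one>, \<ominus> a] \<otimes>\<^bsub>poly_ring R\<^esub> q" by (simp add: lin)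
  moreover have "eval q a = dq f a a"
  proof -
    have "eval q a = dq (map (\<lambda>p. eval p a) (map ?c f)) (eval X a) (eval (?c a) a)"
      unfolding q_def by (rule E.dq_hom[OF cf X ca])
    moreover have "map (\<lambda>p. eval p a) (map ?c f) = f"
      using fc evc by (auto intro!: map_idI)
    ultimately show ?thesis using evc a by (simp add: eval_var)
  qed
  ultimately show ?thesis using q that by blast
qed

text \<open>After one factor X - a is split off, multiplicity at least 2 means that the cofactor
  vanishes at \<open>a\<close> too, and its value there is \<open>dq f a a\<close>. This trades
  multiplicities for two membership conditions, which are all that is used of simple zeros from here
  on.\<close>

lemma (in field) alg_mult_one_iff:
  assumes f: "f \<in> carrier (poly_ring R)" and a: "a \<in> carrier R"
  shows "alg_mult f a = 1 \<longleftrightarrow> eval f a = \<zero> \<and> dq f a a \<noteq> \<zero>"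
proof (cases "f \<noteq> [] \<and> eval f a = \<zero>")
  case False
  then show ?thesis
    using alg_mult_gt_zero_iff_is_root[OF f, of a] by (auto simp: is_root_def)
next
  case True
  note sr = carrier_is_subring
  interpret UP: domain "poly_ring R" by (rule univ_poly_is_domain[OF sr])
  let ?l = "[\<one>, \<ominus> a]"
  obtain q where q: "q \<in> carrier (poly_ring R)" "f = ?l \<otimes>\<^bsub>poly_ring R\<^esub> q" "eval q a = dq f a a"
    using split_linear_factor[OF f a] True by blast
  have l: "?l \<in> carrier (poly_ring R)" "?l \<noteq> \<zero>\<^bsub>poly_ring R\<^esub>"
    using a by (auto simp: univ_poly_carrier[symmetric] polynomial_def univ_poly_zero)
  have sq: "?l [^]\<^bsub>poly_ring R\<^esub> (2::nat) = ?l \<otimes>\<^bsub>poly_ring R\<^esub> ?l"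
    using l by (simp add: numeral_2_eq_2)
  have "2 \<le> alg_mult f a \<longleftrightarrow> (?l [^]\<^bsub>poly_ring R\<^esub> (2::nat)) pdivides f"
    using alg_multE(2)[OF a f] le_alg_mult_imp_pdivides[OF a f] True by blast
  also have "\<dots> \<longleftrightarrow> ?l pdivides q"
  proof
    assume "(?l [^]\<^bsub>poly_ring R\<^esub> (2::nat)) pdivides f"
    then obtain c where c: "c \<in> carrier (poly_ring R)" "?l \<otimes>\<^bsub>poly_ring R\<^esub> q = (?l \<otimes>\<^bsub>poly_ring R\<^esub> ?l) \<otimes>\<^bsub>poly_ring R\<^esub> c"
      unfolding sq q(2) pdivides_def factor_def by blast
    then have "?l \<otimes>\<^bsub>poly_ring R\<^esub> q = ?l \<otimes>\<^bsub>poly_ring R\<^esub> (?l \<otimes>\<^bsub>poly_ring R\<^esub> c)"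
      using l by (simp add: UP.m_assoc)
    then have "q = ?l \<otimes>\<^bsub>poly_ring R\<^esub> c"
      using UP.m_lcancel[OF l(2,1) q(1)] c(1) l(1) UP.m_closed by blast
    then show "?l pdivides q" using c(1) unfolding pdivides_def factor_def by blast
  next
    assume "?l pdivides q"
    then obtain c where c: "c \<in> carrier (poly_ring R)" "q = ?l \<otimes>\<^bsub>poly_ring R\<^esub> c"
      unfolding pdivides_def factor_def by blast
    then have "f = (?l [^]\<^bsub>poly_ring R\<^esub> (2::nat)) \<otimes>\<^bsub>poly_ring R\<^esub> c"
      unfolding sq using q(2) l(1) by (simp add: UP.m_assoc)
    then show "(?l [^]\<^bsub>poly_ring R\<^esub> (2::nat)) pdivides f"
      using c(1) unfolding pdivides_def factor_def by blast
  qed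
  also have "\<dots> \<longleftrightarrow> eval q a = \<zero>"
  proof (cases "q = []")
    case True then show ?thesis using pdivides_zero[OF sr l(1)] by simp
  next
    case False then show ?thesis
      using pdivides_imp_is_root[OF False a] is_root_imp_pdivides[OF q(1), of a] a
      by (auto simp: is_root_def)
  qed
  finally have "2 \<le> alg_mult f a \<longleftrightarrow> dq f a a = \<zero>" using q(3) by simp
  moreover have "alg_mult f a > 0"
    using alg_mult_gt_zero_iff_is_root[OF f, of a] True a by (simp add: is_root_def)
  ultimately show ?thesis using True by auto
qed

section \<open>Valuation rings\<close>

text \<open>For a valuation ring this is the maximal ideal. Zero is listed separately because its
  inverse is unspecified.\<close>

definition nonunits :: "('k, 'b) ring_scheme \<Rightarrow> 'k set \<Rightarrow> 'k set" where
  "nonunits K A = {x \<in> A. x = \<zero>\<^bsub>K\<^esub> \<or> inv\<^bsub>K\<^esub> x \<notin> A}"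

text \<open>Hensel's lemma for a single polynomial without mention of the residue field:
  \<open>a\<close> is any representative of the zero of the reduction, and lying in \<open>I\<close>
  replaces having residue zero.\<close>

definition (in ring) hensel_at :: "'a set \<Rightarrow> 'a set \<Rightarrow> 'a list \<Rightarrow> bool" where
  "hensel_at A I f \<longleftrightarrow>
     (\<forall>a \<in> A. eval f a \<in> I \<and> dq f a a \<notin> I \<longrightarrow> (\<exists>b \<in> A. eval f b = \<zero> \<and> b \<ominus> a \<in> I))"

locale valuation_subring = field K for K :: "('k, 'b) ring_scheme" (structure) +
  fixes A :: "'k set"
  assumes subring: "subring A K"
    and total: "\<lbrakk>x \<in> carrier K; x \<noteq> \<zero>\<rbrakk> \<Longrightarrow> x \<in> A \<or> inv x \<in> A"
begin

abbreviation I where "I \<equiv> nonunits K A"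
abbreviation RA where "RA \<equiv> K\<lparr>carrier := A\<rparr>"

lemma A_sub: "x \<in> A \<Longrightarrow> x \<in> carrier K"
  and A_closed [simp]: "\<lbrakk>x \<in> A; y \<in> A\<rbrakk> \<Longrightarrow> x \<otimes> y \<in> A" "\<lbrakk>x \<in> A; y \<in> A\<rbrakk> \<Longrightarrow> x \<oplus> y \<in> A"
    "x \<in> A \<Longrightarrow> \<ominus> x \<in> A" "\<zero> \<in> A" "\<one> \<in> A"
  using subringE[OF subring] by auto

lemma A_minus [simp]: "\<lbrakk>x \<in> A; y \<in> A\<rbrakk> \<Longrightarrow> x \<ominus> y \<in> A"
  by (simp add: a_minus_def)

lemma I_sub: "x \<in> I \<Longrightarrow> x \<in> A"
  by (simp add: nonunits_def)

lemma A_cring: "cring RA"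
  using subcring_iff[OF subringE(1)[OF subring]] subcringI'[OF subring] by simp

lemma one_notin_I: "\<one> \<notin> I"
  by (simp add: nonunits_def)

lemma nz_inv: "\<lbrakk>x \<in> carrier K; x \<noteq> \<zero>\<rbrakk> \<Longrightarrow> inv x \<in> carrier K \<and> inv x \<noteq> \<zero> \<and> x \<otimes> inv x = \<one> \<and> inv x \<otimes> x = \<one> \<and> inv (inv x) = x"
proof -
  assume x: "x \<in> carrier K" "x \<noteq> \<zero>"
  then have u: "x \<in> Units K" using field_Units by blast
  then have "inv x \<in> Units K" by simp
  then have "inv x \<noteq> \<zero>" using field_Units by blast
  then show ?thesis using u by simp
qed

lemma inv_mult: "\<lbrakk>x \<in> carrier K; x \<noteq> \<zero>; y \<in> carrier K; y \<noteq> \<zero>\<rbrakk> \<Longrightarrow> inv (x \<otimes> y) = inv x \<otimes> inv y"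
proof -
  assume *: "x \<in> carrier K" "x \<noteq> \<zero>" "y \<in> carrier K" "y \<noteq> \<zero>"
  then have "(inv x \<otimes> inv y) \<otimes> (x \<otimes> y) = (inv x \<otimes> x) \<otimes> (inv y \<otimes> y)"
    using nz_inv by (simp add: m_ac)
  then show ?thesis using * nz_inv
    by (metis comm_inv_char l_one m_closed m_comm one_closed)
qed

lemma I_absorb: "\<lbrakk>x \<in> I; y \<in> A\<rbrakk> \<Longrightarrow> x \<otimes> y \<in> I"
proof -
  assume x: "x \<in> I" and y: "y \<in> A"
  have "inv x \<in> A" if "x \<noteq> \<zero>" "y \<noteq> \<zero>" "inv (x \<otimes> y) \<in> A"
  proof -
    have "inv x = y \<otimes> inv (x \<otimes> y)"
      using x y that nz_inv[of x] nz_inv[of y] A_sub I_sub inv_mult[of x y]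
      by (metis m_closed m_comm m_lcomm r_one)
    then show ?thesis using y that by simp
  qed
  moreover have "y \<noteq> \<zero>" "x \<noteq> \<zero>" if "x \<otimes> y \<noteq> \<zero>"
    using that A_sub[OF y] A_sub[OF I_sub[OF x]] by auto
  ultimately show ?thesis using x y by (auto simp: nonunits_def)
qed

lemma I_uminus: "x \<in> I \<Longrightarrow> \<ominus> x \<in> I"
  using I_absorb[of x "\<ominus> \<one>"] I_sub A_sub by (simp add: r_minus)

text \<open>The summand of smaller value is factored out: x + y = y (x/y + 1), where one of the two
  quotients x/y and y/x lies in \<open>A\<close>.\<close>

lemma I_add: "\<lbrakk>x \<in> I; y \<in> I\<rbrakk> \<Longrightarrow> x \<oplus> y \<in> I"
proof -
  have *: "x \<oplus> y \<in> I" if x: "x \<in> I" and y: "y \<in> I" "y \<noteq> \<zero>" "x \<otimes> inv y \<in> A" for x y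
  proof -
    have c: "x \<in> carrier K" "y \<in> carrier K" "inv y \<in> carrier K" "inv y \<otimes> y = \<one>"
      using x y I_sub A_sub nz_inv by auto
    have "x \<oplus> y = y \<otimes> (x \<otimes> inv y \<oplus> \<one>)"
      using c by (simp add: r_distr m_ac)
    then show ?thesis using I_absorb[OF y(1)] y(3) by simp
  qed
  assume xy: "x \<in> I" "y \<in> I"
  have c: "x \<in> carrier K" "y \<in> carrier K" using xy I_sub A_sub by auto
  show ?thesis
  proof (cases "x = \<zero> \<or> y = \<zero>")
    case True then show ?thesis using xy c by auto
  next
    case False
    have "x \<otimes> inv y \<in> A \<or> inv (x \<otimes> inv y) \<in> A"
      using total[of "x \<otimes> inv y"] c False nz_inv[of y] integral by auto
    moreover have "inv (x \<otimes> inv y) = y \<otimes> inv x"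
      using inv_mult[of x "inv y"] nz_inv[of y] nz_inv[of x] c False by (simp add: m_comm)
    ultimately show ?thesis
      using *[of x y] *[of y x] xy c False a_comm by auto
  qed
qed

lemma I_minus: "\<lbrakk>x \<in> I; y \<in> I\<rbrakk> \<Longrightarrow> x \<ominus> y \<in> I"
  by (simp add: a_minus_def I_add I_uminus)

lemma zero_in_I: "\<zero> \<in> I"
  by (simp add: nonunits_def)

lemma I_ideal: "ideal I RA"
proof -
  interpret RA: cring RA by (rule A_cring)
  have minv: "\<ominus>\<^bsub>RA\<^esub> x = \<ominus> x" if "x \<in> A" for x
    by (rule RA.minus_equality) (use that A_sub in \<open>auto simp: l_neg\<close>)
  show ?thesis
  proof (rule idealI)
    show "ring RA" by (rule RA.ring_axioms)
    show "subgroup I (add_monoid RA)"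
      by (rule RA.add.subgroupI)
        (use zero_in_I I_sub minv I_uminus I_add in \<open>auto simp: a_inv_def[symmetric]\<close>)
  next
    fix a x assume "a \<in> I" "x \<in> carrier RA"
    then show "x \<otimes>\<^bsub>RA\<^esub> a \<in> I" "a \<otimes>\<^bsub>RA\<^esub> x \<in> I"
      using I_absorb I_sub A_sub m_comm[of x a] by auto
  qed
qed

lemma I_maximal: "maximalideal I RA"
proof (rule maximalidealI[OF I_ideal])
  show "carrier RA \<noteq> I" using one_notin_I A_closed(5) by auto
next
  fix J assume J: "ideal J RA" "I \<subseteq> J" "J \<subseteq> carrier RA"
  show "J = I \<or> J = carrier RA"
  proof (cases "J = I")
    case False
    then obtain x where x: "x \<in> J" "x \<notin> I" using J by auto
    then have "x \<in> A" "x \<noteq> \<zero>" "inv x \<in> A" using J by (auto simp: nonunits_def)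
    then have "\<one> \<in> J"
      using ideal.I_l_closed[OF J(1) x(1), of "inv x"] nz_inv[of x] A_sub by auto
    then show ?thesis using ideal.one_imp_carrier[OF J(1)] by simp
  qed simp
qed

abbreviation res where "res x \<equiv> I +>\<^bsub>RA\<^esub> x"

lemma res_hom: "ring_hom_ring RA (RA Quot I) res"
  by (rule ideal.rcos_ring_hom_ring[OF I_ideal])

lemma res_field: "field (RA Quot I)"
  by (rule maximalideal.quotient_is_field[OF I_maximal A_cring])

lemma A_minus_eq: "\<lbrakk>x \<in> A; y \<in> A\<rbrakk> \<Longrightarrow> x \<ominus>\<^bsub>RA\<^esub> y = x \<ominus> y"
proof -
  assume *: "x \<in> A" "y \<in> A"
  interpret RA: cring RA by (rule A_cring)
  have "\<ominus>\<^bsub>RA\<^esub> y = \<ominus> y"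
    by (rule RA.minus_equality) (use * A_sub in \<open>auto simp: l_neg\<close>)
  then show ?thesis by (simp add: a_minus_def)
qed

lemma res_eq_iff: "\<lbrakk>x \<in> A; y \<in> A\<rbrakk> \<Longrightarrow> res x = res y \<longleftrightarrow> x \<ominus> y \<in> I"
  using ring.quotient_eq_iff_same_a_r_cos[OF cring.axioms(1)[OF A_cring] I_ideal, of x y]
  by (auto simp: A_minus_eq)

lemma res_zero_iff: "x \<in> A \<Longrightarrow> res x = \<zero>\<^bsub>RA Quot I\<^esub> \<longleftrightarrow> x \<in> I"
proof -
  assume x: "x \<in> A"
  interpret h: ring_hom_ring RA "RA Quot I" res by (rule res_hom)
  show ?thesis using res_eq_iff[of x \<zero>] h.hom_zero x A_sub[of x] by (simp add: a_minus_def)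
qed

text \<open>Evaluation and difference quotients commute with the residue map. The coefficients may
  change within their residue classes as well as the arguments; \<open>K_hensel\<close> perturbs
  both.\<close>

lemma eval_cong:
  assumes "map res f = map res g" "set f \<subseteq> A" "set g \<subseteq> A" "a \<in> A" "b \<in> A" "a \<ominus> b \<in> I"
  shows "eval f a \<in> A" "eval f a \<ominus> eval g b \<in> I"
    "\<lbrakk>a' \<in> A; b' \<in> A; a' \<ominus> b' \<in> I\<rbrakk> \<Longrightarrow> dq f a a' \<in> A \<and> dq f a a' \<ominus> dq g b b' \<in> I"
proof -
  interpret h: ring_hom_ring RA "RA Quot I" res by (rule res_hom)
  note [simp] = eval_consistent[OF subring] dq_consistent[OF subring]
  have ev: "eval f a \<in> A" "eval g b \<in> A"
    using h.R.eval_in_carrier[of f a] h.R.eval_in_carrier[of g b] assms by simp_all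
  have ab: "res a = res b" using assms res_eq_iff by simp
  show "eval f a \<in> A" by (rule ev)
  have "res (eval f a) = res (eval g b)"
    using h.eval_hom'[of a f] h.eval_hom'[of b g] assms ab by simp
  then show "eval f a \<ominus> eval g b \<in> I" using ev res_eq_iff by simp
  assume *: "a' \<in> A" "b' \<in> A" "a' \<ominus> b' \<in> I"
  have dv: "dq f a a' \<in> A" "dq g b b' \<in> A"
    using h.R.dq_closed[of f a a'] h.R.dq_closed[of g b b'] assms * by simp_all
  have "res a' = res b'" using * res_eq_iff by simp
  then have "res (dq f a a') = res (dq g b b')"
    using h.dq_hom[of f a a'] h.dq_hom[of g b b'] assms * ab by simp
  then show "dq f a a' \<in> A \<and> dq f a a' \<ominus> dq g b b' \<in> I" using dv res_eq_iff by simp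
qed

lemma I_cong: "\<lbrakk>x \<in> A; y \<in> A; x \<ominus> y \<in> I\<rbrakk> \<Longrightarrow> x \<in> I \<longleftrightarrow> y \<in> I"
  using res_eq_iff res_zero_iff by metis

text \<open>Every residue is represented in \<open>A\<close>, and normalising the reduced list
  changes neither its values nor its difference quotients, so the simple zeros of the reduction are
  the residues of those \<open>a\<close> with f(a) in \<open>I\<close> and f'(a) not in
  \<open>I\<close>.\<close>

lemma reduction_lift_iff:
  assumes f: "set f \<subseteq> A" and f': "f \<in> carrier (poly_ring RA)" 
  shows "(\<forall>\<alpha> \<in> carrier (RA Quot I).
        ring.alg_mult (RA Quot I) (ring.normalize (RA Quot I) (map res f)) \<alpha> = 1 \<longrightarrow>
        (\<exists>a \<in> A. ring.eval RA f a = \<zero> \<and> res a = \<alpha>)) \<longleftrightarrow> hensel_at A I f"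
proof -
  interpret F: field "RA Quot I" by (rule res_field)
  interpret h: ring_hom_ring RA "RA Quot I" res by (rule res_hom)
  note [simp] = eval_consistent[OF subring] dq_consistent[OF subring]
  let ?f = "F.normalize (map res f)"
  have mf: "set (map res f) \<subseteq> carrier (RA Quot I)" using f by auto
  have pf: "?f \<in> carrier (poly_ring (RA Quot I))"
    using F.normalize_gives_polynomial[OF mf] by (simp add: univ_poly_carrier)
  have iff: "F.alg_mult ?f (res a) = 1 \<longleftrightarrow> eval f a \<in> I \<and> dq f a a \<notin> I" if a: "a \<in> A" for a
  proof -
    have "F.eval ?f (res a) = res (eval f a)" "F.dq ?f (res a) (res a) = res (dq f a a)"
      using F.eval_normalize[OF mf] F.dq_normalize[OF mf] h.eval_hom'[of a f] h.dq_hom[of f a a] a f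
      by auto
    moreover have "eval f a \<in> A" "dq f a a \<in> A"
      using h.R.eval_in_carrier h.R.dq_closed a f by auto
    ultimately show ?thesis
      using F.alg_mult_one_iff[OF pf, of "res a"] a res_zero_iff by simp
  qed
  have surj: "carrier (RA Quot I) = res ` A"
    by (auto simp: FactRing_def A_RCOSETS_def')
  show ?thesis
    unfolding surj hensel_at_def ball_simps using iff res_eq_iff by auto
qed

end

lemma (in valuation) unit_facts:
  assumes "x \<in> carrier K" "x \<noteq> \<zero>"
  shows "v x \<in> carrier G" "inv x \<in> carrier K" "inv x \<noteq> \<zero>" "v (inv x) = inv\<^bsub>G\<^esub> (v x)"
    "gle G \<one>\<^bsub>G\<^esub> (inv\<^bsub>G\<^esub> (v x)) \<longleftrightarrow> gle G (v x) \<one>\<^bsub>G\<^esub>"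
proof -
  have mc: "x \<in> carrier (Multiplicative_Group.mult_of K)" using assms by simp
  interpret U: group "Multiplicative_Group.mult_of K" by (rule field_mult_group)
  interpret h: group_hom "Multiplicative_Group.mult_of K" G v
    by (simp add: group_hom_def group_hom_axioms_def v_hom U.group_axioms G.is_group)
  show vx: "v x \<in> carrier G" using mc by simp
  show i: "inv x \<in> carrier K" "inv x \<noteq> \<zero>"
    using assms U.inv_closed[OF mc] m_inv_mult_of[OF mc] by auto
  show "v (inv x) = inv\<^bsub>G\<^esub> (v x)"
    using h.hom_inv[OF mc] m_inv_mult_of[OF mc] by simp
  show "gle G \<one>\<^bsub>G\<^esub> (inv\<^bsub>G\<^esub> (v x)) \<longleftrightarrow> gle G (v x) \<one>\<^bsub>G\<^esub>"
    using G.gle_mult[of "\<one>\<^bsub>G\<^esub>" "inv\<^bsub>G\<^esub> (v x)" "v x"] G.gle_mult[of "v x" "\<one>\<^bsub>G\<^esub>" "inv\<^bsub>G\<^esub> (v x)"] vx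
    by auto
qed

lemma (in valuation) valuation_subring_val_ring_set:
  "valuation_subring K (val_ring_set K G v)"
proof (intro valuation_subring.intro valuation_subring_axioms.intro field_axioms)
  let ?A = "val_ring_set K G v"
  have hm: "v (x \<otimes> y) = v x \<otimes>\<^bsub>G\<^esub> v y" if "x \<in> carrier K" "x \<noteq> \<zero>" "y \<in> carrier K" "y \<noteq> \<zero>" for x y
    using v_hom that by (auto simp: hom_def)
  have v1: "v \<one> = \<one>\<^bsub>G\<^esub>"
  proof -
    have "v \<one> \<otimes>\<^bsub>G\<^esub> v \<one> = v \<one>" using hm[of \<one> \<one>] by simp
    then show ?thesis using unit_facts(1)[of \<one>] by (metis G.l_cancel_one' one_closed one_not_zero)
  qed
  have neg: "\<ominus> x \<in> ?A" if x: "x \<in> ?A" for x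
  proof -
    \<comment> \<open>The square of v(-1) is trivial; since an ordered group has no element of order
      two, v(-1) itself is trivial.\<close>
    have sq: "v (\<ominus> \<one>) \<otimes>\<^bsub>G\<^esub> v (\<ominus> \<one>) = \<one>\<^bsub>G\<^esub>"
      using hm[of "\<ominus> \<one>" "\<ominus> \<one>"] v1 by (simp add: l_minus r_minus)
    have vm: "v (\<ominus> \<one>) \<in> carrier G" using unit_facts(1)[of "\<ominus> \<one>"] by simp
    have m1: "v (\<ominus> \<one>) = \<one>\<^bsub>G\<^esub>"
    proof (rule G.gle_antisym)
      have "gle G (v (\<ominus> \<one>)) \<one>\<^bsub>G\<^esub> \<Longrightarrow> gle G \<one>\<^bsub>G\<^esub> (v (\<ominus> \<one>))"
        using G.gle_mult[of "v (\<ominus> \<one>)" "\<one>\<^bsub>G\<^esub>" "v (\<ominus> \<one>)"] vm sq by simp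
      moreover have "gle G \<one>\<^bsub>G\<^esub> (v (\<ominus> \<one>)) \<Longrightarrow> gle G (v (\<ominus> \<one>)) \<one>\<^bsub>G\<^esub>"
        using G.gle_mult[of "\<one>\<^bsub>G\<^esub>" "v (\<ominus> \<one>)" "v (\<ominus> \<one>)"] vm sq by simp
      ultimately show "gle G (v (\<ominus> \<one>)) \<one>\<^bsub>G\<^esub>" "gle G \<one>\<^bsub>G\<^esub> (v (\<ominus> \<one>))"
        using G.gle_total[OF vm G.one_closed] by blast+
    qed (use vm in auto)
    show "\<ominus> x \<in> ?A"
    proof (cases "x = \<zero>")
      case True then show ?thesis using x by (simp add: val_ring_set_def)
    next
      case False
      then have c: "x \<in> carrier K" "gle G \<one>\<^bsub>G\<^esub> (v x)" using x by (auto simp: val_ring_set_def)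
      have "v (\<ominus> x) = v x"
        using hm[of "\<ominus> \<one>" x] c False m1 unit_facts(1)[of x] by (simp add: l_minus)
      then show ?thesis using c by (simp add: val_ring_set_def)
    qed
  qed
  show "subring ?A K"
  proof (rule subringI)
    show "?A \<subseteq> carrier K" by (auto simp: val_ring_set_def)
    show "\<one> \<in> ?A" using v1 by (auto simp: val_ring_set_def G.gle_refl)
  next
    fix x y assume xy: "x \<in> ?A" "y \<in> ?A"
    show "x \<otimes> y \<in> ?A"
    proof (cases "x = \<zero> \<or> y = \<zero>")
      case True then show ?thesis using xy by (auto simp: val_ring_set_def)
    next
      case False
      then have c: "x \<in> carrier K" "y \<in> carrier K" "x \<noteq> \<zero>" "y \<noteq> \<zero>" "gle G \<one>\<^bsub>G\<^esub> (v x)" "gle G \<one>\<^bsub>G\<^esub> (v y)"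
        using xy by (auto simp: val_ring_set_def)
      have "gle G (v y) (v x \<otimes>\<^bsub>G\<^esub> v y)"
        using G.gle_mult[of "\<one>\<^bsub>G\<^esub>" "v x" "v y"] c unit_facts(1) by auto
      then have "gle G \<one>\<^bsub>G\<^esub> (v x \<otimes>\<^bsub>G\<^esub> v y)"
        using G.gle_trans[of "\<one>\<^bsub>G\<^esub>" "v y" "v x \<otimes>\<^bsub>G\<^esub> v y"] c unit_facts(1) by auto
      then show ?thesis using c hm by (auto simp: val_ring_set_def)
    qed
    show "x \<oplus> y \<in> ?A"
    proof (cases "x = \<zero> \<or> y = \<zero> \<or> x \<oplus> y = \<zero>")
      case True then show ?thesis using xy by (auto simp: val_ring_set_def)
    next
      case False
      then have c: "x \<in> carrier K" "y \<in> carrier K" "x \<noteq> \<zero>" "y \<noteq> \<zero>" "gle G \<one>\<^bsub>G\<^esub> (v x)" "gle G \<one>\<^bsub>G\<^esub> (v y)"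
        using xy by (auto simp: val_ring_set_def)
      then have "gle G \<one>\<^bsub>G\<^esub> (v (x \<oplus> y))"
        using v_add[of x y] False G.gle_trans[of "\<one>\<^bsub>G\<^esub>" "v x" "v (x \<oplus> y)"] G.gle_trans[of "\<one>\<^bsub>G\<^esub>" "v y" "v (x \<oplus> y)"]
          unit_facts(1) by auto
      then show ?thesis using c by (auto simp: val_ring_set_def)
    qed
  next
    fix h assume "h \<in> ?A"
    then show "\<ominus> h \<in> ?A" by (rule neg)
  qed
next
  fix x assume x: "x \<in> carrier K" "x \<noteq> \<zero>"
  then show "x \<in> val_ring_set K G v \<or> inv x \<in> val_ring_set K G v"
    using unit_facts[OF x] G.gle_total[of "v x" "\<one>\<^bsub>G\<^esub>"] by (auto simp: val_ring_set_def)
qed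

lemma (in valuation) val_ideal_eq_nonunits: "val_ideal K G v = nonunits K (val_ring_set K G v)"
proof -
  have "gless G \<one>\<^bsub>G\<^esub> (v x) \<longleftrightarrow> gle G \<one>\<^bsub>G\<^esub> (v x) \<and> inv x \<notin> val_ring_set K G v"
    if x: "x \<in> carrier K" "x \<noteq> \<zero>" for x
  proof -
    note u = unit_facts[OF x]
    have "inv x \<in> val_ring_set K G v \<longleftrightarrow> gle G (v x) \<one>\<^bsub>G\<^esub>"
      using u(2,3,5) by (simp add: val_ring_set_def u(4))
    moreover have "gle G (v x) \<one>\<^bsub>G\<^esub> \<longleftrightarrow> v x = \<one>\<^bsub>G\<^esub>" if "gle G \<one>\<^bsub>G\<^esub> (v x)"
      using that G.gle_antisym[OF u(1) G.one_closed] G.gle_refl[OF u(1)] by metis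
    ultimately show ?thesis unfolding gless_def by metis
  qed
  moreover have "x \<in> val_ring_set K G v \<longleftrightarrow> x \<in> carrier K \<and> (x = \<zero> \<or> gle G \<one>\<^bsub>G\<^esub> (v x))" for x
    by (simp add: val_ring_set_def)
  ultimately show ?thesis
    unfolding val_ideal_def nonunits_def set_eq_iff mem_Collect_eq by blast
qed

lemma (in valuation) simple_zeros_lift_iff:
  assumes "f \<in> carrier (poly_ring (val_ring K G v))"
  shows "simple_zeros_lift K G v f \<longleftrightarrow> hensel_at (val_ring_set K G v) (val_ideal K G v) f"
proof -
  let ?A = "val_ring_set K G v"
  interpret V: valuation_subring K ?A by (rule valuation_subring_val_ring_set)
  interpret RA: cring V.RA by (rule V.A_cring)
  have "set f \<subseteq> ?A"
    using assms RA.polynomial_incl[of _ f] by (simp add: val_ring_def univ_poly_carrier[symmetric])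
  then show ?thesis
    using V.reduction_lift_iff[of f] assms
    by (simp add: simple_zeros_lift_def reduction_def residue_field_def residue_def[abs_def]
        val_ring_def val_ideal_eq_nonunits)
qed

lemma (in valuation) mem_poly_ring_val_ring:
  assumes "set f \<subseteq> val_ring_set K G v" "f = [] \<or> hd f \<noteq> \<zero>"
  shows "f \<in> carrier (poly_ring (val_ring K G v))"
  using assms by (simp add: univ_poly_carrier[symmetric] polynomial_def val_ring_def)

text \<open>The value group is the group of nonzero elements modulo the units of \<open>A\<close>,
  ordered by divisibility. Its elements are sets of field elements, which is the type that
  \<open>henselian_field\<close> asks for.\<close>

lemma (in valuation_subring) ex_valuation:
  assumes nt: "A \<noteq> carrier K"
  obtains G :: "'k set ogroup" and v where
    "valuation K G v" "nontrivial_valuation K G v" "val_ring_set K G v = A"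
proof -
  define M where "M = Multiplicative_Group.mult_of K"
  define U where "U = {x \<in> A. x \<noteq> \<zero> \<and> inv x \<in> A}"
  have Mc [simp]: "carrier M = carrier K - {\<zero>}" "monoid.mult M = monoid.mult K" "\<one>\<^bsub>M\<^esub> = \<one>"
    by (simp_all add: M_def)
  interpret M: group M unfolding M_def by (rule field_mult_group)
  interpret M: comm_group M by (rule M.group_comm_groupI) (auto simp: m_comm)
  have Minv: "inv\<^bsub>M\<^esub> x = inv x" if "x \<in> carrier K" "x \<noteq> \<zero>" for x
    using that by (simp add: M_def m_inv_mult_of)
  have subU: "subgroup U M"
  proof (rule M.subgroupI)
    show "U \<subseteq> carrier M" using A_sub by (auto simp: U_def)
    have "\<one> \<in> U" by (simp add: U_def)
    then show "U \<noteq> {}" by blast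
  next
    fix x assume "x \<in> U"
    then show "inv\<^bsub>M\<^esub> x \<in> U" using A_sub[of x] nz_inv[of x] Minv[of x] by (auto simp: U_def)
  next
    fix x y assume "x \<in> U" "y \<in> U"
    then show "x \<otimes>\<^bsub>M\<^esub> y \<in> U"
      using A_sub[of x] A_sub[of y] nz_inv[of x] nz_inv[of y] inv_mult[of x y] integral[of x y]
      by (auto simp: U_def)
  qed
  have nU: "U \<lhd> M" by (rule M.subgroup_imp_normal[OF subU])
  interpret Q: comm_group "M Mod U" by (rule M.abelian_FactGroup[OF subU])
  define v where "v x = U #>\<^bsub>M\<^esub> x" for x
  have v_hom: "v \<in> hom M (M Mod U)"
    using normal.r_coset_hom_Mod[OF nU] by (simp add: v_def[abs_def])
  define le where "le C D \<longleftrightarrow> (\<exists>x \<in> C. \<exists>y \<in> D. y \<otimes> inv x \<in> A)" for C D :: "'k set"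
  define G :: "'k set ogroup" where
    "G = \<lparr>carrier = carrier (M Mod U), monoid.mult = monoid.mult (M Mod U), one = \<one>\<^bsub>M Mod U\<^esub>, gle = le\<rparr>"
  have Gs: "carrier G = carrier (M Mod U)" "monoid.mult G = monoid.mult (M Mod U)" "\<one>\<^bsub>G\<^esub> = \<one>\<^bsub>M Mod U\<^esub>" "gle G = le"
    by (simp_all add: G_def)
  have carr: "carrier (M Mod U) = v ` (carrier K - {\<zero>})"
    by (auto simp: FactGroup_def RCOSETS_def v_def)
  have mult4: "(p \<otimes> q) \<otimes> ((r \<otimes> s) \<otimes> (t \<otimes> u)) = (p \<otimes> r) \<otimes> (q \<otimes> t) \<otimes> (s \<otimes> u)"
    if "p \<in> carrier K" "q \<in> carrier K" "r \<in> carrier K" "s \<in> carrier K" "t \<in> carrier K" "u \<in> carrier K"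
    for p q r s t u
    using that by algebra
  have memv: "x' \<in> v x \<longleftrightarrow> (\<exists>u \<in> U. x' = u \<otimes> x)" for x x'
    by (auto simp: v_def r_coset_def)
  have le_iff: "le (v x) (v y) \<longleftrightarrow> y \<otimes> inv x \<in> A" if x: "x \<in> carrier K" "x \<noteq> \<zero>" and y: "y \<in> carrier K" "y \<noteq> \<zero>" for x y
  proof
    assume "le (v x) (v y)"
    then obtain a b where ab: "a \<in> U" "b \<in> U" "(b \<otimes> y) \<otimes> inv (a \<otimes> x) \<in> A"
      by (auto simp: le_def memv)
    then have c: "a \<in> carrier K" "b \<in> carrier K" "a \<noteq> \<zero>" "b \<noteq> \<zero>" "inv b \<in> A" "a \<in> A" by (auto simp: U_def A_sub)
    have "y \<otimes> inv x = (inv b \<otimes> a) \<otimes> ((b \<otimes> y) \<otimes> inv (a \<otimes> x))"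
    proof -
      have "(inv b \<otimes> a) \<otimes> ((b \<otimes> y) \<otimes> (inv a \<otimes> inv x)) = (inv b \<otimes> b) \<otimes> (a \<otimes> inv a) \<otimes> (y \<otimes> inv x)"
        using mult4[of "inv b" a b y "inv a" "inv x"] c x y nz_inv[of a] nz_inv[of b] nz_inv[of x] by simp
      then show ?thesis using c x y nz_inv[of a] nz_inv[of b] nz_inv[of x] inv_mult[of a x] by simp
    qed
    then show "y \<otimes> inv x \<in> A" using ab(3) c by simp
  next
    assume "y \<otimes> inv x \<in> A"
    moreover have "\<one> \<in> U" by (simp add: U_def)
    then have "x \<in> v x" "y \<in> v y" using x y memv[of x x] memv[of y y] l_one by metis+
    ultimately show "le (v x) (v y)" by (auto simp: le_def)
  qed
  have v_eq: "v x = v y" if x: "x \<in> carrier K" "x \<noteq> \<zero>" and y: "y \<in> carrier K" "y \<noteq> \<zero>"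
    and "y \<otimes> inv x \<in> A" "x \<otimes> inv y \<in> A" for x y
  proof -
    have "inv (y \<otimes> inv x) = x \<otimes> inv y"
      using x y nz_inv[of x] nz_inv[of y] inv_mult[of y "inv x"] by (simp add: m_comm)
    then have "y \<otimes> inv x \<in> U" using that nz_inv[of x] integral[of y "inv x"] by (auto simp: U_def)
    moreover have "y = (y \<otimes> inv x) \<otimes> x" using x y nz_inv[of x] by (simp add: m_assoc)
    ultimately have "y \<in> v x" using memv by blast
    then show ?thesis unfolding v_def using M.repr_independence[OF _ _ subU] x by simp
  qed
  have vm: "v x \<otimes>\<^bsub>M Mod U\<^esub> v y = v (x \<otimes> y)" if "x \<in> carrier K" "x \<noteq> \<zero>" "y \<in> carrier K" "y \<noteq> \<zero>" for x y
    using v_hom that by (simp add: hom_def)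
  have v1: "v \<one> = \<one>\<^bsub>M Mod U\<^esub>"
    unfolding v_def using M.coset_join2[OF _ subU, of "\<one>"] A_closed(5) subgroup.one_closed[OF subU]
    by (simp add: FactGroup_def)
  have "comm_group G"
    by (rule comm_groupI; unfold Gs) (use Q.l_inv_ex in \<open>auto simp: Q.m_assoc Q.m_lcomm Q.m_comm simp del: mult_FactGroup one_FactGroup\<close>)
  moreover have "ordered_abelian_group_axioms G"
  proof -
    have antisym: "v x = v y"
      if "x \<in> carrier K - {\<zero>}" "y \<in> carrier K - {\<zero>}" "le (v x) (v y)" "le (v y) (v x)" for x y
      using that le_iff v_eq by simp
    have trans: "le (v x) (v z)"
      if "x \<in> carrier K - {\<zero>}" "y \<in> carrier K - {\<zero>}" "z \<in> carrier K - {\<zero>}" "le (v x) (v y)" "le (v y) (v z)" for x y z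
    proof -
      have xyz: "x \<in> carrier K" "x \<noteq> \<zero>" "y \<in> carrier K" "y \<noteq> \<zero>" "z \<in> carrier K" "z \<noteq> \<zero>" using that by auto
      then have "(z \<otimes> inv y) \<otimes> (y \<otimes> inv x) \<in> A" using le_iff that by simp
      moreover have "(z \<otimes> inv y) \<otimes> (y \<otimes> inv x) = z \<otimes> ((inv y \<otimes> y) \<otimes> inv x)"
        using xyz nz_inv[of x] nz_inv[of y] m_assoc m_closed by metis
      ultimately show ?thesis using le_iff xyz nz_inv[of x] nz_inv[of y] by simp
    qed
    have tot: "le (v x) (v y) \<or> le (v y) (v x)" if "x \<in> carrier K - {\<zero>}" "y \<in> carrier K - {\<zero>}" for x y
    proof -
      have xy: "x \<in> carrier K" "x \<noteq> \<zero>" "y \<in> carrier K" "y \<noteq> \<zero>" using that by auto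
      have "inv (y \<otimes> inv x) = x \<otimes> inv y"
        using xy nz_inv[of x] nz_inv[of y] inv_mult[of y "inv x"] by (simp add: m_comm)
      then show ?thesis
        using xy le_iff total[of "y \<otimes> inv x"] nz_inv[of x] integral[of y "inv x"] by auto
    qed
    have mono: "le (v x \<otimes>\<^bsub>M Mod U\<^esub> v z) (v y \<otimes>\<^bsub>M Mod U\<^esub> v z)"
      if "x \<in> carrier K - {\<zero>}" "y \<in> carrier K - {\<zero>}" "z \<in> carrier K - {\<zero>}" "le (v x) (v y)" for x y z
    proof -
      have xyz: "x \<in> carrier K" "x \<noteq> \<zero>" "y \<in> carrier K" "y \<noteq> \<zero>" "z \<in> carrier K" "z \<noteq> \<zero>" using that by auto
      then have "y \<otimes> inv x \<in> A" using le_iff that by simp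
      moreover have "(y \<otimes> z) \<otimes> inv (x \<otimes> z) = y \<otimes> inv x"
        using xyz nz_inv[of x] nz_inv[of z] mult4[of y z "inv x" \<one> "inv z" \<one>] inv_mult[of x z] by simp
      moreover have "v x \<otimes>\<^bsub>M Mod U\<^esub> v z = v (x \<otimes> z)" "v y \<otimes>\<^bsub>M Mod U\<^esub> v z = v (y \<otimes> z)"
        using vm xyz by blast+
      ultimately show ?thesis
        using le_iff[of "x \<otimes> z" "y \<otimes> z"] xyz integral by auto
    qed
    have refl: "le (v x) (v x)" if "x \<in> carrier K - {\<zero>}" for x
      using that le_iff nz_inv[of x] by simp
    show ?thesis
    proof (rule ordered_abelian_group_axioms.intro, unfold Gs carr)
      fix C D E assume CDE: "C \<in> v ` (carrier K - {\<zero>})" "D \<in> v ` (carrier K - {\<zero>})" "E \<in> v ` (carrier K - {\<zero>})"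
      then obtain x y z where xyz: "x \<in> carrier K - {\<zero>}" "y \<in> carrier K - {\<zero>}" "z \<in> carrier K - {\<zero>}"
        and [simp]: "C = v x" "D = v y" "E = v z" by blast
      show "le C D \<Longrightarrow> le D E \<Longrightarrow> le C E" using trans[OF xyz] by simp
      show "le C D \<Longrightarrow> le (C \<otimes>\<^bsub>M Mod U\<^esub> E) (D \<otimes>\<^bsub>M Mod U\<^esub> E)" using mono[OF xyz] by simp
    next
      fix C D assume "C \<in> v ` (carrier K - {\<zero>})" "D \<in> v ` (carrier K - {\<zero>})"
      then obtain x y where xy: "x \<in> carrier K - {\<zero>}" "y \<in> carrier K - {\<zero>}"
        and [simp]: "C = v x" "D = v y" by blast
      show "le C D \<Longrightarrow> le D C \<Longrightarrow> C = D" using antisym[OF xy] by simp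
      show "le C D \<or> le D C" using tot[OF xy] by simp
    qed (use refl in blast)
  qed
  ultimately have ord: "ordered_abelian_group G" by (simp add: ordered_abelian_group_def)
  have "valuation K G v"
  proof (intro valuation.intro ord field_axioms valuation_axioms.intro)
    show "v \<in> hom (Multiplicative_Group.mult_of K) G"
      using v_hom by (simp add: hom_def Gs M_def)
  next
    fix x y assume xy: "x \<in> carrier K" "y \<in> carrier K" "x \<noteq> \<zero>" "y \<noteq> \<zero>" "x \<oplus> y \<noteq> \<zero>"
    have c: "inv x \<in> carrier K" "inv y \<in> carrier K" "x \<otimes> inv x = \<one>" "y \<otimes> inv y = \<one>" using nz_inv xy by auto
    have "(x \<oplus> y) \<otimes> inv x = \<one> \<oplus> y \<otimes> inv x" "(x \<oplus> y) \<otimes> inv y = x \<otimes> inv y \<oplus> \<one>"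
      using xy c by (simp_all add: l_distr)
    moreover have "y \<otimes> inv x \<in> A \<or> x \<otimes> inv y \<in> A"
      using total[of "y \<otimes> inv x"] xy c integral[of y "inv x"] inv_mult[of y "inv x"] nz_inv[of x] by (auto simp: m_comm)
    ultimately show "gle G (v x) (v (x \<oplus> y)) \<or> gle G (v y) (v (x \<oplus> y))"
      unfolding Gs using le_iff xy by auto
  qed
  moreover have vr: "val_ring_set K G v = A"
  proof -
    have "gle G \<one>\<^bsub>G\<^esub> (v x) \<longleftrightarrow> x \<in> A" if "x \<in> carrier K" "x \<noteq> \<zero>" for x
      unfolding Gs v1[symmetric] using le_iff[of \<one> x] that by simp
    then show ?thesis using A_sub A_closed(4) unfolding val_ring_set_def set_eq_iff mem_Collect_eq by metis
  qed
  moreover have "nontrivial_valuation K G v"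
  proof -
    obtain x where x: "x \<in> carrier K" "x \<notin> A" using nt subringE(1)[OF subring] by auto
    then have "x \<noteq> \<zero>" by auto
    have "v x \<noteq> \<one>\<^bsub>G\<^esub>"
    proof
      assume "v x = \<one>\<^bsub>G\<^esub>"
      then have "le (v \<one>) (v x)" using le_iff[of \<one> \<one>] v1 by (simp add: Gs)
      then show False using le_iff[of \<one> x] x \<open>x \<noteq> \<zero>\<close> by simp
    qed
    then show ?thesis using x \<open>x \<noteq> \<zero>\<close> by (auto simp: nontrivial_valuation_def)
  qed
  ultimately show ?thesis using that by blast
qed

section \<open>Ultrapowers\<close>

text \<open>Zorn's lemma is applied to families of sets whose finite intersections are all infinite.
  Asking for infinite instead of nonempty intersections makes the resulting ultrafilter
  free.\<close>

lemma ex_free_ultrafilter: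
  obtains F :: "nat filter" where "F \<noteq> bot" "F \<le> sequentially"
    "\<And>P. eventually P F \<or> eventually (\<lambda>i. \<not> P i) F"
proof -
  define fip where "fip U \<longleftrightarrow> (\<forall>S. finite S \<and> S \<subseteq> U \<longrightarrow> infinite (\<Inter>S))" for U :: "nat set set"
  have "\<exists>U \<in> Collect fip. \<forall>V \<in> Collect fip. U \<subseteq> V \<longrightarrow> V = U"
  proof (rule subset_Zorn_nonempty)
    show "Collect fip \<noteq> {}" unfolding fip_def by (auto intro!: exI[of _ "{}"])
    fix CC assume CC: "CC \<noteq> {}" "subset.chain (Collect fip) CC"
    have "infinite (\<Inter>S)" if S: "finite S" "S \<subseteq> \<Union>CC" for S
    proof -
      obtain V where "V \<in> CC" "S \<subseteq> V"
        using finite_subset_Union_chain[OF S CC] by blast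
      then show ?thesis using S(1) CC(2) by (auto simp: fip_def subset.chain_def)
    qed
    then show "\<Union>CC \<in> Collect fip" by (simp add: fip_def)
  qed
  then obtain U where U: "fip U" and max: "\<And>V. fip V \<Longrightarrow> U \<subseteq> V \<Longrightarrow> V = U" by blast
  \<comment> \<open>By maximality a set belongs to \<open>U\<close> as soon as adding it would
    preserve the intersection property. The filter axioms are read off from this criterion.\<close>
  have in_iff: "W \<in> U \<longleftrightarrow> (\<forall>S. finite S \<and> S \<subseteq> U \<longrightarrow> infinite (\<Inter>S \<inter> W))" for W
  proof
    assume "W \<in> U"
    then show "\<forall>S. finite S \<and> S \<subseteq> U \<longrightarrow> infinite (\<Inter>S \<inter> W)"
      using U unfolding fip_def by (metis Inf_insert Int_commute finite_insert insert_subset)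
  next
    assume *: "\<forall>S. finite S \<and> S \<subseteq> U \<longrightarrow> infinite (\<Inter>S \<inter> W)"
    have "infinite (\<Inter>S)" if S: "finite S" "S \<subseteq> insert W U" for S
    proof -
      have "infinite (\<Inter>(S - {W}) \<inter> W)" using *[rule_format, of "S - {W}"] S by auto
      moreover have "\<Inter>(S - {W}) \<inter> W \<subseteq> \<Inter>S" by auto
      ultimately show ?thesis using finite_subset by blast
    qed
    then have "fip (insert W U)" by (simp add: fip_def)
    then show "W \<in> U" using max[of "insert W U"] by blast
  qed
  have up: "W' \<in> U" if "W \<in> U" "W \<subseteq> W'" for W W'
    using that in_iff[of W] in_iff[of W'] finite_subset[of "_ \<inter> W" "_ \<inter> W'"] by (meson Int_mono order_refl)
  have cap: "W \<inter> W' \<in> U" if "W \<in> U" "W' \<in> U" for W W'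
  proof -
    have "infinite (\<Inter>S \<inter> (W \<inter> W'))" if S: "finite S" "S \<subseteq> U" for S
    proof -
      have "infinite (\<Inter>(insert W S) \<inter> W')" using in_iff[of W'] \<open>W \<in> U\<close> \<open>W' \<in> U\<close> S by (metis finite_insert insert_subset)
      then show ?thesis by (simp add: Int_ac)
    qed
    then show ?thesis unfolding in_iff[of "W \<inter> W'"] by blast
  qed
  \<comment> \<open>If both \<open>W\<close> and its complement are rejected, the witnesses
    \<open>S\<close> and \<open>T\<close> together have an intersection covered by two finite
    sets.\<close>
  have ultra: "W \<in> U \<or> - W \<in> U" for W
  proof (rule ccontr)
    assume "\<not> (W \<in> U \<or> - W \<in> U)"
    then obtain S T where ST: "finite S" "S \<subseteq> U" "finite (\<Inter>S \<inter> W)" "finite T" "T \<subseteq> U" "finite (\<Inter>T \<inter> - W)"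
      unfolding in_iff by blast
    then have "infinite (\<Inter>(S \<union> T))" using U by (auto simp: fip_def)
    moreover have "\<Inter>(S \<union> T) \<subseteq> (\<Inter>S \<inter> W) \<union> (\<Inter>T \<inter> - W)" by blast
    ultimately show False using ST(3,6) by (meson finite_Un finite_subset)
  qed
  have inf: "infinite W" if "W \<in> U" for W using that in_iff[of W] by (metis Inf_empty Int_UNIV_left empty_subsetI finite.emptyI)
  have univ: "UNIV \<in> U" using ultra[of UNIV] inf[of "{}"] by auto
  define F where "F = Abs_filter (\<lambda>P. Collect P \<in> U)"
  have ev: "eventually P F \<longleftrightarrow> Collect P \<in> U" for P
    unfolding F_def
  proof (rule eventually_Abs_filter, rule is_filter.intro)
    show "Collect (\<lambda>i. P i \<and> Q i) \<in> U" if "Collect P \<in> U" "Collect Q \<in> U" for P Q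
      using cap[OF that] by (simp add: Collect_conj_eq)
    show "Collect Q \<in> U" if "\<forall>i. P i \<longrightarrow> Q i" "Collect P \<in> U" for P Q
      using up[OF that(2), of "Collect Q"] that(1) by blast
  qed (use univ in simp)
  show thesis
  proof (rule that)
    show "F \<noteq> bot" using inf[of "{}"] by (auto simp: trivial_limit_def ev)
    show "eventually P F \<or> eventually (\<lambda>i. \<not> P i) F" for P
      using ultra[of "Collect P"] by (simp add: ev Collect_neg_eq)
    show "F \<le> sequentially"
    proof (rule filter_leI)
      fix P :: "nat \<Rightarrow> bool" assume "eventually P sequentially"
      then obtain n where "\<forall>i \<ge> n. P i" by (auto simp: eventually_sequentially)
      then have "- Collect P \<subseteq> {..<n}" by (auto simp: not_le[symmetric])
      then have "finite (- Collect P)" using finite_subset by blast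
      then show "eventually P F" using inf[of "- Collect P"] ultra[of "Collect P"] by (auto simp: ev)
    qed
  qed
qed

locale ultrapower = field R for R :: "('k, 'b) ring_scheme" (structure) +
  fixes F :: "nat filter"
  assumes proper: "F \<noteq> bot"
    and ultra: "eventually P F \<or> eventually (\<lambda>i. \<not> P i) F"
begin

definition S :: "(nat \<Rightarrow> 'k) set" where "S = {x. \<forall>i. x i \<in> carrier R}"

definition cls :: "(nat \<Rightarrow> 'k) \<Rightarrow> (nat \<Rightarrow> 'k) set" where
  "cls x = {y \<in> S. eventually (\<lambda>i. y i = x i) F}"

text \<open>The operations on classes act through chosen representatives; by \<open>rep_cls\<close>
  the choice agrees with any given representative almost everywhere.\<close>

definition rep :: "(nat \<Rightarrow> 'k) set \<Rightarrow> nat \<Rightarrow> 'k" where "rep C = (SOME x. x \<in> S \<and> cls x = C)"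

definition L :: "(nat \<Rightarrow> 'k) set ring" where
  "L = \<lparr>carrier = cls ` S, monoid.mult = (\<lambda>C D. cls (\<lambda>i. rep C i \<otimes> rep D i)), one = cls (\<lambda>i. \<one>),
        zero = cls (\<lambda>i. \<zero>), add = (\<lambda>C D. cls (\<lambda>i. rep C i \<oplus> rep D i))\<rparr>"

lemma ev_not: "eventually (\<lambda>i. \<not> P i) F \<longleftrightarrow> \<not> eventually P F"
proof
  assume "eventually (\<lambda>i. \<not> P i) F"
  then show "\<not> eventually P F"
    using proper eventually_conj[of P F "\<lambda>i. \<not> P i"] by (auto simp: trivial_limit_def)
qed (use ultra in blast)

lemma ev_ex: "eventually P F \<Longrightarrow> \<exists>i. P i"
  using proper by (metis (mono_tags, lifting) eventually_mono trivial_limit_def)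

lemma S_D: "x \<in> S \<Longrightarrow> x i \<in> carrier R" by (simp add: S_def)

lemma cls_eq_iff: "\<lbrakk>x \<in> S; y \<in> S\<rbrakk> \<Longrightarrow> cls x = cls y \<longleftrightarrow> eventually (\<lambda>i. x i = y i) F"
proof
  assume x: "x \<in> S" "y \<in> S"
  show "eventually (\<lambda>i. x i = y i) F" if "cls x = cls y"
  proof -
    have "x \<in> cls x" using x by (simp add: cls_def)
    then show ?thesis unfolding that by (simp add: cls_def)
  qed
  assume e: "eventually (\<lambda>i. x i = y i) F"
  have "eventually (\<lambda>i. z i = x i) F \<longleftrightarrow> eventually (\<lambda>i. z i = y i) F" for z
  proof
    show "eventually (\<lambda>i. z i = y i) F" if "eventually (\<lambda>i. z i = x i) F"
      using that e by eventually_elim simp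
    show "eventually (\<lambda>i. z i = x i) F" if "eventually (\<lambda>i. z i = y i) F"
      using that e by eventually_elim simp
  qed
  then show "cls x = cls y" by (simp add: cls_def)
qed

lemma rep: "C \<in> carrier L \<Longrightarrow> rep C \<in> S \<and> cls (rep C) = C"
  unfolding rep_def by (rule someI_ex[of "\<lambda>x. x \<in> S \<and> cls x = C"]) (auto simp: L_def)

lemma carrier_L: "carrier L = cls ` S" by (simp add: L_def)

lemma cls_L [simp]: "x \<in> S \<Longrightarrow> cls x \<in> carrier L" by (simp add: carrier_L)

lemma L_cases: assumes "C \<in> carrier L" obtains x where "x \<in> S" "C = cls x"
  using assms by (auto simp: carrier_L)

lemma rep_cls: "x \<in> S \<Longrightarrow> eventually (\<lambda>i. rep (cls x) i = x i) F"
  using rep[of "cls x"] cls_eq_iff[of "rep (cls x)" x] by simp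

lemma S_ops [simp]:
  "\<lbrakk>x \<in> S; y \<in> S\<rbrakk> \<Longrightarrow> (\<lambda>i. x i \<otimes> y i) \<in> S" "\<lbrakk>x \<in> S; y \<in> S\<rbrakk> \<Longrightarrow> (\<lambda>i. x i \<oplus> y i) \<in> S"
  "x \<in> S \<Longrightarrow> (\<lambda>i. \<ominus> x i) \<in> S" "\<lbrakk>x \<in> S; y \<in> S\<rbrakk> \<Longrightarrow> (\<lambda>i. x i \<ominus> y i) \<in> S"
  "c \<in> carrier R \<Longrightarrow> (\<lambda>i. c) \<in> S" "x \<in> S \<Longrightarrow> (\<lambda>i. x i [^] (n::nat)) \<in> S"
  by (auto simp: S_def)

lemma L_mult: assumes "x \<in> S" "y \<in> S" shows "cls x \<otimes>\<^bsub>L\<^esub> cls y = cls (\<lambda>i. x i \<otimes> y i)"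
proof -
  have "eventually (\<lambda>i. rep (cls x) i \<otimes> rep (cls y) i = x i \<otimes> y i) F"
    using rep_cls[OF assms(1)] rep_cls[OF assms(2)] by eventually_elim simp
  then show ?thesis using rep[of "cls x"] rep[of "cls y"] assms by (simp add: L_def cls_eq_iff)
qed

lemma L_add: assumes "x \<in> S" "y \<in> S" shows "cls x \<oplus>\<^bsub>L\<^esub> cls y = cls (\<lambda>i. x i \<oplus> y i)"
proof -
  have "eventually (\<lambda>i. rep (cls x) i \<oplus> rep (cls y) i = x i \<oplus> y i) F"
    using rep_cls[OF assms(1)] rep_cls[OF assms(2)] by eventually_elim simp
  then show ?thesis using rep[of "cls x"] rep[of "cls y"] assms by (simp add: L_def cls_eq_iff)
qed

lemma L_consts: "\<zero>\<^bsub>L\<^esub> = cls (\<lambda>i. \<zero>)" "\<one>\<^bsub>L\<^esub> = cls (\<lambda>i. \<one>)" by (simp_all add: L_def)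

lemma cls_zero_iff: "x \<in> S \<Longrightarrow> cls x = \<zero>\<^bsub>L\<^esub> \<longleftrightarrow> eventually (\<lambda>i. x i = \<zero>) F"
  by (simp add: L_consts cls_eq_iff)

text \<open>A nonzero class vanishes only on a null set, so inverting coordinatewise with the
  default zero gives an inverse almost everywhere.\<close>

lemma L_mult_inv:
  assumes x: "x \<in> S" "cls x \<noteq> \<zero>\<^bsub>L\<^esub>"
  shows "(\<lambda>i. if x i = \<zero> then \<zero> else inv x i) \<in> S" "cls x \<otimes>\<^bsub>L\<^esub> cls (\<lambda>i. if x i = \<zero> then \<zero> else inv x i) = \<one>\<^bsub>L\<^esub>"
proof -
  let ?y = "\<lambda>i. if x i = \<zero> then \<zero> else inv x i"
  have i: "inv x i \<in> carrier R \<and> x i \<otimes> inv x i = \<one>" if "x i \<noteq> \<zero>" for i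
    using field_Units S_D[OF x(1), of i] that by simp
  show y: "?y \<in> S" using i by (auto simp: S_def)
  have "eventually (\<lambda>i. x i \<noteq> \<zero>) F" using x by (simp add: cls_zero_iff ev_not)
  then have "eventually (\<lambda>i. x i \<otimes> ?y i = \<one>) F" by eventually_elim (use i in simp)
  then show "cls x \<otimes>\<^bsub>L\<^esub> cls ?y = \<one>\<^bsub>L\<^esub>" using x(1) y by (simp add: L_mult L_consts cls_eq_iff)
qed

lemma L_cring: "cring L"
proof (rule cringI)
  have c: "C \<in> carrier L \<longleftrightarrow> (\<exists>x \<in> S. C = cls x)" for C by (auto simp: carrier_L)
  show "abelian_group L"
  proof (rule abelian_groupI; unfold c)
    fix C assume "\<exists>x \<in> S. C = cls x"
    then obtain x where x: "x \<in> S" "C = cls x" by blast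
    then have "cls (\<lambda>i. \<ominus> x i) \<oplus>\<^bsub>L\<^esub> C = \<zero>\<^bsub>L\<^esub>" by (simp add: L_add L_consts S_D l_neg)
    then show "\<exists>D \<in> carrier L. D \<oplus>\<^bsub>L\<^esub> C = \<zero>\<^bsub>L\<^esub>" using x by (intro bexI[of _ "cls (\<lambda>i. \<ominus> x i)"]) simp_all
    show "\<zero>\<^bsub>L\<^esub> \<oplus>\<^bsub>L\<^esub> C = C" using x by (simp add: L_add L_consts S_D)
    fix D assume "\<exists>x \<in> S. D = cls x"
    then obtain y where y: "y \<in> S" "D = cls y" by blast
    show "\<exists>x \<in> S. C \<oplus>\<^bsub>L\<^esub> D = cls x" using x y L_add S_ops(2) by blast
    show "C \<oplus>\<^bsub>L\<^esub> D = D \<oplus>\<^bsub>L\<^esub> C" using x y by (simp add: L_add S_D a_comm)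
    fix E assume "\<exists>x \<in> S. E = cls x"
    then obtain z where "z \<in> S" "E = cls z" by blast
    then show "C \<oplus>\<^bsub>L\<^esub> D \<oplus>\<^bsub>L\<^esub> E = C \<oplus>\<^bsub>L\<^esub> (D \<oplus>\<^bsub>L\<^esub> E)" using x y by (simp add: L_add S_D a_assoc)
  qed (use L_consts(1) in force)
  show "comm_monoid L"
  proof (rule comm_monoidI; unfold c)
    fix C assume "\<exists>x \<in> S. C = cls x"
    then obtain x where x: "x \<in> S" "C = cls x" by blast
    show "\<one>\<^bsub>L\<^esub> \<otimes>\<^bsub>L\<^esub> C = C" using x by (simp add: L_mult L_consts S_D)
    fix D assume "\<exists>x \<in> S. D = cls x"
    then obtain y where y: "y \<in> S" "D = cls y" by blast
    show "\<exists>x \<in> S. C \<otimes>\<^bsub>L\<^esub> D = cls x" using x y L_mult S_ops(1) by blast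
    show "C \<otimes>\<^bsub>L\<^esub> D = D \<otimes>\<^bsub>L\<^esub> C" using x y by (simp add: L_mult S_D m_comm)
    fix E assume "\<exists>x \<in> S. E = cls x"
    then obtain z where "z \<in> S" "E = cls z" by blast
    then show "C \<otimes>\<^bsub>L\<^esub> D \<otimes>\<^bsub>L\<^esub> E = C \<otimes>\<^bsub>L\<^esub> (D \<otimes>\<^bsub>L\<^esub> E)" using x y by (simp add: L_mult S_D m_assoc)
  qed (use L_consts(2) in force)
  fix C D E assume "C \<in> carrier L" "D \<in> carrier L" "E \<in> carrier L"
  then obtain x y z where "x \<in> S" "C = cls x" "y \<in> S" "D = cls y" "z \<in> S" "E = cls z" unfolding c by blast
  then show "(C \<oplus>\<^bsub>L\<^esub> D) \<otimes>\<^bsub>L\<^esub> E = C \<otimes>\<^bsub>L\<^esub> E \<oplus>\<^bsub>L\<^esub> D \<otimes>\<^bsub>L\<^esub> E" by (simp add: L_mult L_add S_D l_distr)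
qed

lemma L_field: "field L"
proof -
  interpret L: cring L by (rule L_cring)
  show ?thesis
  proof (rule L.cring_fieldI2)
    show "\<zero>\<^bsub>L\<^esub> \<noteq> \<one>\<^bsub>L\<^esub>"
    proof
      assume "\<zero>\<^bsub>L\<^esub> = \<one>\<^bsub>L\<^esub>"
      then have "eventually (\<lambda>i. \<one> = \<zero>) F" by (simp add: L_consts cls_eq_iff)
      then show False using ev_ex by fastforce
    qed
    fix C assume "C \<in> carrier L" "C \<noteq> \<zero>\<^bsub>L\<^esub>"
    moreover from this(1) obtain x where "x \<in> S" "C = cls x" by (rule L_cases)
    ultimately show "\<exists>D \<in> carrier L. C \<otimes>\<^bsub>L\<^esub> D = \<one>\<^bsub>L\<^esub>"
      using L_mult_inv[of x] by (intro bexI[of _ "cls (\<lambda>i. if x i = \<zero> then \<zero> else inv x i)"]) simp_all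
  qed
qed

sublocale L: field L by (rule L_field)

lemma L_uminus: "x \<in> S \<Longrightarrow> \<ominus>\<^bsub>L\<^esub> cls x = cls (\<lambda>i. \<ominus> x i)"
  by (rule L.minus_equality) (auto simp: L_add L_consts S_D l_neg)

lemma L_minus: "\<lbrakk>x \<in> S; y \<in> S\<rbrakk> \<Longrightarrow> cls x \<ominus>\<^bsub>L\<^esub> cls y = cls (\<lambda>i. x i \<ominus> y i)"
  by (simp add: a_minus_def L_uminus L_add)

lemma L_pow: "x \<in> S \<Longrightarrow> cls x [^]\<^bsub>L\<^esub> (n::nat) = cls (\<lambda>i. x i [^] n)"
  by (induct n) (simp_all add: L_consts L_mult)

lemma L_inv: assumes "x \<in> S" "cls x \<noteq> \<zero>\<^bsub>L\<^esub>"
  shows "inv\<^bsub>L\<^esub> (cls x) = cls (\<lambda>i. if x i = \<zero> then \<zero> else inv x i)"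
  by (rule L.comm_inv_char) (use L_mult_inv[OF assms] assms in auto)

subsection \<open>The theorem of Los\<close>

lemma teval_L:
  assumes "\<And>n. e n \<in> S"
  shows "(\<lambda>i. teval R (\<lambda>n. e n i) t) \<in> S \<and> teval L (\<lambda>n. cls (e n)) t = cls (\<lambda>i. teval R (\<lambda>n. e n i) t)"
  using assms by (induct t) (simp_all add: L_consts L_add L_mult L_minus)

text \<open>Negation rests on the ultrafilter property, and the existential quantifier on choosing a
  witness at each index.\<close>

lemma los: "(\<And>n. e n \<in> S) \<Longrightarrow> rsat L (\<lambda>n. cls (e n)) \<phi> \<longleftrightarrow> eventually (\<lambda>i. rsat R (\<lambda>n. e n i) \<phi>) F"
proof (induct \<phi> arbitrary: e)
  case (REq s t)
  then show ?case using teval_L[where t = s, OF REq(1)] teval_L[where t = t, OF REq(1)] by (simp add: cls_eq_iff)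
next
  case (RNot \<phi>) then show ?case by (simp add: ev_not)
next
  case (RAnd \<phi> \<psi>) then show ?case by (simp add: eventually_conj_iff)
next
  case (REx x \<phi>)
  have upd: "(\<lambda>n. cls (e n))(x := cls a) = (\<lambda>n. cls ((e(x := a)) n))"
    "(\<lambda>n. (e(x := a)) n i) = (\<lambda>n. e n i)(x := a i)" for a i
    by (auto simp: fun_eq_iff)
  have IH: "rsat L ((\<lambda>n. cls (e n))(x := cls a)) \<phi> \<longleftrightarrow> eventually (\<lambda>i. rsat R ((\<lambda>n. e n i)(x := a i)) \<phi>) F"
    if "a \<in> S" for a
    unfolding upd(1) upd(2)[symmetric] by (rule REx(1)) (use REx(2) that in auto)
  have "rsat L (\<lambda>n. cls (e n)) (REx x \<phi>) \<longleftrightarrow> (\<exists>a \<in> S. eventually (\<lambda>i. rsat R ((\<lambda>n. e n i)(x := a i)) \<phi>) F)"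
    using IH by (auto simp: carrier_L)
  also have "\<dots> \<longleftrightarrow> eventually (\<lambda>i. rsat R (\<lambda>n. e n i) (REx x \<phi>)) F"
  proof
    assume "\<exists>a \<in> S. eventually (\<lambda>i. rsat R ((\<lambda>n. e n i)(x := a i)) \<phi>) F"
    then obtain a where a: "a \<in> S" "eventually (\<lambda>i. rsat R ((\<lambda>n. e n i)(x := a i)) \<phi>) F" by blast
    from a(2) show "eventually (\<lambda>i. rsat R (\<lambda>n. e n i) (REx x \<phi>)) F"
      by eventually_elim (use S_D[OF a(1)] in auto)
  next
    assume *: "eventually (\<lambda>i. rsat R (\<lambda>n. e n i) (REx x \<phi>)) F"
    \<comment> \<open>Where no witness exists the default zero keeps the sequence inside the
      carrier; this happens only on a null set.\<close>
    define a where "a i = (if rsat R (\<lambda>n. e n i) (REx x \<phi>)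
      then SOME b. b \<in> carrier R \<and> rsat R ((\<lambda>n. e n i)(x := b)) \<phi> else \<zero>)" for i
    have a: "a i \<in> carrier R \<and> rsat R ((\<lambda>n. e n i)(x := a i)) \<phi>" if "rsat R (\<lambda>n. e n i) (REx x \<phi>)" for i
    proof -
      have "\<exists>b. b \<in> carrier R \<and> rsat R ((\<lambda>n. e n i)(x := b)) \<phi>" using that by auto
      from someI_ex[OF this] show ?thesis using that unfolding a_def by (simp only: if_True)
    qed
    have "a \<in> S" unfolding S_def mem_Collect_eq
    proof
      fix i show "a i \<in> carrier R"
        by (cases "rsat R (\<lambda>n. e n i) (REx x \<phi>)") (use a in blast, simp add: a_def)
    qed
    moreover have "eventually (\<lambda>i. rsat R ((\<lambda>n. e n i)(x := a i)) \<phi>) F"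
      using * by eventually_elim (use a in blast)
    ultimately show "\<exists>a \<in> S. eventually (\<lambda>i. rsat R ((\<lambda>n. e n i)(x := a i)) \<phi>) F" by blast
  qed
  finally show ?case .
qed

text \<open>Assignments in the ultrapower are handled through sequences of representatives,
  assignments in the base field through constant sequences.\<close>

lemma L_elem_equiv: "elem_equiv R L"
  unfolding elem_equiv_def rmodels_def
proof (intro allI impI iffI)
  fix \<phi> and e :: "nat \<Rightarrow> _" assume *: "\<forall>e. range e \<subseteq> carrier R \<longrightarrow> rsat R e \<phi>" and e: "range e \<subseteq> carrier L"
  have r: "rep (e n) \<in> S" "cls (rep (e n)) = e n" for n :: nat using rep e by auto
  have "rsat L (\<lambda>n. cls (rep (e n))) \<phi>"
    unfolding los[OF r(1)]
  proof (intro always_eventually allI)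
    fix i show "rsat R (\<lambda>n. rep (e n) i) \<phi>"
      using *[rule_format, of "\<lambda>n. rep (e n) i"] S_D[OF r(1)] by auto
  qed
  then show "rsat L e \<phi>" by (simp add: r(2))
next
  fix \<phi> and e :: "nat \<Rightarrow> _" assume *: "\<forall>e. range e \<subseteq> carrier L \<longrightarrow> rsat L e \<phi>" and e: "range e \<subseteq> carrier R"
  have S: "(\<lambda>i::nat. e n) \<in> S" for n :: nat using e by (auto simp: S_def)
  have "rsat L (\<lambda>n. cls (\<lambda>i. e n)) \<phi>"
  proof (rule *[rule_format], rule image_subsetI)
    fix n show "cls (\<lambda>i. e n) \<in> carrier L" by (rule cls_L[OF S])
  qed
  then have "eventually (\<lambda>i::nat. rsat R e \<phi>) F" using los[of "\<lambda>n i. e n" \<phi>] S by simp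
  then show "rsat R e \<phi>" using ev_ex by auto
qed

end

section \<open>Ultraproducts of valuation rings\<close>

text \<open>The field is the same at every index and only the valuation ring varies. This lets a
  ring with Hensel's lemma for more and more degrees stand at later and later indices.\<close>

locale ultraproduct_valuation = ultrapower R F for R :: "('k, 'b) ring_scheme" (structure) and F +
  fixes Q :: "nat \<Rightarrow> 'k set"
  assumes Q_subring: "valuation_subring R (Q i)"
    and Q_proper: "Q i \<noteq> carrier R"
begin

sublocale Q: valuation_subring R "Q i" for i by (rule Q_subring)

definition B :: "(nat \<Rightarrow> 'k) set set" where "B = {cls x | x. x \<in> S \<and> eventually (\<lambda>i. x i \<in> Q i) F}"

lemma cls_B_iff: "x \<in> S \<Longrightarrow> cls x \<in> B \<longleftrightarrow> eventually (\<lambda>i. x i \<in> Q i) F"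
proof
  assume x: "x \<in> S"
  assume "cls x \<in> B"
  then obtain y where y: "cls x = cls y" "y \<in> S" "eventually (\<lambda>i. y i \<in> Q i) F" by (auto simp: B_def)
  have "eventually (\<lambda>i. x i = y i) F" using cls_eq_iff x y by blast
  then show "eventually (\<lambda>i. x i \<in> Q i) F" using y(3) by eventually_elim simp
qed (auto simp: B_def)

lemma B_cases: assumes "C \<in> B" obtains x where "x \<in> S" "C = cls x" "eventually (\<lambda>i. x i \<in> Q i) F"
  using assms by (auto simp: B_def)

lemma B_subring: "valuation_subring L B"
proof (intro valuation_subring.intro valuation_subring_axioms.intro L_field)
  show "subring B L"
  proof (rule L.subringI)
    show "B \<subseteq> carrier L" by (auto simp: B_def)
    show "\<one>\<^bsub>L\<^esub> \<in> B" by (simp add: L_consts cls_B_iff)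
  next
    fix C assume "C \<in> B"
    then obtain x where x: "x \<in> S" "C = cls x" "eventually (\<lambda>i. x i \<in> Q i) F" by (rule B_cases)
    from x(3) have "eventually (\<lambda>i. \<ominus> x i \<in> Q i) F" by eventually_elim simp
    then show "\<ominus>\<^bsub>L\<^esub> C \<in> B" using x by (simp add: L_uminus cls_B_iff)
  next
    fix C D assume CD: "C \<in> B" "D \<in> B"
    from CD(1) obtain x where x: "x \<in> S" "C = cls x" "eventually (\<lambda>i. x i \<in> Q i) F" by (rule B_cases)
    from CD(2) obtain y where y: "y \<in> S" "D = cls y" "eventually (\<lambda>i. y i \<in> Q i) F" by (rule B_cases)
    from x(3) y(3) have "eventually (\<lambda>i. x i \<otimes> y i \<in> Q i) F" "eventually (\<lambda>i. x i \<oplus> y i \<in> Q i) F"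
      by (eventually_elim, simp)+
    then show "C \<otimes>\<^bsub>L\<^esub> D \<in> B" "C \<oplus>\<^bsub>L\<^esub> D \<in> B" using x y by (simp_all add: L_mult L_add cls_B_iff)
  qed
next
  fix C assume "C \<in> carrier L" "C \<noteq> \<zero>\<^bsub>L\<^esub>"
  then obtain x where x: "x \<in> S" "C = cls x" "cls x \<noteq> \<zero>\<^bsub>L\<^esub>" by (metis L_cases)
  show "C \<in> B \<or> inv\<^bsub>L\<^esub> C \<in> B"
  proof (rule disjCI)
    assume "inv\<^bsub>L\<^esub> C \<notin> B"
    then have "eventually (\<lambda>i. (if x i = \<zero> then \<zero> else inv x i) \<notin> Q i) F"
      using x L_mult_inv(1)[OF x(1,3)] by (simp add: L_inv cls_B_iff ev_not)
    then have "eventually (\<lambda>i. x i \<in> Q i) F"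
      by eventually_elim (use Q.total S_D[OF x(1)] in \<open>auto split: if_splits\<close>)
    then show "C \<in> B" using x by (simp add: cls_B_iff)
  qed
qed

sublocale VL: valuation_subring L B by (rule B_subring)

lemma B_proper: "B \<noteq> carrier L"
proof -
  have "\<exists>x. x \<in> carrier R \<and> x \<notin> Q i" for i using Q_proper[of i] Q.A_sub[of _ i] by blast
  then obtain x where x: "\<And>i. x i \<in> carrier R \<and> x i \<notin> Q i" by metis
  then have "x \<in> S" by (simp add: S_def)
  moreover have "cls x \<notin> B"
    using x cls_B_iff[OF \<open>x \<in> S\<close>] ev_ex[of "\<lambda>i. x i \<in> Q i"] by blast
  ultimately show ?thesis using cls_L by blast
qed

lemma cls_nonunits_iff: "x \<in> S \<Longrightarrow> cls x \<in> VL.I \<longleftrightarrow> eventually (\<lambda>i. x i \<in> nonunits R (Q i)) F"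
proof -
  assume x: "x \<in> S"
  show ?thesis
  proof (cases "cls x = \<zero>\<^bsub>L\<^esub>")
    case True
    then have "eventually (\<lambda>i. x i = \<zero>) F" using cls_zero_iff x by blast
    then have "eventually (\<lambda>i. x i \<in> nonunits R (Q i)) F" by eventually_elim (simp add: Q.zero_in_I)
    then show ?thesis using True VL.zero_in_I by simp
  next
    case False
    then have nz: "eventually (\<lambda>i. x i \<noteq> \<zero>) F" using x by (simp add: cls_zero_iff ev_not)
    let ?y = "\<lambda>i. if x i = \<zero> then \<zero> else inv x i"
    have "cls x \<in> VL.I \<longleftrightarrow> eventually (\<lambda>i. x i \<in> Q i) F \<and> eventually (\<lambda>i. ?y i \<notin> Q i) F"
      using x False L_inv[OF x False] L_mult_inv(1)[OF x False] by (simp add: nonunits_def cls_B_iff ev_not)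
    also have "\<dots> \<longleftrightarrow> eventually (\<lambda>i. x i \<in> Q i \<and> ?y i \<notin> Q i) F" by (simp add: eventually_conj_iff)
    also have "\<dots> \<longleftrightarrow> eventually (\<lambda>i. x i \<in> nonunits R (Q i)) F"
      by (rule eventually_cong[OF nz]) (simp add: nonunits_def)
    finally show ?thesis .
  qed
qed

lemma eval_S: "\<lbrakk>set fs \<subseteq> S; x \<in> S\<rbrakk> \<Longrightarrow>
    (\<lambda>i. eval (map (\<lambda>f. f i) fs) (x i)) \<in> S \<and> L.eval (map cls fs) (cls x) = cls (\<lambda>i. eval (map (\<lambda>f. f i) fs) (x i))"
  by (induct fs) (simp_all add: L_consts L_pow L_mult L_add)

lemma pow_diff_S: "\<lbrakk>x \<in> S; y \<in> S\<rbrakk> \<Longrightarrow>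
    (\<lambda>i. pow_diff (x i) (y i) k) \<in> S \<and> L.pow_diff (cls x) (cls y) k = cls (\<lambda>i. pow_diff (x i) (y i) k)"
  by (induct k) (simp_all add: L_consts L_pow L_mult L_add)

lemma dq_S: "\<lbrakk>set fs \<subseteq> S; x \<in> S; y \<in> S\<rbrakk> \<Longrightarrow>
    (\<lambda>i. dq (map (\<lambda>f. f i) fs) (x i) (y i)) \<in> S \<and>
    L.dq (map cls fs) (cls x) (cls y) = cls (\<lambda>i. dq (map (\<lambda>f. f i) fs) (x i) (y i))"
  by (induct fs) (simp_all add: L_consts L_mult L_add pow_diff_S)

text \<open>A polynomial over the ultraproduct is represented by polynomials of one common length,
  so a bound on the length at almost all indices suffices. The roots found there are assembled into
  one sequence.\<close>

lemma L_hensel_at: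
  assumes hens: "\<And>d. eventually (\<lambda>i. \<forall>f. set f \<subseteq> Q i \<and> length f \<le> d \<longrightarrow> hensel_at (Q i) (nonunits R (Q i)) f) F"
    and f: "set f \<subseteq> B"
  shows "L.hensel_at B VL.I f"
  unfolding L.hensel_at_def
proof (intro ballI impI)
  have "\<exists>fs. set fs \<subseteq> S \<and> f = map cls fs"
    using f
  proof (induct f)
    case (Cons c f)
    then obtain fs where "set fs \<subseteq> S" "f = map cls fs" by auto
    moreover obtain x where "x \<in> S" "c = cls x" using Cons(2) by (auto simp: B_def)
    ultimately show ?case by (intro exI[of _ "x # fs"]) simp
  qed simp
  then obtain fs where fs: "set fs \<subseteq> S" "f = map cls fs" by blast
  fix C assume "C \<in> B" and C: "L.eval f C \<in> VL.I \<and> L.dq f C C \<notin> VL.I"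
  then obtain x where x: "x \<in> S" "C = cls x" "eventually (\<lambda>i. x i \<in> Q i) F" using B_cases by blast
  let ?f = "\<lambda>i. map (\<lambda>f. f i) fs"
  note E = eval_S[OF fs(1) x(1)] and D = dq_S[OF fs(1) x(1) x(1)]
  have e: "eventually (\<lambda>i. eval (?f i) (x i) \<in> nonunits R (Q i)) F"
    using C E by (simp add: fs(2) x(2) cls_nonunits_iff)
  have d: "eventually (\<lambda>i. dq (?f i) (x i) (x i) \<notin> nonunits R (Q i)) F"
    using C D by (simp add: fs(2) x(2) cls_nonunits_iff ev_not)
  have "eventually (\<lambda>i. \<forall>g \<in> set fs. g i \<in> Q i) F"
    using f fs by (intro eventually_ball_finite) (auto simp: cls_B_iff subset_iff)
  then have "eventually (\<lambda>i. set (?f i) \<subseteq> Q i) F" by eventually_elim auto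
  then have ex: "eventually (\<lambda>i. \<exists>b. b \<in> Q i \<and> eval (?f i) b = \<zero> \<and> b \<ominus> x i \<in> nonunits R (Q i)) F"
    using hens[of "length fs"] e d x(3)
  proof eventually_elim
    case (elim i)
    then have "hensel_at (Q i) (nonunits R (Q i)) (?f i)" by simp
    then show ?case using elim unfolding hensel_at_def by blast
  qed
  define b where "b i = (if \<exists>b. b \<in> Q i \<and> eval (?f i) b = \<zero> \<and> b \<ominus> x i \<in> nonunits R (Q i)
    then SOME b. b \<in> Q i \<and> eval (?f i) b = \<zero> \<and> b \<ominus> x i \<in> nonunits R (Q i) else \<zero>)" for i
  have b: "b i \<in> Q i \<and> eval (?f i) (b i) = \<zero> \<and> b i \<ominus> x i \<in> nonunits R (Q i)"
    if *: "\<exists>b. b \<in> Q i \<and> eval (?f i) b = \<zero> \<and> b \<ominus> x i \<in> nonunits R (Q i)" for i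
    using someI_ex[OF *] * unfolding b_def by (simp only: if_True)
  have bS: "b \<in> S" unfolding S_def mem_Collect_eq
  proof
    fix i show "b i \<in> carrier R"
      by (cases "\<exists>b. b \<in> Q i \<and> eval (?f i) b = \<zero> \<and> b \<ominus> x i \<in> nonunits R (Q i)")
        (use b Q.A_sub in blast, simp only: b_def if_False zero_closed)
  qed
  have ev: "eventually (\<lambda>i. b i \<in> Q i) F" "eventually (\<lambda>i. eval (?f i) (b i) = \<zero>) F"
    "eventually (\<lambda>i. b i \<ominus> x i \<in> nonunits R (Q i)) F"
    using ex by (eventually_elim, use b in blast)+
  have "cls b \<in> B" using ev(1) bS by (simp add: cls_B_iff)
  moreover have "L.eval f (cls b) = \<zero>\<^bsub>L\<^esub>" using eval_S[OF fs(1) bS] ev(2) by (simp add: fs(2) cls_zero_iff)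
  moreover have "cls b \<ominus>\<^bsub>L\<^esub> C \<in> VL.I" using ev(3) bS x by (simp add: L_minus cls_nonunits_iff)
  ultimately show "\<exists>b \<in> B. L.eval f b = \<zero>\<^bsub>L\<^esub> \<and> b \<ominus>\<^bsub>L\<^esub> C \<in> VL.I" by blast
qed

lemma L_henselian:
  assumes "\<And>d. eventually (\<lambda>i. \<forall>f. set f \<subseteq> Q i \<and> length f \<le> d \<longrightarrow> hensel_at (Q i) (nonunits R (Q i)) f) F"
  shows "henselian_field L"
proof -
  obtain G :: "(nat \<Rightarrow> 'k) set set ogroup" and v where
    v: "valuation L G v" "nontrivial_valuation L G v" "val_ring_set L G v = B"
    using VL.ex_valuation[OF B_proper] by blast
  interpret U: valuation L G v by (rule v(1))
  have "simple_zeros_lift L G v f" if f: "f \<in> carrier (poly_ring (val_ring L G v))" for f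
  proof -
    have "set f \<subseteq> B" using f by (auto simp: univ_poly_carrier[symmetric] polynomial_def val_ring_def v(3))
    then show ?thesis
      unfolding U.simple_zeros_lift_iff[OF f] U.val_ideal_eq_nonunits v(3) by (rule L_hensel_at[OF assms])
  qed
  then have "henselian_valuation L G v" by (simp add: henselian_valuation_def)
  then show ?thesis using v(1,2) L_field unfolding henselian_field_def by blast
qed

end

text \<open>At index \<open>i\<close> Hensel's lemma is available up to length \<open>i\<close>; the
  ultrafilter is free, so any fixed length is covered almost everywhere.\<close>

lemma t_henselianI:
  fixes R :: "('k, 'b) ring_scheme"
  assumes R: "field R"
    and vr: "\<And>i. valuation_subring R (Q i)" and pr: "\<And>i. Q i \<noteq> carrier R"
    and hens: "\<And>i f. set f \<subseteq> Q i \<Longrightarrow> length f \<le> i \<Longrightarrow> ring.hensel_at R (Q i) (nonunits R (Q i)) f"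
  shows "t_henselian R"
proof -
  obtain F :: "nat filter" where F: "F \<noteq> bot" "F \<le> sequentially"
    "\<And>P. eventually P F \<or> eventually (\<lambda>i. \<not> P i) F" by (rule ex_free_ultrafilter) blast
  interpret ultraproduct_valuation R F Q
    by (intro ultraproduct_valuation.intro ultrapower.intro ultrapower_axioms.intro
        ultraproduct_valuation_axioms.intro R F vr pr)
  have "henselian_field L"
  proof (rule L_henselian)
    fix d
    have "eventually (\<lambda>i. d \<le> i) F" using F(2) eventually_ge_at_top by (rule filter_leD)
    then show "eventually (\<lambda>i. \<forall>f. set f \<subseteq> Q i \<and> length f \<le> d \<longrightarrow> hensel_at (Q i) (nonunits R (Q i)) f) F"
      by eventually_elim (use hens in auto)
  qed
  then show ?thesis using R L_elem_equiv unfolding t_henselian_def by blast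
qed

section \<open>Fields of Hahn series\<close>

subsection \<open>Well-ordered subsets of an ordered abelian group\<close>

abbreviation hsupp :: "('a \<Rightarrow> real) \<Rightarrow> 'a set" where "hsupp x \<equiv> {\<gamma>. x \<gamma> \<noteq> 0}"

definition wo_in :: "('a, 'b) ogroup_scheme \<Rightarrow> 'a set \<Rightarrow> bool" where
  "wo_in G V \<longleftrightarrow> V \<subseteq> carrier G \<and> (\<forall>Y \<subseteq> V. Y \<noteq> {} \<longrightarrow> (\<exists>m \<in> Y. \<forall>y \<in> Y. gle G m y))"

text \<open>A sum over an infinite set is zero by convention. \<open>finite_pairs\<close> shows that
  for well-ordered supports the index set of the product is finite, so this is the true
  convolution.\<close>

definition hahn_ring :: "('a, 'b) ogroup_scheme \<Rightarrow> ('a \<Rightarrow> real) ring" where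
  "hahn_ring G = \<lparr>carrier = {x. wo_in G (hsupp x)},
     monoid.mult = (\<lambda>x y \<gamma>. \<Sum>(\<alpha>, \<beta>) \<in> {(\<alpha>, \<beta>). x \<alpha> \<noteq> 0 \<and> y \<beta> \<noteq> 0 \<and> \<alpha> \<otimes>\<^bsub>G\<^esub> \<beta> = \<gamma>}. x \<alpha> * y \<beta>),
     one = (\<lambda>\<gamma>. if \<gamma> = \<one>\<^bsub>G\<^esub> then 1 else 0),
     zero = (\<lambda>\<gamma>. 0), add = (\<lambda>x y \<gamma>. x \<gamma> + y \<gamma>)\<rparr>"

definition hmon :: "real \<Rightarrow> 'a \<Rightarrow> ('a \<Rightarrow> real)" where
  "hmon r \<gamma> = (\<lambda>\<delta>. if \<delta> = \<gamma> then r else 0)"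

context ordered_abelian_group
begin

abbreviation le (infix \<open>\<sqsubseteq>\<close> 50) where "x \<sqsubseteq> y \<equiv> gle G x y"
abbreviation lt (infix \<open>\<sqsubset>\<close> 50) where "x \<sqsubset> y \<equiv> gless G x y"
abbreviation wo where "wo \<equiv> wo_in G"
abbreviation H where "H \<equiv> hahn_ring G"

lemma lt_irrefl [simp]: "\<not> x \<sqsubset> x" by (simp add: gless_def)

lemma not_le: "\<lbrakk>x \<in> carrier G; y \<in> carrier G\<rbrakk> \<Longrightarrow> \<not> x \<sqsubseteq> y \<longleftrightarrow> y \<sqsubset> x"
  using gle_total gle_antisym gle_refl unfolding gless_def by metis

lemma not_lt: "\<lbrakk>x \<in> carrier G; y \<in> carrier G\<rbrakk> \<Longrightarrow> \<not> x \<sqsubset> y \<longleftrightarrow> y \<sqsubseteq> x"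
  using not_le by metis

lemma lt_imp_le: "x \<sqsubset> y \<Longrightarrow> x \<sqsubseteq> y" by (simp add: gless_def)

lemma lt_trans: "\<lbrakk>x \<in> carrier G; y \<in> carrier G; z \<in> carrier G; x \<sqsubset> y; y \<sqsubset> z\<rbrakk> \<Longrightarrow> x \<sqsubset> z"
  and le_lt_trans: "\<lbrakk>x \<in> carrier G; y \<in> carrier G; z \<in> carrier G; x \<sqsubseteq> y; y \<sqsubset> z\<rbrakk> \<Longrightarrow> x \<sqsubset> z"
  and lt_le_trans: "\<lbrakk>x \<in> carrier G; y \<in> carrier G; z \<in> carrier G; x \<sqsubset> y; y \<sqsubseteq> z\<rbrakk> \<Longrightarrow> x \<sqsubset> z"
  using gle_trans gle_antisym unfolding gless_def by metis+

lemma cancel [simp]: "\<lbrakk>x \<in> carrier G; y \<in> carrier G\<rbrakk> \<Longrightarrow> inv x \<otimes> (x \<otimes> y) = y"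
    "\<lbrakk>x \<in> carrier G; y \<in> carrier G\<rbrakk> \<Longrightarrow> x \<otimes> (inv x \<otimes> y) = y"
  by (simp_all add: m_assoc[symmetric])

lemma mult_le_iff: "\<lbrakk>x \<in> carrier G; y \<in> carrier G; z \<in> carrier G\<rbrakk> \<Longrightarrow> z \<otimes> x \<sqsubseteq> z \<otimes> y \<longleftrightarrow> x \<sqsubseteq> y"
  using gle_mult[of x y z] gle_mult[of "z \<otimes> x" "z \<otimes> y" "inv z"] by (auto simp: m_ac)

lemma mult_lt_iff: "\<lbrakk>x \<in> carrier G; y \<in> carrier G; z \<in> carrier G\<rbrakk> \<Longrightarrow> z \<otimes> x \<sqsubset> z \<otimes> y \<longleftrightarrow> x \<sqsubset> y"
  using mult_le_iff not_le by (metis m_closed)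

lemma mult_mono: "\<lbrakk>x \<in> carrier G; y \<in> carrier G; z \<in> carrier G; w \<in> carrier G; x \<sqsubseteq> y; z \<sqsubseteq> w\<rbrakk> \<Longrightarrow> x \<otimes> z \<sqsubseteq> y \<otimes> w"
  using gle_trans[of "x \<otimes> z" "y \<otimes> z" "y \<otimes> w"] gle_mult mult_le_iff by simp

lemma mult_strict_mono: "\<lbrakk>x \<in> carrier G; y \<in> carrier G; z \<in> carrier G; w \<in> carrier G; x \<sqsubset> y; z \<sqsubseteq> w\<rbrakk> \<Longrightarrow> x \<otimes> z \<sqsubset> y \<otimes> w"
  using lt_le_trans[of "x \<otimes> z" "y \<otimes> z" "y \<otimes> w"] mult_lt_iff[of x y z] mult_le_iff[of z w y] by (simp add: m_comm)

lemma one_le_iff: "\<lbrakk>x \<in> carrier G; y \<in> carrier G\<rbrakk> \<Longrightarrow> \<one> \<sqsubseteq> inv x \<otimes> y \<longleftrightarrow> x \<sqsubseteq> y"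
  using mult_le_iff[of "\<one>" "inv x \<otimes> y" x] by simp

lemma one_lt_iff: "\<lbrakk>x \<in> carrier G; y \<in> carrier G\<rbrakk> \<Longrightarrow> \<one> \<sqsubset> inv x \<otimes> y \<longleftrightarrow> x \<sqsubset> y"
  using mult_lt_iff[of "\<one>" "inv x \<otimes> y" x] by simp

lemma wo_sub: "wo V \<Longrightarrow> x \<in> V \<Longrightarrow> x \<in> carrier G"
  by (auto simp: wo_in_def)

lemma wo_min: "\<lbrakk>wo V; Y \<subseteq> V; Y \<noteq> {}\<rbrakk> \<Longrightarrow> \<exists>m \<in> Y. \<forall>y \<in> Y. m \<sqsubseteq> y"
  by (simp add: wo_in_def)

lemma wo_subset: "\<lbrakk>wo V; Y \<subseteq> V\<rbrakk> \<Longrightarrow> wo Y"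
  by (meson order_trans wo_in_def)

lemma wo_union: assumes "wo V" "wo Y" shows "wo (V \<union> Y)"
  unfolding wo_in_def
proof (intro conjI allI impI)
  show "V \<union> Y \<subseteq> carrier G" using assms by (simp add: wo_in_def)
  fix Z assume Z: "Z \<subseteq> V \<union> Y" "Z \<noteq> {}"
  show "\<exists>m \<in> Z. \<forall>z \<in> Z. m \<sqsubseteq> z"
  proof (cases "Z \<inter> V = {} \<or> Z \<inter> Y = {}")
    case True
    then have "Z \<subseteq> V \<or> Z \<subseteq> Y" using Z by blast
    then show ?thesis using wo_min[OF assms(1), of Z] wo_min[OF assms(2), of Z] Z by blast
  next
    case False
    then obtain a b where ab: "a \<in> Z \<inter> V" "\<forall>z \<in> Z \<inter> V. a \<sqsubseteq> z" "b \<in> Z \<inter> Y" "\<forall>z \<in> Z \<inter> Y. b \<sqsubseteq> z"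
      using wo_min[OF assms(1), of "Z \<inter> V"] wo_min[OF assms(2), of "Z \<inter> Y"] by blast
    then have c: "a \<in> carrier G" "b \<in> carrier G" using assms wo_sub by blast+
    have zc: "z \<in> carrier G" if "z \<in> Z" for z using that Z assms wo_sub by blast
    have "a \<sqsubseteq> b \<or> b \<sqsubseteq> a" by (rule gle_total[OF c])
    then show ?thesis
    proof
      assume "a \<sqsubseteq> b"
      then have "\<forall>z \<in> Z. a \<sqsubseteq> z" using ab Z gle_trans[OF c] zc by blast
      then show ?thesis using ab by blast
    next
      assume "b \<sqsubseteq> a"
      then have "\<forall>z \<in> Z. b \<sqsubseteq> z" using ab Z gle_trans[OF c(2,1)] zc by blast
      then show ?thesis using ab by blast
    qed
  qed
qed

lemma wo_empty [simp]: "wo {}" by (auto simp: wo_in_def)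

lemma wo_singleton [simp]: "x \<in> carrier G \<Longrightarrow> wo {x}"
  by (auto simp: wo_in_def gle_refl subset_singleton_iff)

text \<open>The elements with finitely many predecessors form a set \<open>T\<close> which is finite
  because it has a greatest element; the least element outside \<open>T\<close> would have only
  finitely many predecessors as well.\<close>

lemma finite_if_min_max:
  assumes R: "wo R" and mx: "\<And>S. \<lbrakk>S \<subseteq> R; S \<noteq> {}\<rbrakk> \<Longrightarrow> \<exists>m \<in> S. \<forall>s \<in> S. s \<sqsubseteq> m"
  shows "finite R"
proof -
  define T where "T = {\<alpha> \<in> R. finite {r \<in> R. r \<sqsubseteq> \<alpha>}}"
  have TR: "T \<subseteq> R" by (auto simp: T_def)
  have T: "finite T"
  proof (cases "T = {}")
    case False
    then obtain m where m: "m \<in> T" "\<forall>s \<in> T. s \<sqsubseteq> m" using mx[OF TR] by blast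
    then have "T \<subseteq> {r \<in> R. r \<sqsubseteq> m}" using TR by blast
    moreover have "finite {r \<in> R. r \<sqsubseteq> m}" using m(1) by (simp add: T_def)
    ultimately show ?thesis by (rule finite_subset)
  qed simp
  show ?thesis
  proof (cases "R \<subseteq> T")
    case True then show ?thesis using T by (rule finite_subset)
  next
    case False
    then have "R - T \<subseteq> R" "R - T \<noteq> {}" by blast+
    from wo_min[OF R this] obtain n where n: "n \<in> R" "n \<notin> T" "\<And>s. s \<in> R - T \<Longrightarrow> n \<sqsubseteq> s" by blast
    have "{r \<in> R. r \<sqsubseteq> n} \<subseteq> insert n T"
    proof
      fix r assume r: "r \<in> {r \<in> R. r \<sqsubseteq> n}"
      then show "r \<in> insert n T"
        using n(3)[of r] gle_antisym[of r n] wo_sub[OF R] n(1) by auto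
    qed
    then have "finite {r \<in> R. r \<sqsubseteq> n}" using T by (meson finite_insert finite_subset)
    then show ?thesis using n(1,2) by (simp add: T_def)
  qed
qed

text \<open>Each first factor \<alpha> gets its least partner \<open>b \<alpha>\<close>, with
  product \<open>z \<alpha>\<close>. The minimum of \<open>Z\<close> is sought among the records
  \<open>Rc\<close>, the \<alpha> at which \<open>z\<close> falls below all its earlier values.
  Along records \<open>b\<close> strictly decreases, so a record with least \<open>b\<close> is the
  last one and attains the minimum.\<close>

lemma wo_mult:
  assumes V: "wo V" and Y: "wo Y"
  shows "wo (V <#> Y)"
  unfolding wo_in_def
proof (intro conjI allI impI)
  show "V <#> Y \<subseteq> carrier G" using set_mult_closed V Y unfolding wo_in_def by blast
  fix Z assume Z: "Z \<subseteq> V <#> Y" "Z \<noteq> {}"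
  define S where "S = {\<alpha> \<in> V. \<exists>\<beta> \<in> Y. \<alpha> \<otimes> \<beta> \<in> Z}"
  define b where "b \<alpha> = (SOME \<beta>. \<beta> \<in> Y \<and> \<alpha> \<otimes> \<beta> \<in> Z \<and> (\<forall>\<beta>' \<in> Y. \<alpha> \<otimes> \<beta>' \<in> Z \<longrightarrow> \<beta> \<sqsubseteq> \<beta>'))" for \<alpha>
  define z where "z \<alpha> = \<alpha> \<otimes> b \<alpha>" for \<alpha>
  have bprop: "b \<alpha> \<in> Y \<and> \<alpha> \<otimes> b \<alpha> \<in> Z \<and> (\<forall>\<beta>' \<in> Y. \<alpha> \<otimes> \<beta>' \<in> Z \<longrightarrow> b \<alpha> \<sqsubseteq> \<beta>')" if "\<alpha> \<in> S" for \<alpha>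
    unfolding b_def
  proof (rule someI_ex)
    have "{\<beta> \<in> Y. \<alpha> \<otimes> \<beta> \<in> Z} \<noteq> {}" using that by (auto simp: S_def)
    then show "\<exists>\<beta>. \<beta> \<in> Y \<and> \<alpha> \<otimes> \<beta> \<in> Z \<and> (\<forall>\<beta>' \<in> Y. \<alpha> \<otimes> \<beta>' \<in> Z \<longrightarrow> \<beta> \<sqsubseteq> \<beta>')"
      using wo_min[OF Y, of "{\<beta> \<in> Y. \<alpha> \<otimes> \<beta> \<in> Z}"] by blast
  qed
  have Sc: "\<alpha> \<in> carrier G" "b \<alpha> \<in> carrier G" "z \<alpha> \<in> carrier G" "z \<alpha> \<in> Z" if "\<alpha> \<in> S" for \<alpha>
    using that bprop[OF that] wo_sub[OF V] wo_sub[OF Y] by (auto simp: S_def z_def)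
  define Rc where "Rc = {\<alpha> \<in> S. \<forall>\<alpha>' \<in> S. \<alpha>' \<sqsubset> \<alpha> \<longrightarrow> z \<alpha> \<sqsubset> z \<alpha>'}"
  have S_sub: "S \<subseteq> V" by (auto simp: S_def)
  have S_ne: "S \<noteq> {}" using Z by (auto simp: S_def set_mult_def)
  obtain s0 where "s0 \<in> S" "\<forall>s \<in> S. s0 \<sqsubseteq> s" using wo_min[OF V S_sub S_ne] by blast
  then have "s0 \<in> Rc" using Sc not_le by (auto simp: Rc_def) (metis not_lt)
  then have "b ` Rc \<subseteq> Y" "b ` Rc \<noteq> {}" using bprop by (auto simp: Rc_def)
  then obtain m where m: "m \<in> Rc" "\<forall>\<alpha> \<in> Rc. b m \<sqsubseteq> b \<alpha>" using wo_min[OF Y, of "b ` Rc"] by blast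
  have mS: "m \<in> S" using m by (simp add: Rc_def)
  have "z m \<sqsubseteq> w" if w: "w \<in> Z" for w
  proof (rule ccontr)
    assume nle: "\<not> z m \<sqsubseteq> w"
    obtain \<alpha> \<beta> where ab: "\<alpha> \<in> V" "\<beta> \<in> Y" "w = \<alpha> \<otimes> \<beta>" using w Z unfolding set_mult_def by blast
    then have \<alpha>S: "\<alpha> \<in> S" using w by (auto simp: S_def)
    have wc: "w \<in> carrier G" using ab wo_sub[OF V] wo_sub[OF Y] by simp
    have "z \<alpha> \<sqsubseteq> w"
      unfolding z_def ab(3) using bprop[OF \<alpha>S] ab w mult_le_iff wo_sub[OF V] wo_sub[OF Y] by simp
    then have "z \<alpha> \<sqsubset> z m" using nle not_le[OF Sc(3)[OF mS] wc] le_lt_trans Sc(3) \<alpha>S mS wc by blast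
    \<comment> \<open>The first \<alpha> whose product lies below \<open>z m\<close> is itself a
      record. It cannot come after \<open>m\<close>, by the choice of \<open>m\<close>, nor before
      it, since \<open>m\<close> is a record.\<close>
    then have "{\<alpha> \<in> S. z \<alpha> \<sqsubset> z m} \<subseteq> V" "{\<alpha> \<in> S. z \<alpha> \<sqsubset> z m} \<noteq> {}" using \<alpha>S S_sub by auto
    then obtain a1 where a1: "a1 \<in> S" "z a1 \<sqsubset> z m" "\<forall>\<alpha> \<in> S. z \<alpha> \<sqsubset> z m \<longrightarrow> a1 \<sqsubseteq> \<alpha>"
      using wo_min[OF V, of "{\<alpha> \<in> S. z \<alpha> \<sqsubset> z m}"] by blast
    have a1R: "a1 \<in> Rc"
      unfolding Rc_def
    proof (intro CollectI conjI ballI impI a1(1))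
      fix \<alpha>' assume \<alpha>': "\<alpha>' \<in> S" "\<alpha>' \<sqsubset> a1"
      then have "\<not> z \<alpha>' \<sqsubset> z m" using a1(3) not_le Sc(1) a1(1) by blast
      then show "z a1 \<sqsubset> z \<alpha>'" using a1 \<alpha>' lt_le_trans not_lt Sc(3) mS by metis
    qed
    have "\<not> m \<sqsubset> a1"
    proof
      assume "m \<sqsubset> a1"
      moreover have "b m \<sqsubseteq> b a1" using m a1R by blast
      ultimately have "z m \<sqsubset> z a1"
        unfolding z_def using mult_strict_mono Sc mS a1(1) by blast
      then show False using a1(2) Sc(3) mS a1(1) by (metis lt_trans lt_irrefl)
    qed
    moreover have "\<not> a1 \<sqsubset> m"
      using m(1) a1 Sc(3) mS unfolding Rc_def by (metis (mono_tags, lifting) lt_trans lt_irrefl mem_Collect_eq)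
    ultimately have "a1 = m" using not_lt Sc(1) mS a1(1) gle_antisym by metis
    then show False using a1(2) by simp
  qed
  then show "\<exists>m \<in> Z. \<forall>y \<in> Z. m \<sqsubseteq> y" using Sc(4)[OF mS] by blast
qed

end

subsection \<open>Convex subgroups\<close>

locale convex_subgroup = ordered_abelian_group G for G :: "('a, 'b) ogroup_scheme" (structure) +
  fixes C :: "'a set"
  assumes C_subgroup: "subgroup C G"
    and C_convex: "\<lbrakk>c \<in> C; x \<in> carrier G; \<one> \<sqsubseteq> x; x \<sqsubseteq> c\<rbrakk> \<Longrightarrow> x \<in> C"
begin

lemma C_sub: "c \<in> C \<Longrightarrow> c \<in> carrier G"
  and C_closed [simp]: "\<one> \<in> C" "\<lbrakk>c \<in> C; d \<in> C\<rbrakk> \<Longrightarrow> c \<otimes> d \<in> C" "c \<in> C \<Longrightarrow> inv c \<in> C"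
  using C_subgroup subgroup.mem_carrier subgroup.one_closed subgroup.m_closed subgroup.m_inv_closed
  by fastforce+

text \<open>\<open>ll \<gamma> \<delta>\<close> says that the coset of \<open>\<gamma>\<close> lies strictly below that of \<open>\<delta>\<close> in \<open>G/C\<close>.\<close>

definition ll :: "'a \<Rightarrow> 'a \<Rightarrow> bool" (infix \<open>\<lless>\<close> 50) where
  "\<gamma> \<lless> \<delta> \<longleftrightarrow> \<gamma> \<sqsubset> \<delta> \<and> inv \<gamma> \<otimes> \<delta> \<notin> C"

lemma ll_irrefl [simp]: "\<not> \<gamma> \<lless> \<gamma>" by (simp add: ll_def)

lemma ll_imp_lt: "\<gamma> \<lless> \<delta> \<Longrightarrow> \<gamma> \<sqsubset> \<delta>" by (simp add: ll_def)

lemma ll_le_trans: assumes "\<gamma> \<in> carrier G" "\<delta> \<in> carrier G" "\<epsilon> \<in> carrier G" "\<gamma> \<lless> \<delta>" "\<delta> \<sqsubseteq> \<epsilon>"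
  shows "\<gamma> \<lless> \<epsilon>"
proof -
  have "\<gamma> \<sqsubset> \<epsilon>" using assms lt_le_trans ll_imp_lt by blast
  moreover have "inv \<gamma> \<otimes> \<epsilon> \<notin> C"
  proof
    assume "inv \<gamma> \<otimes> \<epsilon> \<in> C"
    moreover have "\<one> \<sqsubseteq> inv \<gamma> \<otimes> \<delta>" "inv \<gamma> \<otimes> \<delta> \<sqsubseteq> inv \<gamma> \<otimes> \<epsilon>"
      using assms one_lt_iff[of \<gamma> \<delta>] mult_le_iff[of \<delta> \<epsilon> "inv \<gamma>"] by (auto simp: ll_def gless_def)
    ultimately show False using C_convex[of "inv \<gamma> \<otimes> \<epsilon>" "inv \<gamma> \<otimes> \<delta>"] assms by (auto simp: ll_def)
  qed
  ultimately show ?thesis by (simp add: ll_def)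
qed

lemma le_ll_trans: assumes "\<gamma> \<in> carrier G" "\<delta> \<in> carrier G" "\<epsilon> \<in> carrier G" "\<gamma> \<sqsubseteq> \<delta>" "\<delta> \<lless> \<epsilon>"
  shows "\<gamma> \<lless> \<epsilon>"
proof -
  have "\<gamma> \<sqsubset> \<epsilon>" using assms le_lt_trans ll_imp_lt by blast
  moreover have "inv \<gamma> \<otimes> \<epsilon> \<notin> C"
  proof
    assume "inv \<gamma> \<otimes> \<epsilon> \<in> C"
    moreover have "\<one> \<sqsubseteq> inv \<delta> \<otimes> \<epsilon>" using assms one_lt_iff[of \<delta> \<epsilon>] by (auto simp: ll_def gless_def)
    moreover have "inv \<delta> \<otimes> \<epsilon> \<sqsubseteq> inv \<gamma> \<otimes> \<epsilon>"
    proof -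
      have "(inv \<gamma> \<otimes> inv \<delta>) \<otimes> \<gamma> \<sqsubseteq> (inv \<gamma> \<otimes> inv \<delta>) \<otimes> \<delta>" using assms mult_le_iff by simp
      moreover have "(inv \<delta> \<otimes> inv \<gamma>) \<otimes> \<gamma> = inv \<delta>" "(inv \<gamma> \<otimes> inv \<delta>) \<otimes> \<delta> = inv \<gamma>"
        using assms by (simp_all add: m_assoc)
      moreover have "inv \<delta> \<otimes> inv \<gamma> = inv \<gamma> \<otimes> inv \<delta>" using assms by (simp add: m_comm)
      ultimately have "inv \<delta> \<sqsubseteq> inv \<gamma>" by simp
      then show ?thesis using assms gle_mult by simp
    qed
    ultimately show False using C_convex[of "inv \<gamma> \<otimes> \<epsilon>" "inv \<delta> \<otimes> \<epsilon>"] assms by (auto simp: ll_def)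
  qed
  ultimately show ?thesis by (simp add: ll_def)
qed

lemma ll_trans: "\<lbrakk>\<gamma> \<in> carrier G; \<delta> \<in> carrier G; \<epsilon> \<in> carrier G; \<gamma> \<lless> \<delta>; \<delta> \<lless> \<epsilon>\<rbrakk> \<Longrightarrow> \<gamma> \<lless> \<epsilon>"
  using ll_le_trans ll_imp_lt lt_imp_le by blast

lemma ll_mult_iff: "\<lbrakk>\<gamma> \<in> carrier G; \<delta> \<in> carrier G; \<epsilon> \<in> carrier G\<rbrakk> \<Longrightarrow> \<epsilon> \<otimes> \<gamma> \<lless> \<epsilon> \<otimes> \<delta> \<longleftrightarrow> \<gamma> \<lless> \<delta>"
proof -
  assume *: "\<gamma> \<in> carrier G" "\<delta> \<in> carrier G" "\<epsilon> \<in> carrier G"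
  then have "inv (\<epsilon> \<otimes> \<gamma>) \<otimes> (\<epsilon> \<otimes> \<delta>) = inv \<gamma> \<otimes> \<delta>"
    by (simp add: inv_mult_group m_ac)
  then show ?thesis using * mult_lt_iff by (simp add: ll_def)
qed

text \<open>The negation of \<open>\<gamma> \<lless> \<delta>\<close> is the weak order of cosets
  with the arguments exchanged, so it is transitive because the cosets are linearly ordered.\<close>

lemma not_ll_trans:
  assumes c: "\<gamma> \<in> carrier G" "\<delta> \<in> carrier G" "\<epsilon> \<in> carrier G" and "\<not> \<gamma> \<lless> \<delta>" "\<not> \<delta> \<lless> \<epsilon>"
  shows "\<not> \<gamma> \<lless> \<epsilon>"
proof
  assume g: "\<gamma> \<lless> \<epsilon>"
  have de: "\<delta> \<sqsubset> \<epsilon>" using ll_le_trans[OF c(1,3,2) g] assms not_lt by blast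
  then have d: "inv \<delta> \<otimes> \<epsilon> \<in> C" using assms by (simp add: ll_def)
  have "\<gamma> \<sqsubset> \<delta>" using le_ll_trans[OF c(2,1,3) _ g] assms not_lt by blast
  then have "inv \<gamma> \<otimes> \<delta> \<in> C" using assms by (simp add: ll_def)
  then have "(inv \<gamma> \<otimes> \<delta>) \<otimes> (inv \<delta> \<otimes> \<epsilon>) \<in> C" using d by simp
  moreover have "(inv \<gamma> \<otimes> \<delta>) \<otimes> (inv \<delta> \<otimes> \<epsilon>) = inv \<gamma> \<otimes> \<epsilon>" using c by (simp add: m_assoc)
  ultimately show False using g by (simp add: ll_def)
qed

lemma same_coset: "\<lbrakk>\<gamma> \<in> carrier G; \<delta> \<in> carrier G\<rbrakk> \<Longrightarrow> inv \<gamma> \<otimes> \<delta> \<in> C \<longleftrightarrow> \<not> \<gamma> \<lless> \<delta> \<and> \<not> \<delta> \<lless> \<gamma>"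
proof -
  assume c: "\<gamma> \<in> carrier G" "\<delta> \<in> carrier G"
  have e: "inv (inv \<gamma> \<otimes> \<delta>) = inv \<delta> \<otimes> \<gamma>" using c by (simp add: inv_mult_group m_comm)
  have "inv \<gamma> \<otimes> \<delta> \<in> C \<longleftrightarrow> inv \<delta> \<otimes> \<gamma> \<in> C"
    using C_closed(3)[of "inv \<gamma> \<otimes> \<delta>"] C_closed(3)[of "inv \<delta> \<otimes> \<gamma>"] e c by (metis inv_closed inv_inv m_closed)
  moreover have "inv \<gamma> \<otimes> \<delta> \<in> C" if "\<not> \<gamma> \<sqsubset> \<delta>" "\<not> \<delta> \<sqsubset> \<gamma>"
    using that c not_lt gle_antisym[of \<gamma> \<delta>] by (auto simp: l_inv)
  ultimately show ?thesis by (auto simp: ll_def)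
qed

text \<open>The finiteness behind products of series over G/C: each coset meeting \<open>V\<close>
  is represented by its least element in \<open>V\<close>. The product of the two cosets being
  fixed, a larger representative forces a strictly smaller partner. A least partner in the
  well-ordered \<open>Y\<close> therefore yields a greatest representative in any nonempty set of
  them, and \<open>finite_if_min_max\<close> applies.\<close>

lemma finite_coset_reps:
  assumes V: "wo V" and Y: "wo Y" and g: "\<gamma> \<in> carrier G"
  shows "finite {\<alpha> \<in> V. (\<forall>\<alpha>' \<in> V. inv \<alpha> \<otimes> \<alpha>' \<in> C \<longrightarrow> \<alpha> \<sqsubseteq> \<alpha>') \<and> (\<exists>\<beta> \<in> Y. inv \<gamma> \<otimes> (\<alpha> \<otimes> \<beta>) \<in> C)}"
    (is "finite ?R")
proof (rule finite_if_min_max)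
  show "wo ?R" by (rule wo_subset[OF V]) simp
  fix S assume S: "S \<subseteq> ?R" "S \<noteq> {}"
  define b where "b \<alpha> = (SOME \<beta>. \<beta> \<in> Y \<and> inv \<gamma> \<otimes> (\<alpha> \<otimes> \<beta>) \<in> C)" for \<alpha>
  have b: "b \<alpha> \<in> Y" "inv \<gamma> \<otimes> (\<alpha> \<otimes> b \<alpha>) \<in> C" "\<alpha> \<in> carrier G" "b \<alpha> \<in> carrier G" if "\<alpha> \<in> ?R" for \<alpha>
  proof -
    have "b \<alpha> \<in> Y \<and> inv \<gamma> \<otimes> (\<alpha> \<otimes> b \<alpha>) \<in> C"
      unfolding b_def by (rule someI_ex) (use that in blast)
    then show "b \<alpha> \<in> Y" "inv \<gamma> \<otimes> (\<alpha> \<otimes> b \<alpha>) \<in> C" "\<alpha> \<in> carrier G" "b \<alpha> \<in> carrier G"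
      using that wo_sub[OF V] wo_sub[OF Y] by auto
  qed
  have anti: "b \<alpha>' \<sqsubset> b \<alpha>" if a: "\<alpha> \<in> ?R" "\<alpha>' \<in> ?R" "\<alpha> \<sqsubset> \<alpha>'" for \<alpha> \<alpha>'
  proof -
    note c = b[OF a(1)] b[OF a(2)]
    have "inv \<alpha>' \<otimes> \<alpha> \<notin> C" using a not_le[of \<alpha>' \<alpha>] c by blast
    then have "inv \<alpha> \<otimes> \<alpha>' \<notin> C" using same_coset[of \<alpha> \<alpha>'] same_coset[of \<alpha>' \<alpha>] c by blast
    then have "\<alpha> \<lless> \<alpha>'" using a by (simp add: ll_def)
    then have 1: "b \<alpha>' \<otimes> \<alpha> \<lless> b \<alpha>' \<otimes> \<alpha>'" using c ll_mult_iff by blast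
    have 2: "\<not> b \<alpha>' \<otimes> \<alpha>' \<lless> \<gamma>" "\<not> \<gamma> \<lless> b \<alpha> \<otimes> \<alpha>"
      using same_coset[of \<gamma> "\<alpha> \<otimes> b \<alpha>"] same_coset[of \<gamma> "\<alpha>' \<otimes> b \<alpha>'"] c g by (auto simp: m_comm)
    have "b \<alpha>' \<otimes> \<alpha> \<lless> b \<alpha> \<otimes> \<alpha>"
    proof (rule ccontr)
      assume n: "\<not> b \<alpha>' \<otimes> \<alpha> \<lless> b \<alpha> \<otimes> \<alpha>"
      have "\<not> b \<alpha> \<otimes> \<alpha> \<lless> b \<alpha> \<otimes> \<alpha>" by simp
      have "\<not> \<gamma> \<lless> b \<alpha>' \<otimes> \<alpha>'" "\<not> b \<alpha> \<otimes> \<alpha> \<lless> \<gamma>"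
        using same_coset[of \<gamma> "\<alpha> \<otimes> b \<alpha>"] same_coset[of \<gamma> "\<alpha>' \<otimes> b \<alpha>'"] c g by (auto simp: m_comm)
      then have "\<not> b \<alpha>' \<otimes> \<alpha> \<lless> b \<alpha>' \<otimes> \<alpha>'"
        using not_ll_trans[of "b \<alpha>' \<otimes> \<alpha>" "b \<alpha> \<otimes> \<alpha>" \<gamma>] not_ll_trans[of "b \<alpha>' \<otimes> \<alpha>" \<gamma> "b \<alpha>' \<otimes> \<alpha>'"] n c g
        by simp
      then show False using 1 by blast
    qed
    then have "b \<alpha>' \<lless> b \<alpha>" using ll_mult_iff[of "b \<alpha>'" "b \<alpha>" \<alpha>] c by (simp add: m_comm)
    then show ?thesis by (rule ll_imp_lt)
  qed
  have "b ` S \<subseteq> Y" "b ` S \<noteq> {}" using S b(1) by blast+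
  then obtain m where m: "m \<in> S" "\<forall>\<alpha> \<in> S. b m \<sqsubseteq> b \<alpha>" using wo_min[OF Y, of "b ` S"] by blast
  have "s \<sqsubseteq> m" if s: "s \<in> S" for s
  proof (rule ccontr)
    have R: "s \<in> ?R" "m \<in> ?R" using subsetD[OF S(1)] s m(1) by simp_all
    assume "\<not> s \<sqsubseteq> m"
    then have "m \<sqsubset> s" using not_le b(3) R by blast
    then have "b s \<sqsubset> b m" using anti R by blast
    then show False using m(2) s not_le[OF b(4)[OF R(2)] b(4)[OF R(1)]] by blast
  qed
  then show "\<exists>m \<in> S. \<forall>s \<in> S. s \<sqsubseteq> m" using m(1) by blast
qed

end

context ordered_abelian_group
begin

lemma trivial_convex: "convex_subgroup G {\<one>}"
  by unfold_locales (auto simp: gle_antisym triv_subgroup)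

text \<open>For the trivial subgroup every element is its own coset representative, and the first
  component of a pair determines the second.\<close>

lemma finite_pairs:
  assumes "wo V" "wo Y"
  shows "finite {(\<alpha>, \<beta>). \<alpha> \<in> V \<and> \<beta> \<in> Y \<and> \<alpha> \<otimes> \<beta> = \<gamma>}"
proof (cases "\<gamma> \<in> carrier G")
  case True
  interpret T: convex_subgroup G "{\<one>}" by (rule trivial_convex)
  let ?P = "{(\<alpha>, \<beta>). \<alpha> \<in> V \<and> \<beta> \<in> Y \<and> \<alpha> \<otimes> \<beta> = \<gamma>}"
  let ?R = "{\<alpha> \<in> V. (\<forall>\<alpha>' \<in> V. inv \<alpha> \<otimes> \<alpha>' \<in> {\<one>} \<longrightarrow> \<alpha> \<sqsubseteq> \<alpha>') \<and> (\<exists>\<beta> \<in> Y. inv \<gamma> \<otimes> (\<alpha> \<otimes> \<beta>) \<in> {\<one>})}"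
  have "?P \<subseteq> (\<lambda>\<alpha>. (\<alpha>, inv \<alpha> \<otimes> \<gamma>)) ` ?R"
  proof clarify
    fix \<alpha> \<beta> assume ab: "\<alpha> \<in> V" "\<beta> \<in> Y" "\<gamma> = \<alpha> \<otimes> \<beta>"
    have c: "\<alpha> \<in> carrier G" "\<beta> \<in> carrier G" using ab wo_sub assms by auto
    have "\<alpha> = \<alpha>'" if "\<alpha>' \<in> V" "inv \<alpha> \<otimes> \<alpha>' = \<one>" for \<alpha>'
      using that wo_sub[OF assms(1) that(1)] c by (metis inv_closed inv_equality inv_inv)
    moreover have "inv \<gamma> \<otimes> (\<alpha> \<otimes> \<beta>) = \<one>" using ab(3) c by simp
    ultimately have "\<alpha> \<in> ?R" using ab c gle_refl by blast
    moreover have "\<beta> = inv \<alpha> \<otimes> (\<alpha> \<otimes> \<beta>)" using c by simp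
    ultimately show "(\<alpha>, \<beta>) \<in> (\<lambda>\<alpha>'. (\<alpha>', inv \<alpha>' \<otimes> (\<alpha> \<otimes> \<beta>))) ` {\<alpha>' \<in> V. (\<forall>\<alpha>'' \<in> V. inv \<alpha>' \<otimes> \<alpha>'' \<in> {\<one>} \<longrightarrow> \<alpha>' \<sqsubseteq> \<alpha>'') \<and> (\<exists>\<beta>' \<in> Y. inv (\<alpha> \<otimes> \<beta>) \<otimes> (\<alpha>' \<otimes> \<beta>') \<in> {\<one>})}"
      unfolding ab(3) by blast
  qed
  then show ?thesis using T.finite_coset_reps[OF assms True] finite_surj by blast
next
  case False
  then have "{(\<alpha>, \<beta>). \<alpha> \<in> V \<and> \<beta> \<in> Y \<and> \<alpha> \<otimes> \<beta> = \<gamma>} = {}" using wo_sub assms by auto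
  then show ?thesis by (simp only: finite.emptyI)
qed

end

subsection \<open>The ring of Hahn series\<close>

context ordered_abelian_group
begin

lemma H_simps: "carrier H = {x. wo (hsupp x)}" "\<zero>\<^bsub>H\<^esub> = (\<lambda>\<gamma>. 0)" "x \<oplus>\<^bsub>H\<^esub> y = (\<lambda>\<gamma>. x \<gamma> + y \<gamma>)"
    "\<one>\<^bsub>H\<^esub> = hmon 1 \<one>"
  by (simp_all add: hahn_ring_def hmon_def)

lemma H_wo: "x \<in> carrier H \<Longrightarrow> wo (hsupp x)" by (simp add: H_simps)

lemma H_out: "\<lbrakk>x \<in> carrier H; \<gamma> \<notin> carrier G\<rbrakk> \<Longrightarrow> x \<gamma> = 0"
  using wo_sub[OF H_wo] by blast

definition pairs :: "'a set \<Rightarrow> 'a set \<Rightarrow> 'a \<Rightarrow> ('a \<times> 'a) set" where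
  "pairs V Y \<gamma> = {(\<alpha>, \<beta>). \<alpha> \<in> V \<and> \<beta> \<in> Y \<and> \<alpha> \<otimes> \<beta> = \<gamma>}"

lemma finite_pairs' [simp]: "\<lbrakk>wo V; wo Y\<rbrakk> \<Longrightarrow> finite (pairs V Y \<gamma>)"
  unfolding pairs_def by (rule finite_pairs)

lemma H_mult: "(x \<otimes>\<^bsub>H\<^esub> y) \<gamma> = (\<Sum>(\<alpha>, \<beta>) \<in> pairs (hsupp x) (hsupp y) \<gamma>. x \<alpha> * y \<beta>)"
  by (simp add: hahn_ring_def pairs_def)

text \<open>Sums of products can be compared only over a common index set, which this
  provides.\<close>

lemma H_mult_superset:
  assumes "wo V" "wo Y" "hsupp x \<subseteq> V" "hsupp y \<subseteq> Y"
  shows "(x \<otimes>\<^bsub>H\<^esub> y) \<gamma> = (\<Sum>(\<alpha>, \<beta>) \<in> pairs V Y \<gamma>. x \<alpha> * y \<beta>)"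
  unfolding H_mult
  by (rule sum.mono_neutral_left) (use assms in \<open>auto simp: pairs_def finite_pairs[unfolded pairs_def]\<close>)

lemma hsupp_mult: "hsupp (x \<otimes>\<^bsub>H\<^esub> y) \<subseteq> hsupp x <#> hsupp y"
proof
  fix \<gamma> assume "\<gamma> \<in> hsupp (x \<otimes>\<^bsub>H\<^esub> y)"
  then have "(\<Sum>(\<alpha>, \<beta>) \<in> pairs (hsupp x) (hsupp y) \<gamma>. x \<alpha> * y \<beta>) \<noteq> 0" by (simp add: H_mult)
  then have "pairs (hsupp x) (hsupp y) \<gamma> \<noteq> {}" by (metis sum.empty)
  then show "\<gamma> \<in> hsupp x <#> hsupp y" by (auto simp: pairs_def set_mult_def)
qed

lemma hsupp_multE:
  assumes "(x \<otimes>\<^bsub>H\<^esub> y) \<gamma> \<noteq> 0"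
  obtains \<alpha> \<beta> where "x \<alpha> \<noteq> 0" "y \<beta> \<noteq> 0" "\<gamma> = \<alpha> \<otimes> \<beta>"
  using hsupp_mult[of x y] assms by (force simp: set_mult_def)

lemma H_mult_closed: "\<lbrakk>x \<in> carrier H; y \<in> carrier H\<rbrakk> \<Longrightarrow> x \<otimes>\<^bsub>H\<^esub> y \<in> carrier H"
  using wo_subset[OF wo_mult hsupp_mult] by (simp add: H_simps)

lemma H_add_closed: "\<lbrakk>x \<in> carrier H; y \<in> carrier H\<rbrakk> \<Longrightarrow> x \<oplus>\<^bsub>H\<^esub> y \<in> carrier H"
proof -
  assume "x \<in> carrier H" "y \<in> carrier H"
  moreover have "hsupp (\<lambda>\<gamma>. x \<gamma> + y \<gamma>) \<subseteq> hsupp x \<union> hsupp y" by auto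
  ultimately show ?thesis using wo_subset wo_union unfolding H_simps mem_Collect_eq by blast
qed

lemma hmon_closed [simp]: "\<gamma> \<in> carrier G \<Longrightarrow> hmon r \<gamma> \<in> carrier H"
proof -
  assume "\<gamma> \<in> carrier G"
  moreover have "hsupp (hmon r \<gamma>) \<subseteq> {\<gamma>}" by (auto simp: hmon_def)
  ultimately show ?thesis using wo_subset[OF wo_singleton] by (simp add: H_simps)
qed

lemma H_mult_comm: assumes "x \<in> carrier H" "y \<in> carrier H" shows "x \<otimes>\<^bsub>H\<^esub> y = y \<otimes>\<^bsub>H\<^esub> x"
proof
  fix \<gamma>
  have "pairs (hsupp y) (hsupp x) \<gamma> = prod.swap ` pairs (hsupp x) (hsupp y) \<gamma>"
  proof -
    have c: "\<alpha> \<in> carrier G" "\<beta> \<in> carrier G" if "x \<alpha> \<noteq> 0" "y \<beta> \<noteq> 0" for \<alpha> \<beta>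
      using that H_out assms by auto
    have "(\<beta>, \<alpha>) \<in> pairs (hsupp y) (hsupp x) \<gamma> \<longleftrightarrow> (\<alpha>, \<beta>) \<in> pairs (hsupp x) (hsupp y) \<gamma>" for \<alpha> \<beta>
      using c[of \<alpha> \<beta>] m_comm[of \<alpha> \<beta>] by (auto simp: pairs_def)
    then show ?thesis by force
  qed
  then show "(x \<otimes>\<^bsub>H\<^esub> y) \<gamma> = (y \<otimes>\<^bsub>H\<^esub> x) \<gamma>"
    unfolding H_mult by (simp add: sum.reindex case_prod_unfold mult.commute)
qed

lemma H_mult_distrib:
  assumes "x \<in> carrier H" "y \<in> carrier H" "z \<in> carrier H"
  shows "(x \<oplus>\<^bsub>H\<^esub> y) \<otimes>\<^bsub>H\<^esub> z = x \<otimes>\<^bsub>H\<^esub> z \<oplus>\<^bsub>H\<^esub> y \<otimes>\<^bsub>H\<^esub> z"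
proof
  fix \<gamma>
  let ?V = "hsupp x \<union> hsupp y"
  have w: "wo ?V" "wo (hsupp z)" using assms wo_union H_wo by auto
  have "((x \<oplus>\<^bsub>H\<^esub> y) \<otimes>\<^bsub>H\<^esub> z) \<gamma> = (\<Sum>(\<alpha>, \<beta>) \<in> pairs ?V (hsupp z) \<gamma>. (x \<alpha> + y \<alpha>) * z \<beta>)"
    by (subst H_mult_superset[OF w]) (auto simp: H_simps)
  also have "\<dots> = (\<Sum>(\<alpha>, \<beta>) \<in> pairs ?V (hsupp z) \<gamma>. x \<alpha> * z \<beta>) + (\<Sum>(\<alpha>, \<beta>) \<in> pairs ?V (hsupp z) \<gamma>. y \<alpha> * z \<beta>)"
    by (simp add: sum.distrib[symmetric] case_prod_unfold distrib_right)
  also have "\<dots> = (x \<otimes>\<^bsub>H\<^esub> z) \<gamma> + (y \<otimes>\<^bsub>H\<^esub> z) \<gamma>"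
    by (subst (1 2) H_mult_superset[OF w]) auto
  finally show "((x \<oplus>\<^bsub>H\<^esub> y) \<otimes>\<^bsub>H\<^esub> z) \<gamma> = (x \<otimes>\<^bsub>H\<^esub> z \<oplus>\<^bsub>H\<^esub> y \<otimes>\<^bsub>H\<^esub> z) \<gamma>" by (simp add: H_simps)
qed

text \<open>The sum over triples depends on the three factors symmetrically up to cycling them, so
  associativity follows from commutativity.\<close>

lemma H_mult_triple:
  assumes "x \<in> carrier H" "y \<in> carrier H" "z \<in> carrier H"
  shows "((x \<otimes>\<^bsub>H\<^esub> y) \<otimes>\<^bsub>H\<^esub> z) \<gamma> =
    (\<Sum>(\<alpha>, \<beta>, \<epsilon>) \<in> {(\<alpha>, \<beta>, \<epsilon>). \<alpha> \<in> hsupp x \<and> \<beta> \<in> hsupp y \<and> \<epsilon> \<in> hsupp z \<and> \<alpha> \<otimes> \<beta> \<otimes> \<epsilon> = \<gamma>}. x \<alpha> * y \<beta> * z \<epsilon>)"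
proof -
  let ?V = "hsupp x" and ?Y = "hsupp y" and ?Z = "hsupp z"
  have w: "wo ?V" "wo ?Y" "wo ?Z" "wo (?V <#> ?Y)" using assms H_wo wo_mult by auto
  let ?S = "SIGMA p : pairs (?V <#> ?Y) ?Z \<gamma>. pairs ?V ?Y (fst p)"
  have "((x \<otimes>\<^bsub>H\<^esub> y) \<otimes>\<^bsub>H\<^esub> z) \<gamma> = (\<Sum>(\<delta>, \<epsilon>) \<in> pairs (?V <#> ?Y) ?Z \<gamma>. (x \<otimes>\<^bsub>H\<^esub> y) \<delta> * z \<epsilon>)"
    by (rule H_mult_superset[OF w(4,3) hsupp_mult]) simp
  also have "\<dots> = (\<Sum>p \<in> pairs (?V <#> ?Y) ?Z \<gamma>. \<Sum>q \<in> pairs ?V ?Y (fst p). x (fst q) * y (snd q) * z (snd p))"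
    by (simp add: H_mult case_prod_unfold sum_distrib_right)
  also have "\<dots> = (\<Sum>(p, q) \<in> ?S. x (fst q) * y (snd q) * z (snd p))"
    using w by (subst sum.Sigma) auto
  also have "\<dots> = (\<Sum>(\<alpha>, \<beta>, \<epsilon>) \<in> {(\<alpha>, \<beta>, \<epsilon>). \<alpha> \<in> ?V \<and> \<beta> \<in> ?Y \<and> \<epsilon> \<in> ?Z \<and> \<alpha> \<otimes> \<beta> \<otimes> \<epsilon> = \<gamma>}. x \<alpha> * y \<beta> * z \<epsilon>)"
    by (rule sum.reindex_bij_witness[of _ "\<lambda>(\<alpha>, \<beta>, \<epsilon>). ((\<alpha> \<otimes> \<beta>, \<epsilon>), (\<alpha>, \<beta>))" "\<lambda>(p, q). (fst q, snd q, snd p)"])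
      (auto simp: pairs_def set_mult_def)
  finally show ?thesis .
qed

lemma H_mult_assoc:
  assumes "x \<in> carrier H" "y \<in> carrier H" "z \<in> carrier H"
  shows "(x \<otimes>\<^bsub>H\<^esub> y) \<otimes>\<^bsub>H\<^esub> z = x \<otimes>\<^bsub>H\<^esub> (y \<otimes>\<^bsub>H\<^esub> z)"
proof
  fix \<gamma>
  have c: "\<alpha> \<otimes> \<beta> \<otimes> \<epsilon> = \<beta> \<otimes> \<epsilon> \<otimes> \<alpha>" if "x \<alpha> \<noteq> 0" "y \<beta> \<noteq> 0" "z \<epsilon> \<noteq> 0" for \<alpha> \<beta> \<epsilon>
  proof -
    have "\<alpha> \<in> carrier G" "\<beta> \<in> carrier G" "\<epsilon> \<in> carrier G" using that H_out assms by auto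
    then show ?thesis by (simp add: m_ac)
  qed
  have "(x \<otimes>\<^bsub>H\<^esub> (y \<otimes>\<^bsub>H\<^esub> z)) \<gamma> = ((y \<otimes>\<^bsub>H\<^esub> z) \<otimes>\<^bsub>H\<^esub> x) \<gamma>"
    using H_mult_comm H_mult_closed assms by metis
  also have "\<dots> = ((x \<otimes>\<^bsub>H\<^esub> y) \<otimes>\<^bsub>H\<^esub> z) \<gamma>"
    unfolding H_mult_triple[OF assms] H_mult_triple[OF assms(2,3,1)]
    by (rule sum.reindex_bij_witness[of _ "\<lambda>(\<alpha>, \<beta>, \<epsilon>). (\<beta>, \<epsilon>, \<alpha>)" "\<lambda>(\<beta>, \<epsilon>, \<alpha>). (\<alpha>, \<beta>, \<epsilon>)"])
      (auto intro: c c[symmetric])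
  finally show "((x \<otimes>\<^bsub>H\<^esub> y) \<otimes>\<^bsub>H\<^esub> z) \<gamma> = (x \<otimes>\<^bsub>H\<^esub> (y \<otimes>\<^bsub>H\<^esub> z)) \<gamma>" by simp
qed

lemma hmon_mult_left:
  assumes x: "x \<in> carrier H" and g: "\<gamma> \<in> carrier G" and d: "\<delta> \<in> carrier G"
  shows "(hmon r \<gamma> \<otimes>\<^bsub>H\<^esub> x) \<delta> = r * x (inv \<gamma> \<otimes> \<delta>)"
proof -
  have "(hmon r \<gamma> \<otimes>\<^bsub>H\<^esub> x) \<delta> = (\<Sum>(\<alpha>, \<beta>) \<in> pairs {\<gamma>} (hsupp x) \<delta>. hmon r \<gamma> \<alpha> * x \<beta>)"
    using x g by (intro H_mult_superset) (auto simp: H_wo hmon_def)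
  also have "pairs {\<gamma>} (hsupp x) \<delta> = (if x (inv \<gamma> \<otimes> \<delta>) = 0 then {} else {(\<gamma>, inv \<gamma> \<otimes> \<delta>)})"
  proof -
    have "\<beta> = inv \<gamma> \<otimes> \<delta>" if "x \<beta> \<noteq> 0" "\<gamma> \<otimes> \<beta> = \<delta>" for \<beta>
    proof -
      have "\<beta> \<in> carrier G" using that H_out[OF x, of \<beta>] by blast
      then show ?thesis using that g by auto
    qed
    moreover have "\<gamma> \<otimes> (inv \<gamma> \<otimes> \<delta>) = \<delta>" using g d by simp
    ultimately have "p \<in> pairs {\<gamma>} (hsupp x) \<delta> \<longleftrightarrow> p = (\<gamma>, inv \<gamma> \<otimes> \<delta>) \<and> x (inv \<gamma> \<otimes> \<delta>) \<noteq> 0" for p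
      by (cases p) (simp add: pairs_def, metis)
    then show ?thesis by (simp add: set_eq_iff)
  qed
  finally show ?thesis by (simp add: hmon_def)
qed

lemma hmon_mult_hmon:
  assumes "\<gamma> \<in> carrier G" "\<delta> \<in> carrier G"
  shows "hmon r \<gamma> \<otimes>\<^bsub>H\<^esub> hmon s \<delta> = hmon (r * s) (\<gamma> \<otimes> \<delta>)"
proof
  fix \<epsilon>
  show "(hmon r \<gamma> \<otimes>\<^bsub>H\<^esub> hmon s \<delta>) \<epsilon> = hmon (r * s) (\<gamma> \<otimes> \<delta>) \<epsilon>"
  proof (cases "\<epsilon> \<in> carrier G")
    case True
    then have "inv \<gamma> \<otimes> \<epsilon> = \<delta> \<longleftrightarrow> \<epsilon> = \<gamma> \<otimes> \<delta>" using assms by auto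
    then show ?thesis using hmon_mult_left[OF hmon_closed assms(1) True] assms by (simp add: hmon_def)
  next
    case False
    then have "(hmon r \<gamma> \<otimes>\<^bsub>H\<^esub> hmon s \<delta>) \<epsilon> = 0" using H_out H_mult_closed assms by simp
    then show ?thesis using False assms by (auto simp: hmon_def)
  qed
qed

lemma H_cring: "cring H"
proof (rule cringI)
  show "abelian_group H"
  proof (rule abelian_groupI)
    fix x assume x: "x \<in> carrier H"
    show "\<exists>y \<in> carrier H. y \<oplus>\<^bsub>H\<^esub> x = \<zero>\<^bsub>H\<^esub>"
      by (rule bexI[of _ "\<lambda>\<gamma>. - x \<gamma>"]) (use x in \<open>auto simp: H_simps\<close>)
  qed (use H_add_closed in \<open>auto simp: H_simps add.assoc add.commute add.left_commute\<close>)
  show "Group.comm_monoid H"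
  proof (rule comm_monoidI)
    fix x assume x: "x \<in> carrier H"
    show "\<one>\<^bsub>H\<^esub> \<otimes>\<^bsub>H\<^esub> x = x"
    proof
      fix \<gamma> show "(\<one>\<^bsub>H\<^esub> \<otimes>\<^bsub>H\<^esub> x) \<gamma> = x \<gamma>"
      proof (cases "\<gamma> \<in> carrier G")
        case True then show ?thesis using hmon_mult_left[OF x _ True, of \<one> 1] by (simp add: H_simps)
      next
        case False
        then show ?thesis using H_out[OF H_mult_closed[of "hmon 1 \<one>" x]] H_out[OF x] x by (simp add: H_simps(4))
      qed
    qed
  qed (use H_mult_closed H_mult_assoc H_mult_comm H_simps(4) in auto)
qed (rule H_mult_distrib)

end

sublocale ordered_abelian_group \<subseteq> H: cring "hahn_ring G"
  by (rule H_cring)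

section \<open>Leading exponents of Hahn series\<close>

context ordered_abelian_group
begin

lemma H_uminus: "x \<in> carrier H \<Longrightarrow> \<ominus>\<^bsub>H\<^esub> x = (\<lambda>\<gamma>. - x \<gamma>)"
  by (rule H.minus_equality) (auto simp: H_simps)

lemma H_minus: "\<lbrakk>x \<in> carrier H; y \<in> carrier H\<rbrakk> \<Longrightarrow> x \<ominus>\<^bsub>H\<^esub> y = (\<lambda>\<gamma>. x \<gamma> - y \<gamma>)"
  by (simp add: a_minus_def H_uminus) (simp add: H_simps)

text \<open>The leading exponent, that is, the natural valuation of the field of Hahn series. At the
  zero series its value is unspecified.\<close>

definition vmin :: "('a \<Rightarrow> real) \<Rightarrow> 'a" where
  "vmin x = (SOME m. x m \<noteq> 0 \<and> (\<forall>\<gamma>. x \<gamma> \<noteq> 0 \<longrightarrow> m \<sqsubseteq> \<gamma>))"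

lemma vmin:
  assumes "x \<in> carrier H" "x \<noteq> \<zero>\<^bsub>H\<^esub>"
  shows "x (vmin x) \<noteq> 0" "x \<gamma> \<noteq> 0 \<Longrightarrow> vmin x \<sqsubseteq> \<gamma>" "vmin x \<in> carrier G"
proof -
  have "hsupp x \<noteq> {}" using assms by (auto simp: H_simps)
  then have "\<exists>m. x m \<noteq> 0 \<and> (\<forall>\<gamma>. x \<gamma> \<noteq> 0 \<longrightarrow> m \<sqsubseteq> \<gamma>)"
    using wo_min[OF H_wo[OF assms(1)], of "hsupp x"] by auto
  then have "x (vmin x) \<noteq> 0 \<and> (\<forall>\<gamma>. x \<gamma> \<noteq> 0 \<longrightarrow> vmin x \<sqsubseteq> \<gamma>)"
    unfolding vmin_def by (rule someI_ex)
  then show "x (vmin x) \<noteq> 0" "x \<gamma> \<noteq> 0 \<Longrightarrow> vmin x \<sqsubseteq> \<gamma>" "vmin x \<in> carrier G"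
    using H_out[OF assms(1)] by auto
qed

lemma vmin_eqI:
  assumes "x \<in> carrier H" "x m \<noteq> 0" "\<And>\<gamma>. x \<gamma> \<noteq> 0 \<Longrightarrow> m \<sqsubseteq> \<gamma>"
  shows "vmin x = m"
proof -
  have "x \<noteq> \<zero>\<^bsub>H\<^esub>" using assms by (auto simp: H_simps)
  then show ?thesis
    using vmin[OF assms(1)] assms H_out[OF assms(1)] by (metis gle_antisym)
qed

lemma H_mult_lead:
  assumes x: "x \<in> carrier H" "x \<noteq> \<zero>\<^bsub>H\<^esub>" and y: "y \<in> carrier H" "y \<noteq> \<zero>\<^bsub>H\<^esub>"
  shows "(x \<otimes>\<^bsub>H\<^esub> y) (vmin x \<otimes> vmin y) = x (vmin x) * y (vmin y)" "x \<otimes>\<^bsub>H\<^esub> y \<noteq> \<zero>\<^bsub>H\<^esub>"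
    "vmin (x \<otimes>\<^bsub>H\<^esub> y) = vmin x \<otimes> vmin y"
proof -
  let ?a = "vmin x" and ?b = "vmin y"
  note vx = vmin[OF x] and vy = vmin[OF y]
  have "pairs (hsupp x) (hsupp y) (?a \<otimes> ?b) = {(?a, ?b)}"
  proof -
    have "\<alpha> = ?a \<and> \<beta> = ?b" if "x \<alpha> \<noteq> 0" "y \<beta> \<noteq> 0" "\<alpha> \<otimes> \<beta> = ?a \<otimes> ?b" for \<alpha> \<beta>
    proof -
      have c: "\<alpha> \<in> carrier G" "\<beta> \<in> carrier G" using that H_out x y by auto
      have "?a \<sqsubseteq> \<alpha>" "?b \<sqsubseteq> \<beta>" using vx vy that by auto
      then have "\<not> ?a \<sqsubset> \<alpha>" using mult_strict_mono[of ?a \<alpha> ?b \<beta>] that c vx vy by auto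
      then have "\<alpha> = ?a" using \<open>?a \<sqsubseteq> \<alpha>\<close> by (simp add: gless_def)
      then show ?thesis using that c vx vy by simp
    qed
    then show ?thesis using vx vy by (auto simp: pairs_def)
  qed
  then show 1: "(x \<otimes>\<^bsub>H\<^esub> y) (?a \<otimes> ?b) = x ?a * y ?b" by (simp add: H_mult)
  then show "x \<otimes>\<^bsub>H\<^esub> y \<noteq> \<zero>\<^bsub>H\<^esub>" using vx vy by (auto simp: H_simps)
  show "vmin (x \<otimes>\<^bsub>H\<^esub> y) = ?a \<otimes> ?b"
  proof (rule vmin_eqI[OF H_mult_closed[OF x(1) y(1)]])
    show "(x \<otimes>\<^bsub>H\<^esub> y) (?a \<otimes> ?b) \<noteq> 0" using 1 vx vy by simp
    fix \<gamma> assume "(x \<otimes>\<^bsub>H\<^esub> y) \<gamma> \<noteq> 0"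
    then obtain \<alpha> \<beta> where "x \<alpha> \<noteq> 0" "y \<beta> \<noteq> 0" "\<gamma> = \<alpha> \<otimes> \<beta>" by (rule hsupp_multE)
    then show "?a \<otimes> ?b \<sqsubseteq> \<gamma>" using mult_mono vx vy H_out x y by metis
  qed
qed

end

subsection \<open>A fixed point theorem\<close>

context convex_subgroup
begin

text \<open>In terms of the valuation with values in G/C, \<open>leag \<gamma> x y\<close> says that
  x - y has value above the coset of \<gamma>, and \<open>ltag \<gamma> x y\<close> that its value
  is at least that coset. A map taking \<open>ltag\<close> to \<open>leag\<close> is thus a strict
  contraction.\<close>

definition leag :: "'a \<Rightarrow> ('a \<Rightarrow> real) \<Rightarrow> ('a \<Rightarrow> real) \<Rightarrow> bool" where
  "leag \<gamma> x y \<longleftrightarrow> (\<forall>\<delta> \<in> carrier G. \<not> \<gamma> \<lless> \<delta> \<longrightarrow> x \<delta> = y \<delta>)"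

definition ltag :: "'a \<Rightarrow> ('a \<Rightarrow> real) \<Rightarrow> ('a \<Rightarrow> real) \<Rightarrow> bool" where
  "ltag \<gamma> x y \<longleftrightarrow> (\<forall>\<delta> \<in> carrier G. \<delta> \<lless> \<gamma> \<longrightarrow> x \<delta> = y \<delta>)"

lemma leag_sym: "leag \<gamma> x y \<Longrightarrow> leag \<gamma> y x"
  and leag_trans: "\<lbrakk>leag \<gamma> x y; leag \<gamma> y z\<rbrakk> \<Longrightarrow> leag \<gamma> x z"
  by (auto simp: leag_def)

lemma leag_mono: "\<lbrakk>leag \<gamma> x y; \<gamma> \<in> carrier G; \<delta> \<in> carrier G; \<not> \<gamma> \<lless> \<delta>\<rbrakk> \<Longrightarrow> leag \<delta> x y"
  unfolding leag_def using not_ll_trans by blast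

lemma leag_ltag: "\<lbrakk>leag \<gamma> x y; \<gamma> \<in> carrier G\<rbrakk> \<Longrightarrow> ltag \<gamma> x y"
  unfolding leag_def ltag_def using ll_trans ll_irrefl by blast

text \<open>The sets \<open>B\<close> to which the theorem applies are closed under glueing approximations along an
  initial segment of \<open>G/C\<close>. The fixed point is glued from all approximate fixed points; if it were
  not exact, one more application of \<open>\<phi>\<close> would approximate beyond the segment.\<close>

definition glue_closed :: "('a \<Rightarrow> real) set \<Rightarrow> bool" where
  "glue_closed B \<longleftrightarrow> (\<forall>z D. D \<subseteq> carrier G \<longrightarrow> (\<forall>\<gamma> \<in> D. \<forall>\<delta> \<in> carrier G. \<not> \<gamma> \<lless> \<delta> \<longrightarrow> \<delta> \<in> D) \<longrightarrow>
     (\<forall>\<gamma> \<in> D. \<exists>x \<in> B. leag \<gamma> z x) \<longrightarrow> (\<forall>\<gamma>. \<gamma> \<notin> D \<longrightarrow> z \<gamma> = 0) \<longrightarrow> z \<in> B)"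

theorem fixed_point:
  assumes BH: "B \<subseteq> carrier H" and glue: "glue_closed B"
    and phi: "\<And>x. x \<in> B \<Longrightarrow> \<phi> x \<in> B"
    and contr: "\<And>x y \<gamma>. \<lbrakk>x \<in> B; y \<in> B; \<gamma> \<in> carrier G; ltag \<gamma> x y\<rbrakk> \<Longrightarrow> leag \<gamma> (\<phi> x) (\<phi> y)"
  shows "\<exists>z \<in> B. \<phi> z = z"
proof -
  \<comment> \<open>Two distinct series differ first at some exponent; any property \<open>P\<close>
    that is inherited downwards from a point of difference holds at this first one.\<close>
  have ne_min: "\<exists>\<delta> \<in> carrier G. x \<delta> \<noteq> y \<delta> \<and> ltag \<delta> x y \<and> (P \<delta>)"
    if "x \<in> carrier H" "y \<in> carrier H" "\<epsilon> \<in> carrier G" "x \<epsilon> \<noteq> y \<epsilon>" "P \<epsilon>"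
      and P: "\<And>\<delta>. \<lbrakk>\<delta> \<in> carrier G; \<delta> \<sqsubseteq> \<epsilon>; P \<epsilon>\<rbrakk> \<Longrightarrow> P \<delta>" for x y \<epsilon> P
  proof -
    have "wo (hsupp x \<union> hsupp y)" using that H_wo wo_union by blast
    moreover have "{\<delta>. x \<delta> \<noteq> y \<delta>} \<subseteq> hsupp x \<union> hsupp y" by auto
    moreover have "{\<delta>. x \<delta> \<noteq> y \<delta>} \<noteq> {}" using that by auto
    ultimately have "wo {\<delta>. x \<delta> \<noteq> y \<delta>}" "{\<delta>. x \<delta> \<noteq> y \<delta>} \<noteq> {}" using wo_subset by blast+
    then obtain d where d: "x d \<noteq> y d" "\<forall>\<delta> \<in> {\<delta>. x \<delta> \<noteq> y \<delta>}. d \<sqsubseteq> \<delta>" "d \<in> carrier G"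
      using wo_min[of "{\<delta>. x \<delta> \<noteq> y \<delta>}" "{\<delta>. x \<delta> \<noteq> y \<delta>}"] wo_sub[of "{\<delta>. x \<delta> \<noteq> y \<delta>}"] by auto
    have "ltag d x y"
      unfolding ltag_def using d not_le ll_imp_lt by blast
    then show ?thesis using d that P[of d] by blast
  qed
  define D where "D = {\<gamma> \<in> carrier G. \<exists>x \<in> B. leag \<gamma> (\<phi> x) x}"
  \<comment> \<open>At the first exponent where two approximate fixed points differ, the contraction
    property makes their images agree, but there the images equal the points themselves.\<close>
  have uniq: "leag \<gamma> x y"
    if xy: "x \<in> B" "y \<in> B" "leag \<gamma> (\<phi> x) x" "leag \<gamma> (\<phi> y) y" and g: "\<gamma> \<in> carrier G" for x y \<gamma>
  proof (rule ccontr)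
    assume "\<not> leag \<gamma> x y"
    then obtain e where e: "e \<in> carrier G" "\<not> \<gamma> \<lless> e" "x e \<noteq> y e" by (auto simp: leag_def)
    have "\<exists>\<delta> \<in> carrier G. x \<delta> \<noteq> y \<delta> \<and> ltag \<delta> x y \<and> \<not> \<gamma> \<lless> \<delta>"
    proof (rule ne_min)
      show "\<not> \<gamma> \<lless> \<delta>" if "\<delta> \<in> carrier G" "\<delta> \<sqsubseteq> e" for \<delta>
        using ll_le_trans[OF g that(1) e(1) _ that(2)] e(2) by blast
    qed (use xy e BH in auto)
    then obtain d where d: "d \<in> carrier G" "x d \<noteq> y d" "ltag d x y" "\<not> \<gamma> \<lless> d" by blast
    have "leag d (\<phi> x) (\<phi> y)" using contr xy d by blast
    then have "\<phi> x d = \<phi> y d" using d by (simp add: leag_def)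
    moreover have "\<phi> x d = x d" "\<phi> y d = y d" using xy d by (auto simp: leag_def)
    ultimately show False using d by simp
  qed
  define W where "W \<gamma> = (SOME x. x \<in> B \<and> leag \<gamma> (\<phi> x) x)" for \<gamma>
  have W: "W \<gamma> \<in> B" "leag \<gamma> (\<phi> (W \<gamma>)) (W \<gamma>)" "\<gamma> \<in> carrier G" if "\<gamma> \<in> D" for \<gamma>
  proof -
    have "W \<gamma> \<in> B \<and> leag \<gamma> (\<phi> (W \<gamma>)) (W \<gamma>)"
      using that unfolding W_def D_def mem_Collect_eq by (intro someI_ex[of "\<lambda>x. x \<in> B \<and> leag \<gamma> (\<phi> x) x"]) blast
    then show "W \<gamma> \<in> B" "leag \<gamma> (\<phi> (W \<gamma>)) (W \<gamma>)" "\<gamma> \<in> carrier G" using that by (auto simp: D_def)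
  qed
  have Ddown: "\<delta> \<in> D" if "\<gamma> \<in> D" "\<delta> \<in> carrier G" "\<not> \<gamma> \<lless> \<delta>" for \<gamma> \<delta>
    using that leag_mono[OF W(2)[OF that(1)] W(3)[OF that(1)] that(2,3)] W(1)[OF that(1)]
    unfolding D_def by blast
  define z where "z \<gamma> = (if \<gamma> \<in> D then W \<gamma> \<gamma> else 0)" for \<gamma>
  have zW: "leag \<gamma> z (W \<gamma>)" if g: "\<gamma> \<in> D" for \<gamma>
    unfolding leag_def
  proof (intro ballI impI)
    fix \<delta> assume d: "\<delta> \<in> carrier G" "\<not> \<gamma> \<lless> \<delta>"
    then have dD: "\<delta> \<in> D" using Ddown g by blast
    have "leag \<delta> (\<phi> (W \<gamma>)) (W \<gamma>)" using leag_mono W(2,3) g d by blast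
    then have "leag \<delta> (W \<delta>) (W \<gamma>)" using uniq[of "W \<delta>" "W \<gamma>" \<delta>] W[OF dD] W[OF g] by blast
    then have "W \<delta> \<delta> = W \<gamma> \<delta>" using d by (simp add: leag_def)
    then show "z \<delta> = W \<gamma> \<delta>" using dD by (simp add: z_def)
  qed
  have "D \<subseteq> carrier G" by (auto simp: D_def)
  moreover have "\<forall>\<gamma> \<in> D. \<forall>\<delta> \<in> carrier G. \<not> \<gamma> \<lless> \<delta> \<longrightarrow> \<delta> \<in> D" using Ddown by blast
  moreover have "\<forall>\<gamma> \<in> D. \<exists>x \<in> B. leag \<gamma> z x" using W zW by blast
  moreover have "\<forall>\<gamma>. \<gamma> \<notin> D \<longrightarrow> z \<gamma> = 0" by (simp add: z_def)
  ultimately have zB: "z \<in> B" using glue unfolding glue_closed_def by blast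
  have near: "leag \<gamma> (\<phi> z) z" if g: "\<gamma> \<in> D" for \<gamma>
  proof -
    have "leag \<gamma> (\<phi> z) (\<phi> (W \<gamma>))" using contr[OF zB W(1)[OF g] W(3)[OF g]] leag_ltag zW W g by blast
    then show ?thesis using leag_trans leag_sym zW W g by metis
  qed
  have "\<phi> z = z"
  proof (rule ccontr)
    assume "\<phi> z \<noteq> z"
    then obtain e where e: "\<phi> z e \<noteq> z e" by blast
    have c: "\<phi> z \<in> carrier H" "z \<in> carrier H" using zB phi BH by auto
    then have "e \<in> carrier G" using H_out e by metis
    then obtain d where d: "d \<in> carrier G" "\<phi> z d \<noteq> z d" "ltag d (\<phi> z) z"
      using ne_min[OF c, of e "\<lambda>_. True"] e by blast
    then have "leag d (\<phi> (\<phi> z)) (\<phi> z)" using contr zB phi by blast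
    then have "d \<in> D" using d phi[OF zB] unfolding D_def by blast
    then have "leag d (\<phi> z) z" by (rule near)
    then show False using d by (simp add: leag_def)
  qed
  then show ?thesis using zB by blast
qed

section \<open>The valuation ring and the maximal ideal of the valuation with values in G/C\<close>

definition OC :: "('a \<Rightarrow> real) set" where
  "OC = {x \<in> carrier H. \<forall>\<gamma>. x \<gamma> \<noteq> 0 \<longrightarrow> \<not> \<gamma> \<lless> \<one>}"

definition MC :: "('a \<Rightarrow> real) set" where
  "MC = {x \<in> carrier H. \<forall>\<gamma>. x \<gamma> \<noteq> 0 \<longrightarrow> \<one> \<lless> \<gamma>}"

text \<open>A factor from the maximal ideal raises the value strictly. Both the inversion of series
  and Hensel's lemma obtain their contractions from this.\<close>

lemma MC_contraction:
  assumes "u \<in> carrier H" "v \<in> carrier H" "x \<in> carrier H" "y \<in> carrier H" "m \<in> MC"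
    and eq: "u \<ominus>\<^bsub>H\<^esub> v = (x \<ominus>\<^bsub>H\<^esub> y) \<otimes>\<^bsub>H\<^esub> m" and lt: "ltag \<gamma> x y" and g: "\<gamma> \<in> carrier G"
  shows "leag \<gamma> u v"
  unfolding leag_def
proof (intro ballI impI, rule ccontr)
  fix \<delta> assume d: "\<delta> \<in> carrier G" "\<not> \<gamma> \<lless> \<delta>" "u \<delta> \<noteq> v \<delta>"
  have "((x \<ominus>\<^bsub>H\<^esub> y) \<otimes>\<^bsub>H\<^esub> m) \<delta> \<noteq> 0" using d(3) H_minus assms(1,2) by (simp add: eq[symmetric])
  then obtain \<alpha> \<beta> where ab: "(x \<ominus>\<^bsub>H\<^esub> y) \<alpha> \<noteq> 0" "m \<beta> \<noteq> 0" "\<delta> = \<alpha> \<otimes> \<beta>" by (rule hsupp_multE)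
  have c: "\<alpha> \<in> carrier G" "\<beta> \<in> carrier G" "\<one> \<lless> \<beta>"
    using ab assms H_out[of "x \<ominus>\<^bsub>H\<^esub> y" \<alpha>] H_out[of m \<beta>] by (auto simp: MC_def)
  have "x \<alpha> \<noteq> y \<alpha>" using ab assms by (simp add: H_minus)
  then have "\<not> \<alpha> \<lless> \<gamma>" using lt c by (auto simp: ltag_def)
  moreover have "\<alpha> \<lless> \<delta>" using ll_mult_iff[of \<one> \<beta> \<alpha>] c ab(3) by simp
  ultimately show False using not_ll_trans[OF c(1) g d(1)] d(2) by blast
qed

lemma not_ll_mult: "\<lbrakk>\<alpha> \<in> carrier G; \<beta> \<in> carrier G; \<not> \<alpha> \<lless> \<one>; \<not> \<beta> \<lless> \<one>\<rbrakk> \<Longrightarrow> \<not> \<alpha> \<otimes> \<beta> \<lless> \<one>"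
  using ll_mult_iff[of \<beta> \<one> \<alpha>] not_ll_trans[of "\<alpha> \<otimes> \<beta>" \<alpha> \<one>] by simp

lemma ll_mult_one: "\<lbrakk>\<alpha> \<in> carrier G; \<beta> \<in> carrier G; \<not> \<alpha> \<lless> \<one>; \<one> \<lless> \<beta>\<rbrakk> \<Longrightarrow> \<one> \<lless> \<alpha> \<otimes> \<beta>"
  using ll_mult_iff[of \<one> \<beta> \<alpha>] not_ll_trans[of \<alpha> \<one> "\<alpha> \<otimes> \<beta>"] by auto

lemma OC_sub: "x \<in> OC \<Longrightarrow> x \<in> carrier H" and MC_sub: "x \<in> MC \<Longrightarrow> x \<in> carrier H"
  by (auto simp: OC_def MC_def)

lemma MC_OC: "x \<in> MC \<Longrightarrow> x \<in> OC"
proof -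
  assume x: "x \<in> MC"
  have "\<not> \<gamma> \<lless> \<one>" if "x \<gamma> \<noteq> 0" for \<gamma>
  proof -
    have "\<one> \<lless> \<gamma>" "\<gamma> \<in> carrier G" using x that H_out[of x \<gamma>] by (auto simp: MC_def)
    then show ?thesis using ll_trans[of \<gamma> \<one> \<gamma>] by auto
  qed
  then show ?thesis using x by (simp add: OC_def MC_def)
qed

lemma OC_subring: "subring OC H"
proof (rule H.subringI)
  show "OC \<subseteq> carrier H" by (auto simp: OC_def)
  show "\<one>\<^bsub>H\<^esub> \<in> OC" by (simp add: OC_def) (simp add: H_simps hmon_def)
next
  fix x assume "x \<in> OC" then show "\<ominus>\<^bsub>H\<^esub> x \<in> OC" by (simp add: OC_def) (simp add: H_uminus)
next
  fix x y assume xy: "x \<in> OC" "y \<in> OC"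
  show "x \<otimes>\<^bsub>H\<^esub> y \<in> OC"
  proof -
    have "\<not> \<gamma> \<lless> \<one>" if "(x \<otimes>\<^bsub>H\<^esub> y) \<gamma> \<noteq> 0" for \<gamma>
      using that
    proof (rule hsupp_multE)
      fix \<alpha> \<beta> assume "x \<alpha> \<noteq> 0" "y \<beta> \<noteq> 0" "\<gamma> = \<alpha> \<otimes> \<beta>"
      then show ?thesis using xy not_ll_mult[of \<alpha> \<beta>] H_out[of x \<alpha>] H_out[of y \<beta>] by (auto simp: OC_def)
    qed
    then show ?thesis using xy by (simp add: OC_def)
  qed
  show "x \<oplus>\<^bsub>H\<^esub> y \<in> OC" using xy H_add_closed by (auto simp: OC_def H_simps(3)) (metis add_0)
qed

lemma MC_mult: "\<lbrakk>x \<in> OC; y \<in> MC\<rbrakk> \<Longrightarrow> x \<otimes>\<^bsub>H\<^esub> y \<in> MC"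
proof -
  assume xy: "x \<in> OC" "y \<in> MC"
  have "\<one> \<lless> \<gamma>" if "(x \<otimes>\<^bsub>H\<^esub> y) \<gamma> \<noteq> 0" for \<gamma>
    using that
  proof (rule hsupp_multE)
    fix \<alpha> \<beta> assume "x \<alpha> \<noteq> 0" "y \<beta> \<noteq> 0" "\<gamma> = \<alpha> \<otimes> \<beta>"
    then show ?thesis using xy ll_mult_one[of \<alpha> \<beta>] H_out[of x \<alpha>] H_out[of y \<beta>] by (auto simp: OC_def MC_def)
  qed
  then show ?thesis using xy by (simp add: OC_def MC_def)
qed

lemma MC_add: "\<lbrakk>x \<in> MC; y \<in> MC\<rbrakk> \<Longrightarrow> x \<oplus>\<^bsub>H\<^esub> y \<in> MC"
  using H_add_closed by (auto simp: MC_def H_simps(3)) (metis add_0)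

text \<open>Below a chosen point of a set \<open>Y\<close> in its support the glued series coincides
  with a single Hahn series, whose support supplies the least element of \<open>Y\<close>.\<close>

lemma glue_closed_carrier:
  assumes "D \<subseteq> carrier G" "\<And>\<gamma> \<delta>. \<lbrakk>\<gamma> \<in> D; \<delta> \<in> carrier G; \<not> \<gamma> \<lless> \<delta>\<rbrakk> \<Longrightarrow> \<delta> \<in> D"
    "\<And>\<gamma>. \<gamma> \<in> D \<Longrightarrow> \<exists>x \<in> carrier H. leag \<gamma> z x" "\<And>\<gamma>. \<gamma> \<notin> D \<Longrightarrow> z \<gamma> = 0"
  shows "z \<in> carrier H"
proof -
  have zD: "\<gamma> \<in> D" if "z \<gamma> \<noteq> 0" for \<gamma> using that assms(4) by blast
  have "\<exists>m \<in> Y. \<forall>y \<in> Y. m \<sqsubseteq> y" if Y: "Y \<subseteq> hsupp z" "Y \<noteq> {}" for Y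
  proof -
    obtain g where g: "g \<in> Y" using Y by blast
    then have gD: "g \<in> D" "g \<in> carrier G" using Y zD assms(1) by auto
    obtain x where x: "x \<in> carrier H" "leag g z x" using assms(3)[OF gD(1)] by blast
    have Yc: "y \<in> carrier G" if "y \<in> Y" for y using that Y zD assms(1) by auto
    let ?Z = "{y \<in> Y. y \<sqsubseteq> g}"
    have "y \<in> hsupp x" if y: "y \<in> ?Z" for y
    proof -
      have "\<not> g \<lless> y" using y Yc[of y] gD not_le ll_imp_lt by blast
      then have "z y = x y" using x Yc[of y] y by (simp add: leag_def)
      then show ?thesis using y Y by auto
    qed
    then have "?Z \<subseteq> hsupp x" by blast
    moreover have "?Z \<noteq> {}" using g gle_refl gD by auto
    ultimately obtain m where m: "m \<in> ?Z" "\<forall>y \<in> ?Z. m \<sqsubseteq> y" using wo_min[OF H_wo[OF x(1)]] by meson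
    have "m \<sqsubseteq> y" if "y \<in> Y" for y
    proof (cases "y \<sqsubseteq> g")
      case True then show ?thesis using m that by blast
    next
      case False
      then have "g \<sqsubseteq> y" using gle_total gD Yc that by blast
      then show ?thesis using m(1) gle_trans[of m g y] Yc gD that by blast
    qed
    then show ?thesis using m(1) by blast
  qed
  moreover have "hsupp z \<subseteq> carrier G" using zD assms(1) by blast
  ultimately show ?thesis by (simp add: H_simps wo_in_def)
qed

end

subsection \<open>Hahn series with coefficients in a residue field\<close>

text \<open>The part of \<open>x\<close> on the coset of \<gamma> by \<open>E\<close>, shifted back
  into \<open>E\<close> by the monomial with exponent inv \<gamma>.\<close>

definition (in ordered_abelian_group) sl :: "'a set \<Rightarrow> 'a \<Rightarrow> ('a \<Rightarrow> real) \<Rightarrow> ('a \<Rightarrow> real)" where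
  "sl E \<gamma> x = (\<lambda>\<delta>. if \<delta> \<in> E then x (\<gamma> \<otimes> \<delta>) else 0)"

context ordered_abelian_group
begin

lemma sl_closed:
  assumes x: "x \<in> carrier H" and g: "\<gamma> \<in> carrier G" and E: "E \<subseteq> carrier G"
  shows "sl E \<gamma> x \<in> carrier H"
proof -
  have "hsupp (sl E \<gamma> x) \<subseteq> hsupp (hmon 1 (inv \<gamma>) \<otimes>\<^bsub>H\<^esub> x)"
    using hmon_mult_left[OF x, of "inv \<gamma>" _ 1] g E by (auto simp: sl_def)
  moreover have "hmon 1 (inv \<gamma>) \<otimes>\<^bsub>H\<^esub> x \<in> carrier H" using x g by simp
  ultimately have "wo (hsupp (sl E \<gamma> x))" using wo_subset H_wo by blast
  then show ?thesis by (simp add: H_simps(1))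
qed

end

text \<open>The set \<open>L\<close> below is the field of Hahn series over \<open>D/C\<close> with coefficients in \<open>k\<close>: the slice
  of a series at \<open>\<gamma>\<close> is the coefficient of the coset of \<open>\<gamma>\<close>.\<close>

locale hahn_level = convex_subgroup G C for G :: "('a, 'b) ogroup_scheme" (structure) and C +
  fixes D :: "'a set" and k :: "('a \<Rightarrow> real) set"
  assumes D_subgroup: "subgroup D G" and CD: "C \<subseteq> D"
    and k_subring: "subring k (hahn_ring G)"
    and k_supp: "\<lbrakk>x \<in> k; x \<gamma> \<noteq> 0\<rbrakk> \<Longrightarrow> \<gamma> \<in> C"
    and k_inv: "\<lbrakk>x \<in> k; x \<noteq> \<zero>\<^bsub>hahn_ring G\<^esub>\<rbrakk> \<Longrightarrow> \<exists>y \<in> k. x \<otimes>\<^bsub>hahn_ring G\<^esub> y = \<one>\<^bsub>hahn_ring G\<^esub>"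
    and k_hmon: "\<gamma> \<in> C \<Longrightarrow> hmon r \<gamma> \<in> k"
begin

definition L :: "('a \<Rightarrow> real) set" where
  "L = {x \<in> carrier H. hsupp x \<subseteq> D \<and> (\<forall>\<gamma> \<in> D. sl C \<gamma> x \<in> k)}"

lemma D_sub: "\<gamma> \<in> D \<Longrightarrow> \<gamma> \<in> carrier G"
  and D_closed [simp]: "\<one> \<in> D" "\<lbrakk>\<gamma> \<in> D; \<delta> \<in> D\<rbrakk> \<Longrightarrow> \<gamma> \<otimes> \<delta> \<in> D" "\<gamma> \<in> D \<Longrightarrow> inv \<gamma> \<in> D"
  using D_subgroup subgroup.mem_carrier subgroup.one_closed subgroup.m_closed subgroup.m_inv_closed
  by fastforce+

lemma k_sub: "x \<in> k \<Longrightarrow> x \<in> carrier H" and k_zero: "(\<lambda>\<gamma>. 0) \<in> k"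
  and k_mult: "\<lbrakk>x \<in> k; y \<in> k\<rbrakk> \<Longrightarrow> x \<otimes>\<^bsub>H\<^esub> y \<in> k" and k_add: "\<lbrakk>x \<in> k; y \<in> k\<rbrakk> \<Longrightarrow> (\<lambda>\<gamma>. x \<gamma> + y \<gamma>) \<in> k"
  and k_uminus: "x \<in> k \<Longrightarrow> (\<lambda>\<gamma>. - x \<gamma>) \<in> k"
proof -
  note E = subringE[OF k_subring]
  show k: "x \<in> k \<Longrightarrow> x \<in> carrier H" "(\<lambda>\<gamma>. 0) \<in> k" using E(1,2) by (auto simp: H_simps(2))
  show "\<lbrakk>x \<in> k; y \<in> k\<rbrakk> \<Longrightarrow> x \<otimes>\<^bsub>H\<^esub> y \<in> k" by (rule E(6))
  show "\<lbrakk>x \<in> k; y \<in> k\<rbrakk> \<Longrightarrow> (\<lambda>\<gamma>. x \<gamma> + y \<gamma>) \<in> k" using E(7)[of x y] by (simp add: H_simps(3))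
  show "x \<in> k \<Longrightarrow> (\<lambda>\<gamma>. - x \<gamma>) \<in> k" using E(5)[of x] H_uminus[OF k(1)] by simp
qed

lemma k_sum: "\<lbrakk>finite S; \<And>\<alpha>. \<alpha> \<in> S \<Longrightarrow> f \<alpha> \<in> k\<rbrakk> \<Longrightarrow> (\<lambda>\<gamma>. \<Sum>\<alpha> \<in> S. f \<alpha> \<gamma>) \<in> k"
  by (induct S rule: finite_induct) (auto simp: k_zero k_add)

lemma L_sub: "x \<in> L \<Longrightarrow> x \<in> carrier H"
  and L_supp: "\<lbrakk>x \<in> L; x \<gamma> \<noteq> 0\<rbrakk> \<Longrightarrow> \<gamma> \<in> D"
  and L_sl: "\<lbrakk>x \<in> L; \<gamma> \<in> D\<rbrakk> \<Longrightarrow> sl C \<gamma> x \<in> k"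
  by (auto simp: L_def)

text \<open>The convolution formula over D/C: a coefficient of the product is a finite sum of
  products of coefficients. The index set takes one representative per coset, the least one in the
  support of \<open>x\<close>, and is finite by \<open>finite_coset_reps\<close>.\<close>

lemma sl_mult:
  assumes x: "x \<in> carrier H" and y: "y \<in> carrier H" and g: "\<gamma> \<in> carrier G"
  obtains S where "finite S" "S \<subseteq> hsupp x"
    "sl C \<gamma> (x \<otimes>\<^bsub>H\<^esub> y) = (\<lambda>\<delta>. \<Sum>\<alpha> \<in> S. (sl C \<alpha> x \<otimes>\<^bsub>H\<^esub> sl C (inv \<alpha> \<otimes> \<gamma>) y) \<delta>)"
proof -
  let ?V = "hsupp x" and ?Y = "hsupp y"
  define S where "S = {\<alpha> \<in> ?V. (\<forall>\<alpha>' \<in> ?V. inv \<alpha> \<otimes> \<alpha>' \<in> C \<longrightarrow> \<alpha> \<sqsubseteq> \<alpha>') \<and> (\<exists>\<beta> \<in> ?Y. inv \<gamma> \<otimes> (\<alpha> \<otimes> \<beta>) \<in> C)}"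
  have fin: "finite S" unfolding S_def by (rule finite_coset_reps[OF H_wo[OF x] H_wo[OF y] g])
  have Vc: "\<alpha> \<in> carrier G" if "x \<alpha> \<noteq> 0" for \<alpha> using that x H_out by blast
  have Yc: "\<beta> \<in> carrier G" if "y \<beta> \<noteq> 0" for \<beta> using that y H_out by blast
  define rep where "rep \<alpha> = (SOME m. m \<in> ?V \<and> inv \<alpha> \<otimes> m \<in> C \<and> (\<forall>m' \<in> ?V. inv \<alpha> \<otimes> m' \<in> C \<longrightarrow> m \<sqsubseteq> m'))" for \<alpha>
  have rep: "rep \<alpha> \<in> ?V" "inv \<alpha> \<otimes> rep \<alpha> \<in> C" "\<forall>m' \<in> ?V. inv \<alpha> \<otimes> m' \<in> C \<longrightarrow> rep \<alpha> \<sqsubseteq> m'" if a: "x \<alpha> \<noteq> 0" for \<alpha>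
  proof -
    have "{m \<in> ?V. inv \<alpha> \<otimes> m \<in> C} \<noteq> {}" using a Vc[OF a] by (auto intro!: exI[of _ \<alpha>])
    then have "\<exists>m. m \<in> ?V \<and> inv \<alpha> \<otimes> m \<in> C \<and> (\<forall>m' \<in> ?V. inv \<alpha> \<otimes> m' \<in> C \<longrightarrow> m \<sqsubseteq> m')"
      using wo_min[OF H_wo[OF x], of "{m \<in> ?V. inv \<alpha> \<otimes> m \<in> C}"] by blast
    then have "rep \<alpha> \<in> ?V \<and> inv \<alpha> \<otimes> rep \<alpha> \<in> C \<and> (\<forall>m' \<in> ?V. inv \<alpha> \<otimes> m' \<in> C \<longrightarrow> rep \<alpha> \<sqsubseteq> m')"
      unfolding rep_def by (rule someI_ex)
    then show "rep \<alpha> \<in> ?V" "inv \<alpha> \<otimes> rep \<alpha> \<in> C" "\<forall>m' \<in> ?V. inv \<alpha> \<otimes> m' \<in> C \<longrightarrow> rep \<alpha> \<sqsubseteq> m'" by blast+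
  qed
  have coset_trans: "inv \<alpha> \<otimes> \<epsilon> \<in> C" if "inv \<alpha> \<otimes> \<beta> \<in> C" "inv \<beta> \<otimes> \<epsilon> \<in> C" "\<alpha> \<in> carrier G" "\<beta> \<in> carrier G" "\<epsilon> \<in> carrier G" for \<alpha> \<beta> \<epsilon>
  proof -
    have "(inv \<alpha> \<otimes> \<beta>) \<otimes> (inv \<beta> \<otimes> \<epsilon>) = inv \<alpha> \<otimes> \<epsilon>" using that by (simp add: m_assoc)
    then show ?thesis using C_closed(2)[OF that(1,2)] by simp
  qed
  have coset_sym: "inv \<beta> \<otimes> \<alpha> \<in> C" if "inv \<alpha> \<otimes> \<beta> \<in> C" "\<alpha> \<in> carrier G" "\<beta> \<in> carrier G" for \<alpha> \<beta>
    using C_closed(3)[OF that(1)] that by (simp add: inv_mult_group m_comm)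
  have "sl C \<gamma> (x \<otimes>\<^bsub>H\<^esub> y) c = (\<Sum>\<alpha> \<in> S. (sl C \<alpha> x \<otimes>\<^bsub>H\<^esub> sl C (inv \<alpha> \<otimes> \<gamma>) y) c)" for c
  proof (cases "c \<in> C")
    case False
    have "(sl C \<alpha> x \<otimes>\<^bsub>H\<^esub> sl C (inv \<alpha> \<otimes> \<gamma>) y) c = 0" for \<alpha>
    proof (rule ccontr)
      assume "(sl C \<alpha> x \<otimes>\<^bsub>H\<^esub> sl C (inv \<alpha> \<otimes> \<gamma>) y) c \<noteq> 0"
      then obtain a b where "sl C \<alpha> x a \<noteq> 0" "sl C (inv \<alpha> \<otimes> \<gamma>) y b \<noteq> 0" "c = a \<otimes> b" by (rule hsupp_multE)
      then show False using False by (auto simp: sl_def split: if_splits)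
    qed
    then show ?thesis using False by (simp add: sl_def)
  next
    case True
    then have cc: "c \<in> carrier G" by (rule C_sub)
    let ?P = "\<lambda>\<alpha>. pairs (hsupp (sl C \<alpha> x)) (hsupp (sl C (inv \<alpha> \<otimes> \<gamma>) y)) c"
    have P: "?P \<alpha> = {(a, b). a \<in> C \<and> b \<in> C \<and> x (\<alpha> \<otimes> a) \<noteq> 0 \<and> y (inv \<alpha> \<otimes> \<gamma> \<otimes> b) \<noteq> 0 \<and> a \<otimes> b = c}" for \<alpha>
      by (auto simp: pairs_def sl_def split: if_splits)
    have "(\<Sum>\<alpha> \<in> S. (sl C \<alpha> x \<otimes>\<^bsub>H\<^esub> sl C (inv \<alpha> \<otimes> \<gamma>) y) c) =
      (\<Sum>\<alpha> \<in> S. \<Sum>q \<in> ?P \<alpha>. x (\<alpha> \<otimes> fst q) * y (inv \<alpha> \<otimes> \<gamma> \<otimes> snd q))"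
      unfolding H_mult by (intro sum.cong refl) (auto simp: pairs_def sl_def split: if_splits)
    also have "\<dots> = (\<Sum>(\<alpha>, q) \<in> (SIGMA \<alpha> : S. ?P \<alpha>). x (\<alpha> \<otimes> fst q) * y (inv \<alpha> \<otimes> \<gamma> \<otimes> snd q))"
    proof (rule sum.Sigma[OF fin], rule ballI)
      fix \<alpha> assume "\<alpha> \<in> S"
      then have "\<alpha> \<in> carrier G" using Vc by (auto simp: S_def)
      then have "wo (hsupp (sl C \<alpha> x))" "wo (hsupp (sl C (inv \<alpha> \<otimes> \<gamma>) y))"
        using sl_closed[OF x, of \<alpha> C] sl_closed[OF y, of "inv \<alpha> \<otimes> \<gamma>" C] g C_sub H_wo by auto
      then show "finite (?P \<alpha>)" by (rule finite_pairs')
    qed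
    also have "\<dots> = (\<Sum>(\<alpha>, \<beta>) \<in> pairs ?V ?Y (\<gamma> \<otimes> c). x \<alpha> * y \<beta>)"
    \<comment> \<open>A pair of exponents corresponds to the representative of the coset of its
      first component together with two displacements inside \<open>C\<close>; \<open>rep\<close>
      recovers the representative.\<close>
    proof (rule sum.reindex_bij_witness[of _ "\<lambda>(\<alpha>, \<beta>). (rep \<alpha>, (inv (rep \<alpha>) \<otimes> \<alpha>, inv \<gamma> \<otimes> (rep \<alpha> \<otimes> \<beta>)))"
          "\<lambda>(\<alpha>, q). (\<alpha> \<otimes> fst q, inv \<alpha> \<otimes> \<gamma> \<otimes> snd q)"])
      fix p assume "p \<in> (SIGMA \<alpha> : S. ?P \<alpha>)"
      then obtain \<alpha> a b where p: "p = (\<alpha>, (a, b))" and a: "\<alpha> \<in> S" "a \<in> C" "b \<in> C" "x (\<alpha> \<otimes> a) \<noteq> 0"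
          "y (inv \<alpha> \<otimes> \<gamma> \<otimes> b) \<noteq> 0" "a \<otimes> b = c" unfolding P by auto
      have c: "\<alpha> \<in> carrier G" "a \<in> carrier G" "b \<in> carrier G" "x \<alpha> \<noteq> 0" using a Vc C_sub by (auto simp: S_def)
      have reps: "rep (\<alpha> \<otimes> a) = \<alpha>"
      proof (rule gle_antisym)
        note r = rep[OF a(4)]
        have rc: "rep (\<alpha> \<otimes> a) \<in> carrier G" using r Vc by auto
        show "rep (\<alpha> \<otimes> a) \<in> carrier G" "\<alpha> \<in> carrier G" by fact+
        have aa: "inv (\<alpha> \<otimes> a) \<otimes> \<alpha> \<in> C" using a c by (simp add: inv_mult_group m_assoc)
        then show "rep (\<alpha> \<otimes> a) \<sqsubseteq> \<alpha>" using r(3) c by auto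
        have "inv \<alpha> \<otimes> rep (\<alpha> \<otimes> a) \<in> C"
          using coset_trans[of \<alpha> "\<alpha> \<otimes> a" "rep (\<alpha> \<otimes> a)"] a c r rc by auto
        then show "\<alpha> \<sqsubseteq> rep (\<alpha> \<otimes> a)" using a(1) r(1) by (auto simp: S_def)
      qed
      have e: "inv \<gamma> \<otimes> (\<alpha> \<otimes> (inv \<alpha> \<otimes> \<gamma> \<otimes> b)) = b" using c g by (simp add: m_assoc)
      show "(\<lambda>(\<alpha>, \<beta>). (rep \<alpha>, (inv (rep \<alpha>) \<otimes> \<alpha>, inv \<gamma> \<otimes> (rep \<alpha> \<otimes> \<beta>)))) ((\<lambda>(\<alpha>, q). (\<alpha> \<otimes> fst q, inv \<alpha> \<otimes> \<gamma> \<otimes> snd q)) p) = p"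
        using reps e c by (simp add: p)
      have "\<alpha> \<otimes> a \<otimes> (inv \<alpha> \<otimes> \<gamma> \<otimes> b) = \<gamma> \<otimes> (a \<otimes> b)"
      proof -
        have "\<alpha> \<otimes> a \<otimes> (inv \<alpha> \<otimes> \<gamma> \<otimes> b) = (\<alpha> \<otimes> inv \<alpha>) \<otimes> (\<gamma> \<otimes> (a \<otimes> b))"
          using c g inv_closed[OF c(1)] by (simp only: m_ac m_closed)
        then show ?thesis using c g by (simp add: r_inv)
      qed
      then show "(\<lambda>(\<alpha>, q). (\<alpha> \<otimes> fst q, inv \<alpha> \<otimes> \<gamma> \<otimes> snd q)) p \<in> pairs ?V ?Y (\<gamma> \<otimes> c)"
        using a by (simp add: p pairs_def)
      show "(case (\<lambda>(\<alpha>, q). (\<alpha> \<otimes> fst q, inv \<alpha> \<otimes> \<gamma> \<otimes> snd q)) p of (\<alpha>, \<beta>) \<Rightarrow> x \<alpha> * y \<beta>) =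
          (case p of (\<alpha>, q) \<Rightarrow> x (\<alpha> \<otimes> fst q) * y (inv \<alpha> \<otimes> \<gamma> \<otimes> snd q))" by (simp add: p)
    next
      fix p assume "p \<in> pairs ?V ?Y (\<gamma> \<otimes> c)"
      then obtain \<alpha> \<beta> where p: "p = (\<alpha>, \<beta>)" and a: "x \<alpha> \<noteq> 0" "y \<beta> \<noteq> 0" "\<alpha> \<otimes> \<beta> = \<gamma> \<otimes> c" by (auto simp: pairs_def)
      note r = rep[OF a(1)]
      have c: "\<alpha> \<in> carrier G" "\<beta> \<in> carrier G" "rep \<alpha> \<in> carrier G" using a r Vc Yc by auto
      have s1: "inv (rep \<alpha>) \<otimes> \<alpha> \<in> C" using coset_sym r c by blast
      have e1: "inv \<gamma> \<otimes> (rep \<alpha> \<otimes> \<beta>) = (inv \<alpha> \<otimes> rep \<alpha>) \<otimes> c"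
      proof -
        have "inv \<gamma> \<otimes> (rep \<alpha> \<otimes> \<beta>) = inv \<gamma> \<otimes> (rep \<alpha> \<otimes> (inv \<alpha> \<otimes> (\<alpha> \<otimes> \<beta>)))" using c by simp
        also have "\<dots> = (inv \<gamma> \<otimes> \<gamma>) \<otimes> ((inv \<alpha> \<otimes> rep \<alpha>) \<otimes> c)"
          unfolding a(3) using c g cc inv_closed by (simp only: m_ac m_closed)
        finally show ?thesis using c g cc by (simp add: l_inv)
      qed
      have s2: "inv \<gamma> \<otimes> (rep \<alpha> \<otimes> \<beta>) \<in> C" unfolding e1 using r(2) True by simp
      have e2: "inv (rep \<alpha>) \<otimes> \<gamma> \<otimes> (inv \<gamma> \<otimes> (rep \<alpha> \<otimes> \<beta>)) = \<beta>" using c g by (simp add: m_assoc)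
      have e3: "rep \<alpha> \<otimes> (inv (rep \<alpha>) \<otimes> \<alpha>) = \<alpha>" using c by simp
      show "(\<lambda>(\<alpha>, q). (\<alpha> \<otimes> fst q, inv \<alpha> \<otimes> \<gamma> \<otimes> snd q)) ((\<lambda>(\<alpha>, \<beta>). (rep \<alpha>, (inv (rep \<alpha>) \<otimes> \<alpha>, inv \<gamma> \<otimes> (rep \<alpha> \<otimes> \<beta>)))) p) = p"
        by (simp add: p e2 e3)
      have "rep \<alpha> \<in> S"
      proof -
        have "rep \<alpha> \<sqsubseteq> m" if "m \<in> ?V" "inv (rep \<alpha>) \<otimes> m \<in> C" for m
          using r(3) that coset_trans[of \<alpha> "rep \<alpha>" m] r(2) c Vc by auto
        then show ?thesis using r s2 a(2) unfolding S_def by blast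
      qed
      moreover have "(inv (rep \<alpha>) \<otimes> \<alpha>) \<otimes> (inv \<gamma> \<otimes> (rep \<alpha> \<otimes> \<beta>)) = c"
      proof -
        have "(inv (rep \<alpha>) \<otimes> \<alpha>) \<otimes> ((inv \<alpha> \<otimes> rep \<alpha>) \<otimes> c) = c" using c cc by (simp add: m_assoc)
        then show ?thesis unfolding e1 .
      qed
      ultimately show "(\<lambda>(\<alpha>, \<beta>). (rep \<alpha>, (inv (rep \<alpha>) \<otimes> \<alpha>, inv \<gamma> \<otimes> (rep \<alpha> \<otimes> \<beta>)))) p \<in> (SIGMA \<alpha> : S. ?P \<alpha>)"
        unfolding P using s1 s2 a e2 e3 by (simp add: p)
    qed
    also have "\<dots> = sl C \<gamma> (x \<otimes>\<^bsub>H\<^esub> y) c" using True by (simp add: sl_def H_mult)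
    finally show ?thesis by simp
  qed
  then show ?thesis using that[OF fin] by (auto simp: S_def)
qed

lemma hmon_L: assumes d: "\<delta> \<in> D" shows "hmon r \<delta> \<in> L"
proof -
  have "sl C \<gamma> (hmon r \<delta>) = (if inv \<gamma> \<otimes> \<delta> \<in> C then hmon r (inv \<gamma> \<otimes> \<delta>) else (\<lambda>\<gamma>. 0))" if "\<gamma> \<in> D" for \<gamma>
  proof -
    have "\<gamma> \<otimes> \<epsilon> = \<delta> \<longleftrightarrow> \<epsilon> = inv \<gamma> \<otimes> \<delta>" if "\<epsilon> \<in> C" for \<epsilon>
      using C_sub[OF that] D_sub[OF d] D_sub[OF \<open>\<gamma> \<in> D\<close>] by auto
    then show ?thesis by (auto simp: sl_def hmon_def)
  qed
  then have "sl C \<gamma> (hmon r \<delta>) \<in> k" if "\<gamma> \<in> D" for \<gamma>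
    using that k_hmon k_zero by simp
  moreover have "hsupp (hmon r \<delta>) \<subseteq> D" using d by (auto simp: hmon_def)
  ultimately show ?thesis using hmon_closed[OF D_sub[OF d]] unfolding L_def by blast
qed

lemma L_subring: "subring L H"
proof (rule H.subringI)
  show "L \<subseteq> carrier H" by (auto simp: L_def)
  show "\<one>\<^bsub>H\<^esub> \<in> L" using hmon_L[of \<one> 1] by (simp add: H_simps(4))
next
  fix x assume x: "x \<in> L"
  have "sl C \<gamma> (\<lambda>\<delta>. - x \<delta>) = (\<lambda>\<delta>. - sl C \<gamma> x \<delta>)" for \<gamma> by (auto simp: sl_def)
  then show "\<ominus>\<^bsub>H\<^esub> x \<in> L" using x H.a_inv_closed[of x] k_uminus by (auto simp: L_def H_uminus)
next
  fix x y assume xy: "x \<in> L" "y \<in> L"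
  show "x \<otimes>\<^bsub>H\<^esub> y \<in> L"
  proof -
    have "sl C \<gamma> (x \<otimes>\<^bsub>H\<^esub> y) \<in> k" if g: "\<gamma> \<in> D" for \<gamma>
    proof -
      obtain S where S: "finite S" "S \<subseteq> hsupp x"
        "sl C \<gamma> (x \<otimes>\<^bsub>H\<^esub> y) = (\<lambda>\<delta>. \<Sum>\<alpha> \<in> S. (sl C \<alpha> x \<otimes>\<^bsub>H\<^esub> sl C (inv \<alpha> \<otimes> \<gamma>) y) \<delta>)"
        using sl_mult[OF L_sub[OF xy(1)] L_sub[OF xy(2)] D_sub[OF g]] by blast
      show ?thesis unfolding S(3)
        by (rule k_sum[OF S(1)]) (use S(2) xy L_supp L_sl g k_mult in \<open>auto intro!: k_mult\<close>)
    qed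
    moreover have "hsupp (x \<otimes>\<^bsub>H\<^esub> y) \<subseteq> D"
      using L_supp[OF xy(1)] L_supp[OF xy(2)] D_closed(2) by (auto elim!: hsupp_multE)
    moreover have "x \<otimes>\<^bsub>H\<^esub> y \<in> carrier H" using H_mult_closed[OF L_sub[OF xy(1)] L_sub[OF xy(2)]] .
    ultimately show ?thesis unfolding L_def by blast
  qed
  have "sl C \<gamma> (\<lambda>\<delta>. x \<delta> + y \<delta>) = (\<lambda>\<delta>. sl C \<gamma> x \<delta> + sl C \<gamma> y \<delta>)" for \<gamma> by (auto simp: sl_def)
  then show "x \<oplus>\<^bsub>H\<^esub> y \<in> L"
  proof -
    have "\<gamma> \<in> D" if "x \<gamma> + y \<gamma> \<noteq> 0" for \<gamma>
      using that L_supp[OF xy(1), of \<gamma>] L_supp[OF xy(2), of \<gamma>] by (cases "x \<gamma> = 0") auto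
    moreover have "sl C \<gamma> (\<lambda>\<delta>. x \<delta> + y \<delta>) \<in> k" if "\<gamma> \<in> D" for \<gamma>
      using k_add[OF L_sl[OF xy(1) that] L_sl[OF xy(2) that]]
        \<open>\<And>\<gamma>. sl C \<gamma> (\<lambda>\<delta>. x \<delta> + y \<delta>) = (\<lambda>\<delta>. sl C \<gamma> x \<delta> + sl C \<gamma> y \<delta>)\<close> by simp
    moreover have "(\<lambda>\<delta>. x \<delta> + y \<delta>) \<in> carrier H"
      using H_add_closed[OF L_sub[OF xy(1)] L_sub[OF xy(2)]] by (simp add: H_simps(3))
    ultimately show ?thesis by (auto simp: L_def H_simps(3))
  qed
qed

end

context hahn_level
begin

lemma k_L: "x \<in> k \<Longrightarrow> x \<in> L"
proof -
  assume x: "x \<in> k"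
  have "sl C \<gamma> x \<in> k" if g: "\<gamma> \<in> D" for \<gamma>
  proof (cases "\<gamma> \<in> C")
    case True
    have "sl C \<gamma> x = hmon 1 (inv \<gamma>) \<otimes>\<^bsub>H\<^esub> x"
    proof
      fix \<delta> show "sl C \<gamma> x \<delta> = (hmon 1 (inv \<gamma>) \<otimes>\<^bsub>H\<^esub> x) \<delta>"
      proof (cases "\<delta> \<in> C")
        case True
        then show ?thesis
          using hmon_mult_left[OF k_sub[OF x], of "inv \<gamma>" \<delta> 1] C_sub D_sub[OF g] by (simp add: sl_def)
      next
        case False
        then have "(hmon 1 (inv \<gamma>) \<otimes>\<^bsub>H\<^esub> x) \<delta> = 0"
          using k_supp[OF k_mult[OF k_hmon x], of "inv \<gamma>" 1 \<delta>] C_closed(3)[OF \<open>\<gamma> \<in> C\<close>] by blast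
        then show ?thesis using False by (simp add: sl_def)
      qed
    qed
    then show ?thesis using k_mult[OF k_hmon x] True by simp
  next
    case False
    have "x (\<gamma> \<otimes> \<delta>) = 0" if d: "\<delta> \<in> C" for \<delta>
    proof (rule ccontr)
      assume "x (\<gamma> \<otimes> \<delta>) \<noteq> 0"
      then have "(\<gamma> \<otimes> \<delta>) \<otimes> inv \<delta> \<in> C" using k_supp[OF x] d by simp
      then show False using False d C_sub[OF d] D_sub[OF g] by (simp add: m_assoc)
    qed
    then have "sl C \<gamma> x = (\<lambda>\<gamma>. 0)" by (auto simp: sl_def)
    then show ?thesis using k_zero by simp
  qed
  then show "x \<in> L" using x k_sub k_supp CD by (auto simp: L_def)
qed

text \<open>Agreement of series is measured by whole cosets of \<open>C\<close>, so every slice of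
  the glued series is a slice of one of the approximations or zero. The set \<open>S\<close> is
  everything when series are inverted, and the exponents above \<open>C\<close> for Hensel's
  lemma.\<close>

lemma L_glue: "glue_closed {x \<in> L. hsupp x \<subseteq> S}"
  unfolding glue_closed_def
proof (intro allI impI)
  fix z E assume E: "E \<subseteq> carrier G" "\<forall>\<gamma> \<in> E. \<forall>\<delta> \<in> carrier G. \<not> \<gamma> \<lless> \<delta> \<longrightarrow> \<delta> \<in> E"
    and z: "\<forall>\<gamma> \<in> E. \<exists>x \<in> {x \<in> L. hsupp x \<subseteq> S}. leag \<gamma> z x" "\<forall>\<gamma>. \<gamma> \<notin> E \<longrightarrow> z \<gamma> = 0"
  have zH: "z \<in> carrier H"
    using E z L_sub by (intro glue_closed_carrier[of E]) blast+
  have zx: "\<exists>x \<in> L. hsupp x \<subseteq> S \<and> leag \<gamma> z x" if "\<gamma> \<in> E" for \<gamma> using z(1) that by blast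
  have supp: "\<gamma> \<in> S \<and> \<gamma> \<in> D" if "z \<gamma> \<noteq> 0" for \<gamma>
  proof -
    have g: "\<gamma> \<in> E" using that z(2) by blast
    then obtain x where x: "x \<in> L" "hsupp x \<subseteq> S" "leag \<gamma> z x" using zx by blast
    then have "x \<gamma> = z \<gamma>" using g E(1) by (auto simp: leag_def)
    then show ?thesis using that x L_supp[OF x(1), of \<gamma>] by auto
  qed
  have "sl C \<gamma> z \<in> k" if g: "\<gamma> \<in> D" for \<gamma>
  proof -
    have nl: "\<not> \<gamma> \<lless> \<gamma> \<otimes> \<delta>" "\<not> \<gamma> \<otimes> \<delta> \<lless> \<gamma>" "\<gamma> \<otimes> \<delta> \<in> carrier G" if "\<delta> \<in> C" for \<delta>
      using same_coset[of \<gamma> "\<gamma> \<otimes> \<delta>"] that C_sub[OF that] D_sub[OF g] by auto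
    show ?thesis
    proof (cases "\<gamma> \<in> E")
      case True
      then obtain x where x: "x \<in> L" "leag \<gamma> z x" using zx by blast
      then have "sl C \<gamma> z = sl C \<gamma> x" using nl by (auto simp: sl_def leag_def)
      then show ?thesis using L_sl[OF x(1) g] by simp
    next
      case False
      then have "z (\<gamma> \<otimes> \<delta>) = 0" if "\<delta> \<in> C" for \<delta>
        using nl[OF that] E(2) z(2) D_sub[OF g] by metis
      then have "sl C \<gamma> z = (\<lambda>\<gamma>. 0)" by (auto simp: sl_def)
      then show ?thesis using k_zero by simp
    qed
  qed
  then show "z \<in> {x \<in> L. hsupp x \<subseteq> S}" using zH supp by (auto simp: L_def)
qed

lemma k_OC: "x \<in> k \<Longrightarrow> x \<in> OC"
proof -
  assume x: "x \<in> k"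
  have "\<not> \<gamma> \<lless> \<one>" if "\<gamma> \<in> C" for \<gamma>
    using that C_sub[OF that] by (simp add: ll_def)
  then show ?thesis using x k_sub k_supp by (auto simp: OC_def)
qed

text \<open>Division by the leading monomial and then by the constant slice turns \<open>x\<close>
  into 1 - m with \<open>m\<close> in the maximal ideal. The geometric series inverting 1 - m is
  obtained as the fixed point of z \<mapsto> 1 + m z.\<close>

lemma L_inverse:
  assumes x: "x \<in> L" "x \<noteq> \<zero>\<^bsub>H\<^esub>"
  shows "\<exists>y \<in> L. x \<otimes>\<^bsub>H\<^esub> y = \<one>\<^bsub>H\<^esub>"
proof -
  note LE = subringE[OF L_subring]
  note xH = L_sub[OF x(1)]
  note vx = vmin[OF xH x(2)]
  have gD: "vmin x \<in> D" using L_supp x(1) vx(1) by blast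
  define t where "t = hmon 1 (inv (vmin x))"
  have tL: "t \<in> L" using gD by (simp add: t_def hmon_L)
  define x' where "x' = t \<otimes>\<^bsub>H\<^esub> x"
  have x'L: "x' \<in> L" using LE(6) tL x(1) by (simp add: x'_def)
  have x'v: "x' \<delta> = x (vmin x \<otimes> \<delta>)" if "\<delta> \<in> carrier G" for \<delta>
    using hmon_mult_left[OF xH, of "inv (vmin x)" \<delta> 1] that vx(3) by (simp add: x'_def t_def)
  have x'ge: "\<one> \<sqsubseteq> \<delta>" if "x' \<delta> \<noteq> 0" for \<delta>
  proof -
    have d: "\<delta> \<in> carrier G" using that L_sub[OF x'L] H_out by blast
    then have "vmin x \<sqsubseteq> vmin x \<otimes> \<delta>" using vx(2) that x'v by simp
    then show ?thesis using mult_le_iff[of \<one> \<delta> "vmin x"] d vx(3) by simp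
  qed
  \<comment> \<open>The constant slice of the rescaled series is nonzero because its leading
    exponent is now neutral, so it is invertible in \<open>k\<close>.\<close>
  define s where "s = sl C \<one> x'"
  have s: "s \<in> k" using L_sl[OF x'L, of \<one>] by (simp add: s_def)
  have "s \<one> \<noteq> 0" using x'v[of \<one>] vx by (simp add: s_def sl_def)
  then have "s \<noteq> \<zero>\<^bsub>H\<^esub>" by (auto simp: H_simps)
  then obtain s' where s': "s' \<in> k" "s \<otimes>\<^bsub>H\<^esub> s' = \<one>\<^bsub>H\<^esub>" using k_inv s by blast
  have c: "s \<in> carrier H" "s' \<in> carrier H" "x' \<in> carrier H" "t \<in> carrier H"
    using s s' k_sub L_sub x'L tL by auto
  define m where "m = \<one>\<^bsub>H\<^esub> \<ominus>\<^bsub>H\<^esub> s' \<otimes>\<^bsub>H\<^esub> x'"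
  have "m = s' \<otimes>\<^bsub>H\<^esub> (s \<ominus>\<^bsub>H\<^esub> x')"
  proof -
    have "s' \<otimes>\<^bsub>H\<^esub> (s \<ominus>\<^bsub>H\<^esub> x') = s \<otimes>\<^bsub>H\<^esub> s' \<ominus>\<^bsub>H\<^esub> s' \<otimes>\<^bsub>H\<^esub> x'" using c by algebra
    then show ?thesis by (simp add: m_def s'(2))
  qed
  moreover have "s \<ominus>\<^bsub>H\<^esub> x' \<in> MC"
  proof -
    have "\<one> \<lless> \<delta>" if "s \<delta> - x' \<delta> \<noteq> 0" for \<delta>
    proof -
      have "s \<delta> \<noteq> 0 \<or> x' \<delta> \<noteq> 0" using that by auto
      then have d: "\<delta> \<in> carrier G" using H_out c by blast
      have nC: "\<delta> \<notin> C"
      proof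
        assume "\<delta> \<in> C" then show False using that d by (simp add: s_def sl_def)
      qed
      then have "\<one> \<sqsubseteq> \<delta>" using that x'ge by (simp add: s_def sl_def)
      then show ?thesis using nC d by (auto simp: ll_def gless_def)
    qed
    then show ?thesis using c H_minus[OF c(1,3)] H.minus_closed[OF c(1,3)] by (simp add: MC_def)
  qed
  ultimately have mMC: "m \<in> MC" using MC_mult[OF k_OC[OF s'(1)]] by simp
  have mL: "m \<in> L"
    using LE(3,5,6,7) k_L[OF s'(1)] x'L by (simp add: m_def a_minus_def)
  have mH: "m \<in> carrier H" by (rule L_sub[OF mL])
  have "\<exists>z \<in> {x \<in> L. hsupp x \<subseteq> UNIV}. \<one>\<^bsub>H\<^esub> \<oplus>\<^bsub>H\<^esub> m \<otimes>\<^bsub>H\<^esub> z = z"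
  proof (rule fixed_point[OF _ L_glue])
    show "{x \<in> L. hsupp x \<subseteq> UNIV} \<subseteq> carrier H" using L_sub by blast
    show "\<And>z. z \<in> {x \<in> L. hsupp x \<subseteq> UNIV} \<Longrightarrow> \<one>\<^bsub>H\<^esub> \<oplus>\<^bsub>H\<^esub> m \<otimes>\<^bsub>H\<^esub> z \<in> {x \<in> L. hsupp x \<subseteq> UNIV}"
      using LE(3,6,7) mL by simp
    fix u v \<gamma> assume uv: "u \<in> {x \<in> L. hsupp x \<subseteq> UNIV}" "v \<in> {x \<in> L. hsupp x \<subseteq> UNIV}" "\<gamma> \<in> carrier G" "ltag \<gamma> u v"
    then have c': "u \<in> carrier H" "v \<in> carrier H" using L_sub by auto
    have "(\<one>\<^bsub>H\<^esub> \<oplus>\<^bsub>H\<^esub> m \<otimes>\<^bsub>H\<^esub> u) \<ominus>\<^bsub>H\<^esub> (\<one>\<^bsub>H\<^esub> \<oplus>\<^bsub>H\<^esub> m \<otimes>\<^bsub>H\<^esub> v) = (u \<ominus>\<^bsub>H\<^esub> v) \<otimes>\<^bsub>H\<^esub> m"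
      using c' mH by algebra
    then show "leag \<gamma> (\<one>\<^bsub>H\<^esub> \<oplus>\<^bsub>H\<^esub> m \<otimes>\<^bsub>H\<^esub> u) (\<one>\<^bsub>H\<^esub> \<oplus>\<^bsub>H\<^esub> m \<otimes>\<^bsub>H\<^esub> v)"
      using MC_contraction[OF _ _ c' mMC _ uv(4,3)] c' mH by simp
  qed
  then obtain z where z: "z \<in> L" "\<one>\<^bsub>H\<^esub> \<oplus>\<^bsub>H\<^esub> m \<otimes>\<^bsub>H\<^esub> z = z" by blast
  have zH: "z \<in> carrier H" by (rule L_sub[OF z(1)])
  have "x \<otimes>\<^bsub>H\<^esub> (t \<otimes>\<^bsub>H\<^esub> (s' \<otimes>\<^bsub>H\<^esub> z)) = (s' \<otimes>\<^bsub>H\<^esub> x') \<otimes>\<^bsub>H\<^esub> z"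
    unfolding x'_def using xH c zH by algebra
  also have "\<dots> = (\<one>\<^bsub>H\<^esub> \<ominus>\<^bsub>H\<^esub> m) \<otimes>\<^bsub>H\<^esub> z"
  proof -
    have "\<one>\<^bsub>H\<^esub> \<ominus>\<^bsub>H\<^esub> (\<one>\<^bsub>H\<^esub> \<ominus>\<^bsub>H\<^esub> s' \<otimes>\<^bsub>H\<^esub> x') = s' \<otimes>\<^bsub>H\<^esub> x'" using c by algebra
    then show ?thesis by (simp add: m_def)
  qed
  also have "\<dots> = (\<one>\<^bsub>H\<^esub> \<oplus>\<^bsub>H\<^esub> m \<otimes>\<^bsub>H\<^esub> z) \<ominus>\<^bsub>H\<^esub> m \<otimes>\<^bsub>H\<^esub> z"
    unfolding z(2) using mH zH by algebra
  also have "\<dots> = \<one>\<^bsub>H\<^esub>" using mH zH by algebra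
  finally show ?thesis using LE(6) tL k_L[OF s'(1)] z(1) by blast
qed

end

text \<open>Trivial \<open>C\<close> and real constants turn the relative theory into that of
  ordinary real Hahn series over \<open>D\<close>. \<open>H_field\<close> uses it with the whole
  group, \<open>root_one_plus\<close> with a cyclic one.\<close>

lemma (in ordered_abelian_group) hahn_level_trivial:
  assumes D: "subgroup D G"
  shows "hahn_level G {\<one>} D {hmon r \<one> | r. True}"
proof -
  interpret convex_subgroup G "{\<one>}" by (rule trivial_convex)
  let ?k = "{hmon r \<one> | r. True}"
  have sr: "subring ?k H"
  proof (rule H.subringI)
    show "?k \<subseteq> carrier H" by auto
    show "\<one>\<^bsub>H\<^esub> \<in> ?k" by (auto simp: H_simps(4))
  next
    fix x assume "x \<in> ?k"
    then obtain r where "x = hmon r \<one>" by blast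
    then have "\<ominus>\<^bsub>H\<^esub> x = hmon (- r) \<one>" by (simp add: H_uminus) (auto simp: hmon_def)
    then show "\<ominus>\<^bsub>H\<^esub> x \<in> ?k" by blast
  next
    fix x y assume "x \<in> ?k" "y \<in> ?k"
    then obtain r s where xy: "x = hmon r \<one>" "y = hmon s \<one>" by blast
    then have "x \<oplus>\<^bsub>H\<^esub> y = hmon (r + s) \<one>" by (auto simp: H_simps(3) hmon_def)
    then show "x \<oplus>\<^bsub>H\<^esub> y \<in> ?k" by blast
    have "x \<otimes>\<^bsub>H\<^esub> y = hmon (r * s) \<one>" using xy hmon_mult_hmon[of \<one> \<one> r s] by simp
    then show "x \<otimes>\<^bsub>H\<^esub> y \<in> ?k" by blast
  qed
  show ?thesis
  proof (intro hahn_level.intro convex_subgroup_axioms hahn_level_axioms.intro D sr)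
    show "{\<one>} \<subseteq> D" using subgroup.one_closed[OF D] by simp
    fix x assume "x \<in> ?k" "x \<noteq> \<zero>\<^bsub>H\<^esub>"
    then obtain r where r: "x = hmon r \<one>" by blast
    have "r \<noteq> 0" using \<open>x \<noteq> \<zero>\<^bsub>H\<^esub>\<close> r by (auto simp: H_simps(2) hmon_def)
    then have "x \<otimes>\<^bsub>H\<^esub> hmon (1 / r) \<one> = \<one>\<^bsub>H\<^esub>"
      using r hmon_mult_hmon[of \<one> \<one> r "1 / r"] by (simp add: H_simps(4))
    then show "\<exists>y \<in> ?k. x \<otimes>\<^bsub>H\<^esub> y = \<one>\<^bsub>H\<^esub>" by blast
  qed (auto simp: hmon_def split: if_splits)
qed

text \<open>Slices at single exponents are real constants, so every Hahn series belongs to the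
  trivial level and is inverted there.\<close>

lemma (in ordered_abelian_group) H_field: "field H"
proof (rule H.cring_fieldI2)
  interpret T: hahn_level G "{\<one>}" "carrier G" "{hmon r \<one> | r. True}"
    by (rule hahn_level_trivial[OF subgroup_self])
  show "\<zero>\<^bsub>H\<^esub> \<noteq> \<one>\<^bsub>H\<^esub>" by (auto simp: H_simps hmon_def fun_eq_iff)
  fix x assume x: "x \<in> carrier H" "x \<noteq> \<zero>\<^bsub>H\<^esub>"
  have "sl {\<one>} \<gamma> x = hmon (x \<gamma>) \<one>" if "\<gamma> \<in> carrier G" for \<gamma>
    using that by (auto simp: sl_def hmon_def)
  then have "x \<in> T.L" using x(1) H_out[OF x(1)] unfolding T.L_def by blast
  then show "\<exists>y \<in> carrier H. x \<otimes>\<^bsub>H\<^esub> y = \<one>\<^bsub>H\<^esub>" using T.L_inverse x(2) T.L_sub by blast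
qed

sublocale ordered_abelian_group \<subseteq> H: field "hahn_ring G"
  by (rule H_field)

context ordered_abelian_group
begin

lemma H_inv: assumes "x \<in> carrier H" "x \<noteq> \<zero>\<^bsub>H\<^esub>"
  shows "inv\<^bsub>H\<^esub> x \<in> carrier H" "inv\<^bsub>H\<^esub> x \<noteq> \<zero>\<^bsub>H\<^esub>" "x \<otimes>\<^bsub>H\<^esub> inv\<^bsub>H\<^esub> x = \<one>\<^bsub>H\<^esub>" "inv\<^bsub>H\<^esub> (inv\<^bsub>H\<^esub> x) = x"
    "vmin (inv\<^bsub>H\<^esub> x) = inv (vmin x)"
proof -
  have "x \<in> Units H" using H.field_Units assms by blast
  then show i: "inv\<^bsub>H\<^esub> x \<in> carrier H" "x \<otimes>\<^bsub>H\<^esub> inv\<^bsub>H\<^esub> x = \<one>\<^bsub>H\<^esub>" "inv\<^bsub>H\<^esub> (inv\<^bsub>H\<^esub> x) = x" by auto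
  show nz: "inv\<^bsub>H\<^esub> x \<noteq> \<zero>\<^bsub>H\<^esub>"
    using i assms H.r_null[OF assms(1)] H.one_not_zero by metis
  have "vmin x \<otimes> vmin (inv\<^bsub>H\<^esub> x) = vmin \<one>\<^bsub>H\<^esub>"
    using H_mult_lead(3)[OF assms i(1) nz] i(2) by simp
  also have "vmin \<one>\<^bsub>H\<^esub> = \<one>"
    by (rule vmin_eqI[OF H.one_closed]) (auto simp: H_simps(4) hmon_def gle_refl split: if_splits)
  finally show "vmin (inv\<^bsub>H\<^esub> x) = inv (vmin x)"
    using vmin(3) assms i(1) nz by (metis inv_equality m_comm)
qed

end

sublocale convex_subgroup \<subseteq> V: valuation_subring "hahn_ring G" OC
proof (intro valuation_subring.intro valuation_subring_axioms.intro H_field OC_subring)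
  fix x assume x: "x \<in> carrier H" "x \<noteq> \<zero>\<^bsub>H\<^esub>"
  show "x \<in> OC \<or> inv\<^bsub>H\<^esub> x \<in> OC"
  proof (cases "vmin x \<lless> \<one>")
    case False
    have "\<not> \<gamma> \<lless> \<one>" if "x \<gamma> \<noteq> 0" for \<gamma>
    proof
      assume "\<gamma> \<lless> \<one>"
      then have "vmin x \<lless> \<one>"
        using le_ll_trans[of "vmin x" \<gamma> \<one>] vmin[OF x] that H_out[OF x(1)] by blast
      then show False using False by simp
    qed
    then show ?thesis using x(1) by (simp add: OC_def)
  next
    case True
    note i = H_inv[OF x]
    have "\<one> \<lless> inv (vmin x)"
      using ll_mult_iff[of "vmin x" \<one> "inv (vmin x)"] True vmin(3)[OF x] by simp
    then have "\<one> \<lless> \<gamma>" if "(inv\<^bsub>H\<^esub> x) \<gamma> \<noteq> 0" for \<gamma>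
      using ll_le_trans[of \<one> "inv (vmin x)" \<gamma>] vmin[OF i(1,2), unfolded i(5)] that H_out[OF i(1)] by blast
    then have "inv\<^bsub>H\<^esub> x \<in> MC" using i(1) by (simp add: MC_def)
    then show ?thesis using MC_OC by blast
  qed
qed

context convex_subgroup
begin

lemma inv_MC: assumes x: "x \<in> carrier H" "x \<notin> OC" shows "inv\<^bsub>H\<^esub> x \<in> MC"
proof -
  have nz: "x \<noteq> \<zero>\<^bsub>H\<^esub>" using x(2) by auto
  obtain \<gamma> where g: "x \<gamma> \<noteq> 0" "\<gamma> \<lless> \<one>" using x by (auto simp: OC_def)
  then have v: "vmin x \<lless> \<one>"
    using le_ll_trans[of "vmin x" \<gamma> \<one>] vmin[OF x(1) nz] H_out[OF x(1)] by blast
  note i = H_inv[OF x(1) nz]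
  have "\<one> \<lless> inv (vmin x)"
    using ll_mult_iff[of "vmin x" \<one> "inv (vmin x)"] v vmin(3)[OF x(1) nz] by simp
  then have "\<one> \<lless> \<gamma>" if "(inv\<^bsub>H\<^esub> x) \<gamma> \<noteq> 0" for \<gamma>
    using ll_le_trans[of \<one> "inv (vmin x)" \<gamma>] vmin[OF i(1,2), unfolded i(5)] that H_out[OF i(1)] by blast
  then show ?thesis using i(1) by (simp add: MC_def)
qed

lemma one_notin_MC: "\<one>\<^bsub>H\<^esub> \<notin> MC"
  by (auto simp: MC_def H_simps(4) hmon_def)

lemma nonunits_OC: "nonunits H OC = MC"
proof (rule equalityI; rule subsetI)
  fix x assume x: "x \<in> nonunits H OC"
  show "x \<in> MC"
  proof (cases "x = \<zero>\<^bsub>H\<^esub>")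
    case True then show ?thesis by (simp add: MC_def) (simp add: H_simps)
  next
    case False
    then have "x \<in> carrier H" "inv\<^bsub>H\<^esub> x \<notin> OC" using x OC_sub by (auto simp: nonunits_def)
    then show ?thesis using inv_MC[of "inv\<^bsub>H\<^esub> x"] H_inv[of x] False by auto
  qed
next
  fix x assume x: "x \<in> MC"
  have "inv\<^bsub>H\<^esub> x \<notin> OC" if nz: "x \<noteq> \<zero>\<^bsub>H\<^esub>"
  proof
    assume "inv\<^bsub>H\<^esub> x \<in> OC"
    then have "inv\<^bsub>H\<^esub> x \<otimes>\<^bsub>H\<^esub> x \<in> MC" using MC_mult x by blast
    then show False using H_inv[OF MC_sub[OF x] nz] one_notin_MC MC_sub[OF x] H.m_comm by metis
  qed
  then show "x \<in> nonunits H OC" using MC_OC[OF x] by (auto simp: nonunits_def)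
qed

end

section \<open>Hensel's lemma for relative Hahn series\<close>

context hahn_level
begin

lemma L_subfield: "subfield L H"
proof (rule H.subfieldI'[OF L_subring])
  fix x assume "x \<in> L - {\<zero>\<^bsub>H\<^esub>}"
  then obtain y where "y \<in> L" "x \<otimes>\<^bsub>H\<^esub> y = \<one>\<^bsub>H\<^esub>" "x \<in> L" using L_inverse by auto
  then show "inv\<^bsub>H\<^esub> x \<in> L" using L_sub H.comm_inv_char by metis
qed

text \<open>Newton's iteration with the derivative frozen at \<open>a\<close>: the map h \<mapsto> h
  - f(a + h) w with w = 1/f'(a) multiplies differences u - v by 1 - q w, where the difference
  quotient \<open>q\<close> has the same residue as f'(a). This factor lies in the maximal ideal, so
  the map is a contraction.\<close>

theorem L_hensel:
  assumes f: "set f \<subseteq> L" "set f \<subseteq> OC" and a: "a \<in> L" "a \<in> OC"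
    and fa: "H.eval f a \<in> MC" and der: "H.dq f a a \<notin> MC"
  shows "\<exists>b \<in> L. b \<in> OC \<and> H.eval f b = \<zero>\<^bsub>H\<^esub> \<and> b \<ominus>\<^bsub>H\<^esub> a \<in> MC"
proof -
  note LE = subringE[OF L_subring]
  interpret RL: ring "hahn_ring G\<lparr>carrier := L\<rparr>" by (rule H.subring_is_ring[OF L_subring])
  note cons = H.eval_consistent[OF L_subring] H.dq_consistent[OF L_subring]
  have ev_L: "H.eval f x \<in> L" if "x \<in> L" for x
    using RL.eval_in_carrier[of f x] f that by (simp add: cons)
  have dq_L: "H.dq f x y \<in> L" if "x \<in> L" "y \<in> L" for x y
    using RL.dq_closed[of f x y] f that by (simp add: cons)
  have fH: "set f \<subseteq> carrier H" using f L_sub by blast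
  note VI = nonunits_OC
  let ?e = "H.dq f a a"
  have eOC: "?e \<in> OC" using V.eval_cong(3)[of f f a a a a] f a V.zero_in_I H.r_neg L_sub
    by (simp add: a_minus_def)
  define w where "w = inv\<^bsub>H\<^esub> ?e"
  have e0: "?e \<noteq> \<zero>\<^bsub>H\<^esub>" using der V.zero_in_I VI by auto
  have eH: "?e \<in> carrier H" using OC_sub eOC by blast
  have w: "w \<in> L" "w \<in> OC" "?e \<otimes>\<^bsub>H\<^esub> w = \<one>\<^bsub>H\<^esub>" "w \<noteq> \<zero>\<^bsub>H\<^esub>" "w \<in> carrier H"
    using H.subfield_m_inv[OF L_subfield, of ?e] dq_L[OF a(1) a(1)] e0 der eOC VI H_inv[OF eH e0]
    by (auto simp: w_def nonunits_def)
  \<comment> \<open>This is the part of the maximal ideal inside \<open>L\<close>, described by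
    supports so that \<open>L_glue\<close> applies to it.\<close>
  define B where "B = {x \<in> L. hsupp x \<subseteq> {\<gamma>. \<one> \<lless> \<gamma>}}"
  have Biff: "h \<in> B \<longleftrightarrow> h \<in> L \<and> h \<in> MC" for h using L_sub by (auto simp: B_def MC_def)
  define \<phi> where "\<phi> h = h \<ominus>\<^bsub>H\<^esub> H.eval f (a \<oplus>\<^bsub>H\<^esub> h) \<otimes>\<^bsub>H\<^esub> w" for h
  have ah: "a \<oplus>\<^bsub>H\<^esub> h \<in> L" "a \<oplus>\<^bsub>H\<^esub> h \<in> OC" "a \<oplus>\<^bsub>H\<^esub> h \<ominus>\<^bsub>H\<^esub> a = h" "h \<in> carrier H" if "h \<in> B" for h
  proof -
    show "a \<oplus>\<^bsub>H\<^esub> h \<in> L" "a \<oplus>\<^bsub>H\<^esub> h \<in> OC" "h \<in> carrier H"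
      using that a LE(7) V.A_closed(2) MC_OC L_sub by (auto simp: Biff)
    then show "a \<oplus>\<^bsub>H\<^esub> h \<ominus>\<^bsub>H\<^esub> a = h" using L_sub[OF a(1)] by algebra
  qed
  have evMC: "H.eval f (a \<oplus>\<^bsub>H\<^esub> h) \<in> MC" if h: "h \<in> B" for h
  proof -
    have "H.eval f (a \<oplus>\<^bsub>H\<^esub> h) \<in> OC" "H.eval f (a \<oplus>\<^bsub>H\<^esub> h) \<ominus>\<^bsub>H\<^esub> H.eval f a \<in> MC"
      using V.eval_cong(1,2)[of f f "a \<oplus>\<^bsub>H\<^esub> h" a] f a ah[OF h] h VI by (auto simp: Biff)
    then show ?thesis using V.I_cong[of "H.eval f (a \<oplus>\<^bsub>H\<^esub> h)" "H.eval f a"] fa VI MC_OC by blast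
  qed
  have phiB: "\<phi> h \<in> B" if h: "h \<in> B" for h
  proof -
    have "H.eval f (a \<oplus>\<^bsub>H\<^esub> h) \<otimes>\<^bsub>H\<^esub> w \<in> MC" using V.I_absorb evMC[OF h] w(2) VI by blast
    then have "\<phi> h \<in> MC" unfolding \<phi>_def using V.I_minus VI h Biff by blast
    moreover have "\<phi> h \<in> L"
      using h ev_L[OF ah(1)[OF h]] w(1) LE(5,6,7) by (simp add: \<phi>_def a_minus_def Biff)
    ultimately show ?thesis by (simp add: Biff)
  qed
  have "\<exists>h \<in> B. \<phi> h = h"
  proof (rule fixed_point)
    show "B \<subseteq> carrier H" using ah(4) by blast
    show "glue_closed B" unfolding B_def by (rule L_glue)
    show "\<And>h. h \<in> B \<Longrightarrow> \<phi> h \<in> B" by (rule phiB)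
    fix u v \<gamma> assume uv: "u \<in> B" "v \<in> B" "\<gamma> \<in> carrier G" "ltag \<gamma> u v"
    let ?x = "a \<oplus>\<^bsub>H\<^esub> u" and ?y = "a \<oplus>\<^bsub>H\<^esub> v" and ?q = "H.dq f (a \<oplus>\<^bsub>H\<^esub> u) (a \<oplus>\<^bsub>H\<^esub> v)"
    have c: "u \<in> carrier H" "v \<in> carrier H" "a \<in> carrier H" "?x \<in> carrier H" "?y \<in> carrier H"
      using uv ah L_sub a by auto
    have q: "?q \<in> OC" "?q \<ominus>\<^bsub>H\<^esub> ?e \<in> MC"
      using V.eval_cong(3)[of f f ?x a ?y a] f a ah[OF uv(1)] ah[OF uv(2)] uv VI by (auto simp: Biff)
    have qH: "?q \<in> carrier H" using OC_sub q by blast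
    have evc: "H.eval f ?x \<in> carrier H" "H.eval f ?y \<in> carrier H" using H.eval_in_carrier fH c by auto
    define m where "m = \<ominus>\<^bsub>H\<^esub> ((?q \<ominus>\<^bsub>H\<^esub> ?e) \<otimes>\<^bsub>H\<^esub> w)"
    have m: "m \<in> MC" unfolding m_def using V.I_uminus V.I_absorb q(2) w(2) VI by blast
    have "\<phi> u \<ominus>\<^bsub>H\<^esub> \<phi> v = (u \<ominus>\<^bsub>H\<^esub> v) \<ominus>\<^bsub>H\<^esub> (H.eval f ?x \<ominus>\<^bsub>H\<^esub> H.eval f ?y) \<otimes>\<^bsub>H\<^esub> w"
      unfolding \<phi>_def using c evc w(5) by algebra
    also have "\<dots> = (u \<ominus>\<^bsub>H\<^esub> v) \<ominus>\<^bsub>H\<^esub> ((?x \<ominus>\<^bsub>H\<^esub> ?y) \<otimes>\<^bsub>H\<^esub> ?q) \<otimes>\<^bsub>H\<^esub> w"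
      using H.eval_diff[OF fH c(4,5)] by simp
    also have "?x \<ominus>\<^bsub>H\<^esub> ?y = u \<ominus>\<^bsub>H\<^esub> v" using c by algebra
    also have "(u \<ominus>\<^bsub>H\<^esub> v) \<ominus>\<^bsub>H\<^esub> ((u \<ominus>\<^bsub>H\<^esub> v) \<otimes>\<^bsub>H\<^esub> ?q) \<otimes>\<^bsub>H\<^esub> w = (u \<ominus>\<^bsub>H\<^esub> v) \<otimes>\<^bsub>H\<^esub> (?e \<otimes>\<^bsub>H\<^esub> w \<ominus>\<^bsub>H\<^esub> ?q \<otimes>\<^bsub>H\<^esub> w)"
      unfolding w(3) using c qH w(5) by algebra
    also have "?e \<otimes>\<^bsub>H\<^esub> w \<ominus>\<^bsub>H\<^esub> ?q \<otimes>\<^bsub>H\<^esub> w = m" unfolding m_def using eH qH w(5) by algebra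
    finally show "leag \<gamma> (\<phi> u) (\<phi> v)"
      using MC_contraction[OF _ _ c(1,2) m _ uv(4,3)] phiB uv ah(4) by blast
  qed
  then obtain h where h: "h \<in> B" "\<phi> h = h" by blast
  have hH: "h \<in> carrier H" "H.eval f (a \<oplus>\<^bsub>H\<^esub> h) \<in> carrier H"
    using ah[OF h(1)] L_sub H.eval_in_carrier[OF fH] by auto
  have "H.eval f (a \<oplus>\<^bsub>H\<^esub> h) \<otimes>\<^bsub>H\<^esub> w = h \<ominus>\<^bsub>H\<^esub> \<phi> h" unfolding \<phi>_def using hH w(5) by algebra
  also have "\<dots> = \<zero>\<^bsub>H\<^esub>" using h(2) hH(1) by (simp add: a_minus_def H.r_neg)
  finally have "H.eval f (a \<oplus>\<^bsub>H\<^esub> h) = \<zero>\<^bsub>H\<^esub>" using H.integral hH(2) w(4,5) by blast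
  then show ?thesis using ah[OF h(1)] h(1) Biff by metis
qed

end

section \<open>Maximal subfields over which an element has prime degree\<close>

text \<open>The polynomial with coefficient \<open>q i\<close> at x^i for i < n. Coefficients given
  by a function can be padded and regrouped by exponent without normalising lists.\<close>

definition (in ring) pev :: "(nat \<Rightarrow> 'a) \<Rightarrow> nat \<Rightarrow> 'a \<Rightarrow> 'a" where
  "pev q n x = eval (map q (rev [0..<n])) x"

text \<open>For p at least 1 this is the coefficient list of X^p - c.\<close>

definition (in ring) binomial_poly :: "nat \<Rightarrow> 'a \<Rightarrow> 'a list" where
  "binomial_poly p c = \<one> # replicate (p - 1) \<zero> @ [\<ominus> c]"

text \<open>Linear independence of 1, y, ..., y^(p-1) over \<open>K\<close>. Over a field it says
  that \<open>y\<close> does not have degree below \<open>p\<close>. The form with arbitrary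
  coefficient lists makes sense over subrings and involves finitely many elements at a time.\<close>

definition (in ring) lin_indep_pows :: "'a set \<Rightarrow> nat \<Rightarrow> 'a \<Rightarrow> bool" where
  "lin_indep_pows K p y \<longleftrightarrow> (\<forall>f. set f \<subseteq> K \<longrightarrow> length f \<le> p \<longrightarrow> eval f y = \<zero> \<longrightarrow> set f \<subseteq> {\<zero>})"

context ring
begin

lemma pev_simps [simp]: "pev q 0 x = \<zero>" "pev q (Suc n) x = q n \<otimes> x [^] n \<oplus> pev q n x"
  by (simp_all add: pev_def)

lemma pev_closed [intro]: "\<lbrakk>\<And>i. q i \<in> carrier R; x \<in> carrier R\<rbrakk> \<Longrightarrow> pev q n x \<in> carrier R"
  by (induct n) auto

lemma pev_cong: "\<lbrakk>\<And>i. i < n \<Longrightarrow> q i = q' i\<rbrakk> \<Longrightarrow> pev q n x = pev q' n x"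
  by (induct n) auto

lemma pev_coeff:
  assumes "set cs \<subseteq> carrier R" "x \<in> carrier R" "length cs \<le> n"
  shows "pev (coeff cs) n x = eval cs x"
  using assms(3)
proof (induct n rule: dec_induct)
  case base then show ?case by (simp add: pev_def coeff_list)
next
  case (step n)
  then have "coeff cs n = \<zero>" by (simp add: coeff_length)
  then show ?case using step assms eval_in_carrier by simp
qed

lemma binomial_poly_props:
  assumes "p \<ge> 1" "c \<in> carrier R" "x \<in> carrier R" "y \<in> carrier R"
  shows "eval (binomial_poly p c) x = x [^] p \<ominus> c" "dq (binomial_poly p c) x y = pow_diff x y p"
proof -
  have 1: "eval (replicate n \<zero> @ [\<ominus> c]) x = \<ominus> c" "dq (replicate n \<zero> @ [\<ominus> c]) x y = \<zero>" for n
    using assms by (induct n) auto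
  show "eval (binomial_poly p c) x = x [^] p \<ominus> c" "dq (binomial_poly p c) x y = pow_diff x y p"
    using assms by (auto simp: binomial_poly_def 1 a_minus_def simp del: nat_pow_Suc)
qed

lemma pow_diff_one: "pow_diff \<one> \<one> k = [k] \<cdot> \<one>"
  by (induct k) (auto simp: add.nat_pow_Suc2 a_comm)

lemma normalize_Nil_iff: "normalize cs = [] \<longleftrightarrow> set cs \<subseteq> {\<zero>}"
  by (induct cs) auto

lemma transcendental_zero:
  assumes "(transcendental over K) x" "set cs \<subseteq> K" "K \<subseteq> carrier R" "x \<in> carrier R" "eval cs x = \<zero>"
  shows "set cs \<subseteq> {\<zero>}"
proof -
  have "normalize cs \<in> carrier (K[X])"
    using normalize_gives_polynomial[OF assms(2)] by (simp add: univ_poly_carrier)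
  moreover have "eval (normalize cs) x = \<zero>" using eval_normalize[of cs x] assms by auto
  ultimately show ?thesis using eval_transcendental[OF assms(1)] normalize_Nil_iff by blast
qed

end

lemma (in cring) pev_add:
  assumes "\<And>i. q i \<in> carrier R" "\<And>i. q' i \<in> carrier R" "x \<in> carrier R"
  shows "pev (\<lambda>i. q i \<oplus> q' i) n x = pev q n x \<oplus> pev q' n x"
proof (induct n)
  case (Suc n)
  let ?a = "pev q n x" and ?b = "pev q' n x"
  have c: "?a \<in> carrier R" "?b \<in> carrier R" "x [^] n \<in> carrier R" "q n \<in> carrier R" "q' n \<in> carrier R"
    using assms by auto
  have "(q n \<oplus> q' n) \<otimes> x [^] n \<oplus> (?a \<oplus> ?b) = (q n \<otimes> x [^] n \<oplus> ?a) \<oplus> (q' n \<otimes> x [^] n \<oplus> ?b)"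
    using c by algebra
  then show ?case using Suc by simp
qed simp

lemma (in cring) pev_smult:
  assumes "\<And>i. q i \<in> carrier R" "c \<in> carrier R" "x \<in> carrier R"
  shows "pev (\<lambda>i. q i \<otimes> c) n x = c \<otimes> pev q n x"
proof (induct n)
  case (Suc n)
  let ?a = "pev q n x"
  have cc: "?a \<in> carrier R" "x [^] n \<in> carrier R" "q n \<in> carrier R" using assms by auto
  have "(q n \<otimes> c) \<otimes> x [^] n \<oplus> c \<otimes> ?a = c \<otimes> (q n \<otimes> x [^] n \<oplus> ?a)"
    using cc assms(2) by (simp add: r_distr m_ac)
  then show ?case using Suc by simp
qed (simp add: assms)

lemma (in cring) pev_shift:
  assumes "\<And>i. q i \<in> carrier R" "x \<in> carrier R"
  shows "pev q (m + n) x = x [^] m \<otimes> pev (\<lambda>i. q (m + i)) n x \<oplus> pev q m x"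
proof (induct n)
  case 0 then show ?case using assms by (simp add: pev_closed)
next
  case (Suc n)
  let ?a = "pev (\<lambda>i. q (m + i)) n x" and ?b = "pev q m x"
  have c: "?a \<in> carrier R" "?b \<in> carrier R" "x [^] m \<in> carrier R" "x [^] n \<in> carrier R" "q (m + n) \<in> carrier R"
    using assms by auto
  have "pev q (m + Suc n) x = q (m + n) \<otimes> (x [^] m \<otimes> x [^] n) \<oplus> (x [^] m \<otimes> ?a \<oplus> ?b)"
    using Suc assms by (simp add: nat_pow_mult)
  also have "\<dots> = x [^] m \<otimes> (q (m + n) \<otimes> x [^] n \<oplus> ?a) \<oplus> ?b"
    using c by (simp add: r_distr m_ac a_ac)
  finally show ?case by simp
qed

text \<open>The exponents l < p n are sorted by their residue modulo \<open>p\<close>.\<close>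

lemma (in cring) pev_decompose:
  assumes "\<And>i. q i \<in> carrier R" "y \<in> carrier R"
  shows "pev q (p * n) y = pev (\<lambda>j. pev (\<lambda>i. q (p * i + j)) n (y [^] p)) p y"
proof (induct n)
  case 0
  have "pev (\<lambda>j. \<zero>) m y = \<zero>" for m using assms by (induct m) auto
  then show ?case by simp
next
  case (Suc n)
  let ?w = "(y [^] p) [^] n"
  have cl: "pev (\<lambda>i. q (p * i + j)) n (y [^] p) \<in> carrier R" for j using assms by auto
  have "pev (\<lambda>j. pev (\<lambda>i. q (p * i + j)) (Suc n) (y [^] p)) p y =
      pev (\<lambda>j. q (p * n + j) \<otimes> ?w \<oplus> pev (\<lambda>i. q (p * i + j)) n (y [^] p)) p y" by simp
  also have "\<dots> = pev (\<lambda>j. q (p * n + j) \<otimes> ?w) p y \<oplus> pev (\<lambda>j. pev (\<lambda>i. q (p * i + j)) n (y [^] p)) p y"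
    using assms cl by (intro pev_add) auto
  also have "pev (\<lambda>j. q (p * n + j) \<otimes> ?w) p y = y [^] (p * n) \<otimes> pev (\<lambda>j. q (p * n + j)) p y"
    using assms by (subst pev_smult) (auto simp: nat_pow_pow)
  also have "\<dots> \<oplus> pev (\<lambda>j. pev (\<lambda>i. q (p * i + j)) n (y [^] p)) p y = pev q (p * n + p) y"
    using Suc pev_shift[of q y "p * n" p] assms by simp
  finally show ?case by (simp add: add.commute)
qed

text \<open>If \<open>y\<close> is transcendental over \<open>K\<close>, then distinct exponents \<open>p i + j\<close> make \<open>1, y, \<dots>, y^(p-1)\<close>
  linearly independent over \<open>K[y^p]\<close>.\<close>

lemma (in domain) lin_indep_pows_simple_extension:
  assumes K: "subring K R" and y: "y \<in> carrier R" and tr: "(transcendental over K) y" and p: "p \<ge> 1"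
  shows "lin_indep_pows (simple_extension K (y [^] p)) p y"
  unfolding lin_indep_pows_def
proof (intro allI impI)
  let ?w = "y [^] p"
  fix f assume f: "set f \<subseteq> simple_extension K ?w" "length f \<le> p" "eval f y = \<zero>"
  have Kc: "K \<subseteq> carrier R" using subringE(1)[OF K] .
  have w: "?w \<in> carrier R" using y by simp
  have img: "simple_extension K ?w = (\<lambda>p. eval p ?w) ` carrier (K[X])"
    by (rule simple_extension_as_eval_img[OF Kc w])
  have fc: "set f \<subseteq> carrier R"
    using f(1) simple_extension_in_carrier[OF Kc w] by blast
  have zero: "\<zero> \<in> simple_extension K ?w" by (rule simple_extension.zero)
  have cf: "coeff f j \<in> simple_extension K ?w" for j
  proof -
    have "coeff f j \<in> set f \<union> {\<zero>}" using coeff_img(3)[of f] rangeI[of "coeff f" j] by simp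
    then show ?thesis using subsetD[OF f(1), of "coeff f j"] zero by (elim UnE) simp_all
  qed
  then have "\<forall>j. \<exists>P. P \<in> carrier (K[X]) \<and> coeff f j = eval P ?w" unfolding img by blast
  then obtain P where P: "\<And>j. P j \<in> carrier (K[X])" "\<And>j. coeff f j = eval (P j) ?w" by metis
  have PK: "set (P j) \<subseteq> K" for j using P(1)[of j] polynomial_incl by (simp add: univ_poly_carrier[symmetric])
  have Pc: "coeff (P j) i \<in> K" for i j
  proof -
    have "coeff (P j) i \<in> set (P j) \<union> {\<zero>}" using coeff_img(3)[of "P j"] rangeI[of "coeff (P j)" i] by simp
    then show ?thesis using subsetD[OF PK, of "coeff (P j) i" j] subringE(2)[OF K] by (elim UnE) simp_all
  qed
  define N where "N = Max ((\<lambda>j. length (P j)) ` {..p})"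
  have N: "length (P j) \<le> N" if "j \<le> p" for j unfolding N_def using that by (intro Max_ge) auto
  \<comment> \<open>The coefficients of the polynomials \<open>P j\<close> in y^p are interleaved
    into one polynomial in \<open>y\<close>: exponent l = p i + j receives coefficient
    \<open>i\<close> of \<open>P j\<close>.\<close>
  define q where "q l = coeff (P (l mod p)) (l div p)" for l
  have qK: "q l \<in> K" for l using Pc by (simp add: q_def)
  have "pev q (p * N) y = pev (\<lambda>j. pev (\<lambda>i. q (p * i + j)) N ?w) p y"
    using qK Kc y by (intro pev_decompose) auto
  also have "\<dots> = pev (coeff f) p y"
  proof (rule pev_cong)
    fix j assume j: "j < p"
    have "pev (\<lambda>i. q (p * i + j)) N ?w = pev (coeff (P j)) N ?w"
      using j p by (intro pev_cong) (simp add: q_def)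
    also have "\<dots> = coeff f j" using pev_coeff[of "P j" ?w N] PK Kc w N[of j] j P(2) by auto
    finally show "pev (\<lambda>i. q (p * i + j)) N ?w = coeff f j" .
  qed
  also have "\<dots> = \<zero>" using pev_coeff[OF fc y f(2)] f(3) by simp
  finally have "eval (map q (rev [0..<p * N])) y = \<zero>" by (simp add: pev_def)
  then have "set (map q (rev [0..<p * N])) \<subseteq> {\<zero>}"
    using qK by (intro transcendental_zero[OF tr _ Kc y]) auto
  then have q0: "q l = \<zero>" if "l < p * N" for l using that by (auto simp: image_subset_iff)
  have "coeff f j = \<zero>" if j: "j < length f" for j
  proof -
    have jp: "j < p" using j f(2) by simp
    have "coeff (P j) i = \<zero>" if "i < N" for i
    proof -
      have "p * i + j < p * N" using that jp
        by (metis add.commute add_less_cancel_right less_le_trans mult_Suc_right mult_le_mono2 Suc_leI add_less_mono1)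
      then show ?thesis using q0[of "p * i + j"] jp by (simp add: q_def)
    qed
    then have "pev (coeff (P j)) N ?w = pev (\<lambda>_. \<zero>) N ?w" by (intro pev_cong)
    also have "\<dots> = \<zero>" using w by (induct N) auto
    finally show ?thesis
      using pev_coeff[OF subset_trans[OF PK Kc] w N[of j]] jp P(2) by simp
  qed
  then show "set f \<subseteq> {\<zero>}" unfolding coeff_img(1)[of f, symmetric] by auto
qed

text \<open>A linear relation whose coefficients share the denominator \<open>d\<close> is
  multiplied by \<open>d\<close> to give one over \<open>A\<close>.\<close>

lemma (in domain) lin_indep_pows_smult:
  assumes "lin_indep_pows A p y" "y \<in> carrier R" "set f \<subseteq> carrier R" "d \<in> carrier R" "d \<noteq> \<zero>"
    "\<And>c. c \<in> set f \<Longrightarrow> d \<otimes> c \<in> A" "length f \<le> p" "eval f y = \<zero>"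
  shows "set f \<subseteq> {\<zero>}"
proof -
  have "eval (map (\<lambda>c. d \<otimes> c) g) y = d \<otimes> eval g y" if "set g \<subseteq> carrier R" for g
    using that
  proof (induct g)
    case (Cons c g)
    then have c: "eval g y \<in> carrier R" "y [^] length g \<in> carrier R" "c \<in> carrier R"
      using eval_in_carrier assms(2) by auto
    have "(d \<otimes> c) \<otimes> y [^] length g \<oplus> d \<otimes> eval g y = d \<otimes> (c \<otimes> y [^] length g \<oplus> eval g y)"
      using c assms(4) by algebra
    then show ?case using Cons by simp
  qed (simp add: assms)
  then have "eval (map (\<lambda>c. d \<otimes> c) f) y = \<zero>" using assms(3,4,8) by simp
  moreover have "set (map (\<lambda>c. d \<otimes> c) f) \<subseteq> A" using assms(6) by auto
  ultimately have "set (map (\<lambda>c. d \<otimes> c) f) \<subseteq> {\<zero>}"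
    using assms(1,7) unfolding lin_indep_pows_def by (metis length_map)
  then have "d \<otimes> c = \<zero>" if "c \<in> set f" for c using that by auto
  then show ?thesis using integral[OF _ assms(4)] assms(3,5) by blast
qed

text \<open>Independence passes to fractions by clearing a common denominator of the finitely many
  coefficients.\<close>

lemma (in field) fractions_subfield:
  assumes S: "subring S R" and y: "y \<in> carrier R" and ind: "lin_indep_pows S p y"
  defines "F \<equiv> {a \<otimes> inv b | a b. a \<in> S \<and> b \<in> S \<and> b \<noteq> \<zero>}"
  shows "subfield F R" "S \<subseteq> F" "lin_indep_pows F p y"
    "\<And>L. subfield L R \<Longrightarrow> S \<subseteq> L \<Longrightarrow> F \<subseteq> L"
proof -
  note E = subringE[OF S]
  have Sc: "a \<in> carrier R" if "a \<in> S" for a using E(1) that by blast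
  have iv: "inv b \<in> carrier R" "b \<otimes> inv b = \<one>" "inv b \<noteq> \<zero>" if "b \<in> S" "b \<noteq> \<zero>" for b
    using that Sc[OF that(1)] field_Units by (auto simp: Units_inv_closed)
  have cross: "a = b \<otimes> d \<Longrightarrow> a \<otimes> inv d = b" if "a \<in> carrier R" "b \<in> carrier R" "d \<in> S" "d \<noteq> \<zero>" for a b d
    using that iv[OF that(3,4)] Sc by (simp add: m_assoc)
  \<comment> \<open>Fractions are recognised by having a nonzero multiple in \<open>S\<close> by an
    element of \<open>S\<close>; this and its converse \<open>FE\<close> avoid computing with
    quotients.\<close>
  have FI: "x \<in> F" if "x \<in> carrier R" "d \<in> S" "d \<noteq> \<zero>" "x \<otimes> d \<in> S" for x d
  proof -
    have "x = (x \<otimes> d) \<otimes> inv d" using cross[OF _ that(1-3) refl] Sc[OF that(4)] by simp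
    then show ?thesis using that(2-4) unfolding F_def by blast
  qed
  have FE: "\<exists>d. d \<in> S \<and> d \<noteq> \<zero> \<and> x \<otimes> d \<in> S \<and> x \<in> carrier R" if "x \<in> F" for x
  proof -
    from that obtain a b where ab: "x = a \<otimes> inv b" "a \<in> S" "b \<in> S" "b \<noteq> \<zero>" by (auto simp: F_def)
    moreover have "inv b \<otimes> b = \<one>" using m_comm[of b "inv b"] iv[OF ab(3,4)] Sc[OF ab(3)] by simp
    then have "a \<otimes> inv b \<otimes> b = a" using ab iv[OF ab(3,4)] Sc by (simp add: m_assoc)
    ultimately show ?thesis using iv Sc by (intro exI[of _ b]) auto
  qed
  show SF: "S \<subseteq> F" using FI[of _ \<one>] E(3) Sc by auto
  have "subring F R"
  proof (rule subringI)
    show "F \<subseteq> carrier R" using FE by blast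
    show "\<one> \<in> F" using SF E(3) by blast
  next
    fix x assume "x \<in> F"
    then obtain d where d: "d \<in> S" "d \<noteq> \<zero>" "x \<otimes> d \<in> S" "x \<in> carrier R" using FE by blast
    have "(\<ominus> x) \<otimes> d = \<ominus> (x \<otimes> d)" using d Sc by (simp add: l_minus)
    then show "\<ominus> x \<in> F" using FI[of "\<ominus> x" d] d E(5) by simp
  next
    fix x x' assume "x \<in> F" "x' \<in> F"
    then obtain d d' where d: "d \<in> S" "d \<noteq> \<zero>" "x \<otimes> d \<in> S" "x \<in> carrier R"
      "d' \<in> S" "d' \<noteq> \<zero>" "x' \<otimes> d' \<in> S" "x' \<in> carrier R" using FE by metis
    have dd: "d \<otimes> d' \<in> S" "d \<otimes> d' \<noteq> \<zero>" using d E(6) by (auto simp: integral_iff Sc)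
    have c: "d \<in> carrier R" "d' \<in> carrier R" using d Sc by auto
    have "(x \<otimes> x') \<otimes> (d \<otimes> d') = (x \<otimes> d) \<otimes> (x' \<otimes> d')"
      "(x \<oplus> x') \<otimes> (d \<otimes> d') = (x \<otimes> d) \<otimes> d' \<oplus> (x' \<otimes> d') \<otimes> d" using d(4,8) c by algebra+
    then show "x \<otimes> x' \<in> F" "x \<oplus> x' \<in> F"
      using FI[OF _ dd] d E(6,7) by auto
  qed
  then show "subfield F R"
  proof (rule subfieldI')
    fix x assume "x \<in> F - {\<zero>}"
    then obtain d where d: "d \<in> S" "d \<noteq> \<zero>" "x \<otimes> d \<in> S" "x \<in> carrier R" "x \<noteq> \<zero>" using FE by blast
    have u: "inv x \<in> carrier R" "x \<otimes> inv x = \<one>" using d field_Units by auto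
    have "inv x \<otimes> (x \<otimes> d) = d" using u d Sc[OF d(1)] by (metis m_assoc m_comm l_one)
    then show "inv x \<in> F" using FI[of "inv x" "x \<otimes> d"] d u by (auto simp: integral_iff Sc)
  qed
  show "\<And>L. subfield L R \<Longrightarrow> S \<subseteq> L \<Longrightarrow> F \<subseteq> L"
  proof
    fix L x assume L: "subfield L R" "S \<subseteq> L" and "x \<in> F"
    then obtain a b where ab: "x = a \<otimes> inv b" "a \<in> S" "b \<in> S" "b \<noteq> \<zero>" by (auto simp: F_def)
    then show "x \<in> L"
      using subfield_m_inv(1)[OF L(1), of b] subringE(6)[OF subfieldE(1)[OF L(1)], of a "inv b"] subsetD[OF L(2)]
      by simp
  qed
  have common: "\<exists>d. d \<in> S \<and> d \<noteq> \<zero> \<and> (\<forall>c \<in> set f. d \<otimes> c \<in> S)" if "set f \<subseteq> F" for f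
    using that
  proof (induct f)
    case Nil then show ?case using E(3) one_not_zero by auto
  next
    case (Cons c f)
    then obtain d where d: "d \<in> S" "d \<noteq> \<zero>" "\<forall>c \<in> set f. d \<otimes> c \<in> S" by auto
    obtain e where e: "e \<in> S" "e \<noteq> \<zero>" "c \<otimes> e \<in> S" "c \<in> carrier R" using FE[of c] Cons(2) by auto
    have "(e \<otimes> d) \<otimes> c' \<in> S" if "c' \<in> set (c # f)" for c'
    proof (cases "c' \<in> set f")
      case True
      then have "c' \<in> carrier R" using Cons(2) FE by auto
      then have "(e \<otimes> d) \<otimes> c' = e \<otimes> (d \<otimes> c')" using d e Sc by (simp add: m_assoc)
      then show ?thesis using True d e E(6) by simp
    next
      case False
      then have "c' = c" using that by simp
      moreover have "(e \<otimes> d) \<otimes> c = d \<otimes> (c \<otimes> e)" using e(4) Sc[OF d(1)] Sc[OF e(1)] by algebra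
      ultimately show ?thesis using d e E(6) by simp
    qed
    moreover have "e \<otimes> d \<in> S" "e \<otimes> d \<noteq> \<zero>" using d e E(6) by (auto simp: integral_iff Sc)
    ultimately show ?case by blast
  qed
  show "lin_indep_pows F p y"
    unfolding lin_indep_pows_def
  proof (intro allI impI)
    fix f assume f: "set f \<subseteq> F" "length f \<le> p" "eval f y = \<zero>"
    obtain d where d: "d \<in> S" "d \<noteq> \<zero>" "\<forall>c \<in> set f. d \<otimes> c \<in> S" using common[OF f(1)] by blast
    have "set f \<subseteq> carrier R" using f(1) FE by blast
    then show "set f \<subseteq> {\<zero>}" using lin_indep_pows_smult[OF ind y _ _ d(2)] d f Sc by blast
  qed
qed

text \<open>Degrees in a tower: \<open>p\<close> divides \<open>[M(b, y) : M] = [M(b) : M] [M(b, y) : M(b)]\<close>, and both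
  factors would be smaller than \<open>p\<close>.\<close>

lemma (in field) lin_indep_pows_extend:
  assumes M: "subfield M R" and p: "Factorial_Ring.prime (p :: nat)" and y: "y \<in> carrier R" "y [^] p \<in> M"
    and ind: "lin_indep_pows M p y"
    and b: "b \<in> carrier R" and f: "set f \<subseteq> M" "length f \<le> p" "eval f b = \<zero>" "\<not> set f \<subseteq> {\<zero>}"
  shows "subfield (simple_extension M b) R" "lin_indep_pows (simple_extension M b) p y"
proof -
  have Mr: "subring M R" by (rule subfieldE(1)[OF M])
  have Mc: "M \<subseteq> carrier R" by (rule subfieldE(3)[OF M])
  have p2: "p \<ge> 2" using p by (rule prime_ge_2_nat)
  \<comment> \<open>A nontrivial relation of length at most \<open>p\<close> bounds the degree of
    the minimal polynomial strictly below \<open>p\<close>.\<close>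
  have alg: "(algebraic over N) x \<and> degree (Irr N x) < p \<and> degree (Irr N x) \<ge> 1"
    if N: "subfield N R" and x: "x \<in> carrier R" and g: "set g \<subseteq> N" "length g \<le> p" "eval g x = \<zero>" "\<not> set g \<subseteq> {\<zero>}"
    for N x g
  proof -
    have Nr: "subring N R" by (rule subfieldE(1)[OF N])
    let ?g = "normalize g"
    have gN: "?g \<in> carrier (N[X])"
      using normalize_gives_polynomial[OF g(1)] by (simp add: univ_poly_carrier)
    have g0: "?g \<noteq> []" using g(4) normalize_Nil_iff by simp
    have ge: "eval ?g x = \<zero>" using eval_normalize[of g x] g x subfieldE(3)[OF N] by auto
    have al: "(algebraic over N) x" by (rule algebraicI[OF gN g0 ge])
    have "degree (Irr N x) \<le> degree ?g"
      using pdivides_imp_degree_le[OF Nr IrrE(1)[OF N x al] gN g0 Irr_minimal[OF N x al gN ge]] .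
    also have "\<dots> < p" using normalize_length_le[of g] g(2) p2 by linarith
    finally have "degree (Irr N x) < p" .
    moreover have "degree (Irr N x) \<ge> 1"
      by (rule pirreducible_degree[OF N IrrE(1,2)[OF N x al]])
    ultimately show ?thesis using al by blast
  qed
  note ab = alg[OF M b f]
  show Mb: "subfield (simple_extension M b) R"
    using simple_extension_is_subfield[OF M b] ab by blast
  show "lin_indep_pows (simple_extension M b) p y"
  proof (rule ccontr)
    assume "\<not> ?thesis"
    then obtain g where g: "set g \<subseteq> simple_extension M b" "length g \<le> p" "eval g y = \<zero>" "\<not> set g \<subseteq> {\<zero>}"
      unfolding lin_indep_pows_def by blast
    note ag = alg[OF Mb y(1) g]
    let ?B = "binomial_poly p (y [^] p)"
    have B: "?B \<in> carrier (M[X])"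
    proof -
      have "set ?B \<subseteq> M" "hd ?B \<noteq> \<zero>"
        using subringE(2,3)[OF Mr] subringE(5)[OF Mr y(2)] by (auto simp: binomial_poly_def)
      then show ?thesis unfolding univ_poly_carrier[symmetric] polynomial_def by blast
    qed
    have B0: "?B \<noteq> []" "degree ?B = p" using p2 by (auto simp: binomial_poly_def)
    have Be: "eval ?B y = \<zero>"
      using binomial_poly_props(1)[of p "y [^] p" y y] p2 y(1) by (simp add: a_minus_def r_neg)
    have al: "(algebraic over M) y" by (rule algebraicI[OF B B0(1) Be])
    note Ir = IrrE[OF M y(1) al]
    have "degree (Irr M y) \<le> p"
      using pdivides_imp_degree_le[OF Mr Ir(1) B B0(1) Irr_minimal[OF M y(1) al B Be]] B0(2) by simp
    \<comment> \<open>Independence of the powers rules out a minimal polynomial of degree below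
      \<open>p\<close>; with the bound from X^p - y^p the degree is exactly
      \<open>p\<close>.\<close>
    moreover have "\<not> length (Irr M y) \<le> p"
    proof
      assume "length (Irr M y) \<le> p"
      moreover have "set (Irr M y) \<subseteq> M" using Ir(1) polynomial_incl by (simp add: univ_poly_carrier[symmetric])
      ultimately have z: "set (Irr M y) \<subseteq> {\<zero>}" using ind Ir(4) unfolding lin_indep_pows_def by blast
      have "Irr M y \<noteq> []" using pirreducible_degree[OF M Ir(1,2)] by auto
      then have "lead_coeff (Irr M y) = \<zero>" using z by (cases "Irr M y") auto
      then show False using Ir(3) by simp
    qed
    ultimately have dy: "degree (Irr M y) = p" by simp
    have My: "subfield (simple_extension M y) R" using simple_extension_is_subfield[OF M y(1)] al by blast
    have alb: "(algebraic over (simple_extension M y)) b"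
      using algebraic_mono[OF simple_extension_incl[OF Mc y(1)]] ab by blast
    let ?N = "simple_extension (simple_extension M y) b"
    have N: "simple_extension (simple_extension M b) y = ?N"
      using finite_extension_same_set[OF Mr, of "[y, b]" "[b, y]"] b y(1) by auto
    have d1: "dimension (p * degree (Irr (simple_extension M y) b)) M ?N"
      using telescopic_base[OF M My] dimension_simple_extension[OF M y(1) al]
        dimension_simple_extension[OF My b alb] dy by metis
    have d2: "dimension (degree (Irr M b) * degree (Irr (simple_extension M b) y)) M ?N"
      using telescopic_base[OF M Mb] dimension_simple_extension[OF M b] ab
        dimension_simple_extension[OF Mb y(1)] ag N by metis
    have "p * degree (Irr (simple_extension M y) b) = degree (Irr M b) * degree (Irr (simple_extension M b) y)"
      using dimension_is_inj[OF M d1 d2] .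
    then have "p dvd degree (Irr M b) * degree (Irr (simple_extension M b) y)" by (metis dvd_triv_left)
    then have "p dvd degree (Irr M b) \<or> p dvd degree (Irr (simple_extension M b) y)"
      using p prime_dvd_mult_iff by blast
    then show False using ab ag by (auto dest: dvd_imp_le)
  qed
qed

section \<open>Unions of chains and maximal subfields\<close>

lemma (in ring) chain_Union_subring:
  assumes "\<And>M. M \<in> \<C> \<Longrightarrow> subring M R" "\<C> \<noteq> {}"
    and dir: "\<And>M N. \<lbrakk>M \<in> \<C>; N \<in> \<C>\<rbrakk> \<Longrightarrow> M \<subseteq> N \<or> N \<subseteq> M"
  shows "subring (\<Union>\<C>) R"
proof (rule subringI)
  show "\<Union>\<C> \<subseteq> carrier R" using subringE(1)[OF assms(1)] by blast
  show "\<one> \<in> \<Union>\<C>" using assms(2) subringE(3)[OF assms(1)] by blast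
next
  fix x assume "x \<in> \<Union>\<C>" then show "\<ominus> x \<in> \<Union>\<C>" using subringE(5)[OF assms(1)] by blast
next
  fix x y assume "x \<in> \<Union>\<C>" "y \<in> \<Union>\<C>"
  then obtain M where M: "M \<in> \<C>" "x \<in> M" "y \<in> M" using dir by (metis UnionE subsetD)
  then show "x \<otimes> y \<in> \<Union>\<C>" "x \<oplus> y \<in> \<Union>\<C>" using subringE(6,7)[OF assms(1)[OF M(1)]] by blast+
qed

text \<open>This serves both Zorn's lemma and, later, the union of the whole tower.\<close>

lemma (in field) chain_Union_subfield:
  assumes "\<And>M. M \<in> \<C> \<Longrightarrow> subfield M R" "\<C> \<noteq> {}"
    and "\<And>M N. \<lbrakk>M \<in> \<C>; N \<in> \<C>\<rbrakk> \<Longrightarrow> M \<subseteq> N \<or> N \<subseteq> M"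
  shows "subfield (\<Union>\<C>) R"
proof (rule subfieldI'[OF chain_Union_subring[OF _ assms(2,3)]])
  show "\<And>M. M \<in> \<C> \<Longrightarrow> subring M R" using subfieldE(1)[OF assms(1)] by blast
  fix k assume "k \<in> \<Union>\<C> - {\<zero>}"
  then obtain M where M: "M \<in> \<C>" "k \<in> M - {\<zero>}" by blast
  then show "inv k \<in> \<Union>\<C>" using subfield_m_inv(1)[OF assms(1)[OF M(1)] M(2)] by blast
qed

lemma finite_subset_chain_Union:
  assumes "finite S" "S \<subseteq> \<Union>\<C>" "\<C> \<noteq> {}" "\<And>M N. \<lbrakk>M \<in> \<C>; N \<in> \<C>\<rbrakk> \<Longrightarrow> M \<subseteq> N \<or> N \<subseteq> M"
  shows "\<exists>M \<in> \<C>. S \<subseteq> M"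
  using assms(1,2)
proof (induct S rule: finite_induct)
  case empty then show ?case using assms(3) by blast
next
  case (insert x S)
  then obtain M N where "M \<in> \<C>" "S \<subseteq> M" "N \<in> \<C>" "x \<in> N" by auto
  then show ?case using assms(4)[of M N] by blast
qed

text \<open>Independence concerns finitely many coefficients and so survives unions of chains. If
  \<open>b\<close> in \<open>L\<close> is a root of a nonzero polynomial of degree below
  \<open>p\<close>, then M(b) again satisfies all requirements by
  \<open>lin_indep_pows_extend\<close>, and maximality puts \<open>b\<close> into
  \<open>M\<close>.\<close>

theorem (in field) ex_maximal_prime_degree:
  assumes F: "subfield F R" and L: "subfield L R" and FL: "F \<subseteq> L"
    and p: "Factorial_Ring.prime (p :: nat)" and y: "y \<in> carrier R" "y [^] p \<in> F" and ind: "lin_indep_pows F p y"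
  obtains M where "subfield M R" "F \<subseteq> M" "M \<subseteq> L" "lin_indep_pows M p y"
    "\<And>f b. \<lbrakk>set f \<subseteq> M; length f \<le> p; \<not> set f \<subseteq> {\<zero>}; b \<in> L; eval f b = \<zero>\<rbrakk> \<Longrightarrow> b \<in> M"
proof -
  let ?A = "{M. subfield M R \<and> F \<subseteq> M \<and> M \<subseteq> L \<and> lin_indep_pows M p y}"
  have "\<exists>M \<in> ?A. \<forall>N \<in> ?A. M \<subseteq> N \<longrightarrow> N = M"
  proof (rule subset_Zorn_nonempty)
    show "?A \<noteq> {}" using F FL ind by blast
    fix \<C> assume C: "\<C> \<noteq> {}" "subset.chain ?A \<C>"
    then have dir: "M \<subseteq> N \<or> N \<subseteq> M" if "M \<in> \<C>" "N \<in> \<C>" for M N using that by (auto simp: subset_chain_def)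
    have CA: "M \<in> ?A" if "M \<in> \<C>" for M using that C(2) by (auto simp: subset_chain_def)
    have "lin_indep_pows (\<Union>\<C>) p y"
      unfolding lin_indep_pows_def
    proof (intro allI impI)
      fix f assume f: "set f \<subseteq> \<Union>\<C>" "length f \<le> p" "eval f y = \<zero>"
      then obtain M where "M \<in> \<C>" "set f \<subseteq> M"
        using finite_subset_chain_Union[of "set f" \<C>] C(1) dir by auto
      then show "set f \<subseteq> {\<zero>}" using CA f unfolding lin_indep_pows_def by blast
    qed
    moreover have "subfield (\<Union>\<C>) R"
      using chain_Union_subfield[OF _ C(1)] CA dir by simp
    ultimately show "\<Union>\<C> \<in> ?A" using CA C(1) by blast
  qed
  then obtain M where MA: "M \<in> ?A" and mx: "\<forall>N \<in> ?A. M \<subseteq> N \<longrightarrow> N = M" ..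
  from MA have M: "subfield M R" "F \<subseteq> M" "M \<subseteq> L" "lin_indep_pows M p y" by simp_all
  have "b \<in> M" if f: "set f \<subseteq> M" "length f \<le> p" "\<not> set f \<subseteq> {\<zero>}" and b: "b \<in> L" "eval f b = \<zero>" for f b
  proof -
    have bc: "b \<in> carrier R" using b subfieldE(3)[OF L] by blast
    note ext = lin_indep_pows_extend[OF M(1) p y(1) _ M(4) bc f(1,2) b(2) f(3)]
    have Mc: "M \<subseteq> carrier R" by (rule subfieldE(3)[OF M(1)])
    have "simple_extension M b \<in> ?A"
      using ext y(2) M(2,3) simple_extension_incl[OF Mc bc]
        simple_extension_subring_incl[OF subfieldE(1)[OF L] M(3) b(1)] by auto
    then have "simple_extension M b = M" using bspec[OF mx] simple_extension_incl[OF Mc bc] by simp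
    then show ?thesis using simple_extension_mem[OF subfieldE(1)[OF M(1)] bc] by simp
  qed
  then show ?thesis using that M by blast
qed

section \<open>One step of the construction\<close>

context ordered_abelian_group
begin

lemma H_pow_hmon: "\<gamma> \<in> carrier G \<Longrightarrow> hmon r \<gamma> [^]\<^bsub>H\<^esub> (n::nat) = hmon (r ^ n) (\<gamma> [^] n)"
  by (induct n) (simp_all add: hmon_mult_hmon H_simps(4) mult.commute)

lemma hsupp_pow:
  assumes E: "subgroup E G" and y: "hsupp y \<subseteq> E"
  shows "hsupp (y [^]\<^bsub>H\<^esub> (n::nat)) \<subseteq> E"
proof (induct n)
  case 0 then show ?case using subgroup.one_closed[OF E] by (auto simp: H_simps(4) hmon_def)
next
  case (Suc n)
  show ?case
  proof
    fix \<gamma> assume "\<gamma> \<in> hsupp (y [^]\<^bsub>H\<^esub> Suc n)"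
    then have "(y [^]\<^bsub>H\<^esub> n \<otimes>\<^bsub>H\<^esub> y) \<gamma> \<noteq> 0" by simp
    then obtain \<alpha> \<beta> where "(y [^]\<^bsub>H\<^esub> n) \<alpha> \<noteq> 0" "y \<beta> \<noteq> 0" "\<gamma> = \<alpha> \<otimes> \<beta>" by (rule hsupp_multE)
    then show "\<gamma> \<in> E" using Suc y subgroup.m_closed[OF E] by blast
  qed
qed

text \<open>Slicing along \<open>E\<close> is linear over series supported in \<open>E\<close>. A
  relation between powers of a \<open>y\<close> supported in \<open>E\<close> can therefore be cut
  down to one whose coefficients are supported in \<open>E\<close> too.\<close>

lemma sl_mult_right:
  assumes E: "subgroup E G" and x: "x \<in> carrier H" and y: "y \<in> carrier H" "hsupp y \<subseteq> E" and d: "\<delta> \<in> carrier G"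
  shows "sl E \<delta> (x \<otimes>\<^bsub>H\<^esub> y) = sl E \<delta> x \<otimes>\<^bsub>H\<^esub> y"
proof
  fix \<epsilon>
  note Ec = subgroup.mem_carrier[OF E]
  have xc: "\<alpha> \<in> carrier G" if "x \<alpha> \<noteq> 0" for \<alpha> using that H_out[OF x] by blast
  show "sl E \<delta> (x \<otimes>\<^bsub>H\<^esub> y) \<epsilon> = (sl E \<delta> x \<otimes>\<^bsub>H\<^esub> y) \<epsilon>"
  proof (cases "\<epsilon> \<in> E")
    case False
    have "(sl E \<delta> x \<otimes>\<^bsub>H\<^esub> y) \<epsilon> = 0"
    proof (rule ccontr)
      assume "(sl E \<delta> x \<otimes>\<^bsub>H\<^esub> y) \<epsilon> \<noteq> 0"
      then obtain \<alpha> \<beta> where "sl E \<delta> x \<alpha> \<noteq> 0" "y \<beta> \<noteq> 0" "\<epsilon> = \<alpha> \<otimes> \<beta>" by (rule hsupp_multE)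
      then show False using False y(2) subgroup.m_closed[OF E] by (auto simp: sl_def split: if_splits)
    qed
    then show ?thesis using False by (simp add: sl_def)
  next
    case True
    have "(\<Sum>(\<alpha>, \<beta>) \<in> pairs (hsupp x) (hsupp y) (\<delta> \<otimes> \<epsilon>). x \<alpha> * y \<beta>) =
        (\<Sum>(\<alpha>, \<beta>) \<in> pairs (hsupp (sl E \<delta> x)) (hsupp y) \<epsilon>. sl E \<delta> x \<alpha> * y \<beta>)"
    proof (rule sum.reindex_bij_witness[of _ "\<lambda>(\<alpha>, \<beta>). (\<delta> \<otimes> \<alpha>, \<beta>)" "\<lambda>(\<alpha>, \<beta>). (inv \<delta> \<otimes> \<alpha>, \<beta>)"])
      fix p assume "p \<in> pairs (hsupp x) (hsupp y) (\<delta> \<otimes> \<epsilon>)"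
      then obtain \<alpha> \<beta> where p: "p = (\<alpha>, \<beta>)" "x \<alpha> \<noteq> 0" "y \<beta> \<noteq> 0" "\<alpha> \<otimes> \<beta> = \<delta> \<otimes> \<epsilon>" by (auto simp: pairs_def)
      then have bE: "\<beta> \<in> E" using y(2) by auto
      note c = xc[OF p(2)] Ec[OF bE] Ec[OF True]
      have "inv \<delta> \<otimes> \<alpha> = \<epsilon> \<otimes> inv \<beta>"
      proof -
        have "inv \<delta> \<otimes> \<alpha> = inv \<delta> \<otimes> ((\<alpha> \<otimes> \<beta>) \<otimes> inv \<beta>)" using c by (simp add: m_assoc)
        also have "\<dots> = \<epsilon> \<otimes> inv \<beta>" unfolding p(4) using c d by (simp add: m_assoc)
        finally show ?thesis .
      qed
      then have aE: "inv \<delta> \<otimes> \<alpha> \<in> E"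
        using True bE subgroup.m_closed[OF E] subgroup.m_inv_closed[OF E] by simp
      have "inv \<delta> \<otimes> \<alpha> \<otimes> \<beta> = \<epsilon>" using p(4) c d by (simp add: m_assoc)
      then show "(\<lambda>(\<alpha>, \<beta>). (inv \<delta> \<otimes> \<alpha>, \<beta>)) p \<in> pairs (hsupp (sl E \<delta> x)) (hsupp y) \<epsilon>"
        using p aE c d by (simp add: pairs_def sl_def)
      show "(\<lambda>(\<alpha>, \<beta>). (\<delta> \<otimes> \<alpha>, \<beta>)) ((\<lambda>(\<alpha>, \<beta>). (inv \<delta> \<otimes> \<alpha>, \<beta>)) p) = p" using p c d by simp
      show "(case (\<lambda>(\<alpha>, \<beta>). (inv \<delta> \<otimes> \<alpha>, \<beta>)) p of (\<alpha>, \<beta>) \<Rightarrow> sl E \<delta> x \<alpha> * y \<beta>) = (case p of (\<alpha>, \<beta>) \<Rightarrow> x \<alpha> * y \<beta>)"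
        using p aE c d by (simp add: sl_def)
    next
      fix p assume "p \<in> pairs (hsupp (sl E \<delta> x)) (hsupp y) \<epsilon>"
      then obtain \<alpha> \<beta> where p: "p = (\<alpha>, \<beta>)" "\<alpha> \<in> E" "x (\<delta> \<otimes> \<alpha>) \<noteq> 0" "y \<beta> \<noteq> 0" "\<alpha> \<otimes> \<beta> = \<epsilon>"
        by (auto simp: pairs_def sl_def split: if_splits)
      then have "\<beta> \<in> E" using y(2) by auto
      note c = Ec[OF p(2)] Ec[OF this]
      show "(\<lambda>(\<alpha>, \<beta>). (inv \<delta> \<otimes> \<alpha>, \<beta>)) ((\<lambda>(\<alpha>, \<beta>). (\<delta> \<otimes> \<alpha>, \<beta>)) p) = p" using p c d by simp
      show "(\<lambda>(\<alpha>, \<beta>). (\<delta> \<otimes> \<alpha>, \<beta>)) p \<in> pairs (hsupp x) (hsupp y) (\<delta> \<otimes> \<epsilon>)"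
        using p c d by (auto simp: pairs_def m_assoc)
    qed
    then show ?thesis using True by (simp add: sl_def H_mult)
  qed
qed

lemma sl_eval:
  assumes E: "subgroup E G" and y: "y \<in> carrier H" "hsupp y \<subseteq> E" and d: "\<delta> \<in> carrier G"
    and f: "set f \<subseteq> carrier H"
  shows "H.eval (map (sl E \<delta>) f) y = sl E \<delta> (H.eval f y)"
  using f
proof (induct f)
  case Nil then show ?case by (auto simp: sl_def H_simps(2))
next
  case (Cons c f)
  have c: "c \<in> carrier H" "H.eval f y \<in> carrier H" "y [^]\<^bsub>H\<^esub> length f \<in> carrier H"
    using Cons y H.eval_in_carrier by auto
  have "sl E \<delta> (c \<otimes>\<^bsub>H\<^esub> y [^]\<^bsub>H\<^esub> length f \<oplus>\<^bsub>H\<^esub> H.eval f y) =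
      sl E \<delta> (c \<otimes>\<^bsub>H\<^esub> y [^]\<^bsub>H\<^esub> length f) \<oplus>\<^bsub>H\<^esub> sl E \<delta> (H.eval f y)"
    by (auto simp: sl_def H_simps(3))
  then show ?case
    using Cons sl_mult_right[OF E c(1,3) hsupp_pow[OF E y(2)] d] by simp
qed

lemma H_add_pow: "[k] \<cdot>\<^bsub>H\<^esub> \<one>\<^bsub>H\<^esub> = hmon (real k) \<one>"
  by (induct k) (auto simp: H_simps(2,3,4) hmon_def)

text \<open>Hensel's lemma for X^p - (1 + t) at 1, where the derivative is the nonzero real
  \<open>p\<close>. It is applied over the cyclic group generated by \<open>a\<close>, so that the
  support of the root consists of powers of \<open>a\<close>.\<close>

lemma root_one_plus:
  assumes a: "a \<in> carrier G" "\<one> \<sqsubset> a" and p: "p \<ge> 1"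
  shows "\<exists>y \<in> carrier H. y [^]\<^bsub>H\<^esub> (p::nat) = \<one>\<^bsub>H\<^esub> \<oplus>\<^bsub>H\<^esub> hmon 1 a \<and> hsupp y \<subseteq> generate G {a}"
proof -
  have sg: "subgroup (generate G {a}) G" using a by (intro generate_is_subgroup) simp
  interpret T: hahn_level G "{\<one>}" "generate G {a}" "{hmon r \<one> | r. True}" by (rule hahn_level_trivial[OF sg])
  have aD: "a \<in> generate G {a}" by (rule generate.incl) simp
  let ?c = "\<one>\<^bsub>H\<^esub> \<oplus>\<^bsub>H\<^esub> hmon 1 a"
  let ?f = "H.binomial_poly p ?c"
  have tL: "hmon 1 a \<in> T.L" using T.hmon_L aD .
  have ll1: "T.ll \<one> a" using a by (auto simp: T.ll_def)
  have "T.ll \<one> \<gamma>" if "hmon 1 a \<gamma> \<noteq> 0" for \<gamma> using that ll1 by (auto simp: hmon_def split: if_splits)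
  then have tMC: "hmon 1 a \<in> T.MC" using hmon_closed[OF a(1)] by (simp add: T.MC_def)
  note LE = subringE[OF T.L_subring]
  have fL: "set ?f \<subseteq> T.L" using LE(2,3,5,7) tL by (auto simp: H.binomial_poly_def)
  have fO: "set ?f \<subseteq> T.OC" using T.MC_OC[OF tMC] by (auto simp: H.binomial_poly_def)
  have c: "?c \<in> carrier H" "hmon 1 a \<in> carrier H" using a by auto
  note bp = H.binomial_poly_props[OF p c(1)]
  have e1: "H.eval ?f \<one>\<^bsub>H\<^esub> \<in> T.MC"
  proof -
    have "H.eval ?f \<one>\<^bsub>H\<^esub> = \<one>\<^bsub>H\<^esub> \<ominus>\<^bsub>H\<^esub> (\<one>\<^bsub>H\<^esub> \<oplus>\<^bsub>H\<^esub> hmon 1 a)" using bp(1)[OF H.one_closed H.one_closed] by simp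
    also have "\<dots> = \<ominus>\<^bsub>H\<^esub> hmon 1 a" using c(2) by algebra
    finally show ?thesis using T.V.I_uminus tMC T.nonunits_OC by simp
  qed
  have e2: "H.dq ?f \<one>\<^bsub>H\<^esub> \<one>\<^bsub>H\<^esub> \<notin> T.MC"
  proof -
    have "H.dq ?f \<one>\<^bsub>H\<^esub> \<one>\<^bsub>H\<^esub> = hmon (real p) \<one>"
      using bp(2)[of "\<one>\<^bsub>H\<^esub>" "\<one>\<^bsub>H\<^esub>"] by (simp add: H.pow_diff_one H_add_pow)
    then show ?thesis using p by (auto simp: T.MC_def hmon_def)
  qed
  obtain b where b: "b \<in> T.L" "H.eval ?f b = \<zero>\<^bsub>H\<^esub>"
    using T.L_hensel[OF fL fO LE(3) _ e1 e2] by auto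
  have bH: "b \<in> carrier H" by (rule T.L_sub[OF b(1)])
  have "b [^]\<^bsub>H\<^esub> p \<ominus>\<^bsub>H\<^esub> ?c = \<zero>\<^bsub>H\<^esub>" using bp(1)[OF bH bH] b(2) by simp
  then have "b [^]\<^bsub>H\<^esub> p = ?c" using bH c(1) by (metis H.nat_pow_closed H.r_right_minus_eq)
  moreover have "hsupp b \<subseteq> generate G {a}" using T.L_supp[OF b(1)] by blast
  ultimately show ?thesis using bH by blast
qed

end

section \<open>The ring from which the starting field is built\<close>

context hahn_level
begin

lemma k_subfield: "subfield k H"
proof (rule H.subfieldI'[OF k_subring])
  fix x assume x: "x \<in> k - {\<zero>\<^bsub>H\<^esub>}"
  then obtain y where "y \<in> k" "x \<otimes>\<^bsub>H\<^esub> y = \<one>\<^bsub>H\<^esub>" using k_inv by auto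
  then show "inv\<^bsub>H\<^esub> x \<in> k" using x k_sub H.comm_inv_char by (metis DiffD1)
qed

text \<open>Series with only finitely many nonzero slices: in effect the ring generated by
  \<open>k\<close> and the monomials with exponents in \<open>D\<close>. It contains everything that
  the next field must contain, and is small enough for the root \<open>y\<close> to keep its full
  degree.\<close>

definition S0 :: "('a \<Rightarrow> real) set" where
  "S0 = {x \<in> L. \<exists>F. finite F \<and> F \<subseteq> D \<and> hsupp x \<subseteq> F <#> C}"

lemma S0_L: "x \<in> S0 \<Longrightarrow> x \<in> L" by (simp add: S0_def)

lemma k_S0: "x \<in> k \<Longrightarrow> x \<in> S0"
proof -
  assume x: "x \<in> k"
  have "hsupp x \<subseteq> {\<one>} <#> C" using k_supp[OF x] C_sub by (force simp: set_mult_def)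
  then show ?thesis using k_L[OF x] unfolding S0_def by (auto intro!: exI[of _ "{\<one>}"])
qed

lemma hmon_S0: "\<gamma> \<in> D \<Longrightarrow> hmon r \<gamma> \<in> S0"
proof -
  assume g: "\<gamma> \<in> D"
  have "hsupp (hmon r \<gamma>) \<subseteq> {\<gamma>} <#> C"
    using D_sub[OF g] by (auto simp: set_mult_def hmon_def intro!: bexI[of _ \<one>] split: if_splits)
  then show ?thesis using hmon_L[OF g, of r] g unfolding S0_def by (auto intro!: exI[of _ "{\<gamma>}"])
qed

lemma S0_subring: "subring S0 H"
proof (rule H.subringI)
  note LE = subringE[OF L_subring]
  show "S0 \<subseteq> carrier H" using S0_L L_sub by blast
  show "\<one>\<^bsub>H\<^esub> \<in> S0" using hmon_S0[of \<one> 1] by (simp add: H_simps(4))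
  fix x assume x: "x \<in> S0"
  then obtain F where F: "finite F" "F \<subseteq> D" "hsupp x \<subseteq> F <#> C" by (auto simp: S0_def)
  have xL: "x \<in> L" by (rule S0_L[OF x])
  have "hsupp (\<ominus>\<^bsub>H\<^esub> x) = hsupp x" using H_uminus[OF L_sub[OF xL]] by simp
  then show "\<ominus>\<^bsub>H\<^esub> x \<in> S0" using F LE(5)[OF xL] unfolding S0_def by auto
  fix y assume y: "y \<in> S0"
  then obtain F' where F': "finite F'" "F' \<subseteq> D" "hsupp y \<subseteq> F' <#> C" by (auto simp: S0_def)
  have yL: "y \<in> L" by (rule S0_L[OF y])
  have "hsupp (x \<oplus>\<^bsub>H\<^esub> y) \<subseteq> (F \<union> F') <#> C"
  proof
    fix \<gamma> assume "\<gamma> \<in> hsupp (x \<oplus>\<^bsub>H\<^esub> y)"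
    then have "x \<gamma> \<noteq> 0 \<or> y \<gamma> \<noteq> 0" by (auto simp: H_simps(3))
    then have "\<gamma> \<in> F <#> C \<or> \<gamma> \<in> F' <#> C" using F(3) F'(3) by blast
    then show "\<gamma> \<in> (F \<union> F') <#> C" unfolding set_mult_def by blast
  qed
  then show "x \<oplus>\<^bsub>H\<^esub> y \<in> S0"
    using F F' LE(7)[OF xL yL] unfolding S0_def by (auto intro!: exI[of _ "F \<union> F'"])
  have "hsupp (x \<otimes>\<^bsub>H\<^esub> y) \<subseteq> (F <#> F') <#> C"
  proof
    fix \<gamma> assume "\<gamma> \<in> hsupp (x \<otimes>\<^bsub>H\<^esub> y)"
    then have "(x \<otimes>\<^bsub>H\<^esub> y) \<gamma> \<noteq> 0" by simp
    then obtain \<alpha> \<beta> where ab: "x \<alpha> \<noteq> 0" "y \<beta> \<noteq> 0" "\<gamma> = \<alpha> \<otimes> \<beta>" by (rule hsupp_multE)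
    then have "\<alpha> \<in> F <#> C" "\<beta> \<in> F' <#> C" using F(3) F'(3) by blast+
    then obtain u c v d where uv: "u \<in> F" "c \<in> C" "\<alpha> = u \<otimes> c" "v \<in> F'" "d \<in> C" "\<beta> = v \<otimes> d"
      unfolding set_mult_def by blast
    then have "u \<in> carrier G" "v \<in> carrier G" "c \<in> carrier G" "d \<in> carrier G"
      using F(2) F'(2) D_sub C_sub by auto
    then have "\<gamma> = (u \<otimes> v) \<otimes> (c \<otimes> d)" using ab(3) uv by (simp add: m_ac)
    then show "\<gamma> \<in> (F <#> F') <#> C" using uv C_closed(2) unfolding set_mult_def by blast
  qed
  moreover have "finite (F <#> F')" using F F' by (simp add: set_mult_def)
  moreover have "F <#> F' \<subseteq> D" using F(2) F'(2) D_closed(2) unfolding set_mult_def by blast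
  ultimately show "x \<otimes>\<^bsub>H\<^esub> y \<in> S0"
    using LE(6)[OF xL yL] unfolding S0_def by (auto intro!: exI[of _ "F <#> F'"])
qed

end

locale hahn_step = hahn_level G C D k for G :: "('a, 'b) ogroup_scheme" (structure) and C D k +
  fixes a :: 'a
  assumes aD: "a \<in> D" and a_pos: "\<one> \<lless> a"
begin

abbreviation t where "t \<equiv> hmon 1 a"

lemma aG: "a \<in> carrier G" by (rule D_sub[OF aD])

lemma a_gt: "\<one> \<sqsubset> a" using a_pos by (rule ll_imp_lt)

lemma tH: "t \<in> carrier H" using aG by simp

lemma a_pow_pos: "0 < n \<Longrightarrow> \<one> \<lless> a [^] (n::nat)"
proof (induct n rule: nat_induct_non_zero)
  case 1 then show ?case using a_pos aG by simp
next
  case (Suc n)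
  have "a [^] n \<lless> a [^] n \<otimes> a" using ll_mult_iff[of \<one> a "a [^] n"] a_pos aG by simp
  then show ?case using ll_trans[of \<one> "a [^] n" "a [^] Suc n"] Suc aG by simp
qed

lemma a_pow_C: "a [^] (i::int) \<in> C \<Longrightarrow> i = 0"
proof (rule ccontr)
  assume i: "a [^] i \<in> C" "i \<noteq> 0"
  have *: "a [^] (n::nat) \<notin> C" if "n > 0" for n
    using a_pow_pos[OF that] aG by (simp add: ll_def)
  have "a [^] (nat \<bar>i\<bar>) \<in> C"
  proof (cases "i \<ge> 0")
    case True then show ?thesis using i(1) int_pow_int[of G a "nat i"] by simp
  next
    case False
    then have "a [^] (- i) = inv (a [^] i)" using aG by (simp add: int_pow_neg)
    then have "a [^] (- i) \<in> C" using i(1) by simp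
    then show ?thesis using False int_pow_int[of G a "nat (- i)"] by simp
  qed
  moreover have "nat \<bar>i\<bar> > 0" using i(2) by simp
  ultimately show False using * by blast
qed

text \<open>The group generated by \<open>C\<close> and \<open>a\<close>. It contains the supports
  of the elements of \<open>k\<close>, of \<open>t\<close> and of the root \<open>y\<close>.\<close>

definition E :: "'a set" where "E = {a [^] (i::int) \<otimes> c | i c. c \<in> C}"

lemma E_subgroup: "subgroup E G"
proof (rule subgroupI)
  show "E \<subseteq> carrier G" using aG C_sub by (auto simp: E_def)
  have "a [^] (0::int) \<otimes> \<one> \<in> E" using C_closed(1) unfolding E_def by blast
  then show "E \<noteq> {}" by blast
next
  fix x assume "x \<in> E"
  then obtain i c where x: "x = a [^] (i::int) \<otimes> c" "c \<in> C" by (auto simp: E_def)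
  then have "inv x = a [^] (- i) \<otimes> inv c" using aG C_sub by (simp add: inv_mult int_pow_neg)
  then show "inv x \<in> E" using x(2) C_closed(3) unfolding E_def by blast
next
  fix x y assume "x \<in> E" "y \<in> E"
  then obtain i c j d where x: "x = a [^] (i::int) \<otimes> c" "c \<in> C" "y = a [^] (j::int) \<otimes> d" "d \<in> C"
    unfolding E_def by blast
  then have "x \<otimes> y = a [^] (i + j) \<otimes> (c \<otimes> d)"
    using aG C_sub[OF x(2)] C_sub[OF x(4)] by (simp add: int_pow_mult[symmetric] m_ac)
  then show "x \<otimes> y \<in> E" using x C_closed(2) unfolding E_def by blast
qed

lemma generate_E: "generate G {a} \<subseteq> E"
proof (rule generate_subgroup_incl[OF _ E_subgroup])
  have "a = a [^] (1::int) \<otimes> \<one>" using aG by simp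
  then show "{a} \<subseteq> E" using C_closed(1) unfolding E_def by blast
qed

lemma generate_D: "generate G {a} \<subseteq> D"
  by (rule generate_subgroup_incl[OF _ D_subgroup]) (simp add: aD)

text \<open>Different powers of \<open>a\<close> lie in different cosets of \<open>C\<close>, so
  slicing a polynomial in \<open>t\<close> over \<open>k\<close> reads off its coefficients. This
  makes \<open>t\<close> transcendental over \<open>k\<close>.\<close>

lemma sl_eval_t:
  assumes f: "set f \<subseteq> k"
  shows "sl C (a [^] (j::nat)) (H.eval f t) = H.coeff f j"
  using f
proof (induct f)
  case Nil then show ?case by (auto simp: sl_def H_simps(2))
next
  case (Cons c f)
  let ?n = "length f"
  have c: "c \<in> k" "c \<in> carrier H" using Cons k_sub by auto
  have v: "(c \<otimes>\<^bsub>H\<^esub> t [^]\<^bsub>H\<^esub> ?n) \<gamma> = c (inv (a [^] ?n) \<otimes> \<gamma>)" if "\<gamma> \<in> carrier G" for \<gamma>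
    using hmon_mult_left[OF c(2), of "a [^] ?n" \<gamma> 1] that aG c(2)
    by (simp add: H_pow_hmon H.m_comm)
  have "sl C (a [^] j) (c \<otimes>\<^bsub>H\<^esub> t [^]\<^bsub>H\<^esub> ?n) = (if j = ?n then c else (\<lambda>\<gamma>. 0))"
  proof
    fix \<delta>
    show "sl C (a [^] j) (c \<otimes>\<^bsub>H\<^esub> t [^]\<^bsub>H\<^esub> ?n) \<delta> = (if j = ?n then c else (\<lambda>\<gamma>. 0)) \<delta>"
    proof (cases "\<delta> \<in> C")
      case False then show ?thesis using k_supp[OF c(1), of \<delta>] by (auto simp: sl_def)
    next
      case True
      have dc: "\<delta> \<in> carrier G" by (rule C_sub[OF True])
      have "c (inv (a [^] ?n) \<otimes> (a [^] j \<otimes> \<delta>)) = 0" if "j \<noteq> ?n"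
      proof (rule ccontr)
        assume "c (inv (a [^] ?n) \<otimes> (a [^] j \<otimes> \<delta>)) \<noteq> 0"
        then have "inv (a [^] ?n) \<otimes> (a [^] j \<otimes> \<delta>) \<in> C" by (rule k_supp[OF c(1)])
        then have "(inv (a [^] ?n) \<otimes> (a [^] j \<otimes> \<delta>)) \<otimes> inv \<delta> \<in> C" using True by simp
        then have "inv (a [^] ?n) \<otimes> a [^] j \<in> C" using aG dc by (simp add: m_assoc)
        then have "a [^] (int j - int ?n) \<in> C"
          using aG by (simp add: int_pow_diff int_pow_int m_comm)
        from a_pow_C[OF this] show False using that by simp
      qed
      then show ?thesis using True dc aG v by (auto simp: sl_def)
    qed
  qed
  moreover have "sl C \<gamma> (x \<oplus>\<^bsub>H\<^esub> y) = sl C \<gamma> x \<oplus>\<^bsub>H\<^esub> sl C \<gamma> y" for \<gamma> x y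
    by (auto simp: sl_def H_simps(3))
  moreover have "H.coeff f ?n = \<zero>\<^bsub>H\<^esub>" by (simp add: H.coeff_length)
  moreover have "H.coeff f j \<in> carrier H" using Cons k_sub by (intro H.coeff_in_carrier) auto
  ultimately show ?case using Cons c by (auto simp: H_simps(2)[symmetric])
qed

lemma t_transcendental: "(H.transcendental over k) t"
proof (rule ccontr)
  assume "\<not> (H.transcendental over k) t"
  then have "(H.algebraic over k) t" by (simp add: over_def)
  then obtain f where f: "f \<in> carrier (k[X]\<^bsub>H\<^esub>)" "f \<noteq> []" "H.eval f t = \<zero>\<^bsub>H\<^esub>"
    by (rule H.algebraicE[OF k_subring tH])
  have fk: "set f \<subseteq> k" using f(1) H.polynomial_incl by (simp add: univ_poly_carrier[symmetric])
  have "H.coeff f (degree f) = \<zero>\<^bsub>H\<^esub>"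
    using sl_eval_t[OF fk, of "degree f"] f(3) by (auto simp: sl_def H_simps(2))
  then show False using f(1,2) H.lead_coeff_simp[OF f(2)]
    by (auto simp: univ_poly_carrier[symmetric] polynomial_def)
qed

text \<open>Such an \<open>x\<close> is a Laurent polynomial in \<open>t\<close> over
  \<open>k\<close>, and a high power of \<open>t\<close> removes its negative exponents. All larger
  powers are allowed so that one power serves several coefficients.\<close>

lemma S0_times_pow:
  assumes x: "x \<in> S0" "hsupp x \<subseteq> E"
  shows "\<exists>N. \<forall>M \<ge> N. x \<otimes>\<^bsub>H\<^esub> t [^]\<^bsub>H\<^esub> (M::nat) \<in> H.simple_extension k t"
proof -
  let ?ks = "H.simple_extension k t"
  have ksr: "subring ?ks H" by (rule H.simple_extension_is_subring[OF k_subring tH])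
  note KE = subringE[OF ksr]
  have kks: "k \<subseteq> ?ks" using H.simple_extension_incl[OF _ tH] k_sub by blast
  have tks: "t \<in> ?ks" by (rule H.simple_extension_mem[OF k_subring tH])
  have tpow: "t [^]\<^bsub>H\<^esub> n \<in> ?ks" for n :: nat
    by (induct n) (use KE(3,6) tks in auto)
  have xL: "x \<in> L" by (rule S0_L[OF x(1)])
  have xH: "x \<in> carrier H" by (rule L_sub[OF xL])
  obtain F where F: "finite F" "F \<subseteq> D" "hsupp x \<subseteq> F <#> C" using x(1) by (auto simp: S0_def)
  define idx where "idx f = (SOME i::int. \<exists>c \<in> C. f = a [^] i \<otimes> c)" for f
  define N where "N = Max (insert 0 ((\<lambda>f. nat \<bar>idx f\<bar>) ` F))"
  have ex: "\<exists>i::int. \<bar>i\<bar> \<le> int N \<and> (\<exists>c \<in> C. \<gamma> = a [^] i \<otimes> c)" if g: "x \<gamma> \<noteq> 0" for \<gamma>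
  proof -
    have "\<gamma> \<in> F <#> C" using F(3) g by blast
    then obtain f c where f: "f \<in> F" "c \<in> C" "\<gamma> = f \<otimes> c" unfolding set_mult_def by blast
    have "\<gamma> \<in> E" using x(2) g by blast
    then obtain i d where i: "\<gamma> = a [^] (i::int) \<otimes> d" "d \<in> C" unfolding E_def by blast
    have fc: "f \<in> carrier G" "c \<in> carrier G" "d \<in> carrier G" using f F(2) D_sub C_sub i by auto
    have "f = \<gamma> \<otimes> inv c" using f(3) fc by (simp add: m_assoc)
    also have "\<dots> = a [^] i \<otimes> (d \<otimes> inv c)" using i fc aG by (simp add: m_assoc)
    finally have "f = a [^] i \<otimes> (d \<otimes> inv c)" .
    moreover have "d \<otimes> inv c \<in> C" using i(2) f(2) by simp
    ultimately have "\<exists>i::int. \<exists>c \<in> C. f = a [^] i \<otimes> c" by blast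
    then have "\<exists>c \<in> C. f = a [^] idx f \<otimes> c" unfolding idx_def by (rule someI_ex)
    then obtain e where e: "e \<in> C" "f = a [^] idx f \<otimes> e" by blast
    have "\<gamma> = a [^] idx f \<otimes> (e \<otimes> c)" using f(3) e fc(2) C_sub[OF e(1)] aG by (metis int_pow_closed m_assoc)
    moreover have "nat \<bar>idx f\<bar> \<le> N" unfolding N_def using F(1) f(1) by (intro Max_ge) auto
    ultimately show ?thesis using e(1) f(2) C_closed(2) by (intro exI[of _ "idx f"]) auto
  qed
  \<comment> \<open>Multiplication by t^N moves the exponents from between -N and N to between 0 and
    2 N; coefficient \<open>j\<close> afterwards is the slice at exponent j - N before.\<close>
  define q where "q j = sl C (a [^] (int j - int N)) x" for j
  have aiD: "a [^] (i::int) \<in> D" for i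
    using subgroup_int_pow_closed[OF D_subgroup aD] by simp
  have qk: "q j \<in> k" for j unfolding q_def by (rule L_sl[OF xL aiD])
  have main: "x \<otimes>\<^bsub>H\<^esub> t [^]\<^bsub>H\<^esub> N = (\<lambda>\<gamma>. \<Sum>j \<le> 2 * N. (q j \<otimes>\<^bsub>H\<^esub> t [^]\<^bsub>H\<^esub> j) \<gamma>)"
  proof
    fix \<gamma>
    have tv: "(z \<otimes>\<^bsub>H\<^esub> t [^]\<^bsub>H\<^esub> n) \<gamma> = z (inv (a [^] n) \<otimes> \<gamma>)" if "\<gamma> \<in> carrier G" "z \<in> carrier H" for z and n :: nat
      using hmon_mult_left[OF that(2), of "a [^] n" \<gamma> 1] that aG by (simp add: H_pow_hmon H.m_comm)
    show "(x \<otimes>\<^bsub>H\<^esub> t [^]\<^bsub>H\<^esub> N) \<gamma> = (\<Sum>j \<le> 2 * N. (q j \<otimes>\<^bsub>H\<^esub> t [^]\<^bsub>H\<^esub> j) \<gamma>)"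
    proof (cases "\<gamma> \<in> carrier G")
      case False
      have z: "z \<gamma> = 0" if "z \<in> carrier H" for z using H_out[OF that False] .
      have "(x \<otimes>\<^bsub>H\<^esub> t [^]\<^bsub>H\<^esub> N) \<gamma> = 0" using xH tH by (intro z) simp
      moreover have "(q j \<otimes>\<^bsub>H\<^esub> t [^]\<^bsub>H\<^esub> j) \<gamma> = 0" for j using k_sub[OF qk] tH by (intro z) simp
      ultimately show ?thesis by simp
    next
      case True
      show ?thesis
      proof (cases "\<exists>l c. l \<le> 2 * N \<and> c \<in> C \<and> \<gamma> = a [^] (l::nat) \<otimes> c")
        case True
        then obtain l c where l: "l \<le> 2 * N" "c \<in> C" "\<gamma> = a [^] l \<otimes> c" by blast
        have cc: "c \<in> carrier G" by (rule C_sub[OF l(2)])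
        have z: "(q j \<otimes>\<^bsub>H\<^esub> t [^]\<^bsub>H\<^esub> j) \<gamma> = 0" if "j \<noteq> l" for j
        proof (rule ccontr)
          assume "(q j \<otimes>\<^bsub>H\<^esub> t [^]\<^bsub>H\<^esub> j) \<gamma> \<noteq> 0"
          then have "inv (a [^] j) \<otimes> \<gamma> \<in> C" using tv[OF \<open>\<gamma> \<in> carrier G\<close> k_sub[OF qk]] k_supp[OF qk] by metis
          then have "(inv (a [^] j) \<otimes> \<gamma>) \<otimes> inv c \<in> C" using l(2) by simp
          then have "inv (a [^] j) \<otimes> a [^] l \<in> C" using l(3) aG cc by (simp add: m_assoc)
          then have "a [^] (int l - int j) \<in> C" using aG by (simp add: int_pow_diff int_pow_int m_comm)
          from a_pow_C[OF this] show False using that by simp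
        qed
        have "(\<Sum>j \<le> 2 * N. (q j \<otimes>\<^bsub>H\<^esub> t [^]\<^bsub>H\<^esub> j) \<gamma>) = (\<Sum>j \<in> {l}. (q j \<otimes>\<^bsub>H\<^esub> t [^]\<^bsub>H\<^esub> j) \<gamma>)"
          using l(1) z by (intro sum.mono_neutral_right) auto
        also have "\<dots> = q l (inv (a [^] l) \<otimes> \<gamma>)" using tv[OF \<open>\<gamma> \<in> carrier G\<close> k_sub[OF qk]] by simp
        also have "inv (a [^] l) \<otimes> \<gamma> = c" using l(3) aG cc by simp
        also have "q l c = x (a [^] (int l - int N) \<otimes> c)" using l(2) by (simp add: q_def sl_def)
        also have "a [^] (int l - int N) \<otimes> c = inv (a [^] N) \<otimes> \<gamma>"
          using l(3) aG cc by (simp add: int_pow_diff int_pow_int m_ac)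
        finally show ?thesis using tv[OF \<open>\<gamma> \<in> carrier G\<close> xH] by simp
      next
        case False
        have "(q j \<otimes>\<^bsub>H\<^esub> t [^]\<^bsub>H\<^esub> j) \<gamma> = 0" if "j \<le> 2 * N" for j
        proof (rule ccontr)
          assume "(q j \<otimes>\<^bsub>H\<^esub> t [^]\<^bsub>H\<^esub> j) \<gamma> \<noteq> 0"
          then have "inv (a [^] j) \<otimes> \<gamma> \<in> C" using tv[OF \<open>\<gamma> \<in> carrier G\<close> k_sub[OF qk]] k_supp[OF qk] by metis
          moreover have "\<gamma> = a [^] j \<otimes> (inv (a [^] j) \<otimes> \<gamma>)" using aG \<open>\<gamma> \<in> carrier G\<close> by simp
          ultimately show False using False that by blast
        qed
        moreover have "x (inv (a [^] N) \<otimes> \<gamma>) = 0"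
        proof (rule ccontr)
          assume "x (inv (a [^] N) \<otimes> \<gamma>) \<noteq> 0"
          then obtain i c where i: "\<bar>i\<bar> \<le> int N" "c \<in> C" "inv (a [^] N) \<otimes> \<gamma> = a [^] (i::int) \<otimes> c" using ex by blast
          have "\<gamma> = a [^] N \<otimes> (inv (a [^] N) \<otimes> \<gamma>)" using aG \<open>\<gamma> \<in> carrier G\<close> by simp
          also have "\<dots> = (a [^] (int N) \<otimes> a [^] i) \<otimes> c" unfolding i(3) using aG C_sub[OF i(2)] by (simp add: m_assoc int_pow_int)
          also have "a [^] (int N) \<otimes> a [^] i = a [^] (int N + i)" using aG by (simp add: int_pow_mult)
          also have "a [^] (int N + i) = a [^] nat (int N + i)" using i(1) int_pow_int[of G a "nat (int N + i)"] by simp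
          finally show False using False i by (metis abs_le_iff add_left_mono int_nat_eq le_add2 nat_le_iff mult_2 of_nat_add order_trans)
        qed
        ultimately show ?thesis using tv[OF \<open>\<gamma> \<in> carrier G\<close> xH] by simp
      qed
    qed
  qed
  have sumks: "(\<lambda>\<gamma>. \<Sum>j \<le> n. (q j \<otimes>\<^bsub>H\<^esub> t [^]\<^bsub>H\<^esub> j) \<gamma>) \<in> ?ks" for n
  proof (induct n)
    case 0
    have "q 0 \<otimes>\<^bsub>H\<^esub> t [^]\<^bsub>H\<^esub> (0::nat) \<in> ?ks" using KE(6) kks qk tpow by blast
    moreover have "(\<lambda>\<gamma>. \<Sum>j \<le> (0::nat). (q j \<otimes>\<^bsub>H\<^esub> t [^]\<^bsub>H\<^esub> j) \<gamma>) = q 0 \<otimes>\<^bsub>H\<^esub> t [^]\<^bsub>H\<^esub> (0::nat)" by (simp del: H.nat_pow_0)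
    ultimately show ?case by simp
  next
    case (Suc n)
    have "(\<lambda>\<gamma>. \<Sum>j \<le> n. (q j \<otimes>\<^bsub>H\<^esub> t [^]\<^bsub>H\<^esub> j) \<gamma>) \<oplus>\<^bsub>H\<^esub> (q (Suc n) \<otimes>\<^bsub>H\<^esub> t [^]\<^bsub>H\<^esub> Suc n) \<in> ?ks"
      using KE(7) Suc KE(6)[OF subsetD[OF kks qk] tpow] by blast
    then show ?case by (simp add: H_simps(3) del: H.nat_pow_Suc)
  qed
  have xN: "x \<otimes>\<^bsub>H\<^esub> t [^]\<^bsub>H\<^esub> N \<in> ?ks" unfolding main by (rule sumks)
  have "x \<otimes>\<^bsub>H\<^esub> t [^]\<^bsub>H\<^esub> M \<in> ?ks" if "M \<ge> N" for M
  proof -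
    have "x \<otimes>\<^bsub>H\<^esub> t [^]\<^bsub>H\<^esub> M = (x \<otimes>\<^bsub>H\<^esub> t [^]\<^bsub>H\<^esub> N) \<otimes>\<^bsub>H\<^esub> t [^]\<^bsub>H\<^esub> (M - N)"
      using that xH tH by (simp add: H.m_assoc H.nat_pow_mult)
    then show ?thesis using KE(6)[OF xN tpow] by simp
  qed
  then show ?thesis by blast
qed

text \<open>Suppose a relation has a coefficient that is nonzero at \<delta>. Slicing along the
  coset of \<delta> by \<open>E\<close> keeps this coefficient nonzero and makes all coefficients
  Laurent polynomials in \<open>t\<close>. A power of \<open>t\<close> turns them into polynomials
  in t = y^p - 1, and over k[y^p] the powers of the transcendental \<open>y\<close> are
  independent.\<close>

lemma S0_lin_indep:
  assumes p: "p \<ge> 1" and y: "y \<in> carrier H" "y [^]\<^bsub>H\<^esub> (p::nat) = \<one>\<^bsub>H\<^esub> \<oplus>\<^bsub>H\<^esub> t" "hsupp y \<subseteq> E"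
  shows "H.lin_indep_pows S0 p y"
  unfolding H.lin_indep_pows_def
proof (intro allI impI)
  fix f assume f: "set f \<subseteq> S0" "length f \<le> p" "H.eval f y = \<zero>\<^bsub>H\<^esub>"
  let ?w = "y [^]\<^bsub>H\<^esub> p"
  let ?kw = "H.simple_extension k ?w"
  have wH: "?w \<in> carrier H" using y(1) by simp
  have kwr: "subring ?kw H" by (rule H.simple_extension_is_subring[OF k_subring wH])
  note KE = subringE[OF kwr]
  have kkw: "k \<subseteq> ?kw" using H.simple_extension_incl[OF _ wH] k_sub by blast
  have tw: "t = ?w \<ominus>\<^bsub>H\<^esub> \<one>\<^bsub>H\<^esub>" unfolding y(2) using tH by algebra
  have "?w \<in> ?kw" by (rule H.simple_extension_mem[OF k_subring wH])
  then have tkw: "t \<in> ?kw" unfolding tw using KE(3,5,7) by (simp add: a_minus_def)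
  have kskw: "H.simple_extension k t \<subseteq> ?kw"
    by (rule H.simple_extension_subring_incl[OF kwr kkw tkw])
  \<comment> \<open>The elements algebraic over \<open>k\<close> form a field, so an algebraic
    \<open>y\<close> would make t = y^p - 1 algebraic.\<close>
  have tr: "(H.transcendental over k) y"
  proof (rule ccontr)
    assume "\<not> (H.transcendental over k) y"
    then have ay: "y \<in> {x \<in> carrier H. (H.algebraic over k) x}" using y(1) by (simp add: over_def)
    have sa: "subring {x \<in> carrier H. (H.algebraic over k) x} H"
      by (rule subfieldE(1)[OF H.subfield_of_algebraics[OF k_subfield]])
    have "y [^]\<^bsub>H\<^esub> n \<in> {x \<in> carrier H. (H.algebraic over k) x}" for n :: nat
      by (induct n) (use subringE(3,6)[OF sa] ay in \<open>auto simp del: mem_Collect_eq\<close>)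
    then have "t \<in> {x \<in> carrier H. (H.algebraic over k) x}"
      unfolding tw a_minus_def using subringE(3,5,7)[OF sa] by blast
    then show False using t_transcendental by (simp add: over_def)
  qed
  note indep = H.lin_indep_pows_simple_extension[OF k_subring y(1) tr p]
  show "set f \<subseteq> {\<zero>\<^bsub>H\<^esub>}"
  proof (rule ccontr)
    assume "\<not> ?thesis"
    then obtain c where c: "c \<in> set f" "c \<noteq> \<zero>\<^bsub>H\<^esub>" by blast
    then obtain \<delta> where d: "c \<delta> \<noteq> 0" by (auto simp: H_simps(2))
    have S0H: "x \<in> carrier H" if "x \<in> S0" for x using S0_L[OF that] L_sub by blast
    have fH: "set f \<subseteq> carrier H" using f(1) S0H by blast
    have cS: "c \<in> S0" using c f(1) by blast
    have dD: "\<delta> \<in> D" using L_supp[OF S0_L[OF cS] d] .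
    have dG: "\<delta> \<in> carrier G" by (rule D_sub[OF dD])
    note Ec = subgroup.mem_carrier[OF E_subgroup]
    have ED: "E \<subseteq> D"
    proof
      fix x assume "x \<in> E"
      then show "x \<in> D" using subgroup_int_pow_closed[OF D_subgroup aD] CD by (auto simp: E_def)
    qed
    have slS: "sl E \<delta> x \<in> S0" if x: "x \<in> S0" for x
    proof -
      have xL: "x \<in> L" by (rule S0_L[OF x])
      obtain F where F: "finite F" "F \<subseteq> D" "hsupp x \<subseteq> F <#> C" using x by (auto simp: S0_def)
      have "sl C \<gamma> (sl E \<delta> x) \<in> k" if g: "\<gamma> \<in> D" for \<gamma>
      proof (cases "\<gamma> \<in> E")
        case True
        have "sl C \<gamma> (sl E \<delta> x) = sl C (\<delta> \<otimes> \<gamma>) x"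
        proof
          fix \<epsilon>
          have "\<gamma> \<otimes> \<epsilon> \<in> E" if "\<epsilon> \<in> C"
          proof -
            have "\<epsilon> = a [^] (0::int) \<otimes> \<epsilon>" using C_sub[OF that] by simp
            then have "\<epsilon> \<in> E" using that unfolding E_def by blast
            then show ?thesis using subgroup.m_closed[OF E_subgroup True] by blast
          qed
          then show "sl C \<gamma> (sl E \<delta> x) \<epsilon> = sl C (\<delta> \<otimes> \<gamma>) x \<epsilon>"
            using C_sub D_sub[OF g] dG by (auto simp: sl_def m_assoc)
        qed
        then show ?thesis using L_sl[OF xL, of "\<delta> \<otimes> \<gamma>"] dD g by simp
      next
        case False
        have "\<gamma> \<otimes> \<epsilon> \<notin> E" if "\<epsilon> \<in> C" for \<epsilon>
        proof
          assume *: "\<gamma> \<otimes> \<epsilon> \<in> E"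
          have "\<epsilon> = a [^] (0::int) \<otimes> \<epsilon>" using C_sub[OF that] by simp
          then have "\<epsilon> \<in> E" using that unfolding E_def by blast
          then have "(\<gamma> \<otimes> \<epsilon>) \<otimes> inv \<epsilon> \<in> E" using * subgroup.m_closed[OF E_subgroup] subgroup.m_inv_closed[OF E_subgroup] by blast
          then show False using False C_sub[OF that] D_sub[OF g] by (simp add: m_assoc)
        qed
        then have "sl C \<gamma> (sl E \<delta> x) = (\<lambda>\<gamma>. 0)" by (auto simp: sl_def)
        then show ?thesis using k_zero by simp
      qed
      moreover have "sl E \<delta> x \<in> carrier H" using sl_closed[OF L_sub[OF xL] dG] Ec by blast
      moreover have "hsupp (sl E \<delta> x) \<subseteq> D" using ED by (auto simp: sl_def)
      ultimately have "sl E \<delta> x \<in> L" by (simp add: L_def)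
      moreover have "hsupp (sl E \<delta> x) \<subseteq> ((\<lambda>f. inv \<delta> \<otimes> f) ` F) <#> C"
      proof
        fix \<gamma> assume "\<gamma> \<in> hsupp (sl E \<delta> x)"
        then have g: "\<gamma> \<in> E" "x (\<delta> \<otimes> \<gamma>) \<noteq> 0" by (auto simp: sl_def split: if_splits)
        then have "\<delta> \<otimes> \<gamma> \<in> F <#> C" using F(3) by blast
        then obtain f c where fc: "f \<in> F" "c \<in> C" "\<delta> \<otimes> \<gamma> = f \<otimes> c" unfolding set_mult_def by blast
        have "\<gamma> = inv \<delta> \<otimes> (\<delta> \<otimes> \<gamma>)" using dG Ec[OF g(1)] by simp
        also have "\<dots> = (inv \<delta> \<otimes> f) \<otimes> c" unfolding fc(3) using dG C_sub[OF fc(2)] D_sub F(2) fc(1) by (simp add: m_assoc subset_iff)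
        finally show "\<gamma> \<in> ((\<lambda>f. inv \<delta> \<otimes> f) ` F) <#> C" using fc(1,2) unfolding set_mult_def by blast
      qed
      moreover have "(\<lambda>f. inv \<delta> \<otimes> f) ` F \<subseteq> D" using F(2) dD by auto
      ultimately show ?thesis using F(1) unfolding S0_def by blast
    qed
    let ?g = "map (sl E \<delta>) f"
    have g0: "H.eval ?g y = \<zero>\<^bsub>H\<^esub>"
      using sl_eval[OF E_subgroup y(1,3) dG fH] f(3) by (auto simp: sl_def H_simps(2))
    have gS: "set ?g \<subseteq> S0" using slS f(1) by auto
    have ex: "\<exists>N. \<forall>M \<ge> N. x \<otimes>\<^bsub>H\<^esub> t [^]\<^bsub>H\<^esub> (M::nat) \<in> ?kw" if xg: "x \<in> set ?g" for x
    proof -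
      have "hsupp x \<subseteq> E" using xg by (auto simp: sl_def split: if_splits)
      then obtain N where "\<forall>M \<ge> N. x \<otimes>\<^bsub>H\<^esub> t [^]\<^bsub>H\<^esub> (M::nat) \<in> H.simple_extension k t"
        using S0_times_pow[OF subsetD[OF gS xg]] by blast
      then have "\<forall>M \<ge> N. x \<otimes>\<^bsub>H\<^esub> t [^]\<^bsub>H\<^esub> (M::nat) \<in> ?kw" using subsetD[OF kskw] by simp
      then show ?thesis by (rule exI)
    qed
    then obtain N where N: "\<And>x M. x \<in> set ?g \<Longrightarrow> M \<ge> N x \<Longrightarrow> x \<otimes>\<^bsub>H\<^esub> t [^]\<^bsub>H\<^esub> (M::nat) \<in> ?kw" by metis
    define M where "M = Max (N ` set ?g)"
    have "N x \<le> M" if "x \<in> set ?g" for x unfolding M_def using that by (intro Max_ge) auto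
    then have tM: "t [^]\<^bsub>H\<^esub> M \<otimes>\<^bsub>H\<^esub> x \<in> ?kw" if "x \<in> set ?g" for x
      using N[OF that] that gS S0H tH by (simp add: H.m_comm subset_iff)
    have "(t [^]\<^bsub>H\<^esub> M) (a [^] M) \<noteq> 0" using aG by (simp add: H_pow_hmon) (simp add: hmon_def)
    then have tM0: "t [^]\<^bsub>H\<^esub> M \<noteq> \<zero>\<^bsub>H\<^esub>" by (auto simp: H_simps(2))
    have "set ?g \<subseteq> {\<zero>\<^bsub>H\<^esub>}"
      using H.lin_indep_pows_smult[OF indep y(1) _ _ tM0 tM _ g0] gS S0H tH f(2) by auto
    then have "sl E \<delta> c = \<zero>\<^bsub>H\<^esub>" using c(1) by auto
    then have "sl E \<delta> c \<one> = 0" by (simp add: H_simps(2))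
    then show False using d dG subgroup.one_closed[OF E_subgroup] by (simp add: sl_def)
  qed
qed

text \<open>\<open>M\<close> is chosen maximal between the fractions of \<open>S0\<close> and
  \<open>L\<close>. Hensel's lemma holds in \<open>L\<close>, and since a list of length at most
  \<open>p\<close> has degree below \<open>p\<close>, the root found there already lies in
  \<open>M\<close>.\<close>

theorem step:
  assumes p: "Factorial_Ring.prime (p::nat)"
  obtains M y where "subfield M H" "k \<subseteq> M" "M \<subseteq> L" "\<And>r \<gamma>. \<gamma> \<in> D \<Longrightarrow> hmon r \<gamma> \<in> M"
    "y \<in> carrier H" "y [^]\<^bsub>H\<^esub> p = \<one>\<^bsub>H\<^esub> \<oplus>\<^bsub>H\<^esub> t" "hsupp y \<subseteq> D" "y \<notin> M"
    "\<And>f x. \<lbrakk>set f \<subseteq> M; set f \<subseteq> OC; length f \<le> p; x \<in> M; x \<in> OC; H.eval f x \<in> MC; H.dq f x x \<notin> MC\<rbrakk> \<Longrightarrow>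
       \<exists>b \<in> M. b \<in> OC \<and> H.eval f b = \<zero>\<^bsub>H\<^esub> \<and> b \<ominus>\<^bsub>H\<^esub> x \<in> MC"
proof -
  have p2: "p \<ge> 2" using p by (rule prime_ge_2_nat)
  obtain y where y: "y \<in> carrier H" "y [^]\<^bsub>H\<^esub> p = \<one>\<^bsub>H\<^esub> \<oplus>\<^bsub>H\<^esub> t" "hsupp y \<subseteq> generate G {a}"
    using root_one_plus[OF aG a_gt, of p] p2 by auto
  have ind: "H.lin_indep_pows S0 p y"
    using S0_lin_indep[OF _ y(1,2)] y(3) generate_E p2 by simp
  define F where "F = {u \<otimes>\<^bsub>H\<^esub> inv\<^bsub>H\<^esub> v | u v. u \<in> S0 \<and> v \<in> S0 \<and> v \<noteq> \<zero>\<^bsub>H\<^esub>}"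
  note F = H.fractions_subfield[OF S0_subring y(1) ind, folded F_def]
  have FL: "F \<subseteq> L" using F(4)[OF L_subfield] S0_L by blast
  have yF: "y [^]\<^bsub>H\<^esub> p \<in> F"
    unfolding y(2) using F(2) subringE(3,7)[OF S0_subring] hmon_S0[OF aD] by blast
  obtain M where M: "subfield M H" "F \<subseteq> M" "M \<subseteq> L" "H.lin_indep_pows M p y"
    and cl: "\<And>f b. \<lbrakk>set f \<subseteq> M; length f \<le> p; \<not> set f \<subseteq> {\<zero>\<^bsub>H\<^esub>}; b \<in> L; H.eval f b = \<zero>\<^bsub>H\<^esub>\<rbrakk> \<Longrightarrow> b \<in> M"
    using H.ex_maximal_prime_degree[OF F(1) L_subfield FL p y(1) yF F(3)] by blast
  note ME = subringE[OF subfieldE(1)[OF M(1)]]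
  have "y \<notin> M"
  proof
    assume yM: "y \<in> M"
    \<comment> \<open>An element of \<open>M\<close> satisfies a relation of length 2 over
      \<open>M\<close>, and 2 is at most \<open>p\<close>.\<close>
    have "H.eval [\<one>\<^bsub>H\<^esub>, \<ominus>\<^bsub>H\<^esub> y] y = \<zero>\<^bsub>H\<^esub>" using y(1) by (simp add: H.r_neg)
    moreover have "set [\<one>\<^bsub>H\<^esub>, \<ominus>\<^bsub>H\<^esub> y] \<subseteq> M" "length [\<one>\<^bsub>H\<^esub>, \<ominus>\<^bsub>H\<^esub> y] \<le> p" using ME(3,5) yM p2 by auto
    ultimately have "set [\<one>\<^bsub>H\<^esub>, \<ominus>\<^bsub>H\<^esub> y] \<subseteq> {\<zero>\<^bsub>H\<^esub>}"
      using M(4) unfolding H.lin_indep_pows_def by blast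
    then show False by simp
  qed
  moreover have "\<exists>b \<in> M. b \<in> OC \<and> H.eval f b = \<zero>\<^bsub>H\<^esub> \<and> b \<ominus>\<^bsub>H\<^esub> x \<in> MC"
    if f: "set f \<subseteq> M" "set f \<subseteq> OC" "length f \<le> p" and x: "x \<in> M" "x \<in> OC" and h: "H.eval f x \<in> MC" "H.dq f x x \<notin> MC"
    for f x
  proof -
    obtain b where b: "b \<in> L" "b \<in> OC" "H.eval f b = \<zero>\<^bsub>H\<^esub>" "b \<ominus>\<^bsub>H\<^esub> x \<in> MC"
      using L_hensel[OF _ f(2) _ x(2) h] f(1) x(1) M(3) by blast
    \<comment> \<open>The zero polynomial, for which maximality says nothing, does not occur here:
      its difference quotients vanish.\<close>
    have "H.dq g x x = \<zero>\<^bsub>H\<^esub>" if "set g \<subseteq> {\<zero>\<^bsub>H\<^esub>}" for g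
      using that OC_sub[OF x(2)] by (induct g) auto
    moreover have "\<zero>\<^bsub>H\<^esub> \<in> MC" using V.zero_in_I nonunits_OC by simp
    ultimately have "\<not> set f \<subseteq> {\<zero>\<^bsub>H\<^esub>}" using h(2) by auto
    then show ?thesis using cl[OF f(1,3) _ b(1,3)] b by blast
  qed
  moreover have "hsupp y \<subseteq> D" using y(3) generate_D by blast
  moreover have "k \<subseteq> M" using k_S0 F(2) M(2) by blast
  moreover have "\<And>r \<gamma>. \<gamma> \<in> D \<Longrightarrow> hmon r \<gamma> \<in> M" using hmon_S0 F(2) M(2) by blast
  ultimately show ?thesis using that M y(1,2) by blast
qed

end

section \<open>The exponent group\<close>

text \<open>The Hahn sum over the reversed order of \<open>nat\<close>, on the exponent type \<open>nat \<Rightarrow> 'a\<close> of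
  \<open>'a hahn_series\<close>: the coordinate with the largest index dominates.\<close>

definition top_group :: "(nat \<Rightarrow> 'a ogroup) \<Rightarrow> (nat \<Rightarrow> 'a) ogroup" where
  "top_group A = \<lparr>carrier = {s. (\<forall>i. s i \<in> carrier (A i)) \<and> finite {i. s i \<noteq> \<one>\<^bsub>A i\<^esub>}},
     monoid.mult = (\<lambda>s t i. s i \<otimes>\<^bsub>A i\<^esub> t i), one = (\<lambda>i. \<one>\<^bsub>A i\<^esub>),
     gle = (\<lambda>s t. s = t \<or> (\<exists>m. gless (A m) (s m) (t m) \<and> (\<forall>j > m. s j = t j)))\<rparr>"

lemma (in ordered_abelian_group) lt_mult: 
  "\<lbrakk>x \<in> carrier G; y \<in> carrier G; z \<in> carrier G; x \<sqsubset> y\<rbrakk> \<Longrightarrow> x \<otimes> z \<sqsubset> y \<otimes> z"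
  using mult_lt_iff[of x y z] by (simp add: m_comm)

locale group_sequence =
  fixes A :: "nat \<Rightarrow> 'a ogroup"
  assumes A_ordered: "ordered_abelian_group (A i)"
    and A_nontrivial: "carrier (A i) \<noteq> {\<one>\<^bsub>A i\<^esub>}"
begin

abbreviation \<Gamma> where "\<Gamma> \<equiv> top_group A"

lemma \<Gamma>_simps: "carrier \<Gamma> = {s. (\<forall>i. s i \<in> carrier (A i)) \<and> finite {i. s i \<noteq> \<one>\<^bsub>A i\<^esub>}}"
    "s \<otimes>\<^bsub>\<Gamma>\<^esub> t = (\<lambda>i. s i \<otimes>\<^bsub>A i\<^esub> t i)" "\<one>\<^bsub>\<Gamma>\<^esub> = (\<lambda>i. \<one>\<^bsub>A i\<^esub>)"
    "gle \<Gamma> s t \<longleftrightarrow> s = t \<or> (\<exists>m. gless (A m) (s m) (t m) \<and> (\<forall>j > m. s j = t j))"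
  by (simp_all add: top_group_def)

sublocale A: ordered_abelian_group "A i" for i by (rule A_ordered)

lemma \<Gamma>_comp: "s \<in> carrier \<Gamma> \<Longrightarrow> s i \<in> carrier (A i)" by (simp add: \<Gamma>_simps)

lemma top_diff:
  assumes s: "s \<in> carrier \<Gamma>" and t: "t \<in> carrier \<Gamma>" and "s \<noteq> t"
  obtains m where "s m \<noteq> t m" "\<And>j. j > m \<Longrightarrow> s j = t j"
proof -
  have "{i. s i \<noteq> t i} \<subseteq> {i. s i \<noteq> \<one>\<^bsub>A i\<^esub>} \<union> {i. t i \<noteq> \<one>\<^bsub>A i\<^esub>}" by auto
  then have fin: "finite {i. s i \<noteq> t i}" using s t by (auto simp: \<Gamma>_simps intro: finite_subset)
  have ne: "{i. s i \<noteq> t i} \<noteq> {}" using assms by auto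
  have "s (Max {i. s i \<noteq> t i}) \<noteq> t (Max {i. s i \<noteq> t i})" using Max_in[OF fin ne] by simp
  moreover have "s j = t j" if "j > Max {i. s i \<noteq> t i}" for j
    using that Max_ge[OF fin, of j] by force
  ultimately show ?thesis using that by blast
qed

lemma \<Gamma>_comm_group: "comm_group \<Gamma>"
proof (rule comm_groupI)
  fix x assume x: "x \<in> carrier \<Gamma>"
  define y where "y = (\<lambda>i. inv\<^bsub>A i\<^esub> (x i))"
  have "{i. y i \<noteq> \<one>\<^bsub>A i\<^esub>} \<subseteq> {i. x i \<noteq> \<one>\<^bsub>A i\<^esub>}" by (auto simp: y_def)
  then have "y \<in> carrier \<Gamma>" using x by (auto simp: \<Gamma>_simps y_def intro: finite_subset)
  moreover have "y \<otimes>\<^bsub>\<Gamma>\<^esub> x = \<one>\<^bsub>\<Gamma>\<^esub>" using x by (auto simp: \<Gamma>_simps y_def)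
  ultimately show "\<exists>y \<in> carrier \<Gamma>. y \<otimes>\<^bsub>\<Gamma>\<^esub> x = \<one>\<^bsub>\<Gamma>\<^esub>" by blast
next
  fix x y assume xy: "x \<in> carrier \<Gamma>" "y \<in> carrier \<Gamma>"
  have "{i. (x \<otimes>\<^bsub>\<Gamma>\<^esub> y) i \<noteq> \<one>\<^bsub>A i\<^esub>} \<subseteq> {i. x i \<noteq> \<one>\<^bsub>A i\<^esub>} \<union> {i. y i \<noteq> \<one>\<^bsub>A i\<^esub>}" by (auto simp: \<Gamma>_simps)
  then show "x \<otimes>\<^bsub>\<Gamma>\<^esub> y \<in> carrier \<Gamma>" using xy by (auto simp: \<Gamma>_simps intro: finite_subset)
qed (auto simp: \<Gamma>_simps A.m_assoc A.m_lcomm A.m_comm fun_eq_iff)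

sublocale \<Gamma>: ordered_abelian_group "top_group A"
proof (intro ordered_abelian_group.intro \<Gamma>_comm_group ordered_abelian_group_axioms.intro)
  fix x y z assume c: "x \<in> carrier \<Gamma>" "y \<in> carrier \<Gamma>" "z \<in> carrier \<Gamma>"
  note cx = \<Gamma>_comp[OF c(1)] and cy = \<Gamma>_comp[OF c(2)] and cz = \<Gamma>_comp[OF c(3)]
  show "gle \<Gamma> x z" if le: "gle \<Gamma> x y" "gle \<Gamma> y z"
  proof (cases "x = y \<or> y = z")
    case True then show ?thesis using le by auto
  next
    case False
    then obtain m n where m: "gless (A m) (x m) (y m)" "\<forall>j > m. x j = y j"
      and n: "gless (A n) (y n) (z n)" "\<forall>j > n. y j = z j"
      using le unfolding \<Gamma>_simps by blast
    have "gless (A (max m n)) (x (max m n)) (z (max m n))"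
    proof (cases m n rule: linorder_cases)
      case less then show ?thesis using m n by (simp add: max_def)
    next
      case equal then show ?thesis using m n A.lt_trans[OF cx cy cz] by simp
    next
      case greater then show ?thesis using m n by (simp add: max_def)
    qed
    moreover have "\<forall>j > max m n. x j = z j" using m n by simp
    ultimately show ?thesis unfolding \<Gamma>_simps by blast
  qed
  show "gle \<Gamma> (x \<otimes>\<^bsub>\<Gamma>\<^esub> z) (y \<otimes>\<^bsub>\<Gamma>\<^esub> z)" if le: "gle \<Gamma> x y"
  proof (cases "x = y")
    case True then show ?thesis by (simp add: \<Gamma>_simps)
  next
    case False
    then obtain m where m: "gless (A m) (x m) (y m)" "\<forall>j > m. x j = y j" using le unfolding \<Gamma>_simps by blast
    then have "gless (A m) (x m \<otimes>\<^bsub>A m\<^esub> z m) (y m \<otimes>\<^bsub>A m\<^esub> z m)" using A.lt_mult[OF cx cy cz] by blast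
    then show ?thesis using m(2) unfolding \<Gamma>_simps by (intro disjI2 exI[of _ m]) simp
  qed
next
  fix x y assume c: "x \<in> carrier \<Gamma>" "y \<in> carrier \<Gamma>"
  note cx = \<Gamma>_comp[OF c(1)] and cy = \<Gamma>_comp[OF c(2)]
  show "gle \<Gamma> x y \<or> gle \<Gamma> y x"
  proof (cases "x = y")
    case False
    then obtain m where m: "x m \<noteq> y m" "\<And>j. j > m \<Longrightarrow> x j = y j" using top_diff[OF c] by metis
    have "gless (A m) (x m) (y m) \<or> gless (A m) (y m) (x m)"
      using A.gle_total[OF cx cy] m(1) by (auto simp: gless_def)
    then show ?thesis using m(2) unfolding \<Gamma>_simps by metis
  qed (simp add: \<Gamma>_simps)
  show "x = y" if le: "gle \<Gamma> x y" "gle \<Gamma> y x"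
  proof (rule ccontr)
    assume "x \<noteq> y"
    then obtain m n where m: "gless (A m) (x m) (y m)" "\<forall>j > m. x j = y j"
      and n: "gless (A n) (y n) (x n)" "\<forall>j > n. y j = x j"
      using le unfolding \<Gamma>_simps by blast
    then have "m = n" by (metis A.lt_irrefl linorder_neqE_nat)
    then show False using A.lt_trans[OF cx cy cx] m n by simp
  qed
qed (simp add: \<Gamma>_simps)

lemma \<Gamma>_less_iff: "\<lbrakk>s \<in> carrier \<Gamma>; t \<in> carrier \<Gamma>\<rbrakk> \<Longrightarrow>
    gless \<Gamma> s t \<longleftrightarrow> (\<exists>m. gless (A m) (s m) (t m) \<and> (\<forall>j > m. s j = t j))"
  by (auto simp: gless_def[of \<Gamma>] \<Gamma>_simps)

lemma \<Gamma>_inv: "s \<in> carrier \<Gamma> \<Longrightarrow> (inv\<^bsub>\<Gamma>\<^esub> s) i = inv\<^bsub>A i\<^esub> (s i)"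
proof -
  assume s: "s \<in> carrier \<Gamma>"
  have "(inv\<^bsub>\<Gamma>\<^esub> s \<otimes>\<^bsub>\<Gamma>\<^esub> s) i = \<one>\<^bsub>\<Gamma>\<^esub> i" using s by simp
  then have "(inv\<^bsub>\<Gamma>\<^esub> s) i \<otimes>\<^bsub>A i\<^esub> s i = \<one>\<^bsub>A i\<^esub>" by (simp add: \<Gamma>_simps)
  then show ?thesis using A.inv_equality \<Gamma>_comp s \<Gamma>.inv_closed by metis
qed

section \<open>Convex subgroups and distinguished exponents\<close>

definition C :: "nat \<Rightarrow> (nat \<Rightarrow> 'a) set" where
  "C n = {s \<in> carrier \<Gamma>. \<forall>j \<ge> n. s j = \<one>\<^bsub>A j\<^esub>}"

lemma C_subgroup: "subgroup (C n) \<Gamma>"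
proof (rule \<Gamma>.subgroupI)
  show "C n \<subseteq> carrier \<Gamma>" by (auto simp: C_def)
  have "\<one>\<^bsub>\<Gamma>\<^esub> \<in> C n" using \<Gamma>.one_closed by (simp add: C_def \<Gamma>_simps(3))
  then show "C n \<noteq> {}" by blast
next
  fix x assume "x \<in> C n"
  then show "inv\<^bsub>\<Gamma>\<^esub> x \<in> C n" using \<Gamma>.inv_closed[of x] by (simp add: C_def \<Gamma>_inv)
next
  fix x y assume "x \<in> C n" "y \<in> C n"
  then show "x \<otimes>\<^bsub>\<Gamma>\<^esub> y \<in> C n" using \<Gamma>.m_closed[of x y] by (simp add: C_def \<Gamma>_simps(2))
qed

lemma C_mono: "m \<le> n \<Longrightarrow> C m \<subseteq> C n"
  by (auto simp: C_def)

lemma C_exhaust: "s \<in> carrier \<Gamma> \<Longrightarrow> \<exists>n. s \<in> C n"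
proof -
  assume s: "s \<in> carrier \<Gamma>"
  then obtain n where "\<forall>i \<in> {i. s i \<noteq> \<one>\<^bsub>A i\<^esub>}. i < n"
    using finite_nat_set_iff_bounded by (auto simp: \<Gamma>_simps)
  then have "s \<in> C n" using s by (auto simp: C_def not_less[symmetric])
  then show ?thesis by blast
qed

text \<open>If x \<ge> 1 has a nontrivial coordinate at or beyond \<open>n\<close>, then its topmost
  one is positive and exceeds the neutral coordinate of \<open>c\<close> there, contrary to x \<le>
  c.\<close>

sublocale lev: convex_subgroup "top_group A" "C n" for n
proof (intro convex_subgroup.intro convex_subgroup_axioms.intro \<Gamma>.ordered_abelian_group_axioms C_subgroup)
  fix c x assume c: "c \<in> C n" and x: "x \<in> carrier \<Gamma>" "gle \<Gamma> \<one>\<^bsub>\<Gamma>\<^esub> x" "gle \<Gamma> x c"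
  have cc: "c \<in> carrier \<Gamma>" using c by (simp add: C_def)
  show "x \<in> C n"
  proof (rule ccontr)
    assume "x \<notin> C n"
    then obtain j where j: "j \<ge> n" "x j \<noteq> \<one>\<^bsub>A j\<^esub>" using x by (auto simp: C_def)
    have "x \<noteq> c" using \<open>x \<notin> C n\<close> c by blast
    moreover have "\<one>\<^bsub>\<Gamma>\<^esub> \<noteq> x" using j by (auto simp: \<Gamma>_simps(3))
    ultimately
    obtain m k where m: "gless (A m) \<one>\<^bsub>A m\<^esub> (x m)" "\<forall>j > m. \<one>\<^bsub>A j\<^esub> = x j"
      and k: "gless (A k) (x k) (c k)" "\<forall>j > k. x j = c j"
      using x unfolding \<Gamma>_simps by blast
    have mn: "m \<ge> n" using j m(2) by (metis dual_order.strict_trans1 not_less)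
    have cm: "c m = \<one>\<^bsub>A m\<^esub>" using c mn by (simp add: C_def)
    have "k \<ge> m" using m(1) k(2) cm by (metis A.lt_irrefl not_less)
    then have "gless (A m) (x m) \<one>\<^bsub>A m\<^esub> \<or> k > m" using k(1) cm by (cases "k = m") auto
    then show False
    proof
      assume "gless (A m) (x m) \<one>\<^bsub>A m\<^esub>"
      then show False using m(1) A.lt_trans[OF A.one_closed \<Gamma>_comp[OF x(1)] A.one_closed] by auto
    next
      assume "k > m"
      then have "x k = \<one>\<^bsub>A k\<^esub>" "c k = \<one>\<^bsub>A k\<^esub>" using m(2) c mn by (auto simp: C_def)
      then show False using k(1) by simp
    qed
  qed
qed

abbreviation Hf where "Hf \<equiv> hahn_ring (top_group A)"

lemma ll_iff: "\<lbrakk>s \<in> carrier \<Gamma>; t \<in> carrier \<Gamma>\<rbrakk> \<Longrightarrow>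
    lev.ll n s t \<longleftrightarrow> (\<exists>m \<ge> n. gless (A m) (s m) (t m) \<and> (\<forall>j > m. s j = t j))"
proof -
  assume c: "s \<in> carrier \<Gamma>" "t \<in> carrier \<Gamma>"
  have mem: "inv\<^bsub>\<Gamma>\<^esub> s \<otimes>\<^bsub>\<Gamma>\<^esub> t \<in> C n \<longleftrightarrow> (\<forall>j \<ge> n. s j = t j)"
  proof -
    have "inv\<^bsub>A j\<^esub> (s j) \<otimes>\<^bsub>A j\<^esub> t j = \<one>\<^bsub>A j\<^esub> \<longleftrightarrow> s j = t j" for j
      using \<Gamma>_comp[OF c(1), of j] \<Gamma>_comp[OF c(2), of j]
      by (metis A.inv_closed A.inv_equality A.inv_inv A.l_inv)
    moreover have "inv\<^bsub>\<Gamma>\<^esub> s \<otimes>\<^bsub>\<Gamma>\<^esub> t \<in> carrier \<Gamma>" using c by simp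
    ultimately show ?thesis using c unfolding C_def by (simp add: \<Gamma>_simps(2) \<Gamma>_inv)
  qed
  show ?thesis
    unfolding lev.ll_def mem \<Gamma>_less_iff[OF c]
  proof
    assume *: "(\<exists>m. gless (A m) (s m) (t m) \<and> (\<forall>j > m. s j = t j)) \<and> \<not> (\<forall>j \<ge> n. s j = t j)"
    then obtain m where m: "gless (A m) (s m) (t m)" "\<forall>j > m. s j = t j" by blast
    have "m \<ge> n"
    proof (rule ccontr)
      assume "\<not> m \<ge> n"
      then have "\<forall>j \<ge> n. s j = t j" using m(2) by simp
      then show False using * by blast
    qed
    then show "\<exists>m \<ge> n. gless (A m) (s m) (t m) \<and> (\<forall>j > m. s j = t j)" using m by blast
  next
    assume "\<exists>m \<ge> n. gless (A m) (s m) (t m) \<and> (\<forall>j > m. s j = t j)"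
    then obtain m where m: "m \<ge> n" "gless (A m) (s m) (t m)" "\<forall>j > m. s j = t j" by blast
    then have "s m \<noteq> t m" by (auto simp: gless_def)
    then show "(\<exists>m. gless (A m) (s m) (t m) \<and> (\<forall>j > m. s j = t j)) \<and> \<not> (\<forall>j \<ge> n. s j = t j)"
      using m by blast
  qed
qed

text \<open>A larger convex subgroup gives a coarser valuation: the valuation ring grows and the
  maximal ideal shrinks.\<close>

lemma OC_mono: "m \<le> n \<Longrightarrow> lev.OC m \<subseteq> lev.OC n"
  and MC_mono: "m \<le> n \<Longrightarrow> lev.MC n \<subseteq> lev.MC m"
proof -
  assume mn: "m \<le> n"
  have *: "lev.ll m s t" if "lev.ll n s t" for s t
    using that C_mono[OF mn] by (auto simp: lev.ll_def)
  show "lev.OC m \<subseteq> lev.OC n" "lev.MC n \<subseteq> lev.MC m" using * by (auto simp: lev.OC_def lev.MC_def)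
qed

definition e :: "nat \<Rightarrow> 'a" where
  "e n = (SOME x. x \<in> carrier (A n) \<and> gless (A n) \<one>\<^bsub>A n\<^esub> x)"

lemma e: "e n \<in> carrier (A n)" "gless (A n) \<one>\<^bsub>A n\<^esub> (e n)"
proof -
  obtain x where x: "x \<in> carrier (A n)" "x \<noteq> \<one>\<^bsub>A n\<^esub>" using A_nontrivial[of n] A.one_closed[of n] by blast
  have "gless (A n) \<one>\<^bsub>A n\<^esub> x \<or> gless (A n) x \<one>\<^bsub>A n\<^esub>"
    using x A.gle_total[of x n "\<one>\<^bsub>A n\<^esub>"] by (auto simp: gless_def)
  then have "gless (A n) \<one>\<^bsub>A n\<^esub> x \<or> gless (A n) \<one>\<^bsub>A n\<^esub> (inv\<^bsub>A n\<^esub> x)"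
    using A.one_lt_iff[OF x(1) A.one_closed] x(1) by simp
  then have "\<exists>x. x \<in> carrier (A n) \<and> gless (A n) \<one>\<^bsub>A n\<^esub> x" using x(1) A.inv_closed by blast
  then have "e n \<in> carrier (A n) \<and> gless (A n) \<one>\<^bsub>A n\<^esub> (e n)" unfolding e_def by (rule someI_ex)
  then show "e n \<in> carrier (A n)" "gless (A n) \<one>\<^bsub>A n\<^esub> (e n)" by auto
qed

definition a :: "nat \<Rightarrow> nat \<Rightarrow> 'a" where
  "a n = (\<lambda>i. if i = n then e n else \<one>\<^bsub>A i\<^esub>)"

lemma a_C: "a n \<in> C (Suc n)"
proof -
  have "{i. a n i \<noteq> \<one>\<^bsub>A i\<^esub>} \<subseteq> {n}" by (auto simp: a_def)
  then have "a n \<in> carrier \<Gamma>" using e by (auto simp: \<Gamma>_simps a_def intro: finite_subset)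
  then show ?thesis by (auto simp: C_def a_def)
qed

lemma a_carrier: "a n \<in> carrier \<Gamma>" using a_C by (simp add: C_def)

lemma a_pos: "lev.ll n \<one>\<^bsub>\<Gamma>\<^esub> (a n)"
  unfolding ll_iff[OF \<Gamma>.one_closed a_carrier] using e by (auto simp: a_def \<Gamma>_simps(3) intro!: exI[of _ n])

lemma C_less_a: "\<lbrakk>c \<in> C n; n \<le> m\<rbrakk> \<Longrightarrow> gless \<Gamma> c (a m)"
  using e[of m] a_carrier[of m] by (auto simp: \<Gamma>_less_iff C_def a_def intro!: exI[of _ m])

section \<open>The tower of fields\<close>

text \<open>The bound serves two purposes: polynomials of length at most n + 1 have length at most
  \<open>p m\<close> for all m \<ge> n, and \<open>p n\<close> exceeds 2 and is therefore
  odd.\<close>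

definition p :: "nat \<Rightarrow> nat" where
  "p n = (SOME q. Factorial_Ring.prime q \<and> n + 2 < q)"

lemma p: "Factorial_Ring.prime (p n)" "n + 2 < p n"
  using someI_ex[OF bigger_prime[of "n + 2"]] by (auto simp: p_def)

definition tower_field :: "nat \<Rightarrow> ((nat \<Rightarrow> 'a) \<Rightarrow> real) set \<Rightarrow> bool" where
  "tower_field n k \<longleftrightarrow> subfield k Hf \<and> (\<forall>x \<in> k. \<forall>\<gamma>. x \<gamma> \<noteq> 0 \<longrightarrow> \<gamma> \<in> C n) \<and> (\<forall>\<gamma> \<in> C n. \<forall>r. hmon r \<gamma> \<in> k)"

text \<open>The condition on slices at the neutral exponent says that truncation to
  \<open>C n\<close> leads from \<open>M\<close> back into \<open>k\<close>, so the residue field of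
  level \<open>n\<close> does not grow beyond \<open>k\<close>. The remaining clauses record the
  excluded root and Hensel's lemma at this level for degrees below \<open>p n\<close>.\<close>

definition tower_step :: "nat \<Rightarrow> ((nat \<Rightarrow> 'a) \<Rightarrow> real) set \<Rightarrow> ((nat \<Rightarrow> 'a) \<Rightarrow> real) set \<Rightarrow> bool" where
  "tower_step n k M \<longleftrightarrow> k \<subseteq> M \<and>
     (\<forall>x \<in> M. \<Gamma>.sl (C n) \<one>\<^bsub>\<Gamma>\<^esub> x \<in> k) \<and>
     (\<exists>y \<in> carrier Hf. y [^]\<^bsub>Hf\<^esub> p n = \<one>\<^bsub>Hf\<^esub> \<oplus>\<^bsub>Hf\<^esub> hmon 1 (a n) \<and> hsupp y \<subseteq> C (Suc n) \<and> y \<notin> M) \<and>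
     (\<forall>f x. set f \<subseteq> M \<and> set f \<subseteq> lev.OC n \<and> length f \<le> p n \<and> x \<in> M \<and> x \<in> lev.OC n \<and>
        \<Gamma>.H.eval f x \<in> lev.MC n \<and> \<Gamma>.H.dq f x x \<notin> lev.MC n \<longrightarrow>
        (\<exists>b \<in> M. b \<in> lev.OC n \<and> \<Gamma>.H.eval f b = \<zero>\<^bsub>Hf\<^esub> \<and> b \<ominus>\<^bsub>Hf\<^esub> x \<in> lev.MC n))"

lemma tower_level:
  assumes k: "tower_field n k"
  shows "hahn_step \<Gamma> (C n) (C (Suc n)) k (a n)"
proof (intro hahn_step.intro hahn_level.intro hahn_step_axioms.intro hahn_level_axioms.intro lev.convex_subgroup_axioms
    C_subgroup a_C a_pos)
  show "C n \<subseteq> C (Suc n)" by (rule C_mono) simp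
  show "subring k Hf" using k subfieldE(1) by (auto simp: tower_field_def)
  show "\<And>x \<gamma>. \<lbrakk>x \<in> k; x \<gamma> \<noteq> 0\<rbrakk> \<Longrightarrow> \<gamma> \<in> C n" "\<And>\<gamma> r. \<gamma> \<in> C n \<Longrightarrow> hmon r \<gamma> \<in> k"
    using k by (auto simp: tower_field_def)
  fix x assume x: "x \<in> k" "x \<noteq> \<zero>\<^bsub>Hf\<^esub>"
  have "subfield k Hf" using k by (simp add: tower_field_def)
  from \<Gamma>.H.subfield_m_inv[OF this, of x] x show "\<exists>y \<in> k. x \<otimes>\<^bsub>Hf\<^esub> y = \<one>\<^bsub>Hf\<^esub>" by blast
qed

lemma tower_field_0: "tower_field 0 {hmon r \<one>\<^bsub>\<Gamma>\<^esub> | r. True}"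
proof -
  have C0: "C 0 = {\<one>\<^bsub>\<Gamma>\<^esub>}" using \<Gamma>.one_closed by (auto simp: C_def \<Gamma>_simps)
  interpret T: hahn_level \<Gamma> "{\<one>\<^bsub>\<Gamma>\<^esub>}" "carrier \<Gamma>" "{hmon r \<one>\<^bsub>\<Gamma>\<^esub> | r. True}"
    by (rule \<Gamma>.hahn_level_trivial[OF \<Gamma>.subgroup_self])
  show ?thesis using T.k_subfield unfolding tower_field_def C0 by (auto simp: hmon_def split: if_splits)
qed

lemma tower_extend:
  assumes k: "tower_field n k"
  shows "\<exists>M. tower_field (Suc n) M \<and> tower_step n k M"
proof -
  interpret S: hahn_step \<Gamma> "C n" "C (Suc n)" k "a n" by (rule tower_level[OF k])
  obtain M y where M: "subfield M Hf" "k \<subseteq> M" "M \<subseteq> S.L" "\<And>r \<gamma>. \<gamma> \<in> C (Suc n) \<Longrightarrow> hmon r \<gamma> \<in> M"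
    "y \<in> carrier Hf" "y [^]\<^bsub>Hf\<^esub> p n = \<one>\<^bsub>Hf\<^esub> \<oplus>\<^bsub>Hf\<^esub> hmon 1 (a n)" "hsupp y \<subseteq> C (Suc n)" "y \<notin> M"
    "\<And>f x. \<lbrakk>set f \<subseteq> M; set f \<subseteq> lev.OC n; length f \<le> p n; x \<in> M; x \<in> lev.OC n;
        \<Gamma>.H.eval f x \<in> lev.MC n; \<Gamma>.H.dq f x x \<notin> lev.MC n\<rbrakk> \<Longrightarrow>
       \<exists>b \<in> M. b \<in> lev.OC n \<and> \<Gamma>.H.eval f b = \<zero>\<^bsub>Hf\<^esub> \<and> b \<ominus>\<^bsub>Hf\<^esub> x \<in> lev.MC n"
    using S.step[OF p(1)] by metis
  have "tower_field (Suc n) M"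
    using M(1,4) S.L_supp M(3) unfolding tower_field_def by blast
  moreover have "\<Gamma>.sl (C n) \<one>\<^bsub>\<Gamma>\<^esub> x \<in> k" if "x \<in> M" for x
    using S.L_sl[of x "\<one>\<^bsub>\<Gamma>\<^esub>"] that M(3) S.D_closed(1) by blast
  then have "tower_step n k M"
    unfolding tower_step_def using M by blast
  ultimately show ?thesis by blast
qed

definition K :: "nat \<Rightarrow> ((nat \<Rightarrow> 'a) \<Rightarrow> real) set" where
  "K = (SOME f. \<forall>n. tower_field n (f n) \<and> tower_step n (f n) (f (Suc n)))"

lemma K: "tower_field n (K n)" "tower_step n (K n) (K (Suc n))"
proof -
  have "\<exists>f. \<forall>n. tower_field n (f n) \<and> tower_step n (f n) (f (Suc n))"
    by (rule dependent_nat_choice) (use tower_field_0 tower_extend in blast)+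
  then have "\<forall>n. tower_field n (K n) \<and> tower_step n (K n) (K (Suc n))" unfolding K_def by (rule someI_ex)
  then show "tower_field n (K n)" "tower_step n (K n) (K (Suc n))" by auto
qed

lemma K_subfield: "subfield (K n) Hf"
  and K_supp: "\<lbrakk>x \<in> K n; x \<gamma> \<noteq> 0\<rbrakk> \<Longrightarrow> \<gamma> \<in> C n"
  and K_hmon: "\<gamma> \<in> C n \<Longrightarrow> hmon r \<gamma> \<in> K n"
  using K(1)[of n] by (auto simp: tower_field_def)

lemma K_mono: "m \<le> n \<Longrightarrow> K m \<subseteq> K n"
proof (induct n rule: dec_induct)
  case (step n) then show ?case using K(2)[of n] by (auto simp: tower_step_def)
qed simp

lemma K_sub: "x \<in> K n \<Longrightarrow> x \<in> carrier Hf"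
  using subfieldE(3)[OF K_subfield] by blast

section \<open>Truncation as residue map\<close>

abbreviation \<rho> where "\<rho> n x \<equiv> \<Gamma>.sl (C n) \<one>\<^bsub>\<Gamma>\<^esub> x"

text \<open>Truncation to \<open>C n\<close> picks a representative of the residue class of level
  \<open>n\<close>: what it discards has exponents above \<open>C n\<close>.\<close>

lemma \<rho>_minus: assumes x: "x \<in> lev.OC n" shows "x \<ominus>\<^bsub>Hf\<^esub> \<rho> n x \<in> lev.MC n"
proof -
  have xH: "x \<in> carrier Hf" using x lev.OC_sub by blast
  have rH: "\<rho> n x \<in> carrier Hf" using \<Gamma>.sl_closed[OF xH \<Gamma>.one_closed] lev.C_sub by blast
  have "lev.ll n \<one>\<^bsub>\<Gamma>\<^esub> \<gamma>" if "x \<gamma> - \<rho> n x \<gamma> \<noteq> 0" for \<gamma>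
  proof -
    have nC: "\<gamma> \<notin> C n"
    proof
      assume "\<gamma> \<in> C n"
      then show False using that lev.C_sub by (simp add: \<Gamma>.sl_def)
    qed
    then have nz: "x \<gamma> \<noteq> 0" using that by (simp add: \<Gamma>.sl_def)
    then have g: "\<gamma> \<in> carrier \<Gamma>" using \<Gamma>.H_out[OF xH] by blast
    have "\<not> lev.ll n \<gamma> \<one>\<^bsub>\<Gamma>\<^esub>" using x nz by (simp add: lev.OC_def)
    then show ?thesis using lev.same_coset[OF \<Gamma>.one_closed g] nC g by simp
  qed
  then show ?thesis
    using \<Gamma>.H.minus_closed[OF xH rH] by (simp add: lev.MC_def \<Gamma>.H_minus[OF xH rH])
qed

lemma K_\<rho>: "\<lbrakk>x \<in> K (Suc n)\<rbrakk> \<Longrightarrow> \<rho> n x \<in> K n"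
  using K(2)[of n] by (simp add: tower_step_def)

text \<open>Truncation maps each stage to the one before and fixes series already supported in
  \<open>C n\<close>, so such a series descends stage by stage to \<open>K n\<close>.\<close>

lemma K_\<rho>_fixed:
  assumes "x \<in> K m" "hsupp x \<subseteq> C n"
  shows "x \<in> K n"
proof (cases "m \<le> n")
  case True then show ?thesis using assms K_mono by blast
next
  case False
  then have "n \<le> m" by simp
  then show ?thesis using assms
  proof (induct m rule: dec_induct)
    case (step m)
    have "\<rho> m x = x"
    proof
      fix \<gamma> show "\<rho> m x \<gamma> = x \<gamma>"
        using step.prems(2) C_mono[OF step.hyps(1)] lev.C_sub[of \<gamma> m] by (auto simp: \<Gamma>.sl_def)
    qed
    then show ?case using K_\<rho>[OF step.prems(1)] step by simp
  qed
qed

text \<open>The excluded root is supported in \<open>C (Suc n)\<close>, so it cannot enter the tower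
  later either. The uniqueness assumption identifies an arbitrary root with this one; it will come
  from the order.\<close>

lemma no_root:
  assumes y: "y \<in> K m" "y [^]\<^bsub>Hf\<^esub> p n = \<one>\<^bsub>Hf\<^esub> \<oplus>\<^bsub>Hf\<^esub> hmon 1 (a n)"
    and uniq: "\<And>z. \<lbrakk>z \<in> carrier Hf; z [^]\<^bsub>Hf\<^esub> p n = y [^]\<^bsub>Hf\<^esub> p n\<rbrakk> \<Longrightarrow> z = y"
  shows False
proof -
  obtain z where z: "z \<in> carrier Hf" "z [^]\<^bsub>Hf\<^esub> p n = \<one>\<^bsub>Hf\<^esub> \<oplus>\<^bsub>Hf\<^esub> hmon 1 (a n)"
    "hsupp z \<subseteq> C (Suc n)" "z \<notin> K (Suc n)"
    using K(2)[of n] unfolding tower_step_def by blast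
  have "z = y" using uniq[OF z(1)] y(2) z(2) by simp
  then show False using K_\<rho>_fixed[OF y(1)] z(3,4) by blast
qed

text \<open>A simple zero over \<open>K (Suc m)\<close> is lifted in two steps: first in \<open>K m\<close>, the residue field of
  the valuation of level \<open>m\<close>, and then along this valuation.\<close>

lemma K_hensel:
  assumes "n \<le> m" "set f \<subseteq> K m" "set f \<subseteq> lev.OC n" "length f \<le> Suc n" "x \<in> K m" "x \<in> lev.OC n"
    "\<Gamma>.H.eval f x \<in> lev.MC n" "\<Gamma>.H.dq f x x \<notin> lev.MC n"
  shows "\<exists>b \<in> K m. b \<in> lev.OC n \<and> \<Gamma>.H.eval f b = \<zero>\<^bsub>Hf\<^esub> \<and> b \<ominus>\<^bsub>Hf\<^esub> x \<in> lev.MC n"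
  using assms
proof (induct m arbitrary: f x rule: dec_induct)
  case base
  interpret R: ring "Hf\<lparr>carrier := K n\<rparr>" by (rule \<Gamma>.H.subring_is_ring[OF subfieldE(1)[OF K_subfield]])
  have xH: "x \<in> carrier Hf" using base K_sub by blast
  have ev: "\<Gamma>.H.eval f x \<in> K n"
    using R.eval_in_carrier[of f x] base \<Gamma>.H.eval_consistent[OF subfieldE(1)[OF K_subfield]] by simp
  \<comment> \<open>Exponents of elements of \<open>K n\<close> lie in \<open>C n\<close>, so the
    maximal ideal of level \<open>n\<close> meets \<open>K n\<close> only in zero and
    \<open>x\<close> itself is already a root.\<close>
  have "\<Gamma>.H.eval f x \<gamma> = 0" for \<gamma>
  proof (rule ccontr)
    assume nz: "\<Gamma>.H.eval f x \<gamma> \<noteq> 0"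
    then have "\<gamma> \<in> C n" using K_supp ev by blast
    moreover have "lev.ll n \<one>\<^bsub>\<Gamma>\<^esub> \<gamma>" using base nz by (simp add: lev.MC_def)
    ultimately show False using lev.C_sub by (simp add: lev.ll_def)
  qed
  then have "\<Gamma>.H.eval f x = \<zero>\<^bsub>Hf\<^esub>" by (auto simp: \<Gamma>.H_simps(2))
  moreover have "x \<ominus>\<^bsub>Hf\<^esub> x \<in> lev.MC n"
    using xH lev.V.zero_in_I lev.nonunits_OC by (simp add: a_minus_def \<Gamma>.H.r_neg)
  ultimately show ?case using base by blast
next
  case (step m)
  have mn: "n \<le> m" by (rule step.hyps(1))
  note I = lev.nonunits_OC
  have fOm: "set f \<subseteq> lev.OC m" and xOm: "x \<in> lev.OC m" using step.prems OC_mono[OF mn] by blast+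
  have MCn: "z \<in> lev.MC n" if "z \<in> lev.MC m" for z using that MC_mono[OF mn] by blast
  have rO: "\<rho> m z \<in> lev.OC n" if z: "z \<in> lev.OC n" for z
  proof -
    have zc: "z \<in> carrier Hf" using lev.OC_sub z by blast
    have rc: "\<rho> m z \<in> carrier Hf" using \<Gamma>.sl_closed[OF zc \<Gamma>.one_closed] lev.C_sub by blast
    have "z \<ominus>\<^bsub>Hf\<^esub> \<rho> m z \<in> lev.OC n" using \<rho>_minus[of z m] z OC_mono[OF mn] MCn lev.MC_OC by blast
    then have "z \<ominus>\<^bsub>Hf\<^esub> (z \<ominus>\<^bsub>Hf\<^esub> \<rho> m z) \<in> lev.OC n" using z lev.V.A_minus by blast
    moreover have "z \<ominus>\<^bsub>Hf\<^esub> (z \<ominus>\<^bsub>Hf\<^esub> \<rho> m z) = \<rho> m z" using zc rc by algebra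
    ultimately show ?thesis by simp
  qed
  \<comment> \<open>The truncated data lie in \<open>K m\<close>, where the induction hypothesis
    applies. They have the same residues as the original data at level \<open>m\<close>, hence also
    at the finer level \<open>n\<close>.\<close>
  let ?f = "map (\<rho> m) f" and ?x = "\<rho> m x"
  have f': "set ?f \<subseteq> K m" "set ?f \<subseteq> lev.OC n" "length ?f \<le> Suc n" using step.prems K_\<rho> rO by auto
  have x': "?x \<in> K m" "?x \<in> lev.OC n" "?x \<in> lev.OC m" using step.prems K_\<rho> rO OC_mono[OF mn] by blast+
  have f'm: "set ?f \<subseteq> lev.OC m" using f'(2) OC_mono[OF mn] by blast
  have resm: "map (lev.V.res m) f = map (lev.V.res m) ?f"
  proof -
    have "lev.V.res m z = lev.V.res m (\<rho> m z)" if "z \<in> set f" for z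
      using lev.V.res_eq_iff[of z m "\<rho> m z"] that fOm f'm \<rho>_minus[of z m] I by auto
    then show ?thesis by simp
  qed
  have resn: "map (lev.V.res n) f = map (lev.V.res n) ?f"
  proof -
    have "lev.V.res n z = lev.V.res n (\<rho> m z)" if "z \<in> set f" for z
      using lev.V.res_eq_iff[of z n "\<rho> m z"] that step.prems(2) f'(2) MCn[OF \<rho>_minus[of z m]] fOm I by auto
    then show ?thesis by simp
  qed
  have xx: "x \<ominus>\<^bsub>Hf\<^esub> ?x \<in> lev.MC n" "x \<ominus>\<^bsub>Hf\<^esub> ?x \<in> lev.MC m" using MCn \<rho>_minus xOm by blast+
  have e1: "\<Gamma>.H.eval f x \<in> lev.OC n" "\<Gamma>.H.eval f x \<ominus>\<^bsub>Hf\<^esub> \<Gamma>.H.eval ?f ?x \<in> lev.MC n"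
     "\<Gamma>.H.dq f x x \<in> lev.OC n" "\<Gamma>.H.dq f x x \<ominus>\<^bsub>Hf\<^esub> \<Gamma>.H.dq ?f ?x ?x \<in> lev.MC n"
    using lev.V.eval_cong[OF resn step.prems(2) f'(2) step.prems(5) x'(2)] xx(1) step.prems(5) x'(2) I by auto
  have e2: "\<Gamma>.H.eval ?f ?x \<in> lev.OC n" "\<Gamma>.H.dq ?f ?x ?x \<in> lev.OC n"
    using lev.V.eval_cong(1)[OF refl f'(2) f'(2) x'(2) x'(2)] lev.V.eval_cong(3)[OF refl f'(2) f'(2) x'(2) x'(2), of "?x" "?x"]
      x'(2) lev.V.zero_in_I lev.OC_sub by (auto simp: a_minus_def \<Gamma>.H.r_neg)
  have h: "\<Gamma>.H.eval ?f ?x \<in> lev.MC n" "\<Gamma>.H.dq ?f ?x ?x \<notin> lev.MC n"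
    using lev.V.I_cong[of "\<Gamma>.H.eval f x" n "\<Gamma>.H.eval ?f ?x"] lev.V.I_cong[of "\<Gamma>.H.dq f x x" n "\<Gamma>.H.dq ?f ?x ?x"]
      e1 e2 step.prems(6,7) I by auto
  obtain b where b: "b \<in> K m" "b \<in> lev.OC n" "\<Gamma>.H.eval ?f b = \<zero>\<^bsub>Hf\<^esub>" "b \<ominus>\<^bsub>Hf\<^esub> ?x \<in> lev.MC n"
    using step.hyps(3)[OF f' x'(1,2) h] by blast
  have bH: "b \<in> carrier Hf" "?x \<in> carrier Hf" "x \<in> carrier Hf" using b(1) x'(1) step.prems(4) K_sub by auto
  have bm: "b \<in> lev.OC m" "b \<in> K (Suc m)" using b OC_mono[OF mn] K_mono[of m "Suc m"] by auto
  have bb: "b \<ominus>\<^bsub>Hf\<^esub> b \<in> lev.MC i" for i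
    using bH lev.V.zero_in_I I by (simp add: a_minus_def \<Gamma>.H.r_neg)
  have "\<Gamma>.H.eval f b \<ominus>\<^bsub>Hf\<^esub> \<Gamma>.H.eval ?f b \<in> lev.MC m" "\<Gamma>.H.eval f b \<in> lev.OC m"
    using lev.V.eval_cong(1,2)[OF resm fOm f'm bm(1) bm(1)] bb I by auto
  then have evb: "\<Gamma>.H.eval f b \<in> lev.MC m"
    using b(3) lev.OC_sub by (simp add: a_minus_def)
  have bx: "b \<ominus>\<^bsub>Hf\<^esub> x \<in> lev.MC n"
  proof -
    have "b \<ominus>\<^bsub>Hf\<^esub> x = (b \<ominus>\<^bsub>Hf\<^esub> ?x) \<ominus>\<^bsub>Hf\<^esub> (x \<ominus>\<^bsub>Hf\<^esub> ?x)" using bH by algebra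
    then show ?thesis using lev.V.I_minus b(4) xx(1) I by simp
  qed
  \<comment> \<open>The derivative at \<open>b\<close> has the residue of the derivative at
    \<open>x\<close> at level \<open>n\<close>, so it lies outside the ideal of level
    \<open>n\<close> and all the more outside the smaller one of level \<open>m\<close>.\<close>
  have dqb: "\<Gamma>.H.dq f b b \<notin> lev.MC m"
  proof
    assume "\<Gamma>.H.dq f b b \<in> lev.MC m"
    then have "\<Gamma>.H.dq f b b \<in> lev.MC n" by (rule MCn)
    moreover have "\<Gamma>.H.dq f b b \<in> lev.OC n \<and> \<Gamma>.H.dq f b b \<ominus>\<^bsub>Hf\<^esub> \<Gamma>.H.dq f x x \<in> lev.MC n"
      using lev.V.eval_cong(3)[OF refl step.prems(2,2) b(2) step.prems(5), of b x] bx b(2) step.prems(5) I by auto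
    ultimately show False
      using lev.V.I_cong[of "\<Gamma>.H.dq f b b" n "\<Gamma>.H.dq f x x"] e1(3) step.prems(7) I by auto
  qed
  \<comment> \<open>Here the choice of the primes enters: n + 1 \<le> m + 1 < p m.\<close>
  have "length f \<le> p m" using step.prems(3) mn p(2)[of m] by simp
  then obtain b' where b': "b' \<in> K (Suc m)" "b' \<in> lev.OC m" "\<Gamma>.H.eval f b' = \<zero>\<^bsub>Hf\<^esub>" "b' \<ominus>\<^bsub>Hf\<^esub> b \<in> lev.MC m"
    using K(2)[of m] step.prems(1) fOm bm evb dqb unfolding tower_step_def by blast
  have b'H: "b' \<in> carrier Hf" using b'(1) K_sub by blast
  have "b' = (b' \<ominus>\<^bsub>Hf\<^esub> b) \<oplus>\<^bsub>Hf\<^esub> b" using b'H bH by algebra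
  then have "b' \<in> lev.OC n" using lev.V.A_closed(2)[OF lev.MC_OC[OF MCn[OF b'(4)]] b(2)] by simp
  moreover have "b' \<ominus>\<^bsub>Hf\<^esub> x = (b' \<ominus>\<^bsub>Hf\<^esub> b) \<oplus>\<^bsub>Hf\<^esub> (b \<ominus>\<^bsub>Hf\<^esub> x)" using b'H bH by algebra
  then have "b' \<ominus>\<^bsub>Hf\<^esub> x \<in> lev.MC n" using lev.MC_add[OF MCn[OF b'(4)] bx] by simp
  ultimately show ?case using b' by blast
qed

end

section \<open>The order on Hahn series\<close>

context ordered_abelian_group
begin

definition hpos :: "('a \<Rightarrow> real) \<Rightarrow> bool" where
  "hpos x \<longleftrightarrow> x \<noteq> \<zero>\<^bsub>H\<^esub> \<and> 0 < x (vmin x)"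

definition hle :: "('a \<Rightarrow> real) \<Rightarrow> ('a \<Rightarrow> real) \<Rightarrow> bool" where
  "hle x y \<longleftrightarrow> x = y \<or> hpos (\<lambda>\<gamma>. y \<gamma> - x \<gamma>)"

lemma hposI: "\<lbrakk>x \<in> carrier H; 0 < x m; \<And>\<gamma>. x \<gamma> \<noteq> 0 \<Longrightarrow> m \<sqsubseteq> \<gamma>\<rbrakk> \<Longrightarrow> hpos x"
  using vmin_eqI[of x m] by (auto simp: hpos_def H_simps(2))

lemma hpos_add: assumes x: "x \<in> carrier H" "hpos x" and y: "y \<in> carrier H" "hpos y"
  shows "hpos (x \<oplus>\<^bsub>H\<^esub> y)"
proof -
  have *: "hpos (u \<oplus>\<^bsub>H\<^esub> v)" if u: "u \<in> carrier H" "hpos u" and v: "v \<in> carrier H" "hpos v" and le: "vmin u \<sqsubseteq> vmin v" for u v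
  proof (rule hposI[of _ "vmin u"])
    have u0: "u \<noteq> \<zero>\<^bsub>H\<^esub>" "v \<noteq> \<zero>\<^bsub>H\<^esub>" using u v by (auto simp: hpos_def)
    note vu = vmin[OF u(1) u0(1)] and vv = vmin[OF v(1) u0(2)]
    show "u \<oplus>\<^bsub>H\<^esub> v \<in> carrier H" using u v by simp
    have "v (vmin u) \<ge> 0"
    proof (rule ccontr)
      assume n: "\<not> 0 \<le> v (vmin u)"
      then have "vmin v \<sqsubseteq> vmin u" using vv(2) by auto
      then have "vmin u = vmin v" using le gle_antisym vu(3) vv(3) by blast
      then show False using n v(2) by (simp add: hpos_def)
    qed
    then show "0 < (u \<oplus>\<^bsub>H\<^esub> v) (vmin u)" using u(2) by (simp add: hpos_def H_simps(3))
    fix \<gamma> assume "(u \<oplus>\<^bsub>H\<^esub> v) \<gamma> \<noteq> 0"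
    then have "u \<gamma> \<noteq> 0 \<or> v \<gamma> \<noteq> 0" by (auto simp: H_simps(3))
    then show "vmin u \<sqsubseteq> \<gamma>" using vu(2)[of \<gamma>] vv(2)[of \<gamma>] gle_trans[OF vu(3) vv(3) _ le] H_out[OF v(1)] by blast
  qed
  have v: "vmin x \<in> carrier G" "vmin y \<in> carrier G" using x y vmin(3) by (auto simp: hpos_def)
  from gle_total[OF v] show ?thesis
    using *[OF x y] *[OF y x] H.a_comm[OF x(1) y(1)] by auto
qed

lemma hpos_mult: "\<lbrakk>x \<in> carrier H; hpos x; y \<in> carrier H; hpos y\<rbrakk> \<Longrightarrow> hpos (x \<otimes>\<^bsub>H\<^esub> y)"
  using H_mult_lead[of x y] by (auto simp: hpos_def)

lemma hpos_uminus: "x \<in> carrier H \<Longrightarrow> hpos (\<ominus>\<^bsub>H\<^esub> x) \<longleftrightarrow> x \<noteq> \<zero>\<^bsub>H\<^esub> \<and> x (vmin x) < 0"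
proof -
  assume x: "x \<in> carrier H"
  have "vmin (\<ominus>\<^bsub>H\<^esub> x) = vmin x" if "x \<noteq> \<zero>\<^bsub>H\<^esub>"
    using vmin[OF x that] H.a_inv_closed[OF x] by (intro vmin_eqI) (auto simp: H_uminus[OF x])
  moreover have "\<ominus>\<^bsub>H\<^esub> x = \<zero>\<^bsub>H\<^esub> \<longleftrightarrow> x = \<zero>\<^bsub>H\<^esub>" using x by (auto simp: H_uminus H_simps(2) fun_eq_iff)
  ultimately show ?thesis using x by (auto simp: hpos_def H_uminus)
qed

lemma hpos_cases: "x \<in> carrier H \<Longrightarrow> x = \<zero>\<^bsub>H\<^esub> \<or> hpos x \<or> hpos (\<ominus>\<^bsub>H\<^esub> x)"
  using hpos_uminus[of x] vmin(1)[of x] by (auto simp: hpos_def not_less_iff_gr_or_eq)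

lemma hpos_asym: "\<lbrakk>x \<in> carrier H; hpos x\<rbrakk> \<Longrightarrow> \<not> hpos (\<ominus>\<^bsub>H\<^esub> x)"
  using hpos_uminus[of x] by (auto simp: hpos_def)

lemma hpos_hmon: "\<gamma> \<in> carrier G \<Longrightarrow> hpos (hmon r \<gamma>) \<longleftrightarrow> r > 0"
proof -
  assume g: "\<gamma> \<in> carrier G"
  show ?thesis
  proof (cases "r = 0")
    case True then show ?thesis by (auto simp: hpos_def hmon_def H_simps(2))
  next
    case False
    then have "vmin (hmon r \<gamma>) = \<gamma>"
      by (intro vmin_eqI[OF hmon_closed[OF g]]) (auto simp: hmon_def gle_refl[OF g] split: if_splits)
    then show ?thesis using False by (auto simp: hpos_def hmon_def H_simps(2) fun_eq_iff)
  qed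
qed

lemma hpos_one: "hpos \<one>\<^bsub>H\<^esub>" by (simp add: H_simps(4) hpos_hmon)

lemma hpos_square: "\<lbrakk>x \<in> carrier H; x \<noteq> \<zero>\<^bsub>H\<^esub>\<rbrakk> \<Longrightarrow> hpos (x \<otimes>\<^bsub>H\<^esub> x)"
  using H_mult_lead[of x x] vmin(1)[of x] by (auto simp: hpos_def mult_less_0_iff zero_less_mult_iff)

lemma hpos_pow: "\<lbrakk>x \<in> carrier H; hpos x\<rbrakk> \<Longrightarrow> hpos (x [^]\<^bsub>H\<^esub> (n::nat))"
  by (induct n) (auto simp: hpos_one hpos_mult)

lemma hpos_pow_diff: "\<lbrakk>x \<in> carrier H; hpos x; y \<in> carrier H; hpos y\<rbrakk> \<Longrightarrow> hpos (H.pow_diff x y (Suc n))"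
proof (induct n)
  case (Suc n)
  have "H.pow_diff x y (Suc (Suc n)) = x \<otimes>\<^bsub>H\<^esub> H.pow_diff x y (Suc n) \<oplus>\<^bsub>H\<^esub> y [^]\<^bsub>H\<^esub> Suc n" by simp
  then show ?case
    using Suc hpos_pow[of y "Suc n"] by (simp only: hpos_add hpos_mult H.pow_diff_closed H.nat_pow_closed H.m_closed)
qed (auto simp: hpos_one)

text \<open>An odd power is positive only if its base is. For positive z and y the cofactor of z - y
  in z^p - y^p is a sum of positive terms, hence nonzero.\<close>

lemma hpos_odd_root:
  assumes y: "y \<in> carrier H" "hpos y" and z: "z \<in> carrier H" and p: "odd p"
    and eq: "z [^]\<^bsub>H\<^esub> (p::nat) = y [^]\<^bsub>H\<^esub> p"
  shows "z = y"
proof -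
  obtain n where n: "p = Suc (2 * n)" using p oddE by fastforce
  have zp: "hpos (z [^]\<^bsub>H\<^esub> p)" unfolding eq by (rule hpos_pow[OF y])
  have z0: "z \<noteq> \<zero>\<^bsub>H\<^esub>"
  proof
    assume "z = \<zero>\<^bsub>H\<^esub>"
    then show False using zp n by (simp add: hpos_def)
  qed
  have "hpos z"
  proof (rule ccontr)
    assume "\<not> hpos z"
    then have m: "hpos (\<ominus>\<^bsub>H\<^esub> z)" using hpos_cases[OF z] z0 by blast
    have "hpos ((z \<otimes>\<^bsub>H\<^esub> z) [^]\<^bsub>H\<^esub> n)" using hpos_pow[OF _ hpos_square[OF z z0]] z by simp
    then have "hpos ((z \<otimes>\<^bsub>H\<^esub> z) [^]\<^bsub>H\<^esub> n \<otimes>\<^bsub>H\<^esub> \<ominus>\<^bsub>H\<^esub> z)" using hpos_mult[OF _ _ _ m] z by simp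
    moreover have "(z \<otimes>\<^bsub>H\<^esub> z) [^]\<^bsub>H\<^esub> n \<otimes>\<^bsub>H\<^esub> \<ominus>\<^bsub>H\<^esub> z = \<ominus>\<^bsub>H\<^esub> (z [^]\<^bsub>H\<^esub> p)"
    proof -
      have "(z \<otimes>\<^bsub>H\<^esub> z) [^]\<^bsub>H\<^esub> n = z [^]\<^bsub>H\<^esub> (2 * n)"
        using z H.nat_pow_pow[OF z, of 2 n] by (simp add: numeral_2_eq_2)
      then show ?thesis using z by (simp add: n H.r_minus)
    qed
    ultimately show False using hpos_asym[OF _ zp] z by simp
  qed
  then have pd: "hpos (H.pow_diff z y p)" using hpos_pow_diff z y n by simp
  have "(z \<ominus>\<^bsub>H\<^esub> y) \<otimes>\<^bsub>H\<^esub> H.pow_diff z y p = \<zero>\<^bsub>H\<^esub>"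
    using H.pow_diff_mult[OF z y(1), of p] eq y(1) by (simp add: a_minus_def H.r_neg)
  then have "z \<ominus>\<^bsub>H\<^esub> y = \<zero>\<^bsub>H\<^esub>"
    using H.integral[of "z \<ominus>\<^bsub>H\<^esub> y" "H.pow_diff z y p"] pd z y(1) by (auto simp: hpos_def)
  then show ?thesis using z y(1) by (metis H.r_right_minus_eq)
qed

lemma hle_iff: "\<lbrakk>x \<in> carrier H; y \<in> carrier H\<rbrakk> \<Longrightarrow> hle x y \<longleftrightarrow> x = y \<or> hpos (y \<ominus>\<^bsub>H\<^esub> x)"
  by (simp add: hle_def H_minus)

lemma ordered_subfield:
  assumes F: "subfield F H"
  shows "ordered_field (H\<lparr>carrier := F\<rparr>) hle"
proof (intro ordered_field.intro ordered_field_axioms.intro)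
  show "field (H\<lparr>carrier := F\<rparr>)" by (rule H.subfield_iff(2)[OF F])
  have Fc: "x \<in> carrier H" if "x \<in> F" for x using subfieldE(3)[OF F] that by blast
  fix x y assume "x \<in> carrier (H\<lparr>carrier := F\<rparr>)" "y \<in> carrier (H\<lparr>carrier := F\<rparr>)"
  then have c: "x \<in> carrier H" "y \<in> carrier H" using Fc by auto
  have sw: "\<ominus>\<^bsub>H\<^esub> (y \<ominus>\<^bsub>H\<^esub> x) = x \<ominus>\<^bsub>H\<^esub> y" using c by algebra
  show "hle x y \<or> hle y x"
    using hpos_cases[of "y \<ominus>\<^bsub>H\<^esub> x"] c sw by (auto simp: hle_iff)
  show "x = y" if "hle x y" "hle y x"
    using that hpos_asym[of "y \<ominus>\<^bsub>H\<^esub> x"] c sw by (auto simp: hle_iff)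
  show "hle \<zero>\<^bsub>H\<lparr>carrier := F\<rparr>\<^esub> (x \<otimes>\<^bsub>H\<lparr>carrier := F\<rparr>\<^esub> y)" if "hle \<zero>\<^bsub>H\<lparr>carrier := F\<rparr>\<^esub> x" "hle \<zero>\<^bsub>H\<lparr>carrier := F\<rparr>\<^esub> y"
    using that c hpos_mult[of x y] by (auto simp: hle_iff a_minus_def)
  fix z assume "z \<in> carrier (H\<lparr>carrier := F\<rparr>)"
  then have z: "z \<in> carrier H" using Fc by auto
  have "(y \<ominus>\<^bsub>H\<^esub> x) \<oplus>\<^bsub>H\<^esub> (z \<ominus>\<^bsub>H\<^esub> y) = z \<ominus>\<^bsub>H\<^esub> x" "(y \<oplus>\<^bsub>H\<^esub> z) \<ominus>\<^bsub>H\<^esub> (x \<oplus>\<^bsub>H\<^esub> z) = y \<ominus>\<^bsub>H\<^esub> x"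
    using c z by algebra+
  then show "hle x z" if "hle x y" "hle y z"
    using that hpos_add[of "y \<ominus>\<^bsub>H\<^esub> x" "z \<ominus>\<^bsub>H\<^esub> y"] c z by (auto simp: hle_iff)
  show "hle (x \<oplus>\<^bsub>H\<lparr>carrier := F\<rparr>\<^esub> z) (y \<oplus>\<^bsub>H\<lparr>carrier := F\<rparr>\<^esub> z)" if "hle x y"
    using that c z \<open>(y \<oplus>\<^bsub>H\<^esub> z) \<ominus>\<^bsub>H\<^esub> (x \<oplus>\<^bsub>H\<^esub> z) = y \<ominus>\<^bsub>H\<^esub> x\<close> by (auto simp: hle_iff)
qed (auto simp: hle_def)

end

text \<open>A series outside \<open>OC\<close> has its leading exponent below all exponents of
  \<open>a\<close> and \<open>b\<close>. The differences x - a and b - x then have opposite leading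
  coefficients and cannot both be positive.\<close>

lemma (in convex_subgroup) OC_convex:
  assumes a: "a \<in> OC" and b: "b \<in> OC" and x: "x \<in> carrier H" and ax: "hle a x" and xb: "hle x b"
  shows "x \<in> OC"
proof (rule ccontr)
  assume n: "x \<notin> OC"
  then obtain \<delta> where d: "x \<delta> \<noteq> 0" "\<delta> \<lless> \<one>" using x by (auto simp: OC_def)
  have x0: "x \<noteq> \<zero>\<^bsub>H\<^esub>" using d by (auto simp: H_simps(2))
  note vx = vmin[OF x x0]
  have vl: "vmin x \<lless> \<one>" using le_ll_trans[OF vx(3) _ _ vx(2)[OF d(1)] d(2)] H_out[OF x] d(1) by blast
  have vanish: "c \<gamma> = 0" if c: "c \<in> OC" and g: "\<gamma> \<in> carrier G" "\<gamma> \<sqsubseteq> vmin x" for c \<gamma>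
    using le_ll_trans[OF g(1) vx(3) one_closed g(2) vl] c by (auto simp: OC_def)
  \<comment> \<open>The sign \<open>s\<close> treats x - a and b - x together.\<close>
  have key: "vmin (\<lambda>\<gamma>. s * (x \<gamma> - c \<gamma>)) = vmin x \<and> (\<lambda>\<gamma>. s * (x \<gamma> - c \<gamma>)) (vmin x) = s * x (vmin x)"
    if c: "c \<in> OC" and s: "s = 1 \<or> s = -1" for c and s :: real
  proof -
    have cH: "c \<in> carrier H" by (rule OC_sub[OF c])
    have "(\<lambda>\<gamma>. s * (x \<gamma> - c \<gamma>)) \<in> carrier H"
    proof (cases "s = 1")
      case True then show ?thesis using H.minus_closed[OF x cH] by (simp add: H_minus x cH)
    next
      case False
      then have "(\<lambda>\<gamma>. s * (x \<gamma> - c \<gamma>)) = c \<ominus>\<^bsub>H\<^esub> x" using s by (auto simp: H_minus x cH)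
      then show ?thesis using H.minus_closed[OF cH x] by simp
    qed
    moreover have v: "c (vmin x) = 0" using vanish[OF c vx(3) gle_refl[OF vx(3)]] .
    moreover have "vmin x \<sqsubseteq> \<gamma>" if "s * (x \<gamma> - c \<gamma>) \<noteq> 0" for \<gamma>
    proof (rule ccontr)
      assume n: "\<not> vmin x \<sqsubseteq> \<gamma>"
      have g: "\<gamma> \<in> carrier G" using that H_out[OF x] H_out[OF cH] by force
      then have "\<gamma> \<sqsubseteq> vmin x" using n gle_total vx(3) by blast
      then have "c \<gamma> = 0" using vanish c g by blast
      then show False using that vx(2) n by auto
    qed
    ultimately show ?thesis using vx(1) s by (intro conjI vmin_eqI) auto
  qed
  have "x \<noteq> a" "x \<noteq> b" using n a b by auto
  then have "hpos (\<lambda>\<gamma>. 1 * (x \<gamma> - a \<gamma>))" "hpos (\<lambda>\<gamma>. -1 * (x \<gamma> - b \<gamma>))" using ax xb by (auto simp: hle_def)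
  then have "0 < 1 * x (vmin x)" "0 < - 1 * x (vmin x)"
    using key[OF a, of 1] key[OF b, of "-1"] unfolding hpos_def by auto
  then show False by simp
qed

section \<open>The field\<close>

lemma (in valuation) nonunits_inv: 
  "x \<in> carrier K \<Longrightarrow> x \<notin> val_ring_set K G v \<Longrightarrow> inv x \<in> val_ideal K G v"
proof -
  interpret V: valuation_subring K "val_ring_set K G v" by (rule valuation_subring_val_ring_set)
  assume x: "x \<in> carrier K" "x \<notin> val_ring_set K G v"
  then have "x \<noteq> \<zero>" by (auto simp: val_ring_set_def)
  then show ?thesis
    using V.total[of x] V.nz_inv[of x] x unfolding val_ideal_eq_nonunits nonunits_def by auto
qed

context group_sequence
begin

definition Kf :: "((nat \<Rightarrow> 'a) \<Rightarrow> real) set" where "Kf = (\<Union>n. K n)"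

abbreviation KR where "KR \<equiv> Hf\<lparr>carrier := Kf\<rparr>"

lemma Kf_subfield: "subfield Kf Hf"
  unfolding Kf_def by (rule \<Gamma>.H.chain_Union_subfield) (use K_subfield K_mono nat_le_linear in blast)+

lemma KR_field: "field KR" by (rule \<Gamma>.H.subfield_iff(2)[OF Kf_subfield])

lemma Kf_sub: "x \<in> Kf \<Longrightarrow> x \<in> carrier Hf" using subfieldE(3)[OF Kf_subfield] by blast

lemma Kf_hmon: "\<gamma> \<in> carrier \<Gamma> \<Longrightarrow> hmon r \<gamma> \<in> Kf"
proof -
  assume "\<gamma> \<in> carrier \<Gamma>"
  then obtain n where "\<gamma> \<in> C n" using C_exhaust by blast
  then have "hmon r \<gamma> \<in> K n" by (rule K_hmon)
  then show ?thesis unfolding Kf_def by blast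
qed

lemma Kf_common: "finite S \<Longrightarrow> S \<subseteq> Kf \<Longrightarrow> \<exists>m \<ge> n. S \<subseteq> K m"
proof (induct S rule: finite_induct)
  case (insert x S)
  then obtain m l where "m \<ge> n" "S \<subseteq> K m" "x \<in> K l" by (auto simp: Kf_def)
  then show ?case using K_mono[of m "max m l"] K_mono[of l "max m l"] by (intro exI[of _ "max m l"]) auto
qed auto

lemma KR_inv: "\<lbrakk>x \<in> Kf; x \<noteq> \<zero>\<^bsub>Hf\<^esub>\<rbrakk> \<Longrightarrow> inv\<^bsub>KR\<^esub> x = inv\<^bsub>Hf\<^esub> x"
proof -
  assume x: "x \<in> Kf" "x \<noteq> \<zero>\<^bsub>Hf\<^esub>"
  interpret F: field KR by (rule KR_field)
  have "x \<in> Units KR" using F.field_Units x by simp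
  then show ?thesis
    using \<Gamma>.H.m_inv_monoid_consistent subfieldE(1)[OF Kf_subfield] subring.axioms(2) by blast
qed

lemma KR_minus: "\<lbrakk>x \<in> Kf; y \<in> Kf\<rbrakk> \<Longrightarrow> x \<ominus>\<^bsub>KR\<^esub> y = x \<ominus>\<^bsub>Hf\<^esub> y" "x \<in> Kf \<Longrightarrow> \<ominus>\<^bsub>KR\<^esub> x = \<ominus>\<^bsub>Hf\<^esub> x"
proof -
  interpret F: field KR by (rule KR_field)
  have *: "\<ominus>\<^bsub>KR\<^esub> y = \<ominus>\<^bsub>Hf\<^esub> y" if "y \<in> Kf" for y
    by (rule F.minus_equality)
      (use that subringE(5)[OF subfieldE(1)[OF Kf_subfield]] Kf_sub in \<open>auto simp: \<Gamma>.H.l_neg\<close>)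
  show "\<lbrakk>x \<in> Kf; y \<in> Kf\<rbrakk> \<Longrightarrow> x \<ominus>\<^bsub>KR\<^esub> y = x \<ominus>\<^bsub>Hf\<^esub> y" "x \<in> Kf \<Longrightarrow> \<ominus>\<^bsub>KR\<^esub> x = \<ominus>\<^bsub>Hf\<^esub> x"
    using * by (simp_all add: a_minus_def)
qed

lemma KR_ops: "ring.eval KR = \<Gamma>.H.eval" "ring.dq KR = \<Gamma>.H.dq"
  using \<Gamma>.H.eval_consistent \<Gamma>.H.dq_consistent subfieldE(1)[OF Kf_subfield] by auto

subsection \<open>The valuations \<open>u n\<close>\<close>

definition Gn :: "nat \<Rightarrow> (int \<Rightarrow> 'a) ogroup" where
  "Gn n = hahn_sum {\<gamma>::int. \<gamma> \<le> - int n} (\<lambda>\<gamma>. A (nat (- \<gamma>)))"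

text \<open>Index \<gamma> of the Hahn sum stands for coordinate -\<gamma>, so that a dominating
  largest index becomes a dominating minimum of the support. The restriction is needed because
  elements of the Hahn sum are undefined outside the index set.\<close>

definition proj :: "nat \<Rightarrow> (nat \<Rightarrow> 'a) \<Rightarrow> (int \<Rightarrow> 'a)" where
  "proj n s = (\<lambda>\<gamma> \<in> {\<gamma>::int. \<gamma> \<le> - int n}. s (nat (- \<gamma>)))"

definition u :: "nat \<Rightarrow> ((nat \<Rightarrow> 'a) \<Rightarrow> real) \<Rightarrow> (int \<Rightarrow> 'a)" where
  "u n x = proj n (\<Gamma>.vmin x)"

sublocale Gn: ordered_abelian_group "Gn n" for n
  unfolding Gn_def by (rule ordered_abelian_group_hahn_sum) (rule A_ordered)

lemma Gn_simps:
  "carrier (Gn n) = {s \<in> (\<Pi>\<^sub>E \<gamma> \<in> {\<gamma>::int. \<gamma> \<le> - int n}. carrier (A (nat (- \<gamma>)))).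
     finite {\<gamma> \<in> {\<gamma>::int. \<gamma> \<le> - int n}. s \<gamma> \<noteq> \<one>\<^bsub>A (nat (- \<gamma>))\<^esub>}}"
  "s \<otimes>\<^bsub>Gn n\<^esub> t = (\<lambda>\<gamma> \<in> {\<gamma>::int. \<gamma> \<le> - int n}. s \<gamma> \<otimes>\<^bsub>A (nat (- \<gamma>))\<^esub> t \<gamma>)"
  "\<one>\<^bsub>Gn n\<^esub> = (\<lambda>\<gamma> \<in> {\<gamma>::int. \<gamma> \<le> - int n}. \<one>\<^bsub>A (nat (- \<gamma>))\<^esub>)"
  using carrier_sum_group[of "{\<gamma>::int. \<gamma> \<le> - int n}" "\<lambda>\<gamma>. A (nat (- \<gamma>))"] A.is_group
  by (simp_all add: Gn_def hahn_sum_def)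

lemma proj_carrier: "s \<in> carrier \<Gamma> \<Longrightarrow> proj n s \<in> carrier (Gn n)"
proof -
  assume s: "s \<in> carrier \<Gamma>"
  have "{\<gamma> \<in> {\<gamma>::int. \<gamma> \<le> - int n}. proj n s \<gamma> \<noteq> \<one>\<^bsub>A (nat (- \<gamma>))\<^esub>} \<subseteq> (\<lambda>i. - int i) ` {i. s i \<noteq> \<one>\<^bsub>A i\<^esub>}"
  proof
    fix \<gamma> assume g: "\<gamma> \<in> {\<gamma> \<in> {\<gamma>::int. \<gamma> \<le> - int n}. proj n s \<gamma> \<noteq> \<one>\<^bsub>A (nat (- \<gamma>))\<^esub>}"
    then have "\<gamma> = - int (nat (- \<gamma>))" "s (nat (- \<gamma>)) \<noteq> \<one>\<^bsub>A (nat (- \<gamma>))\<^esub>" by (auto simp: proj_def)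
    then show "\<gamma> \<in> (\<lambda>i. - int i) ` {i. s i \<noteq> \<one>\<^bsub>A i\<^esub>}" by blast
  qed
  moreover have "finite {i. s i \<noteq> \<one>\<^bsub>A i\<^esub>}" using s by (simp add: \<Gamma>_simps)
  ultimately have "finite {\<gamma> \<in> {\<gamma>::int. \<gamma> \<le> - int n}. proj n s \<gamma> \<noteq> \<one>\<^bsub>A (nat (- \<gamma>))\<^esub>}"
    using finite_surj by blast
  then show ?thesis using \<Gamma>_comp[OF s] unfolding Gn_simps by (auto simp: proj_def)
qed

lemma proj_mult: "proj n (s \<otimes>\<^bsub>\<Gamma>\<^esub> t) = proj n s \<otimes>\<^bsub>Gn n\<^esub> proj n t"
  by (auto simp: Gn_simps(2) proj_def \<Gamma>_simps(2))

lemma proj_one_iff: "s \<in> carrier \<Gamma> \<Longrightarrow> proj n s = \<one>\<^bsub>Gn n\<^esub> \<longleftrightarrow> s \<in> C n"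
proof -
  assume s: "s \<in> carrier \<Gamma>"
  have "proj n s = \<one>\<^bsub>Gn n\<^esub> \<longleftrightarrow> (\<forall>\<gamma>::int. \<gamma> \<le> - int n \<longrightarrow> s (nat (- \<gamma>)) = \<one>\<^bsub>A (nat (- \<gamma>))\<^esub>)"
    by (auto simp: Gn_simps(3) proj_def fun_eq_iff)
  also have "\<dots> \<longleftrightarrow> (\<forall>j \<ge> n. s j = \<one>\<^bsub>A j\<^esub>)"
  proof
    assume *: "\<forall>\<gamma>::int. \<gamma> \<le> - int n \<longrightarrow> s (nat (- \<gamma>)) = \<one>\<^bsub>A (nat (- \<gamma>))\<^esub>"
    show "\<forall>j \<ge> n. s j = \<one>\<^bsub>A j\<^esub>"
    proof (intro allI impI)
      fix j assume "n \<le> j" then show "s j = \<one>\<^bsub>A j\<^esub>" using *[rule_format, of "- int j"] by simp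
    qed
  qed auto
  finally show ?thesis using s by (simp add: C_def)
qed

text \<open>The minimum of the support of the projection is the negative of the largest index at
  which \<open>s\<close> is nontrivial, provided that index is at least \<open>n\<close>. The order
  of the Hahn sum is therefore the order of cosets of \<open>C n\<close>.\<close>

lemma proj_nonneg_iff:
  assumes s: "s \<in> carrier \<Gamma>"
  shows "gle (Gn n) \<one>\<^bsub>Gn n\<^esub> (proj n s) \<longleftrightarrow> \<not> lev.ll n s \<one>\<^bsub>\<Gamma>\<^esub>"
proof -
  let ?I = "{\<gamma>::int. \<gamma> \<le> - int n}" and ?B = "\<lambda>\<gamma>::int. A (nat (- \<gamma>))"
  let ?S = "{i \<in> ?I. proj n s i \<noteq> \<one>\<^bsub>?B i\<^esub>}"
  have ps: "proj n s \<in> carrier (Gn n)" by (rule proj_carrier[OF s])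
  have "proj n s \<otimes>\<^bsub>Gn n\<^esub> inv\<^bsub>Gn n\<^esub> \<one>\<^bsub>Gn n\<^esub> = proj n s" using ps by simp
  moreover have "inv\<^bsub>Gn n\<^esub> t = inv\<^bsub>sum_group ?I ?B\<^esub> t" for t
    by (simp add: m_inv_def Gn_def hahn_sum_def)
  ultimately have g: "gle (Gn n) \<one>\<^bsub>Gn n\<^esub> (proj n s) \<longleftrightarrow> \<one>\<^bsub>Gn n\<^esub> = proj n s \<or> hahn_pos ?I ?B (proj n s)"
    by (simp add: Gn_def hahn_sum_def)
  have fin: "finite ?S" using ps by (simp add: Gn_simps)
  have "hahn_pos ?I ?B (proj n s) \<longleftrightarrow> lev.ll n \<one>\<^bsub>\<Gamma>\<^esub> s"
  proof (cases "s \<in> C n")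
    case True
    then have "proj n s = \<one>\<^bsub>Gn n\<^esub>" using proj_one_iff s by blast
    then have "\<not> hahn_pos ?I ?B (proj n s)" by (simp add: hahn_pos_def Gn_def hahn_sum_def)
    moreover have "\<not> lev.ll n \<one>\<^bsub>\<Gamma>\<^esub> s" using True lev.C_sub by (simp add: lev.ll_def)
    ultimately show ?thesis by simp
  next
    case False
    then have ne1: "proj n s \<noteq> \<one>\<^bsub>sum_group ?I ?B\<^esub>" using proj_one_iff[OF s, of n] by (simp add: Gn_def hahn_sum_def)
    have "?S \<noteq> {}"
    proof
      assume "?S = {}"
      then have "proj n s = \<one>\<^bsub>Gn n\<^esub>" by (auto simp: Gn_simps(3) proj_def)
      then show False using ne1 by (simp add: Gn_def hahn_sum_def)
    qed
    note M = Min_in[OF fin this]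
    define i where "i = Min ?S"
    define m where "m = nat (- i)"
    have iS: "i \<in> ?S" unfolding i_def by (rule M)
    then have i1: "i \<le> - int n" by simp
    have i: "i \<le> - int n" "s m \<noteq> \<one>\<^bsub>A m\<^esub>" "n \<le> m" using iS i1 by (simp_all add: proj_def m_def)
    have above: "s j = \<one>\<^bsub>A j\<^esub>" if "j > m" for j
    proof (rule ccontr)
      assume "s j \<noteq> \<one>\<^bsub>A j\<^esub>"
      then have "- int j \<in> ?S" using that i by (auto simp: proj_def m_def)
      then have "i \<le> - int j" unfolding i_def using fin by (rule Min_le[rotated])
      then show False using that by (simp add: m_def)
    qed
    have "hahn_pos ?I ?B (proj n s) \<longleftrightarrow> gless (A m) \<one>\<^bsub>A m\<^esub> (s m)"
    proof -
      have "proj n s i = s m" using i(1) by (simp add: proj_def m_def)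
      then show ?thesis unfolding hahn_pos_def Let_def i_def[symmetric] m_def[symmetric] using ne1 by simp
    qed
    moreover have "gless (A m) \<one>\<^bsub>A m\<^esub> (s m) \<longleftrightarrow> (\<exists>m \<ge> n. gless (A m) \<one>\<^bsub>A m\<^esub> (s m) \<and> (\<forall>j > m. \<one>\<^bsub>A j\<^esub> = s j))"
    proof
      assume "gless (A m) \<one>\<^bsub>A m\<^esub> (s m)"
      then show "\<exists>m \<ge> n. gless (A m) \<one>\<^bsub>A m\<^esub> (s m) \<and> (\<forall>j > m. \<one>\<^bsub>A j\<^esub> = s j)" using i(3) above by auto
    next
      assume "\<exists>m \<ge> n. gless (A m) \<one>\<^bsub>A m\<^esub> (s m) \<and> (\<forall>j > m. \<one>\<^bsub>A j\<^esub> = s j)"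
      then obtain k where k: "gless (A k) \<one>\<^bsub>A k\<^esub> (s k)" "\<forall>j > k. \<one>\<^bsub>A j\<^esub> = s j" by blast
      then have "k = m" using i(2) above by (metis gless_def linorder_neqE_nat)
      then show "gless (A m) \<one>\<^bsub>A m\<^esub> (s m)" using k by simp
    qed
    ultimately show ?thesis using ll_iff[OF \<Gamma>.one_closed s, of n] by (simp add: \<Gamma>_simps(3))
  qed
  then show ?thesis
    using g proj_one_iff[OF s, of n] lev.same_coset[OF \<Gamma>.one_closed s, of n] s
      lev.ll_trans[OF s \<Gamma>.one_closed s, of n] by auto
qed

lemma proj_mono:
  assumes s: "s \<in> carrier \<Gamma>" "t \<in> carrier \<Gamma>" "gle \<Gamma> s t"
  shows "gle (Gn n) (proj n s) (proj n t)"
proof -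
  let ?d = "inv\<^bsub>\<Gamma>\<^esub> s \<otimes>\<^bsub>\<Gamma>\<^esub> t"
  have d: "?d \<in> carrier \<Gamma>" "gle \<Gamma> \<one>\<^bsub>\<Gamma>\<^esub> ?d" using s \<Gamma>.one_le_iff by auto
  have "\<not> lev.ll n ?d \<one>\<^bsub>\<Gamma>\<^esub>" using \<Gamma>.not_lt[OF d(1) \<Gamma>.one_closed] d(2) lev.ll_imp_lt by blast
  then have "gle (Gn n) \<one>\<^bsub>Gn n\<^esub> (proj n ?d)" using proj_nonneg_iff d by blast
  then have "gle (Gn n) (\<one>\<^bsub>Gn n\<^esub> \<otimes>\<^bsub>Gn n\<^esub> proj n s) (proj n ?d \<otimes>\<^bsub>Gn n\<^esub> proj n s)"
    using Gn.gle_mult proj_carrier d(1) s(1) Gn.one_closed by blast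
  moreover have "proj n ?d \<otimes>\<^bsub>Gn n\<^esub> proj n s = proj n t"
  proof -
    have "?d \<otimes>\<^bsub>\<Gamma>\<^esub> s = s \<otimes>\<^bsub>\<Gamma>\<^esub> ?d" using \<Gamma>.m_comm[OF d(1) s(1)] .
    also have "\<dots> = (s \<otimes>\<^bsub>\<Gamma>\<^esub> inv\<^bsub>\<Gamma>\<^esub> s) \<otimes>\<^bsub>\<Gamma>\<^esub> t" using \<Gamma>.m_assoc[OF s(1) \<Gamma>.inv_closed[OF s(1)] s(2)] by simp
    also have "\<dots> = t" using s(1,2) by simp
    finally show ?thesis unfolding proj_mult[symmetric] by simp
  qed
  ultimately show ?thesis using proj_carrier[OF s(1)] by simp
qed

lemma u_valuation: "valuation KR (Gn n) (u n)"
proof (intro valuation.intro KR_field Gn.ordered_abelian_group_axioms valuation_axioms.intro)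
  show "u n \<in> hom (Multiplicative_Group.mult_of KR) (Gn n)"
    using \<Gamma>.H_mult_lead(3) \<Gamma>.vmin(3) Kf_sub by (auto simp: hom_def u_def proj_mult proj_carrier)
next
  fix x y assume xy: "x \<in> carrier KR" "y \<in> carrier KR" "x \<noteq> \<zero>\<^bsub>KR\<^esub>" "y \<noteq> \<zero>\<^bsub>KR\<^esub>" "x \<oplus>\<^bsub>KR\<^esub> y \<noteq> \<zero>\<^bsub>KR\<^esub>"
  then have c: "x \<in> carrier Hf" "y \<in> carrier Hf" "x \<noteq> \<zero>\<^bsub>Hf\<^esub>" "y \<noteq> \<zero>\<^bsub>Hf\<^esub>" "x \<oplus>\<^bsub>Hf\<^esub> y \<noteq> \<zero>\<^bsub>Hf\<^esub>"
    using Kf_sub by auto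
  have cs: "x \<oplus>\<^bsub>Hf\<^esub> y \<in> carrier Hf" using c by simp
  have "x (\<Gamma>.vmin (x \<oplus>\<^bsub>Hf\<^esub> y)) \<noteq> 0 \<or> y (\<Gamma>.vmin (x \<oplus>\<^bsub>Hf\<^esub> y)) \<noteq> 0"
    using \<Gamma>.vmin(1)[OF cs c(5)] by (auto simp: \<Gamma>.H_simps(3))
  then have "gle \<Gamma> (\<Gamma>.vmin x) (\<Gamma>.vmin (x \<oplus>\<^bsub>Hf\<^esub> y)) \<or> gle \<Gamma> (\<Gamma>.vmin y) (\<Gamma>.vmin (x \<oplus>\<^bsub>Hf\<^esub> y))"
    using \<Gamma>.vmin(2)[OF c(1,3)] \<Gamma>.vmin(2)[OF c(2,4)] by blast
  then show "gle (Gn n) (u n x) (u n (x \<oplus>\<^bsub>KR\<^esub> y)) \<or> gle (Gn n) (u n y) (u n (x \<oplus>\<^bsub>KR\<^esub> y))"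
    using proj_mono \<Gamma>.vmin(3) c cs by (auto simp: u_def)
qed

lemma u_val_ring: "val_ring_set KR (Gn n) (u n) = Kf \<inter> lev.OC n"
proof -
  have "gle (Gn n) \<one>\<^bsub>Gn n\<^esub> (u n x) \<longleftrightarrow> x \<in> lev.OC n" if x: "x \<in> Kf" "x \<noteq> \<zero>\<^bsub>Hf\<^esub>" for x
  proof -
    have xc: "x \<in> carrier Hf" by (rule Kf_sub[OF x(1)])
    note v = \<Gamma>.vmin[OF xc x(2)]
    have "(\<not> lev.ll n (\<Gamma>.vmin x) \<one>\<^bsub>\<Gamma>\<^esub>) \<longleftrightarrow> x \<in> lev.OC n"
    proof
      assume n: "\<not> lev.ll n (\<Gamma>.vmin x) \<one>\<^bsub>\<Gamma>\<^esub>"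
      have "\<not> lev.ll n \<gamma> \<one>\<^bsub>\<Gamma>\<^esub>" if "x \<gamma> \<noteq> 0" for \<gamma>
        using lev.le_ll_trans[OF v(3) _ \<Gamma>.one_closed v(2)[OF that]] n \<Gamma>.H_out[OF xc] that by blast
      then show "x \<in> lev.OC n" using xc by (simp add: lev.OC_def)
    qed (use v(1) in \<open>simp add: lev.OC_def\<close>)
    then show ?thesis using proj_nonneg_iff[OF v(3)] by (simp add: u_def)
  qed
  moreover have "\<zero>\<^bsub>Hf\<^esub> \<in> Kf" "\<zero>\<^bsub>Hf\<^esub> \<in> lev.OC n"
    using subringE(2)[OF subfieldE(1)[OF Kf_subfield]] lev.V.A_closed(4) by auto
  moreover have "x \<in> val_ring_set KR (Gn n) (u n) \<longleftrightarrow> x \<in> Kf \<and> (x = \<zero>\<^bsub>Hf\<^esub> \<or> gle (Gn n) \<one>\<^bsub>Gn n\<^esub> (u n x))" for x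
    by (simp add: val_ring_set_def)
  ultimately show ?thesis unfolding set_eq_iff Int_iff by metis
qed

lemma u_val_ideal: "val_ideal KR (Gn n) (u n) = Kf \<inter> lev.MC n"
proof -
  have "nonunits KR (Kf \<inter> lev.OC n) = Kf \<inter> nonunits Hf (lev.OC n)"
    using KR_inv \<Gamma>.H.subfield_m_inv(1)[OF Kf_subfield] by (auto simp: nonunits_def)
  then show ?thesis
    using valuation.val_ideal_eq_nonunits[OF u_valuation] lev.nonunits_OC by (simp add: u_val_ring)
qed

text \<open>Degree at most \<open>n\<close> means length at most n + 1. The finitely many
  coefficients and the approximate root lie in a common \<open>K m\<close> with m \<ge> n, where
  \<open>K_hensel\<close> applies.\<close>

lemma Kf_hensel_at:
  assumes "set f \<subseteq> Kf \<inter> lev.OC n" "length f \<le> Suc n"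
  shows "ring.hensel_at KR (Kf \<inter> lev.OC n) (Kf \<inter> lev.MC n) f"
proof -
  interpret F: field KR by (rule KR_field)
  show ?thesis
    unfolding F.hensel_at_def KR_ops
  proof (intro ballI impI)
    fix x assume x: "x \<in> Kf \<inter> lev.OC n"
      "\<Gamma>.H.eval f x \<in> Kf \<inter> lev.MC n \<and> \<Gamma>.H.dq f x x \<notin> Kf \<inter> lev.MC n"
    obtain m where m: "m \<ge> n" "insert x (set f) \<subseteq> K m"
      using Kf_common[of "insert x (set f)" n] x assms by auto
    have "\<Gamma>.H.dq f x x \<in> Kf" using F.dq_closed[of f x x] x assms unfolding KR_ops by simp
    then have "\<Gamma>.H.eval f x \<in> lev.MC n" "\<Gamma>.H.dq f x x \<notin> lev.MC n" using x by auto
    then obtain b where "b \<in> K m" "b \<in> lev.OC n" "\<Gamma>.H.eval f b = \<zero>\<^bsub>Hf\<^esub>" "b \<ominus>\<^bsub>Hf\<^esub> x \<in> lev.MC n"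
      using K_hensel[of n m f x] m assms x by auto
    moreover then have "b \<in> Kf" "x \<in> Kf" using x by (auto simp: Kf_def)
    moreover then have "b \<ominus>\<^bsub>KR\<^esub> x = b \<ominus>\<^bsub>Hf\<^esub> x" "b \<ominus>\<^bsub>KR\<^esub> x \<in> Kf"
      using KR_minus F.minus_closed[of b x] by auto
    ultimately show "\<exists>b \<in> Kf \<inter> lev.OC n. \<Gamma>.H.eval f b = \<zero>\<^bsub>KR\<^esub> \<and> b \<ominus>\<^bsub>KR\<^esub> x \<in> Kf \<inter> lev.MC n"
      by (intro bexI[of _ b]) auto
  qed
qed

lemma u_n_henselian: "n_henselian n KR (Gn n) (u n)"
  unfolding n_henselian_def
proof (intro ballI impI)
  interpret U: valuation KR "Gn n" "u n" by (rule u_valuation)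
  fix f assume f: "f \<in> carrier (poly_ring (val_ring KR (Gn n) (u n)))" "degree f \<le> n"
  then have "set f \<subseteq> val_ring_set KR (Gn n) (u n)"
    by (auto simp: univ_poly_carrier[symmetric] polynomial_def val_ring_def)
  moreover have "length f \<le> Suc n" using f(2) by simp
  ultimately show "simple_zeros_lift KR (Gn n) (u n) f"
    unfolding U.simple_zeros_lift_iff[OF f(1)] u_val_ring u_val_ideal by (rule Kf_hensel_at)
qed

lemma u_convex: "convex_valuation KR \<Gamma>.hle (Gn n) (u n)"
  unfolding convex_valuation_def u_val_ring
proof (intro ballI impI)
  fix a b x assume "a \<in> Kf \<inter> lev.OC n" "b \<in> Kf \<inter> lev.OC n" "x \<in> carrier KR" "\<Gamma>.hle a x \<and> \<Gamma>.hle x b"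
  then show "x \<in> Kf \<inter> lev.OC n" using lev.OC_convex[of a n b x] Kf_sub[of x] by simp
qed

text \<open>All monomials belong to the field, so \<open>u n\<close> takes every value in the Hahn
  sum and the identity is the required isomorphism.\<close>

lemma u_value_group: "ordered_group_iso (value_group KR (Gn n) (u n)) (Gn n)"
proof -
  interpret U: valuation KR "Gn n" "u n" by (rule u_valuation)
  have "u n ` carrier (Multiplicative_Group.mult_of KR) = carrier (Gn n)"
  proof
    show "u n ` carrier (Multiplicative_Group.mult_of KR) \<subseteq> carrier (Gn n)"
      using U.unit_facts(1) by auto
    show "carrier (Gn n) \<subseteq> u n ` carrier (Multiplicative_Group.mult_of KR)"
    proof
      fix s assume s: "s \<in> carrier (Gn n)"
      \<comment> \<open>The given value is filled up with neutral elements below index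
        \<open>n\<close>; the monomial with this exponent attains it.\<close>
      define \<gamma> where "\<gamma> i = (if n \<le> i then s (- int i) else \<one>\<^bsub>A i\<^esub>)" for i
      have "{i. \<gamma> i \<noteq> \<one>\<^bsub>A i\<^esub>} \<subseteq> (\<lambda>j. nat (- j)) ` {\<gamma> \<in> {\<gamma>::int. \<gamma> \<le> - int n}. s \<gamma> \<noteq> \<one>\<^bsub>A (nat (- \<gamma>))\<^esub>}"
      proof
        fix i assume "i \<in> {i. \<gamma> i \<noteq> \<one>\<^bsub>A i\<^esub>}"
        then have "- int i \<in> {\<gamma> \<in> {\<gamma>::int. \<gamma> \<le> - int n}. s \<gamma> \<noteq> \<one>\<^bsub>A (nat (- \<gamma>))\<^esub>}" by (auto simp: \<gamma>_def split: if_splits)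
        then show "i \<in> (\<lambda>j. nat (- j)) ` {\<gamma> \<in> {\<gamma>::int. \<gamma> \<le> - int n}. s \<gamma> \<noteq> \<one>\<^bsub>A (nat (- \<gamma>))\<^esub>}"
          by (rule rev_image_eqI) simp
      qed
      moreover have "finite {\<gamma> \<in> {\<gamma>::int. \<gamma> \<le> - int n}. s \<gamma> \<noteq> \<one>\<^bsub>A (nat (- \<gamma>))\<^esub>}" using s by (simp add: Gn_simps)
      ultimately have "finite {i. \<gamma> i \<noteq> \<one>\<^bsub>A i\<^esub>}" using finite_surj by blast
      moreover have "\<gamma> i \<in> carrier (A i)" for i
      proof (cases "n \<le> i")
        case True
        then have "s (- int i) \<in> carrier (A (nat (- (- int i))))"
        proof -
          have "s \<in> (\<Pi>\<^sub>E \<gamma> \<in> {\<gamma>::int. \<gamma> \<le> - int n}. carrier (A (nat (- \<gamma>))))" using s by (simp add: Gn_simps)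
          from PiE_mem[OF this, of "- int i"] show ?thesis using True by simp
        qed
        then show ?thesis using True by (simp add: \<gamma>_def)
      qed (simp add: \<gamma>_def)
      ultimately have g: "\<gamma> \<in> carrier \<Gamma>" by (simp add: \<Gamma>_simps)
      have "\<Gamma>.vmin (hmon 1 \<gamma>) = \<gamma>"
        by (intro \<Gamma>.vmin_eqI[OF \<Gamma>.hmon_closed[OF g]]) (auto simp: hmon_def \<Gamma>.gle_refl[OF g] split: if_splits)
      moreover have "proj n \<gamma> = s"
      proof
        fix i show "proj n \<gamma> i = s i"
        proof (cases "i \<le> - int n")
          case True
          then have "n \<le> nat (- i)" by linarith
          then show ?thesis using True by (simp add: proj_def \<gamma>_def)
        next
          case False
          then have "s i = undefined" using s unfolding Gn_simps by (auto dest: PiE_arb)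
          then show ?thesis using False by (simp add: proj_def)
        qed
      qed
      ultimately have "u n (hmon 1 \<gamma>) = s" by (simp add: u_def)
      moreover have "hmon 1 \<gamma> \<noteq> \<zero>\<^bsub>Hf\<^esub>" by (auto simp: hmon_def \<Gamma>.H_simps(2) fun_eq_iff)
      ultimately show "s \<in> u n ` carrier (Multiplicative_Group.mult_of KR)"
        using Kf_hmon[OF g, of 1] by (intro rev_image_eqI[of "hmon 1 \<gamma>"]) auto
    qed
  qed
  then have "value_group KR (Gn n) (u n) = Gn n" by (simp add: value_group_def)
  moreover have "id \<in> iso (Gn n) (Gn n)" by (auto simp: iso_def hom_def bij_betw_def)
  ultimately show ?thesis unfolding ordered_group_iso_def by (intro bexI[of _ id]) simp_all
qed

lemma u_nontrivial: "Kf \<inter> lev.OC n \<noteq> Kf"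
proof -
  have g: "inv\<^bsub>\<Gamma>\<^esub> (a n) \<in> carrier \<Gamma>" using a_carrier by simp
  have "lev.ll n (inv\<^bsub>\<Gamma>\<^esub> (a n)) \<one>\<^bsub>\<Gamma>\<^esub>"
    using lev.ll_mult_iff[of "\<one>\<^bsub>\<Gamma>\<^esub>" "a n" "inv\<^bsub>\<Gamma>\<^esub> (a n)"] a_pos[of n] a_carrier[of n] by simp
  then have "hmon 1 (inv\<^bsub>\<Gamma>\<^esub> (a n)) \<notin> lev.OC n" by (auto simp: lev.OC_def hmon_def)
  then show ?thesis using Kf_hmon[OF g] by blast
qed

subsection \<open>There is no henselian valuation\<close>

text \<open>The value group is of arbitrary type here, so both negative statements of the theorem
  follow.\<close>

lemma not_henselian:
  assumes val: "valuation KR G v" and nt: "nontrivial_valuation KR G v" and hens: "henselian_valuation KR G v"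
  shows False
proof -
  interpret U: valuation KR G v by (rule val)
  define B where "B = val_ring_set KR G v"
  define I where "I = val_ideal KR G v"
  interpret V: valuation_subring KR B unfolding B_def by (rule U.valuation_subring_val_ring_set)
  have I: "I = nonunits KR B" unfolding I_def B_def by (rule U.val_ideal_eq_nonunits)
  note KE = subringE[OF subfieldE(1)[OF Kf_subfield]]
  have BK: "x \<in> Kf" if "x \<in> B" for x using V.A_sub[OF that] by simp
  have IB: "x \<in> B" if "x \<in> I" for x using V.I_sub that I by blast
  have lift: "\<exists>b \<in> B. \<Gamma>.H.eval f b = \<zero>\<^bsub>Hf\<^esub> \<and> b \<ominus>\<^bsub>Hf\<^esub> x \<in> I"
    if f: "set f \<subseteq> B" "hd f \<noteq> \<zero>\<^bsub>Hf\<^esub>" and x: "x \<in> B" "\<Gamma>.H.eval f x \<in> I" "\<Gamma>.H.dq f x x \<notin> I" for f x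
  proof -
    have fp: "f \<in> carrier (poly_ring (val_ring KR G v))"
      using U.mem_poly_ring_val_ring[of f] f by (simp add: B_def)
    have "U.hensel_at B I f"
      using hens U.simple_zeros_lift_iff[OF fp] fp by (simp add: henselian_valuation_def B_def I_def)
    then obtain b where "b \<in> B" "\<Gamma>.H.eval f b = \<zero>\<^bsub>Hf\<^esub>" "b \<ominus>\<^bsub>KR\<^esub> x \<in> I"
      using x unfolding U.hensel_at_def KR_ops by auto
    then show ?thesis using KR_minus(1)[of b x] BK x(1) by auto
  qed
  have one: "\<one>\<^bsub>Hf\<^esub> \<in> B" "\<zero>\<^bsub>Hf\<^esub> \<in> B" "\<one>\<^bsub>Hf\<^esub> \<notin> I" using V.A_closed(4,5) V.one_notin_I I by auto
  have Badd: "x \<oplus>\<^bsub>Hf\<^esub> y \<in> B" if "x \<in> B" "y \<in> B" for x y using V.A_closed(2)[OF that] by simp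
  have Iuminus: "\<ominus>\<^bsub>Hf\<^esub> x \<in> I" if "x \<in> I" for x
    using V.I_uminus[of x] that I KR_minus(2)[OF BK[OF IB[OF that]]] by simp
  have Buminus: "\<ominus>\<^bsub>Hf\<^esub> x \<in> B" if "x \<in> B" for x
    using V.A_closed(3)[OF that] KR_minus(2)[OF BK[OF that]] by simp
  text \<open>The discriminant of \<open>X^2 + X + c\<close> is a square, so the maximal ideal is bounded by \<open>1\<close>.\<close>
  have bound: "\<Gamma>.hpos (\<one>\<^bsub>Hf\<^esub> \<ominus>\<^bsub>Hf\<^esub> c)" if c: "c \<in> I" for c
  proof -
    have cH: "c \<in> carrier Hf" using c IB BK Kf_sub by blast
    have "\<exists>b \<in> B. \<Gamma>.H.eval [\<one>\<^bsub>Hf\<^esub>, \<one>\<^bsub>Hf\<^esub>, c] b = \<zero>\<^bsub>Hf\<^esub> \<and> b \<ominus>\<^bsub>Hf\<^esub> \<zero>\<^bsub>Hf\<^esub> \<in> I"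
      by (rule lift) (use one IB[OF c] c cH in \<open>auto simp: numeral_2_eq_2\<close>)
    then obtain b where b: "b \<in> carrier Hf" "\<Gamma>.H.eval [\<one>\<^bsub>Hf\<^esub>, \<one>\<^bsub>Hf\<^esub>, c] b = \<zero>\<^bsub>Hf\<^esub>" using BK Kf_sub by blast
    have e: "b \<otimes>\<^bsub>Hf\<^esub> b \<oplus>\<^bsub>Hf\<^esub> (b \<oplus>\<^bsub>Hf\<^esub> c) = \<zero>\<^bsub>Hf\<^esub>" using b cH by (simp add: numeral_2_eq_2)
    let ?s = "b \<oplus>\<^bsub>Hf\<^esub> b \<oplus>\<^bsub>Hf\<^esub> \<one>\<^bsub>Hf\<^esub>"
    let ?d = "c \<ominus>\<^bsub>Hf\<^esub> \<one>\<^bsub>Hf\<^esub>"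
    let ?t = "\<one>\<^bsub>Hf\<^esub> \<oplus>\<^bsub>Hf\<^esub> \<one>\<^bsub>Hf\<^esub> \<oplus>\<^bsub>Hf\<^esub> \<one>\<^bsub>Hf\<^esub>"
    have dH: "?d \<in> carrier Hf" using cH by simp
    \<comment> \<open>With s = 2 b + 1 the equation for \<open>b\<close> becomes s^2 = 1 - 4 c. In
      terms of d = c - 1 this reads s^2 + 4 d + 3 = 0, where a positive \<open>d\<close> is visibly
      impossible.\<close>
    have sq: "?s \<otimes>\<^bsub>Hf\<^esub> ?s \<oplus>\<^bsub>Hf\<^esub> (?d \<oplus>\<^bsub>Hf\<^esub> ?d \<oplus>\<^bsub>Hf\<^esub> ?d \<oplus>\<^bsub>Hf\<^esub> ?d \<oplus>\<^bsub>Hf\<^esub> ?t) = \<zero>\<^bsub>Hf\<^esub>"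
    proof -
      let ?q = "b \<otimes>\<^bsub>Hf\<^esub> b"
      have ss: "?s \<otimes>\<^bsub>Hf\<^esub> ?s = ?q \<oplus>\<^bsub>Hf\<^esub> ?q \<oplus>\<^bsub>Hf\<^esub> ?q \<oplus>\<^bsub>Hf\<^esub> ?q \<oplus>\<^bsub>Hf\<^esub> (b \<oplus>\<^bsub>Hf\<^esub> b \<oplus>\<^bsub>Hf\<^esub> b \<oplus>\<^bsub>Hf\<^esub> b) \<oplus>\<^bsub>Hf\<^esub> \<one>\<^bsub>Hf\<^esub>"
        using b(1) by (simp add: \<Gamma>.H.l_distr \<Gamma>.H.r_distr \<Gamma>.H.a_ac)
      have "?q \<gamma> + (b \<gamma> + c \<gamma>) = 0" for \<gamma> using fun_cong[OF e, of \<gamma>] by (simp add: \<Gamma>.H_simps(2,3))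
      from this have q: "?q \<gamma> = - b \<gamma> - c \<gamma>" for \<gamma> by (smt (verit))
      have "(?s \<otimes>\<^bsub>Hf\<^esub> ?s) \<gamma> = 4 * ?q \<gamma> + 4 * b \<gamma> + \<one>\<^bsub>Hf\<^esub> \<gamma>" for \<gamma>
        unfolding ss by (simp add: \<Gamma>.H_simps(3))
      note sq' = this
      show ?thesis
      proof (intro ext)
        fix \<gamma>
        have ad: "(x \<oplus>\<^bsub>Hf\<^esub> y) \<gamma> = x \<gamma> + y \<gamma>" for x y by (simp add: \<Gamma>.H_simps(3))
        have "?d \<gamma> = c \<gamma> - \<one>\<^bsub>Hf\<^esub> \<gamma>" by (simp add: \<Gamma>.H_minus[OF cH \<Gamma>.H.one_closed])
        then show "(?s \<otimes>\<^bsub>Hf\<^esub> ?s \<oplus>\<^bsub>Hf\<^esub> (?d \<oplus>\<^bsub>Hf\<^esub> ?d \<oplus>\<^bsub>Hf\<^esub> ?d \<oplus>\<^bsub>Hf\<^esub> ?d \<oplus>\<^bsub>Hf\<^esub> ?t)) \<gamma> = \<zero>\<^bsub>Hf\<^esub> \<gamma>"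
          using sq'[of \<gamma>] unfolding ad[of "?s \<otimes>\<^bsub>Hf\<^esub> ?s"] ad[of "_ \<oplus>\<^bsub>Hf\<^esub> ?d"] ad[of ?d] ad[of "_ \<oplus>\<^bsub>Hf\<^esub> \<one>\<^bsub>Hf\<^esub>"] ad[of "\<one>\<^bsub>Hf\<^esub>"] using q[of \<gamma>]
          by (simp add: \<Gamma>.H_simps(2))
      qed
    qed
    have "\<not> \<Gamma>.hpos ?d"
    proof
      assume d: "\<Gamma>.hpos ?d"
      let ?r = "?d \<oplus>\<^bsub>Hf\<^esub> ?d \<oplus>\<^bsub>Hf\<^esub> ?d \<oplus>\<^bsub>Hf\<^esub> ?d \<oplus>\<^bsub>Hf\<^esub> ?t"
      have rH: "?r \<in> carrier Hf" "?s \<in> carrier Hf" using b cH by auto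
      have r: "\<Gamma>.hpos ?r" using d dH by (intro \<Gamma>.hpos_add \<Gamma>.hpos_one) auto
      show False
      proof (cases "?s = \<zero>\<^bsub>Hf\<^esub>")
        case True
        then have "?r = \<zero>\<^bsub>Hf\<^esub>" using sq rH by simp
        then show False using r by (simp add: \<Gamma>.hpos_def)
      next
        case False
        have "\<Gamma>.hpos (?s \<otimes>\<^bsub>Hf\<^esub> ?s \<oplus>\<^bsub>Hf\<^esub> ?r)"
          using \<Gamma>.hpos_add[OF _ \<Gamma>.hpos_square[OF rH(2) False] rH(1) r] rH by simp
        then show False unfolding sq by (simp add: \<Gamma>.hpos_def)
      qed
    qed
    moreover have "?d \<noteq> \<zero>\<^bsub>Hf\<^esub>" using c one(3) cH by (metis \<Gamma>.H.one_closed \<Gamma>.H.r_right_minus_eq)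
    moreover have "\<ominus>\<^bsub>Hf\<^esub> ?d = \<one>\<^bsub>Hf\<^esub> \<ominus>\<^bsub>Hf\<^esub> c" using cH by algebra
    ultimately show ?thesis using \<Gamma>.hpos_cases[OF dH] by auto
  qed
  \<comment> \<open>If y/x were outside the valuation ring, then x/y would lie in the maximal ideal
    and be less than 1 by \<open>bound\<close>, contrary to y < x.\<close>
  have convex: "y \<in> I" if x: "x \<in> I" and y: "y \<in> Kf" "\<Gamma>.hpos y" "\<Gamma>.hpos (x \<ominus>\<^bsub>Hf\<^esub> y)" for x y
  proof -
    have xK: "x \<in> Kf" using x IB BK by blast
    have c: "x \<in> carrier Hf" "y \<in> carrier Hf" using xK y(1) Kf_sub by auto
    have y0: "y \<noteq> \<zero>\<^bsub>Hf\<^esub>" using y(2) by (simp add: \<Gamma>.hpos_def)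
    have xp: "\<Gamma>.hpos x"
    proof -
      have "x = (x \<ominus>\<^bsub>Hf\<^esub> y) \<oplus>\<^bsub>Hf\<^esub> y" using c by algebra
      then show ?thesis using \<Gamma>.hpos_add[OF _ y(3) c(2) y(2)] c by simp
    qed
    then have x0: "x \<noteq> \<zero>\<^bsub>Hf\<^esub>" by (simp add: \<Gamma>.hpos_def)
    note ix = \<Gamma>.H_inv[OF c(1) x0] and iy = \<Gamma>.H_inv[OF c(2) y0]
    let ?q = "y \<otimes>\<^bsub>Hf\<^esub> inv\<^bsub>Hf\<^esub> x"
    have ixK: "inv\<^bsub>Hf\<^esub> x \<in> Kf" using \<Gamma>.H.subfield_m_inv(1)[OF Kf_subfield] xK x0 by blast
    have qK: "?q \<in> Kf" using KE(6) y(1) ixK by blast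
    have yq: "y = x \<otimes>\<^bsub>Hf\<^esub> ?q"
    proof -
      have "x \<otimes>\<^bsub>Hf\<^esub> ?q = y \<otimes>\<^bsub>Hf\<^esub> (x \<otimes>\<^bsub>Hf\<^esub> inv\<^bsub>Hf\<^esub> x)" using c ix(1) by algebra
      then show ?thesis using ix(3) c by simp
    qed
    have "?q \<in> B"
    proof (rule ccontr)
      assume n: "?q \<notin> B"
      have q0: "?q \<noteq> \<zero>\<^bsub>Hf\<^esub>" using n one by auto
      have "inv\<^bsub>KR\<^esub> ?q \<in> I" using U.nonunits_inv[of ?q] n qK by (simp add: B_def I_def)
      then have iq: "inv\<^bsub>Hf\<^esub> ?q \<in> I" using KR_inv[OF qK q0] by simp
      have "inv\<^bsub>Hf\<^esub> ?q = x \<otimes>\<^bsub>Hf\<^esub> inv\<^bsub>Hf\<^esub> y"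
      proof -
        have "?q \<otimes>\<^bsub>Hf\<^esub> (x \<otimes>\<^bsub>Hf\<^esub> inv\<^bsub>Hf\<^esub> y) = (x \<otimes>\<^bsub>Hf\<^esub> inv\<^bsub>Hf\<^esub> x) \<otimes>\<^bsub>Hf\<^esub> (y \<otimes>\<^bsub>Hf\<^esub> inv\<^bsub>Hf\<^esub> y)"
          using c ix(1) iy(1) by algebra
        then have "?q \<otimes>\<^bsub>Hf\<^esub> (x \<otimes>\<^bsub>Hf\<^esub> inv\<^bsub>Hf\<^esub> y) = \<one>\<^bsub>Hf\<^esub>" using ix(3) iy(3) by simp
        then show ?thesis
          by (rule \<Gamma>.H.comm_inv_char[OF \<Gamma>.H.m_closed[OF c(2) ix(1)] \<Gamma>.H.m_closed[OF c(1) iy(1)]])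
      qed
      then have "\<Gamma>.hpos (\<one>\<^bsub>Hf\<^esub> \<ominus>\<^bsub>Hf\<^esub> x \<otimes>\<^bsub>Hf\<^esub> inv\<^bsub>Hf\<^esub> y)" using bound[OF iq] by simp
      then have "\<Gamma>.hpos ((\<one>\<^bsub>Hf\<^esub> \<ominus>\<^bsub>Hf\<^esub> x \<otimes>\<^bsub>Hf\<^esub> inv\<^bsub>Hf\<^esub> y) \<otimes>\<^bsub>Hf\<^esub> y)"
        using \<Gamma>.hpos_mult c y(2) iy(1) by simp
      moreover have "(\<one>\<^bsub>Hf\<^esub> \<ominus>\<^bsub>Hf\<^esub> x \<otimes>\<^bsub>Hf\<^esub> inv\<^bsub>Hf\<^esub> y) \<otimes>\<^bsub>Hf\<^esub> y = \<ominus>\<^bsub>Hf\<^esub> (x \<ominus>\<^bsub>Hf\<^esub> y)"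
      proof -
        have "(\<one>\<^bsub>Hf\<^esub> \<ominus>\<^bsub>Hf\<^esub> x \<otimes>\<^bsub>Hf\<^esub> inv\<^bsub>Hf\<^esub> y) \<otimes>\<^bsub>Hf\<^esub> y = y \<ominus>\<^bsub>Hf\<^esub> x \<otimes>\<^bsub>Hf\<^esub> (y \<otimes>\<^bsub>Hf\<^esub> inv\<^bsub>Hf\<^esub> y)"
          using c iy(1) by algebra
        also have "\<dots> = \<ominus>\<^bsub>Hf\<^esub> (x \<ominus>\<^bsub>Hf\<^esub> y)" unfolding iy(3) using c by algebra
        finally show ?thesis .
      qed
      ultimately show False using \<Gamma>.hpos_asym[OF _ y(3)] c by simp
    qed
    then have "x \<otimes>\<^bsub>KR\<^esub> ?q \<in> I" using V.I_absorb x I by blast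
    then show ?thesis using yq by simp
  qed
  \<comment> \<open>An element with nontrivial value or its inverse lies in the maximal
    ideal.\<close>
  obtain x where x: "x \<in> Kf" "x \<noteq> \<zero>\<^bsub>Hf\<^esub>" "x \<in> I"
  proof -
    obtain z where z: "z \<in> Kf" "z \<noteq> \<zero>\<^bsub>Hf\<^esub>" "v z \<noteq> \<one>\<^bsub>G\<^esub>" using nt by (auto simp: nontrivial_valuation_def)
    have "z \<in> I \<or> inv\<^bsub>KR\<^esub> z \<in> I"
    proof (cases "z \<in> B")
      case True
      then show ?thesis using z by (auto simp: B_def I_def val_ring_set_def val_ideal_def gless_def)
    next
      case False then show ?thesis using U.nonunits_inv[of z] z by (simp add: B_def I_def)
    qed
    moreover have "inv\<^bsub>KR\<^esub> z \<in> Kf" "inv\<^bsub>KR\<^esub> z \<noteq> \<zero>\<^bsub>Hf\<^esub>" using V.nz_inv[of z] z by auto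
    ultimately show ?thesis using that z by blast
  qed
  have "\<exists>x. x \<in> Kf \<and> \<Gamma>.hpos x \<and> x \<in> I"
    using \<Gamma>.hpos_cases[OF Kf_sub[OF x(1)]] x Iuminus[OF x(3)] KE(5)[OF x(1)] by blast
  then obtain x where x: "x \<in> Kf" "\<Gamma>.hpos x" "x \<in> I" by blast
  have xH: "x \<in> carrier Hf" and x0: "x \<noteq> \<zero>\<^bsub>Hf\<^esub>" using x Kf_sub by (auto simp: \<Gamma>.hpos_def)
  note vx = \<Gamma>.vmin[OF xH x0]
  \<comment> \<open>The leading exponent of \<open>x\<close> lies in some \<open>C n\<close>, below
    \<open>a n\<close>, so the monomial with exponent \<open>a n\<close> is positive and smaller
    than \<open>x\<close>. Convexity puts it into the maximal ideal.\<close>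
  obtain n where n: "\<Gamma>.vmin x \<in> C n" using C_exhaust[OF vx(3)] by blast
  let ?t = "hmon 1 (a n)"
  have tK: "?t \<in> Kf" by (rule Kf_hmon[OF a_carrier])
  have tH: "?t \<in> carrier Hf" by (rule Kf_sub[OF tK])
  have less: "gless \<Gamma> (\<Gamma>.vmin x) (a n)" by (rule C_less_a[OF n]) simp
  have tI: "?t \<in> I"
  proof (rule convex[OF x(3) tK])
    show "\<Gamma>.hpos ?t" using \<Gamma>.hpos_hmon[OF a_carrier] by simp
    show "\<Gamma>.hpos (x \<ominus>\<^bsub>Hf\<^esub> ?t)"
    proof (rule \<Gamma>.hposI[of _ "\<Gamma>.vmin x"])
      show "x \<ominus>\<^bsub>Hf\<^esub> ?t \<in> carrier Hf" using xH tH by simp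
      have "\<Gamma>.vmin x \<noteq> a n" using less by (auto simp: gless_def)
      then show "0 < (x \<ominus>\<^bsub>Hf\<^esub> ?t) (\<Gamma>.vmin x)" using x(2) by (simp add: \<Gamma>.H_minus xH tH \<Gamma>.hpos_def) (simp add: hmon_def)
      fix \<gamma> assume "(x \<ominus>\<^bsub>Hf\<^esub> ?t) \<gamma> \<noteq> 0"
      then have "x \<gamma> \<noteq> 0 \<or> \<gamma> = a n" unfolding \<Gamma>.H_minus[OF xH tH] by (auto simp: hmon_def split: if_splits)
      then show "gle \<Gamma> (\<Gamma>.vmin x) \<gamma>" using vx(2) less by (auto simp: gless_def)
    qed
  qed
  let ?p = "p n"
  have p2: "?p > 2" "?p \<ge> 1" using p(2)[of n] by auto
  let ?c = "\<one>\<^bsub>Hf\<^esub> \<oplus>\<^bsub>Hf\<^esub> ?t"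
  let ?f = "\<Gamma>.H.binomial_poly ?p ?c"
  have cB: "?c \<in> B" using Badd one(1) IB[OF tI] by blast
  have cH: "?c \<in> carrier Hf" using tH by simp
  note bp = \<Gamma>.H.binomial_poly_props[OF p2(2) cH]
  have "\<exists>b \<in> B. \<Gamma>.H.eval ?f b = \<zero>\<^bsub>Hf\<^esub> \<and> b \<ominus>\<^bsub>Hf\<^esub> \<one>\<^bsub>Hf\<^esub> \<in> I"
  proof (rule lift)
    show "set ?f \<subseteq> B" using one(1,2) Buminus[OF cB] by (auto simp: \<Gamma>.H.binomial_poly_def)
    show "hd ?f \<noteq> \<zero>\<^bsub>Hf\<^esub>" by (simp add: \<Gamma>.H.binomial_poly_def)
    show "\<one>\<^bsub>Hf\<^esub> \<in> B" by (rule one)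
    have "\<Gamma>.H.eval ?f \<one>\<^bsub>Hf\<^esub> = \<one>\<^bsub>Hf\<^esub> \<ominus>\<^bsub>Hf\<^esub> (\<one>\<^bsub>Hf\<^esub> \<oplus>\<^bsub>Hf\<^esub> ?t)" using bp(1)[OF \<Gamma>.H.one_closed \<Gamma>.H.one_closed] by simp
    also have "\<dots> = \<ominus>\<^bsub>Hf\<^esub> ?t" using tH by algebra
    finally show "\<Gamma>.H.eval ?f \<one>\<^bsub>Hf\<^esub> \<in> I" using Iuminus[OF tI] by simp
    have d: "\<Gamma>.H.dq ?f \<one>\<^bsub>Hf\<^esub> \<one>\<^bsub>Hf\<^esub> = hmon (real ?p) \<one>\<^bsub>\<Gamma>\<^esub>"
      using bp(2)[OF \<Gamma>.H.one_closed \<Gamma>.H.one_closed] by (simp add: \<Gamma>.H.pow_diff_one \<Gamma>.H_add_pow)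
    \<comment> \<open>The derivative of X^p at 1 is the real constant \<open>p\<close>; being at
      least 1 it violates \<open>bound\<close>, so it is not in the maximal ideal.\<close>
    show "\<Gamma>.H.dq ?f \<one>\<^bsub>Hf\<^esub> \<one>\<^bsub>Hf\<^esub> \<notin> I"
    proof
      assume "\<Gamma>.H.dq ?f \<one>\<^bsub>Hf\<^esub> \<one>\<^bsub>Hf\<^esub> \<in> I"
      then have "\<Gamma>.hpos (\<one>\<^bsub>Hf\<^esub> \<ominus>\<^bsub>Hf\<^esub> hmon (real ?p) \<one>\<^bsub>\<Gamma>\<^esub>)" using bound d by simp
      moreover have "\<one>\<^bsub>Hf\<^esub> \<ominus>\<^bsub>Hf\<^esub> hmon (real ?p) \<one>\<^bsub>\<Gamma>\<^esub> = hmon (1 - real ?p) \<one>\<^bsub>\<Gamma>\<^esub>"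
        unfolding \<Gamma>.H_minus[OF \<Gamma>.H.one_closed \<Gamma>.hmon_closed[OF \<Gamma>.one_closed]] by (auto simp: \<Gamma>.H_simps(4) hmon_def)
      ultimately show False using \<Gamma>.hpos_hmon[OF \<Gamma>.one_closed, of "1 - real ?p"] p2 by simp
    qed
  qed
  then obtain b where b: "b \<in> B" "\<Gamma>.H.eval ?f b = \<zero>\<^bsub>Hf\<^esub>" "b \<ominus>\<^bsub>Hf\<^esub> \<one>\<^bsub>Hf\<^esub> \<in> I" by blast
  have bH: "b \<in> carrier Hf" using b(1) BK Kf_sub by blast
  \<comment> \<open>The lifted root differs from 1 by an element of the maximal ideal, so it is
    positive by \<open>bound\<close>; this is what makes it comparable with the excluded
    root.\<close>
  have "\<Gamma>.hpos (\<one>\<^bsub>Hf\<^esub> \<ominus>\<^bsub>Hf\<^esub> \<ominus>\<^bsub>Hf\<^esub> (b \<ominus>\<^bsub>Hf\<^esub> \<one>\<^bsub>Hf\<^esub>))" by (rule bound[OF Iuminus[OF b(3)]])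
  moreover have "\<one>\<^bsub>Hf\<^esub> \<ominus>\<^bsub>Hf\<^esub> \<ominus>\<^bsub>Hf\<^esub> (b \<ominus>\<^bsub>Hf\<^esub> \<one>\<^bsub>Hf\<^esub>) = b" using bH by algebra
  ultimately have bpos: "\<Gamma>.hpos b" by simp
  have "b [^]\<^bsub>Hf\<^esub> ?p \<ominus>\<^bsub>Hf\<^esub> ?c = \<zero>\<^bsub>Hf\<^esub>" using bp(1)[OF bH bH] b(2) by simp
  then have bc: "b [^]\<^bsub>Hf\<^esub> ?p = ?c" using bH cH by (metis \<Gamma>.H.nat_pow_closed \<Gamma>.H.r_right_minus_eq)
  obtain m where bm: "b \<in> K m" using BK[OF b(1)] by (auto simp: Kf_def)
  have "odd ?p" using p(1) p2 prime_odd_nat by blast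
  then show False using no_root[OF bm bc] \<Gamma>.hpos_odd_root[OF bH bpos] by blast
qed

end

section \<open>The theorem\<close>

text \<open>At index \<open>n\<close> of the ultraproduct stands the valuation ring of
  \<open>u n\<close>, in which Hensel's lemma holds for lists of length at most
  \<open>n\<close>.\<close>

lemma (in group_sequence) t_henselian_KR: "t_henselian KR"
proof (rule t_henselianI)
  fix n f
  interpret U: valuation KR "Gn n" "u n" by (rule u_valuation)
  show "valuation_subring KR (Kf \<inter> lev.OC n)"
    using U.valuation_subring_val_ring_set by (simp only: u_val_ring)
  show "Kf \<inter> lev.OC n \<noteq> carrier KR" using u_nontrivial by simp
  assume "set f \<subseteq> Kf \<inter> lev.OC n" "length f \<le> n"
  then show "ring.hensel_at KR (Kf \<inter> lev.OC n) (nonunits KR (Kf \<inter> lev.OC n)) f"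
    using Kf_hensel_at[of f n] U.val_ideal_eq_nonunits unfolding u_val_ring u_val_ideal by simp
qed (rule KR_field)

theorem mainTheorem3:
  fixes A :: "nat \<Rightarrow> 'a ogroup"
  assumes "\<And>\<gamma>. ordered_abelian_group (A \<gamma>)"
    and "\<And>\<gamma>. carrier (A \<gamma>) \<noteq> {\<one>\<^bsub>A \<gamma>\<^esub>}"
  shows "\<exists>(K :: 'a hahn_series ring) leK.
    ordered_field K leK \<and>
    (\<forall>n::nat. n \<ge> 1 \<longrightarrow>
      (\<exists>(G :: (int \<Rightarrow> 'a) ogroup) u.
        valuation K G u \<and> convex_valuation K leK G u \<and> n_henselian n K G u \<and>
        ordered_group_iso (value_group K G u)
          (hahn_sum {\<gamma>::int. \<gamma> \<le> - int n} (\<lambda>\<gamma>. A (nat (- \<gamma>)))))) \<and>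
    \<not> (\<exists>(G :: 'a hahn_series set ogroup) v.
        valuation K G v \<and> nontrivial_valuation K G v \<and> henselian_valuation K G v) \<and>
    t_henselian K \<and> \<not> henselian_field K"
proof -
  interpret group_sequence A by (rule group_sequence.intro) (fact assms)+
  have "\<exists>(G :: (int \<Rightarrow> 'a) ogroup) u. valuation KR G u \<and> convex_valuation KR \<Gamma>.hle G u \<and>
      n_henselian n KR G u \<and>
      ordered_group_iso (value_group KR G u) (hahn_sum {\<gamma>::int. \<gamma> \<le> - int n} (\<lambda>\<gamma>. A (nat (- \<gamma>))))" for n
    using u_valuation u_convex u_n_henselian u_value_group[of n] unfolding Gn_def by blast
  moreover have "\<not> henselian_field KR" using not_henselian unfolding henselian_field_def by blast
  ultimately show ?thesis
    using \<Gamma>.ordered_subfield[OF Kf_subfield] not_henselian t_henselian_KR by blast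
qed

end
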